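(* The following algorithm is a $2(n-1)$-approximation algorithm for Network Flow Interdiction, where $n=|V|$, and its running time is $O(m^{5/2}n^3)$ with $m=|E|$. Algorithm: (1) Order the edges so that $\rho(e_1)\leq\rho(e_2)\leq\cdots\leq\rho(e_m)$. (2) For each $j=1,\dots,m$ and each $e\in E$: let $E_\leq=\{e_i\mid i\leq j \text{ and } u(e_i)\leq u(e)\}$ and $E_>=E\setminus E_\leq$; construct a Gomory-Hu tree $(T,\kappa)$ for $(V,E_\leq)$ with capacities $u$; for each edge $f\in E(T)$: form $G'_>$ by contracting in $(V,E_>)$ all pairs of vertices $w,v$ with $wv\in E(T)$ and $\kappa(wv)>\kappa(f)$, find a minimum cost $s$-$t$-cut $C$ in $G'_>$ (with respect to $c$), and store $R_{j,e,f}=\delta(C)\cap E_>$ if $c(R_{j,e,f})\leq B$. (3) Return the stored set $R_{j,e,f}$ minimizing the maximum $s$-$t$-flow value in $G-R_{j,e,f}$.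
   Context: Network Flow Interdiction: an instance consists of an undirected graph $G=(V,E)$ (parallel edges allowed), distinct vertices $s,t\in V$, capacities $u:E\to\mathbb{N}$, costs $c:E\to\mathbb{N}$ and a budget $B$; the goal is to find $R\subseteq E$ with $c(R)=\sum_{e\in R}c(e)\leq B$ minimizing the value of a maximum $s$-$t$-flow in $G-R=(V,E\setminus R)$. A $2(n-1)$-approximation algorithm runs in polynomial time and returns a feasible $R$ whose objective value is at most $2(n-1)\cdot\mathrm{OPT}$. The efficiency of an edge is $\rho(e)=u(e)/c(e)$. For $C\subseteq V$, $\delta(C)$ is the set of edges with exactly one endpoint in $C$. A Gomory-Hu tree for a graph with capacities $u$ on vertex set $V$ is a tree $T$ on $V$ with edge weights $\kappa$ such that for any $w,v\in V$ and any minimum weight edge $e$ on the $w$-$v$ path in $T$, the two components of $T-e$ give a minimum capacity $w$-$v$-cut, whose capacity equals $\kappa(e)$.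
   Formalization: The factor 2(n-1) is stated only when OPT > 0 (for one edge with u=c=B=1, OPT=0 but the algorithm returns the empty set, of flow value 1), and the graph is assumed to have at least one edge, since otherwise no set is stored. *)

theory Defs
  imports Complex_Main "HOL-Library.Extended_Nonnegative_Real"
begin

section \<open>Undirected multigraphs, cuts and flows\<close>

record ('v, 'e) mgraph =
  verts :: "'v set"
  edges :: "'e set"
  ends  :: "'e \<Rightarrow> 'v set"

text \<open>Finite and loopless; parallel edges are allowed, as \<^term>\<open>ends\<close> need not be injective.\<close>

definition mgraph :: "('v, 'e) mgraph \<Rightarrow> bool" where
  "mgraph G \<longleftrightarrow> finite (verts G) \<and> finite (edges G) \<and>
     (\<forall>e\<in>edges G. ends G e \<subseteq> verts G \<and> card (ends G e) = 2)"

definition with_edges :: "('v, 'e) mgraph \<Rightarrow> 'e set \<Rightarrow> ('v, 'e) mgraph" where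
  "with_edges G F = G\<lparr>edges := F\<rparr>"

text \<open>The set usually written \<open>\<delta>(C)\<close>.\<close>

definition cut_edges :: "('v, 'e) mgraph \<Rightarrow> 'v set \<Rightarrow> 'e set" where
  "cut_edges G C = {e \<in> edges G. card (ends G e \<inter> C) = 1}"

definition is_cut :: "('v, 'e) mgraph \<Rightarrow> 'v \<Rightarrow> 'v \<Rightarrow> 'v set \<Rightarrow> bool" where
  "is_cut G s t C \<longleftrightarrow> C \<subseteq> verts G \<and> s \<in> C \<and> t \<in> verts G - C"

definition is_min_cut ::
  "('v, 'e) mgraph \<Rightarrow> ('e \<Rightarrow> nat) \<Rightarrow> 'v \<Rightarrow> 'v \<Rightarrow> 'v set \<Rightarrow> bool" where
  "is_min_cut G w s t C \<longleftrightarrow> is_cut G s t C \<and>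
     (\<forall>D. is_cut G s t D \<longrightarrow> sum w (cut_edges G C) \<le> sum w (cut_edges G D))"

text \<open>
  A flow in an undirected graph: for \<^term>\<open>v \<in> ends G e\<close>, the number \<^term>\<open>f e v\<close> is the
  (signed) amount leaving \<^term>\<open>v\<close> along \<^term>\<open>e\<close>.
\<close>

definition is_flow ::
  "('v, 'e) mgraph \<Rightarrow> ('e \<Rightarrow> nat) \<Rightarrow> 'v \<Rightarrow> 'v \<Rightarrow> ('e \<Rightarrow> 'v \<Rightarrow> real) \<Rightarrow> bool" where
  "is_flow G u s t f \<longleftrightarrow>
     (\<forall>e\<in>edges G. \<forall>v w. ends G e = {v, w} \<longrightarrow> f e v = - f e w) \<and>
     (\<forall>e\<in>edges G. \<forall>v\<in>ends G e. \<bar>f e v\<bar> \<le> real (u e)) \<and>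
     (\<forall>v\<in>verts G - {s, t}. (\<Sum>e | e \<in> edges G \<and> v \<in> ends G e. f e v) = 0)"

definition flow_value :: "('v, 'e) mgraph \<Rightarrow> 'v \<Rightarrow> ('e \<Rightarrow> 'v \<Rightarrow> real) \<Rightarrow> real" where
  "flow_value G s f = (\<Sum>e | e \<in> edges G \<and> s \<in> ends G e. f e s)"

definition max_flow_value ::
  "('v, 'e) mgraph \<Rightarrow> ('e \<Rightarrow> nat) \<Rightarrow> 'v \<Rightarrow> 'v \<Rightarrow> real" where
  "max_flow_value G u s t = (SUP f \<in> {f. is_flow G u s t f}. flow_value G s f)"


section \<open>Contraction\<close>

text \<open>
  \<^term>\<open>contract G P\<close> identifies \<^term>\<open>w\<close> and \<^term>\<open>v\<close> for all \<^term>\<open>(w, v) \<in> P\<close>; its vertices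
  are the resulting classes. Edges that become loops are dropped.
\<close>

definition contract_class :: "('v, 'e) mgraph \<Rightarrow> ('v \<times> 'v) set \<Rightarrow> 'v \<Rightarrow> 'v set" where
  "contract_class G P v = {x \<in> verts G. (v, x) \<in> (P \<union> P\<inverse>)\<^sup>*}"

definition contract :: "('v, 'e) mgraph \<Rightarrow> ('v \<times> 'v) set \<Rightarrow> ('v set, 'e) mgraph" where
  "contract G P =
     \<lparr>verts = contract_class G P ` verts G,
      edges = {e \<in> edges G. card (contract_class G P ` ends G e) = 2},
      ends = (\<lambda>e. contract_class G P ` ends G e)\<rparr>"


section \<open>Gomory-Hu trees\<close>

text \<open>Trees are simple graphs, given by a set of two-element vertex sets.\<close>

definition is_path :: "'v set set \<Rightarrow> 'v \<Rightarrow> 'v list \<Rightarrow> 'v \<Rightarrow> bool" where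
  "is_path F a p b \<longleftrightarrow> p \<noteq> [] \<and> hd p = a \<and> last p = b \<and> distinct p \<and>
     successively (\<lambda>x y. {x, y} \<in> F) p"

definition path_edges :: "'v list \<Rightarrow> 'v set set" where
  "path_edges p = {{p ! i, p ! Suc i} | i. Suc i < length p}"

definition is_cycle :: "'v set set \<Rightarrow> 'v list \<Rightarrow> bool" where
  "is_cycle F p \<longleftrightarrow> 3 \<le> length p \<and> distinct p \<and>
     successively (\<lambda>x y. {x, y} \<in> F) p \<and> {last p, hd p} \<in> F"

definition is_tree :: "'v set \<Rightarrow> 'v set set \<Rightarrow> bool" where
  "is_tree V F \<longleftrightarrow> (\<forall>f\<in>F. f \<subseteq> V \<and> card f = 2) \<and>
     (\<forall>a\<in>V. \<forall>b\<in>V. \<exists>p. is_path F a p b) \<and> (\<nexists>p. is_cycle F p)"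

definition component :: "'v set set \<Rightarrow> 'v \<Rightarrow> 'v set" where
  "component F v = {x. \<exists>p. is_path F v p x}"

definition gomory_hu_tree ::
  "('v, 'e) mgraph \<Rightarrow> ('e \<Rightarrow> nat) \<Rightarrow> 'v set set \<Rightarrow> ('v set \<Rightarrow> nat) \<Rightarrow> bool" where
  "gomory_hu_tree G u T \<kappa> \<longleftrightarrow> is_tree (verts G) T \<and>
     (\<forall>w\<in>verts G. \<forall>v\<in>verts G. w \<noteq> v \<longrightarrow>
        (\<forall>p e. is_path T w p v \<longrightarrow> e \<in> path_edges p \<longrightarrow> \<kappa> e = Min (\<kappa> ` path_edges p) \<longrightarrow>
           is_min_cut G u w v (component (T - {e}) w) \<and>
           sum u (cut_edges G (component (T - {e}) w)) = \<kappa> e))"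


section \<open>Network flow interdiction\<close>

record ('v, 'e) nfi =
  graph  :: "('v, 'e) mgraph"
  source :: 'v
  sink   :: 'v
  cap    :: "'e \<Rightarrow> nat"
  cost   :: "'e \<Rightarrow> nat"
  budget :: nat

definition nfi_instance :: "('v, 'e) nfi \<Rightarrow> bool" where
  "nfi_instance I \<longleftrightarrow> mgraph (graph I) \<and>
     source I \<in> verts (graph I) \<and> sink I \<in> verts (graph I) \<and> source I \<noteq> sink I"

definition feasible :: "('v, 'e) nfi \<Rightarrow> 'e set \<Rightarrow> bool" where
  "feasible I R \<longleftrightarrow> R \<subseteq> edges (graph I) \<and> sum (cost I) R \<le> budget I"

definition objective :: "('v, 'e) nfi \<Rightarrow> 'e set \<Rightarrow> real" where
  "objective I R = max_flow_value (with_edges (graph I) (edges (graph I) - R))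
     (cap I) (source I) (sink I)"

definition OPT :: "('v, 'e) nfi \<Rightarrow> real" where
  "OPT I = Min (objective I ` {R. feasible I R})"

text \<open>
  With values in \<^typ>\<open>ennreal\<close>, an edge of cost \<open>0\<close> and positive capacity has efficiency
  \<open>\<infinity>\<close>, so it comes last in the ordering; \<open>0 / 0 = 0\<close>.
\<close>

definition efficiency :: "('v, 'e) nfi \<Rightarrow> 'e \<Rightarrow> ennreal" where
  "efficiency I e = of_nat (cap I e) / of_nat (cost I e)"


section \<open>The algorithm\<close>

text \<open>
  The algorithm leaves open how ties in the ordering are broken and which Gomory-Hu trees and
  minimum cuts are used. A run is described by the ordering \<^term>\<open>es\<close> and, for each \<open>j\<close>, \<open>e\<close>
  and tree edge \<open>f\<close>, the tree \<open>T j e\<close> with weights \<open>\<kappa> j e\<close> and the cut \<open>C j e f\<close> (irrelevant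
  if \<^term>\<open>s\<close> and \<^term>\<open>t\<close> have been identified, in which case there is no cut and nothing is
  stored).
\<close>

definition low_edges :: "('v, 'e) nfi \<Rightarrow> 'e list \<Rightarrow> nat \<Rightarrow> 'e \<Rightarrow> 'e set" where
  "low_edges I es j e = {x \<in> set (take j es). cap I x \<le> cap I e}"

definition high_edges :: "('v, 'e) nfi \<Rightarrow> 'e list \<Rightarrow> nat \<Rightarrow> 'e \<Rightarrow> 'e set" where
  "high_edges I es j e = edges (graph I) - low_edges I es j e"

definition heavy_pairs ::
  "'v set set \<Rightarrow> ('v set \<Rightarrow> nat) \<Rightarrow> 'v set \<Rightarrow> ('v \<times> 'v) set" where
  "heavy_pairs T \<kappa> f = {(w, v). {w, v} \<in> T \<and> \<kappa> {w, v} > \<kappa> f}"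

definition contracted_graph ::
  "('v, 'e) nfi \<Rightarrow> 'e set \<Rightarrow> 'v set set \<Rightarrow> ('v set \<Rightarrow> nat) \<Rightarrow> 'v set \<Rightarrow> ('v set, 'e) mgraph" where
  "contracted_graph I F T \<kappa> f = contract (with_edges (graph I) F) (heavy_pairs T \<kappa> f)"

definition contracted_vertex ::
  "('v, 'e) nfi \<Rightarrow> 'v set set \<Rightarrow> ('v set \<Rightarrow> nat) \<Rightarrow> 'v set \<Rightarrow> 'v \<Rightarrow> 'v set" where
  "contracted_vertex I T \<kappa> f v = contract_class (graph I) (heavy_pairs T \<kappa> f) v"

definition valid_run ::
  "('v, 'e) nfi \<Rightarrow> 'e list \<Rightarrow> (nat \<Rightarrow> 'e \<Rightarrow> 'v set set) \<Rightarrow> (nat \<Rightarrow> 'e \<Rightarrow> 'v set \<Rightarrow> nat)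
     \<Rightarrow> (nat \<Rightarrow> 'e \<Rightarrow> 'v set \<Rightarrow> 'v set set) \<Rightarrow> bool" where
  "valid_run I es T \<kappa> C \<longleftrightarrow>
     distinct es \<and> set es = edges (graph I) \<and>
     sorted_wrt (\<lambda>x y. efficiency I x \<le> efficiency I y) es \<and>
     (\<forall>j\<in>{1..length es}. \<forall>e\<in>edges (graph I).
        gomory_hu_tree (with_edges (graph I) (low_edges I es j e)) (cap I) (T j e) (\<kappa> j e) \<and>
        (\<forall>f\<in>T j e.
           let G' = contracted_graph I (high_edges I es j e) (T j e) (\<kappa> j e) f;
               s' = contracted_vertex I (T j e) (\<kappa> j e) f (source I);
               t' = contracted_vertex I (T j e) (\<kappa> j e) f (sink I)
           in s' \<noteq> t' \<longrightarrow> is_min_cut G' (cost I) s' t' (C j e f)))"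

definition candidate ::
  "('v, 'e) nfi \<Rightarrow> 'e list \<Rightarrow> (nat \<Rightarrow> 'e \<Rightarrow> 'v set set) \<Rightarrow> (nat \<Rightarrow> 'e \<Rightarrow> 'v set \<Rightarrow> nat)
     \<Rightarrow> (nat \<Rightarrow> 'e \<Rightarrow> 'v set \<Rightarrow> 'v set set) \<Rightarrow> nat \<Rightarrow> 'e \<Rightarrow> 'v set \<Rightarrow> 'e set" where
  "candidate I es T \<kappa> C j e f =
     cut_edges (contracted_graph I (high_edges I es j e) (T j e) (\<kappa> j e) f) (C j e f)
       \<inter> high_edges I es j e"

definition stored ::
  "('v, 'e) nfi \<Rightarrow> 'e list \<Rightarrow> (nat \<Rightarrow> 'e \<Rightarrow> 'v set set) \<Rightarrow> (nat \<Rightarrow> 'e \<Rightarrow> 'v set \<Rightarrow> nat)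
     \<Rightarrow> (nat \<Rightarrow> 'e \<Rightarrow> 'v set \<Rightarrow> 'v set set) \<Rightarrow> 'e set set" where
  "stored I es T \<kappa> C =
     {candidate I es T \<kappa> C j e f | j e f.
        j \<in> {1..length es} \<and> e \<in> edges (graph I) \<and> f \<in> T j e \<and>
        contracted_vertex I (T j e) (\<kappa> j e) f (source I)
          \<noteq> contracted_vertex I (T j e) (\<kappa> j e) f (sink I) \<and>
        sum (cost I) (candidate I es T \<kappa> C j e f) \<le> budget I}"

definition algorithm_output :: "('v, 'e) nfi \<Rightarrow> 'e set \<Rightarrow> bool" where
  "algorithm_output I R \<longleftrightarrow> (\<exists>es T \<kappa> C. valid_run I es T \<kappa> C \<and>
     R \<in> stored I es T \<kappa> C \<and> (\<forall>R'\<in>stored I es T \<kappa> C. objective I R \<le> objective I R'))"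


section \<open>Machine model\<close>

text \<open>
  A structured random access machine with unit costs. A state maps the name of an array and an
  index to a natural number; scalars are kept at index \<open>0\<close>. Every \<open>Skip\<close>, assignment and test
  takes one step; the expressions occurring in a program have constant size, so charging
  for their evaluation separately would change running times by a constant factor only.

  There is no multiplication of stored numbers: \<^term>\<open>(+)\<close> and truncated \<^term>\<open>(-)\<close> are
  the only operations producing new numbers, so the bit length of the contents of the memory grows
  by at most a constant per step and the unit-cost measure cannot be abused. Products
  occur only inside comparisons (\<open>LeqProd\<close>), which is what comparing two ratios needs.
\<close>

type_synonym state = "string \<Rightarrow> nat \<Rightarrow> nat"

datatype aexp = Const nat | Read string aexp | Plus aexp aexp | Minus aexp aexp

datatype bexp = Leq aexp aexp | LeqProd aexp aexp aexp aexp | Not bexp | And bexp bexp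

datatype com = Skip | Assign string aexp aexp | Seq com com | If bexp com com | While bexp com

primrec aval :: "aexp \<Rightarrow> state \<Rightarrow> nat" where
  "aval (Const k) \<sigma> = k"
| "aval (Read x a) \<sigma> = \<sigma> x (aval a \<sigma>)"
| "aval (Plus a b) \<sigma> = aval a \<sigma> + aval b \<sigma>"
| "aval (Minus a b) \<sigma> = aval a \<sigma> - aval b \<sigma>"

primrec bval :: "bexp \<Rightarrow> state \<Rightarrow> bool" where
  "bval (Leq a b) \<sigma> \<longleftrightarrow> aval a \<sigma> \<le> aval b \<sigma>"
| "bval (LeqProd a b c d) \<sigma> \<longleftrightarrow> aval a \<sigma> * aval b \<sigma> \<le> aval c \<sigma> * aval d \<sigma>"
| "bval (Not b) \<sigma> \<longleftrightarrow> \<not> bval b \<sigma>"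
| "bval (And b c) \<sigma> \<longleftrightarrow> bval b \<sigma> \<and> bval c \<sigma>"

text \<open>\<open>exec p \<sigma> k \<tau>\<close>: started in \<open>\<sigma>\<close>, the program \<open>p\<close> terminates in \<open>\<tau>\<close> after \<open>k\<close> steps.\<close>

inductive exec :: "com \<Rightarrow> state \<Rightarrow> nat \<Rightarrow> state \<Rightarrow> bool" where
  Skip: "exec Skip \<sigma> 1 \<sigma>"
| Assign: "exec (Assign x a b) \<sigma> 1 (\<sigma>(x := (\<sigma> x)(aval a \<sigma> := aval b \<sigma>)))"
| Seq: "exec p \<sigma> k \<sigma>' \<Longrightarrow> exec q \<sigma>' l \<sigma>'' \<Longrightarrow> exec (Seq p q) \<sigma> (k + l) \<sigma>''"
| IfTrue: "bval b \<sigma> \<Longrightarrow> exec p \<sigma> k \<sigma>' \<Longrightarrow> exec (If b p q) \<sigma> (Suc k) \<sigma>'"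
| IfFalse: "\<not> bval b \<sigma> \<Longrightarrow> exec q \<sigma> k \<sigma>' \<Longrightarrow> exec (If b p q) \<sigma> (Suc k) \<sigma>'"
| WhileFalse: "\<not> bval b \<sigma> \<Longrightarrow> exec (While b p) \<sigma> 1 \<sigma>"
| WhileTrue: "bval b \<sigma> \<Longrightarrow> exec p \<sigma> k \<sigma>' \<Longrightarrow> exec (While b p) \<sigma>' l \<sigma>'' \<Longrightarrow>
    exec (While b p) \<sigma> (Suc (k + l)) \<sigma>''"

text \<open>
  Input and output conventions, for graphs with vertices \<open>0, \<dots>, n - 1\<close> and edges
  \<open>0, \<dots>, m - 1\<close>: the two ends of edge \<open>e\<close> are given, in either order, as \<open>a e\<close> and \<open>b e\<close>,
  and a set of edges is returned through its characteristic function in the array \<open>out\<close>.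
\<close>

definition numbered :: "(nat, nat) nfi \<Rightarrow> nat \<Rightarrow> nat \<Rightarrow> (nat \<Rightarrow> nat) \<Rightarrow> (nat \<Rightarrow> nat) \<Rightarrow> bool" where
  "numbered I n m a b \<longleftrightarrow> verts (graph I) = {..<n} \<and> edges (graph I) = {..<m} \<and>
     (\<forall>e<m. ends (graph I) e = {a e, b e})"

definition scalar :: "nat \<Rightarrow> nat \<Rightarrow> nat" where
  "scalar k = (\<lambda>_. 0)(0 := k)"

definition array :: "nat \<Rightarrow> (nat \<Rightarrow> nat) \<Rightarrow> nat \<Rightarrow> nat" where
  "array m g = (\<lambda>i. if i < m then g i else 0)"

definition input_state ::
  "(nat, nat) nfi \<Rightarrow> nat \<Rightarrow> nat \<Rightarrow> (nat \<Rightarrow> nat) \<Rightarrow> (nat \<Rightarrow> nat) \<Rightarrow> state" where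
  "input_state I n m a b = (\<lambda>_ _. 0)
     (''n'' := scalar n, ''m'' := scalar m,
      ''source'' := scalar (source I), ''sink'' := scalar (sink I),
      ''budget'' := scalar (budget I),
      ''a'' := array m a, ''b'' := array m b,
      ''cap'' := array m (cap I), ''cost'' := array m (cost I))"

definition output_set :: "nat \<Rightarrow> state \<Rightarrow> nat set" where
  "output_set m \<sigma> = {e. e < m \<and> \<sigma> ''out'' e \<noteq> 0}"

end

theory Submission
  imports Defs
begin

text \<open>
  Approximation. Let \<open>R\<close> be optimal, \<open>S\<close> a minimum cut of \<open>G - R\<close> (as an edge set of \<open>G\<close>) and \<open>e\<close> the edge of largest
  capacity in \<open>S - R\<close>. Keeping edges of \<open>S\<close> is a minimum knapsack problem: a total cost of \<open>c(S) - B\<close>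
  has to be kept at least capacity. Keeping those of capacity at most \<open>u(e)\<close> greedily by efficiency
  exceeds the optimum by at most one edge, hence some \<open>j\<close> satisfies \<open>u(S \<inter> E\<^sub>\<le>) \<le> 2 OPT\<close> and
  \<open>c(S - E\<^sub>\<le>) \<le> B\<close>. Let \<open>f\<close> be the heaviest edge of the Gomory-Hu tree of \<open>E\<^sub>\<le>\<close> that
  crosses \<open>S\<close>. Then \<open>S\<close> survives the contraction, so the minimum cost cut is affordable, and every cut
  \<open>D\<close> of the contracted graph is crossed by at most \<open>n - 1\<close> tree edges, of weight at most
  \<open>\<kappa>(f) \<le> u(S \<inter> E\<^sub>\<le>)\<close>, so that \<open>u(D \<inter> E\<^sub>\<le>) \<le> 2 (n - 1) OPT\<close>.

  Running time. For all \<open>m\<^sup>2\<close> pairs \<open>(j, e)\<close> the program computes a matrix of local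
  connectivities of \<open>(V, E\<^sub>\<le>)\<close>, and then, for each of its at most \<open>n - 1\<close> values, one minimum cut
  of a contraction and one evaluation. The contraction depends on the Gomory-Hu tree only through these
  connectivities, so a flow-equivalent tree found by Gusfield's method suffices. This takes \<open>O(n)\<close>
  maximum flows per pair, each in time \<open>O(n\<^sup>2 sqrt m)\<close> by highest-label push-relabel.
\<close>

section \<open>Maximum flows and minimum cuts\<close>

text \<open>A run in the sense of \<open>algorithm_output\<close> consists of trees and cuts for all
  triples, and the program builds none of these trees. The link is that a tree enters only through
  connectivity: the classes contracted for a tree edge \<open>f\<close> are those of
  \<open>low_conn I L (\<kappa> f)\<close>, and the weights that occur are exactly
  \<open>thresholds I L\<close>; neither mentions \<open>T\<close>. So any Gomory-Hu tree may be put
  beside the cuts found by the program, which is why the existence of such trees has to be proved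
  although none is computed. The obstacle for the exponent 5/2 is that parallel edges leave m
  unbounded in terms of n: nothing linear in m may be spent on a pair \<open>(j, e)\<close>. Hence
  edges are collected in n by n matrices, passing from \<open>j\<close> to \<open>j + 1\<close>
  moves at most one edge, and a solution is remembered as a set of vertices until the end. Square
  roots are avoided by carrying a natural number \<open>K\<close> with \<open>m \<le> K * K\<close>,
  which is fixed only at the end.\<close>

lemma net_sum:
  assumes "finite (edges G)" "finite C"
  shows "(\<Sum>v\<in>C. \<Sum>e | e \<in> edges G \<and> v \<in> ends G e. f e v)
       = (\<Sum>e\<in>edges G. \<Sum>v | v \<in> C \<and> v \<in> ends G e. (f e v :: real))"
  using sum.swap_restrict[OF assms(2,1), of "\<lambda>v e. f e v" "\<lambda>v e. v \<in> ends G e"] by simp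

lemma mgraph_edge:
  assumes "mgraph G" "e \<in> edges G"
  obtains v w where "ends G e = {v, w}" "v \<noteq> w" "v \<in> verts G" "w \<in> verts G"
  using assms unfolding mgraph_def card_2_iff by (metis insert_subset)

lemma mgraph_other_end:
  assumes "mgraph G" "e \<in> edges G" "v \<in> ends G e"
  obtains w where "ends G e = {v, w}"
proof -
  obtain x y where "ends G e = {x, y}" using mgraph_edge[OF assms(1,2)] by blast
  with assms(3) have "ends G e = {v, y} \<or> ends G e = {v, x}" by auto
  with that show thesis by blast
qed

lemma card_doubleton_Int:
  assumes "v \<noteq> w"
  shows "card ({v, w} \<inter> C) = 1 \<longleftrightarrow> (v \<in> C) \<noteq> (w \<in> C)"
proof -
  have "{v, w} \<inter> C = (if v \<in> C then if w \<in> C then {v, w} else {v} else if w \<in> C then {w} else {})" by auto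
  then show ?thesis using assms by auto
qed

lemma cut_edges_subset: "cut_edges G C \<subseteq> edges G"
  by (auto simp: cut_edges_def)

lemma in_cut_edges:
  assumes "mgraph G" "e \<in> edges G" "ends G e = {v, w}"
  shows "e \<in> cut_edges G C \<longleftrightarrow> (v \<in> C) \<noteq> (w \<in> C)"
proof -
  have "card {v, w} = 2" using assms by (auto simp: mgraph_def)
  then have "v \<noteq> w" by auto
  then show ?thesis using assms card_doubleton_Int[of v w C] by (simp add: cut_edges_def)
qed

lemma net_across_cut:
  assumes G: "mgraph G" and fin: "finite C"
    and skew: "\<forall>e\<in>edges G. \<forall>v w. ends G e = {v, w} \<longrightarrow> f e v = - f e w"
  shows "(\<Sum>v\<in>C. \<Sum>e | e \<in> edges G \<and> v \<in> ends G e. f e v)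
       = (\<Sum>e\<in>cut_edges G C. f e (THE v. v \<in> ends G e \<inter> C) :: real)"
proof -
  have fE: "finite (edges G)" using G by (simp add: mgraph_def)
  have *: "(\<Sum>v | v \<in> C \<and> v \<in> ends G e. f e v)
      = (if e \<in> cut_edges G C then f e (THE v. v \<in> ends G e \<inter> C) else 0)" if e: "e \<in> edges G" for e
  proof -
    obtain v w where vw: "ends G e = {v, w}" "v \<noteq> w" using mgraph_edge[OF G e] by metis
    have eq: "{x. x \<in> C \<and> x \<in> ends G e} = ends G e \<inter> C" by auto
    have fw: "f e w = - f e v" using skew[rule_format, OF e vw(1)] by simp
    consider "v \<in> C" "w \<in> C" | "v \<in> C" "w \<notin> C" | "v \<notin> C" "w \<in> C" | "v \<notin> C" "w \<notin> C" by blast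
    then show ?thesis
    proof cases
      case 1 then have "ends G e \<inter> C = {v, w}" using vw by auto
      then show ?thesis unfolding eq using vw(2) fw 1 in_cut_edges[OF G e vw(1), of C] by simp
    next
      case 2 then have "ends G e \<inter> C = {v}" using vw by auto
      then show ?thesis using 2 in_cut_edges[OF G e vw(1), of C] by (simp add: eq)
    next
      case 3 then have "ends G e \<inter> C = {w}" using vw by auto
      then show ?thesis using 3 in_cut_edges[OF G e vw(1), of C] by (simp add: eq)
    next
      case 4 then have "ends G e \<inter> C = {}" using vw by auto
      then show ?thesis using 4 in_cut_edges[OF G e vw(1), of C] by (simp add: eq)
    qed
  qed
  have "edges G \<inter> cut_edges G C = cut_edges G C" by (auto simp: cut_edges_def)
  then show ?thesis unfolding net_sum[OF fE fin] using fE by (simp add: * sum.inter_restrict[symmetric])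
qed

lemma flow_value_across_cut:
  assumes G: "mgraph G" and C: "is_cut G s t C" and f: "is_flow G u s t f"
  shows "flow_value G s f = (\<Sum>e\<in>cut_edges G C. f e (THE v. v \<in> ends G e \<inter> C))"
proof -
  have fin: "finite C" using G C by (auto simp: mgraph_def is_cut_def finite_subset)
  have "(\<Sum>v\<in>C. \<Sum>e | e \<in> edges G \<and> v \<in> ends G e. f e v) = flow_value G s f
      + (\<Sum>v\<in>C - {s}. \<Sum>e | e \<in> edges G \<and> v \<in> ends G e. f e v)"
    using C fin unfolding flow_value_def by (intro sum.remove) (auto simp: is_cut_def)
  also have "(\<Sum>v\<in>C - {s}. \<Sum>e | e \<in> edges G \<and> v \<in> ends G e. f e v) = 0"
    using C f by (intro sum.neutral) (auto simp: is_cut_def is_flow_def)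
  finally show ?thesis using net_across_cut[OF G fin, of f] f by (simp add: is_flow_def)
qed

lemma the_cut_end:
  assumes "mgraph G" "e \<in> cut_edges G C"
  shows "(THE v. v \<in> ends G e \<inter> C) \<in> ends G e \<inter> C"
proof -
  have "card (ends G e \<inter> C) = 1" using assms by (simp add: cut_edges_def)
  then obtain v where "ends G e \<inter> C = {v}" by (metis card_1_singletonE)
  then show ?thesis by simp
qed

lemma flow_value_le_cut:
  assumes G: "mgraph G" and C: "is_cut G s t C" and f: "is_flow G u s t f"
  shows "flow_value G s f \<le> real (sum u (cut_edges G C))"
proof -
  have "(\<Sum>e\<in>cut_edges G C. f e (THE v. v \<in> ends G e \<inter> C)) \<le> (\<Sum>e\<in>cut_edges G C. real (u e))"
  proof (rule sum_mono)
    fix e assume e: "e \<in> cut_edges G C"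
    show "f e (THE v. v \<in> ends G e \<inter> C) \<le> real (u e)"
      using the_cut_end[OF G e] e f cut_edges_subset[of G C] unfolding is_flow_def
      by (meson IntD1 abs_le_D1 subsetD)
  qed
  then show ?thesis using flow_value_across_cut[OF assms] by simp
qed

definition residual :: "('v, 'e) mgraph \<Rightarrow> ('e \<Rightarrow> nat) \<Rightarrow> ('e \<Rightarrow> 'v \<Rightarrow> int) \<Rightarrow> 'v \<Rightarrow> 'v \<Rightarrow> bool" where
  "residual G u f x y \<longleftrightarrow> (\<exists>e\<in>edges G. ends G e = {x, y} \<and> f e x < int (u e))"

text \<open>Conservation is left out so that a path can be augmented one edge at a time, with
  intermediate states that violate it.\<close>

definition pseudoflow :: "('v, 'e) mgraph \<Rightarrow> ('e \<Rightarrow> nat) \<Rightarrow> ('e \<Rightarrow> 'v \<Rightarrow> int) \<Rightarrow> bool" where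
  "pseudoflow G u f \<longleftrightarrow>
     (\<forall>e\<in>edges G. \<forall>v w. ends G e = {v, w} \<longrightarrow> f e v = - f e w) \<and>
     (\<forall>e\<in>edges G. \<forall>v\<in>ends G e. \<bar>f e v\<bar> \<le> int (u e))"

definition net :: "('v, 'e) mgraph \<Rightarrow> ('e \<Rightarrow> 'v \<Rightarrow> int) \<Rightarrow> 'v \<Rightarrow> int" where
  "net G f v = (\<Sum>e | e \<in> edges G \<and> v \<in> ends G e. f e v)"

lemma push_edge:
  assumes G: "mgraph G" and f: "pseudoflow G u f" and e: "e \<in> edges G" "ends G e = {x, y}" "f e x < int (u e)"
  defines "g \<equiv> f(e := (\<lambda>v. if v = x then f e x + 1 else f e v - 1))"
  shows "pseudoflow G u g" and "net G g v = net G f v + (if v = x then 1 else 0) - (if v = y then 1 else 0)"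
proof -
  have "card {x, y} = 2" using G e by (auto simp: mgraph_def)
  then have xy: "x \<noteq> y" by auto
  have fE: "finite (edges G)" using G by (simp add: mgraph_def)
  have sk: "f e x = - f e y" using f e by (simp add: pseudoflow_def)
  have ab: "\<bar>f e x\<bar> \<le> int (u e)" "\<bar>f e y\<bar> \<le> int (u e)" using f e by (auto simp: pseudoflow_def)
  show "pseudoflow G u g"
    unfolding pseudoflow_def
  proof (intro conjI ballI allI impI)
    fix d v w assume d: "d \<in> edges G" "ends G d = {v, w}"
    show "g d v = - g d w"
    proof (cases "d = e")
      case True
      then have "v = x \<and> w = y \<or> v = y \<and> w = x" using d e by (auto simp: doubleton_eq_iff)
      then show ?thesis using True xy sk by (auto simp: g_def)
    next
      case False
      then show ?thesis using f d unfolding pseudoflow_def by (simp add: g_def)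
    qed
  next
    fix d v assume d: "d \<in> edges G" "v \<in> ends G d"
    show "\<bar>g d v\<bar> \<le> int (u d)"
    proof (cases "d = e")
      case True
      then have "v = x \<or> v = y" using d e by simp
      then show ?thesis using True xy sk ab e(3) by (auto simp: g_def)
    next
      case False
      then show ?thesis using f d unfolding pseudoflow_def by (simp add: g_def)
    qed
  qed
  let ?E = "{e \<in> edges G. v \<in> ends G e}"
  show "net G g v = net G f v + (if v = x then 1 else 0) - (if v = y then 1 else 0)"
  proof (cases "v \<in> ends G e")
    case True
    then have ee: "e \<in> ?E" using e by auto
    have "(\<Sum>d\<in>?E - {e}. g d v) = (\<Sum>d\<in>?E - {e}. f d v)" by (intro sum.cong) (auto simp: g_def)
    moreover have "g e v = f e v + (if v = x then 1 else 0) - (if v = y then 1 else 0)"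
      using True e xy by (auto simp: g_def)
    ultimately show ?thesis unfolding net_def using fE ee by (simp add: sum.remove[of _ e])
  next
    case False
    then have "(\<Sum>d\<in>?E. g d v) = (\<Sum>d\<in>?E. f d v)" by (intro sum.cong) (auto simp: g_def)
    then show ?thesis using False e by (auto simp: net_def)
  qed
qed

text \<open>The path is augmented from its far end. The last conjunct carries the induction: the
  first edge has its end \<open>a\<close> off the rest of the path, so it still has the slack it had
  under \<open>f\<close>.\<close>

lemma augment:
  assumes G: "mgraph G" and f: "pseudoflow G u f"
    and "p \<noteq> []" "distinct p" "successively (residual G u f) p"
  shows "\<exists>g. pseudoflow G u g \<and> (\<forall>v. net G g v = net G f v + (if v = hd p then 1 else 0) - (if v = last p then 1 else 0))
    \<and> (\<forall>e\<in>edges G. \<not> ends G e \<subseteq> set p \<longrightarrow> g e = f e)"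
  using assms(3-)
proof (induction p)
  case Nil then show ?case by simp
next
  case (Cons a p)
  show ?case
  proof (cases "p = []")
    case True then show ?thesis using f by auto
  next
    case False
    then obtain b q where p: "p = b # q" by (cases p) auto
    obtain g where g: "pseudoflow G u g"
      "\<And>v. net G g v = net G f v + (if v = b then 1 else 0) - (if v = last p then 1 else 0)"
      "\<And>e. e\<in>edges G \<Longrightarrow> \<not> ends G e \<subseteq> set p \<Longrightarrow> g e = f e"
      using Cons p by auto
    obtain e where e: "e \<in> edges G" "ends G e = {a, b}" "f e a < int (u e)"
      using Cons.prems p by (auto simp: residual_def)
    have ge: "g e = f e" using g(3)[OF e(1)] e Cons.prems by auto
    define h where "h = g(e := (\<lambda>v. if v = a then g e a + 1 else g e v - 1))"
    have h: "pseudoflow G u h" "\<And>v. net G h v = net G g v + (if v = a then 1 else 0) - (if v = b then 1 else 0)"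
      using push_edge[OF G g(1) e(1,2)] e(3) ge unfolding h_def by auto
    have "h e' = f e'" if "e' \<in> edges G" "\<not> ends G e' \<subseteq> set (a # p)" for e'
      using that g(3)[of e'] e p by (auto simp: h_def)
    then show ?thesis using h g(2) False by (intro exI[of _ h]) (auto)
  qed
qed

lemma rtranclp_distinct_path:
  assumes "r\<^sup>*\<^sup>* x y"
  shows "\<exists>p. p \<noteq> [] \<and> distinct p \<and> successively r p \<and> hd p = x \<and> last p = y"
  using assms
proof (induction rule: converse_rtranclp_induct)
  case base then show ?case by (intro exI[of _ "[y]"]) auto
next
  case (step x z)
  then obtain p where p: "p \<noteq> []" "distinct p" "successively r p" "hd p = z" "last p = y" by auto
  show ?case
  proof (cases "x \<in> set p")
    case False
    then show ?thesis using p step by (intro exI[of _ "x # p"]) (auto simp: successively_Cons)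
  next
    case True
    then obtain q q' where "p = q @ x # q'" by (meson split_list)
    then show ?thesis using p by (intro exI[of _ "x # q'"]) (auto simp: successively_append_iff)
  qed
qed

lemma max_flow_min_cut:
  assumes G: "mgraph G" and st: "s \<in> verts G" "t \<in> verts G" "s \<noteq> t"
  shows "\<exists>C f. is_cut G s t C \<and> is_flow G u s t f \<and> flow_value G s f = real (sum u (cut_edges G C))"
proof -
  \<comment> \<open>Nonnegativity of the value is kept so that \<open>nat (net G f s)\<close> really
    increases under augmentation; being bounded, it has a maximiser.\<close>
  define P where "P f \<longleftrightarrow> pseudoflow G u f \<and> (\<forall>v\<in>verts G - {s, t}. net G f v = 0) \<and> net G f s \<ge> 0" for f
  have fE: "finite (edges G)" and fV: "finite (verts G)" using G by (auto simp: mgraph_def)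
  have real_flow: "is_flow G u s t (\<lambda>e v. real_of_int (f e v))"
    and val: "flow_value G s (\<lambda>e v. real_of_int (f e v)) = real_of_int (net G f s)" if "P f" for f
  proof -
    have "real_of_int (f e v) = - real_of_int (f e w)" if "e \<in> edges G" "ends G e = {v, w}" for e v w
      using \<open>P f\<close> that unfolding P_def pseudoflow_def by (metis of_int_minus)
    moreover have "\<bar>real_of_int (f e v)\<bar> \<le> real (u e)" if "e \<in> edges G" "v \<in> ends G e" for e v
    proof -
      have "\<bar>f e v\<bar> \<le> int (u e)" using \<open>P f\<close> that by (auto simp: P_def pseudoflow_def)
      then show ?thesis by linarith
    qed
    moreover have "(\<Sum>e | e \<in> edges G \<and> v \<in> ends G e. real_of_int (f e v)) = 0" if "v \<in> verts G - {s, t}" for v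
      using \<open>P f\<close> that by (auto simp: P_def net_def simp flip: of_int_sum)
    ultimately show "is_flow G u s t (\<lambda>e v. real_of_int (f e v))" unfolding is_flow_def by blast
    show "flow_value G s (\<lambda>e v. real_of_int (f e v)) = real_of_int (net G f s)"
      by (simp add: flow_value_def net_def)
  qed
  have P0: "P (\<lambda>_ _. 0)" by (simp add: P_def pseudoflow_def net_def)
  have "net G f s \<le> int (sum u (edges G))" if "P f" for f
  proof -
    have "net G f s \<le> (\<Sum>e | e \<in> edges G \<and> s \<in> ends G e. int (u e))"
      unfolding net_def using that by (intro sum_mono) (force simp: P_def pseudoflow_def)
    also have "\<dots> \<le> (\<Sum>e\<in>edges G. int (u e))" using fE by (intro sum_mono2) auto
    finally show ?thesis by simp
  qed
  then have "\<forall>f. P f \<longrightarrow> nat (net G f s) < Suc (sum u (edges G))" by (smt (verit) nat_le_iff less_Suc_eq_le)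
  then obtain f where f: "P f" "\<And>g. P g \<Longrightarrow> nat (net G g s) \<le> nat (net G f s)"
    using ex_has_greatest_nat[of P _ "\<lambda>f. nat (net G f s)", OF P0] by blast
  define C where "C = {v \<in> verts G. (residual G u f)\<^sup>*\<^sup>* s v}"
  have "t \<notin> C"
  proof
    assume "t \<in> C"
    then obtain p where p: "p \<noteq> []" "distinct p" "successively (residual G u f) p" "hd p = s" "last p = t"
      using rtranclp_distinct_path[of "residual G u f" s t] by (auto simp: C_def)
    obtain g where g: "pseudoflow G u g"
      "\<And>v. net G g v = net G f v + (if v = s then 1 else 0) - (if v = t then 1 else 0)"
      using augment[OF G _ p(1,2,3)] f(1) p(4,5) unfolding P_def by metis
    have "P g" "net G g s = net G f s + 1" using g f(1) st by (auto simp: P_def)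
    moreover have "net G f s \<ge> 0" using f(1) by (simp add: P_def)
    ultimately show False using f(2)[of g] by simp
  qed
  then have C: "is_cut G s t C" using st by (auto simp: is_cut_def C_def)
  \<comment> \<open>An edge with slack leaving the reachable set would make its outer end reachable,
    so every cut edge is saturated outwards.\<close>
  have "real_of_int (f e (THE v. v \<in> ends G e \<inter> C)) = real (u e)" if e: "e \<in> cut_edges G C" for e
  proof -
    let ?v = "THE v. v \<in> ends G e \<inter> C"
    have eE: "e \<in> edges G" using e by (simp add: cut_edges_def)
    have v: "?v \<in> ends G e" "?v \<in> C" using the_cut_end[OF G e] by auto
    obtain w where w: "ends G e = {?v, w}" using mgraph_other_end[OF G eE v(1)] by blast
    then have wC: "w \<notin> C" using in_cut_edges[OF G eE w] e v by auto
    have "w \<in> verts G" using w eE G by (auto simp: mgraph_def)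
    then have "\<not> residual G u f ?v w" using wC v(2) unfolding C_def by (auto intro: rtranclp.rtrancl_into_rtrancl)
    then have "\<not> f e ?v < int (u e)" using eE w by (auto simp: residual_def)
    moreover have "f e ?v \<le> int (u e)" using f(1) eE v by (force simp: P_def pseudoflow_def)
    ultimately show ?thesis by simp
  qed
  then have "flow_value G s (\<lambda>e v. real_of_int (f e v)) = real (sum u (cut_edges G C))"
    using flow_value_across_cut[OF G C real_flow[OF f(1)]] by simp
  then show ?thesis using C real_flow[OF f(1)] by blast
qed

text \<open>\<open>max_flow_value\<close> is a supremum over real flows. All of them are bounded by
  the cut and an integral flow attains the bound, so the supremum is a maximum.\<close>

lemma max_flow_value_eq_min_cut:
  assumes G: "mgraph G" and st: "s \<in> verts G" "t \<in> verts G" "s \<noteq> t" and C: "is_min_cut G u s t C"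
  shows "max_flow_value G u s t = real (sum u (cut_edges G C))"
proof -
  obtain D f where D: "is_cut G s t D" and f: "is_flow G u s t f" "flow_value G s f = real (sum u (cut_edges G D))"
    using max_flow_min_cut[OF G st] by blast
  have le: "flow_value G s g \<le> real (sum u (cut_edges G C))" if "is_flow G u s t g" for g
    using flow_value_le_cut[OF G _ that] C by (auto simp: is_min_cut_def)
  have "sum u (cut_edges G C) \<le> sum u (cut_edges G D)" using C D by (auto simp: is_min_cut_def)
  then have "real (sum u (cut_edges G C)) \<le> real (sum u (cut_edges G D))" by linarith
  then have "flow_value G s f = real (sum u (cut_edges G C))" using le[OF f(1)] f(2) by linarith
  then show ?thesis unfolding max_flow_value_def using le f(1)
    by (intro cSup_eq_maximum) (auto intro!: image_eqI[of _ _ f])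
qed

lemma min_cut_exists:
  assumes "finite (verts G)" "s \<in> verts G" "t \<in> verts G" "s \<noteq> t"
  shows "\<exists>C. is_min_cut G w s t C"
proof -
  have "is_cut G s t {s}" using assms by (auto simp: is_cut_def)
  then obtain C where "is_cut G s t C" "\<forall>D. is_cut G s t D \<longrightarrow> sum w (cut_edges G C) \<le> sum w (cut_edges G D)"
    using ex_has_least_nat[of "is_cut G s t" _ "\<lambda>C. sum w (cut_edges G C)"] by blast
  then show ?thesis by (auto simp: is_min_cut_def)
qed

section \<open>Gomory-Hu trees\<close>

definition separates :: "'v set \<Rightarrow> 'v \<Rightarrow> 'v \<Rightarrow> bool" where
  "separates D x y \<longleftrightarrow> (x \<in> D) \<noteq> (y \<in> D)"

text \<open>Only symmetry and submodularity of cut capacities are used below. Abstracting from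
  graphs makes the class closed under contraction (\<open>cut_function_vimage\<close>), as the
  recursion in \<open>terminal_tree_exists\<close> requires.\<close>

locale cut_function =
  fixes V :: "'v set" and d :: "'v set \<Rightarrow> nat"
  assumes fin: "finite V"
    and sym: "D \<subseteq> V \<Longrightarrow> d (V - D) = d D"
    and submod: "A \<subseteq> V \<Longrightarrow> B \<subseteq> V \<Longrightarrow> d (A \<inter> B) + d (A \<union> B) \<le> d A + d B"
begin

text \<open>Submodularity for \<open>A\<close> and the complement of \<open>B\<close>, with
  complements removed by symmetry.\<close>

lemma posimod:
  assumes "A \<subseteq> V" "B \<subseteq> V"
  shows "d (A - B) + d (B - A) \<le> d A + d B"
proof -
  have "A \<inter> (V - B) = A - B" "A \<union> (V - B) = V - (B - A)" using assms by auto
  moreover have "B - A \<subseteq> V" "V - B \<subseteq> V" using assms by auto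
  ultimately show ?thesis using submod[of A "V - B"] sym[of B] sym[of "B - A"] assms by simp
qed

text \<open>This says that the local connectivity exceeds \<open>\<theta>\<close>. Speaking of
  thresholds instead of values spares a special case for \<open>x = y\<close>, where the
  connectivity is infinite, and gives an equivalence relation for each
  \<open>\<theta>\<close>.\<close>

definition conn :: "nat \<Rightarrow> 'v \<Rightarrow> 'v \<Rightarrow> bool" where
  "conn \<theta> x y \<longleftrightarrow> (\<forall>D\<subseteq>V. separates D x y \<longrightarrow> \<theta> < d D)"

lemma conn_refl: "conn \<theta> x x" by (simp add: conn_def separates_def)

lemma conn_sym: "conn \<theta> x y \<Longrightarrow> conn \<theta> y x" by (auto simp: conn_def separates_def)

lemma conn_trans:
  assumes "conn \<theta> x y" "conn \<theta> y z"
  shows "conn \<theta> x z"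
  unfolding conn_def
proof (intro allI impI)
  fix D assume D: "D \<subseteq> V" "separates D x z"
  then have "separates D x y \<or> separates D y z" by (auto simp: separates_def)
  then show "\<theta> < d D" using assms D(1) by (auto simp: conn_def)
qed

lemma min_cut_separates:
  assumes min: "\<And>D. D \<subseteq> V \<Longrightarrow> s \<in> D \<Longrightarrow> t \<notin> D \<Longrightarrow> k \<le> d D" and st: "s \<in> V" "t \<in> V"
    and D: "D \<subseteq> V" "separates D s t"
  shows "k \<le> d D"
proof (cases "s \<in> D")
  case True
  then show ?thesis using min[of D] D by (simp add: separates_def)
next
  case False
  then show ?thesis using min[of "V - D"] sym[OF D(1)] D st by (simp add: separates_def)
qed

text \<open>Uncrossing. Let \<open>Y\<close> contain \<open>a\<close> but not \<open>s\<close>. If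
  \<open>b\<close> is outside \<open>Y\<close>, then \<open>Y\<close> itself separates
  \<open>a\<close> from \<open>b\<close>. Otherwise \<open>X \<inter> Y\<close> does, or
  \<open>Y - X\<close> does, and neither is heavier than \<open>Y\<close>: the companion set
  \<open>X \<union> Y\<close> (when \<open>t\<close> is outside \<open>Y\<close>) or
  \<open>X - Y\<close> (when \<open>t\<close> is inside) is an s-t cut and so at least as heavy as
  \<open>X\<close>.\<close>

lemma conn_across_min_cut_aux:
  assumes X: "X \<subseteq> V" "s \<in> X" "t \<in> V - X"
    and min: "\<And>D. D \<subseteq> V \<Longrightarrow> s \<in> D \<Longrightarrow> t \<notin> D \<Longrightarrow> d X \<le> d D"
    and ab: "a \<in> X" "b \<in> V - X" and conn: "conn \<theta> a b"
  shows "conn \<theta> a s"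
proof -
  have cd: "\<theta> < d D" if "D \<subseteq> V" "(a \<in> D) \<noteq> (b \<in> D)" for D
    using conn that by (simp add: conn_def separates_def)
  have main: "\<theta> < d Y" if Y: "Y \<subseteq> V" "a \<in> Y" "s \<notin> Y" for Y
  proof (cases "b \<in> Y")
    case False then show ?thesis using Y by (intro cd) auto
  next
    case bY: True
    show ?thesis
    proof (cases "t \<in> Y")
      case False
      have "\<theta> < d (X \<inter> Y)" using Y ab by (intro cd) auto
      moreover have "d X \<le> d (X \<union> Y)" using X Y False by (intro min) auto
      ultimately show ?thesis using submod[OF X(1) Y(1)] by linarith
    next
      case True
      have "\<theta> < d (Y - X)" using Y ab bY by (intro cd) auto
      moreover have "d X \<le> d (X - Y)" using X Y True by (intro min) auto
      ultimately show ?thesis using posimod[OF X(1) Y(1)] by linarith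
    qed
  qed
  show ?thesis unfolding conn_def separates_def
  proof (intro allI impI)
    fix D assume D: "D \<subseteq> V" "(a \<in> D) \<noteq> (s \<in> D)"
    show "\<theta> < d D"
    proof (cases "a \<in> D")
      case True
      then show ?thesis using main[of D] D by simp
    next
      case False
      then show ?thesis using main[of "V - D"] sym[OF D(1)] D X(1,2) ab(1) by (simp add: subset_iff)
    qed
  qed
qed

text \<open>In terms of values: for \<open>a\<close> and \<open>b\<close> on different sides of a
  minimum s-t cut, their local connectivity is the minimum of those of a and s, of s and t, and of t
  and b. One minimum cut thus settles every pair that it separates, however it crosses other
  cuts.\<close>

lemma conn_across_min_cut:
  assumes X: "X \<subseteq> V" "s \<in> X" "t \<in> V - X"
    and min: "\<And>D. D \<subseteq> V \<Longrightarrow> s \<in> D \<Longrightarrow> t \<notin> D \<Longrightarrow> d X \<le> d D"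
    and ab: "a \<in> X" "b \<in> V - X"
  shows "conn \<theta> a b \<longleftrightarrow> conn \<theta> a s \<and> \<theta> < d X \<and> conn \<theta> t b"
proof
  assume c: "conn \<theta> a b"
  have "conn \<theta> b t"
  proof (rule conn_across_min_cut_aux[of "V - X" t s])
    fix D assume D: "D \<subseteq> V" "t \<in> D" "s \<notin> D"
    then show "d (V - X) \<le> d D" using min[of "V - D"] sym[of D] sym[of X] X by auto
  qed (use X ab conn_sym[OF c] in auto)
  moreover have "\<theta> < d X" using c X ab by (auto simp: conn_def separates_def)
  ultimately show "conn \<theta> a s \<and> \<theta> < d X \<and> conn \<theta> t b"
    using conn_across_min_cut_aux[OF assms c] conn_sym by blast
next
  assume c: "conn \<theta> a s \<and> \<theta> < d X \<and> conn \<theta> t b"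
  have "d X \<le> d D" if "D \<subseteq> V" "separates D s t" for D
    using min_cut_separates[OF min _ _ that] X by auto
  then have "conn \<theta> s t" using c unfolding conn_def by (meson less_le_trans)
  then show "conn \<theta> a b" using c conn_trans by blast
qed

end

text \<open>Contraction along \<open>q\<close>: cuts of the image are the cuts of \<open>V\<close>
  that respect the fibres, and taking preimages commutes with union, intersection and
  complement.\<close>

lemma cut_function_vimage:
  assumes "cut_function V d" "q ` V = W"
  shows "cut_function W (\<lambda>S. d {v \<in> V. q v \<in> S})"
proof -
  interpret cut_function V d by fact
  show ?thesis
  proof
    show "finite W" using assms(2) fin by auto
    fix D assume "D \<subseteq> W"
    have "{v \<in> V. q v \<in> W - D} = V - {v \<in> V. q v \<in> D}" using assms(2) by auto
    then show "d {v \<in> V. q v \<in> W - D} = d {v \<in> V. q v \<in> D}" using sym[of "{v \<in> V. q v \<in> D}"] by auto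
  next
    fix A B assume "A \<subseteq> W" "B \<subseteq> W"
    have "{v \<in> V. q v \<in> A \<inter> B} = {v \<in> V. q v \<in> A} \<inter> {v \<in> V. q v \<in> B}"
      "{v \<in> V. q v \<in> A \<union> B} = {v \<in> V. q v \<in> A} \<union> {v \<in> V. q v \<in> B}" by auto
    then show "d {v \<in> V. q v \<in> A \<inter> B} + d {v \<in> V. q v \<in> A \<union> B} \<le> d {v \<in> V. q v \<in> A} + d {v \<in> V. q v \<in> B}"
      using submod[of "{v \<in> V. q v \<in> A}" "{v \<in> V. q v \<in> B}"] by auto
  qed
qed

section \<open>Paths, bridges and trees\<close>

abbreviation linked :: "'v set set \<Rightarrow> 'v \<Rightarrow> 'v \<Rightarrow> bool" where
  "linked F \<equiv> (\<lambda>x y. {x, y} \<in> F)\<^sup>*\<^sup>*"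

lemma linked_sym: "linked F x y \<Longrightarrow> linked F y x"
proof (induction rule: rtranclp_induct)
  case (step y z)
  have "{z, y} \<in> F" using step(2) by (simp add: insert_commute)
  then show ?case using step(3) by (rule converse_rtranclp_into_rtranclp)
qed simp

lemma linked_mono: "linked F x y \<Longrightarrow> F \<subseteq> F' \<Longrightarrow> linked F' x y"
  by (induction rule: rtranclp_induct) (auto intro: rtranclp.rtrancl_into_rtrancl)

lemma successively_linked:
  "p \<noteq> [] \<Longrightarrow> successively (\<lambda>x y. {x, y} \<in> F) p \<Longrightarrow> linked F (hd p) (last p)"
proof (induction p)
  case (Cons a p)
  then show ?case by (cases p) (auto intro: converse_rtranclp_into_rtranclp)
qed simp

lemma ex_path_iff_linked: "(\<exists>p. is_path F a p b) \<longleftrightarrow> linked F a b"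
proof
  assume "\<exists>p. is_path F a p b"
  then show "linked F a b" unfolding is_path_def using successively_linked by metis
next
  assume "linked F a b"
  then show "\<exists>p. is_path F a p b" using rtranclp_distinct_path[of "\<lambda>x y. {x, y} \<in> F"] unfolding is_path_def by metis
qed

lemma component_linked: "component F v = {x. linked F v x}"
  by (simp add: component_def ex_path_iff_linked)

text \<open>A detour around the edge has at least three vertices, so together with the edge it forms
  a cycle in the sense of \<open>is_cycle\<close>.\<close>

lemma tree_bridge:
  assumes T: "is_tree V F" and e: "{x, y} \<in> F"
  shows "\<not> linked (F - {{x, y}}) x y"
proof
  assume "linked (F - {{x, y}}) x y"
  then obtain p where p: "is_path (F - {{x, y}}) x p y" using ex_path_iff_linked by metis
  have "card {x, y} = 2" using T e by (auto simp: is_tree_def)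
  then have "x \<noteq> y" by auto
  have "length p \<ge> 3"
  proof (rule ccontr)
    assume len: "\<not> 3 \<le> length p"
    obtain q where q: "p = x # q" using p by (cases p) (auto simp: is_path_def)
    show False
    proof (cases q)
      case Nil then show False using p q \<open>x \<noteq> y\<close> by (simp add: is_path_def)
    next
      case (Cons z q')
      then have "p = [x, z]" using q len by (cases q') auto
      then show False using p by (auto simp: is_path_def)
    qed
  qed
  moreover have "successively (\<lambda>x y. {x, y} \<in> F) p"
    using p unfolding is_path_def by (auto intro: successively_mono)
  ultimately have "is_cycle F p" using p e by (auto simp: is_path_def is_cycle_def insert_commute)
  then show False using T by (auto simp: is_tree_def)
qed

text \<open>The bridge condition replaces acyclicity because it can be checked edge by edge when two
  trees are joined; the closing edge of a cycle would violate it.\<close>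

lemma tree_intro:
  assumes F: "\<And>f. f \<in> F \<Longrightarrow> f \<subseteq> V \<and> card f = 2"
    and conn: "\<And>a b. a \<in> V \<Longrightarrow> b \<in> V \<Longrightarrow> linked F a b"
    and bridge: "\<And>x y. {x, y} \<in> F \<Longrightarrow> \<not> linked (F - {{x, y}}) x y"
  shows "is_tree V F"
proof -
  have False if c: "is_cycle F p" for p
  proof -
    from c have p: "3 \<le> length p" "distinct p" "successively (\<lambda>x y. {x, y} \<in> F) p" "{last p, hd p} \<in> F"
      by (auto simp: is_cycle_def)
    have "successively (\<lambda>x y. {x, y} \<in> F - {{hd p, last p}}) p"
      unfolding successively_conv_nth
    proof (intro allI impI)
      fix i assume i: "Suc i < length p"
      have ne: "p \<noteq> []" using p(1) by auto
      have "{p ! i, p ! Suc i} \<noteq> {hd p, last p}"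
      proof
        assume "{p ! i, p ! Suc i} = {hd p, last p}"
        then have "p ! i = p ! 0 \<and> p ! Suc i = p ! (length p - 1) \<or> p ! i = p ! (length p - 1) \<and> p ! Suc i = p ! 0"
          using ne by (simp add: doubleton_eq_iff hd_conv_nth last_conv_nth)
        moreover have "0 < length p" "length p - 1 < length p" "i < length p" using i by auto
        ultimately have "i = 0 \<and> Suc i = length p - 1 \<or> i = length p - 1 \<and> Suc i = 0"
          using p(2) i by (simp add: nth_eq_iff_index_eq)
        then show False using p(1) by auto
      qed
      then show "{p ! i, p ! Suc i} \<in> F - {{hd p, last p}}" using p(3) i by (auto simp: successively_conv_nth)
    qed
    then have "linked (F - {{hd p, last p}}) (hd p) (last p)" using p(1) by (intro successively_linked) auto
    then show False using bridge[of "hd p" "last p"] p(4) by (simp add: insert_commute)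
  qed
  then show ?thesis unfolding is_tree_def using F conn by (auto simp: ex_path_iff_linked)
qed

text \<open>A path visits no vertex twice, so no other step uses this edge and the two remaining
  pieces avoid it.\<close>

lemma path_edge_sides:
  assumes p: "is_path F a p b" and i: "Suc i < length p"
  shows "linked (F - {{p ! i, p ! Suc i}}) a (p ! i)" "linked (F - {{p ! i, p ! Suc i}}) (p ! Suc i) b"
proof -
  let ?F = "F - {{p ! i, p ! Suc i}}"
  have step: "{p ! j, p ! Suc j} \<in> ?F" if "Suc j < length p" "j \<noteq> i" for j
  proof -
    have "{p ! j, p ! Suc j} \<in> F" using p that by (auto simp: is_path_def successively_conv_nth)
    moreover have "distinct p" using p by (simp add: is_path_def)
    ultimately show ?thesis using that i by (auto simp: doubleton_eq_iff nth_eq_iff_index_eq)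
  qed
  have "linked ?F (p ! 0) (p ! j)" if "j \<le> i" for j using that
  proof (induction j)
    case (Suc j) then show ?case using step[of j] i by (auto intro: rtranclp.rtrancl_into_rtrancl)
  qed simp
  then show "linked ?F a (p ! i)" using p by (auto simp: is_path_def hd_conv_nth)
  have "linked ?F (p ! Suc i) (p ! (Suc i + j))" if "Suc i + j < length p" for j using that
  proof (induction j)
    case (Suc j) then show ?case using step[of "Suc i + j"] i by (auto intro: rtranclp.rtrancl_into_rtrancl)
  qed simp
  from this[of "length p - Suc (Suc i)"] have "linked ?F (p ! Suc i) (p ! (length p - 1))" using i
    by (simp add: Suc_diff_Suc numeral_2_eq_2)
  then show "linked ?F (p ! Suc i) b" using p by (auto simp: is_path_def last_conv_nth)
qed

lemma path_crosses:
  assumes p: "is_path F a p b" and D: "a \<in> D" "b \<notin> D"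
  shows "\<exists>i. Suc i < length p \<and> p ! i \<in> D \<and> p ! Suc i \<notin> D"
proof (rule ccontr)
  assume "\<not> ?thesis"
  then have "p ! j \<in> D" if "j < length p" for j using that
    by (induction j) (use p D in \<open>auto simp: is_path_def hd_conv_nth\<close>)
  then show False using p D by (auto simp: is_path_def last_conv_nth)
qed

text \<open>Every vertex other than \<open>r\<close> is charged with the first edge of its path to
  \<open>r\<close>. Each edge is charged by one of its ends: otherwise both ends would reach
  \<open>r\<close> without it, and it would not be a bridge.\<close>

lemma card_tree_edges:
  assumes T: "is_tree V F" and V: "finite V" "r \<in> V"
  shows "card F \<le> card V - 1"
proof -
  have "\<forall>v\<in>V. \<exists>p. is_path F v p r" using T V by (auto simp: is_tree_def)
  then obtain P where P: "\<And>v. v \<in> V \<Longrightarrow> is_path F v (P v) r" by metis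
  let ?g = "\<lambda>v. {v, P v ! 1}"
  have "F \<subseteq> ?g ` (V - {r})"
  proof
    fix f assume f: "f \<in> F"
    have "card f = 2" "f \<subseteq> V" using T f by (auto simp: is_tree_def)
    then obtain x y where f': "f = {x, y}" "x \<noteq> y" "x \<in> V" "y \<in> V" by (auto simp: card_2_iff)
    have avoid: "linked (F - {f}) v r" if v: "v \<in> f" "v = r \<or> ?g v \<noteq> f" for v
    proof -
      have vV: "v \<in> V" using v f' by auto
      note p = P[OF vV]
      show ?thesis
      proof (cases "v = r")
        case False
        have "successively (\<lambda>x y. {x, y} \<in> F - {f}) (P v)"
          unfolding successively_conv_nth
        proof (intro allI impI)
          fix i assume i: "Suc i < length (P v)"
          have "{P v ! i, P v ! Suc i} \<noteq> f"
          proof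
            assume eq: "{P v ! i, P v ! Suc i} = f"
            have "P v ! 0 = v" using p by (auto simp: is_path_def hd_conv_nth)
            moreover have "v = P v ! i \<or> v = P v ! Suc i" using v(1) eq by auto
            ultimately have "P v ! 0 = P v ! i \<or> P v ! 0 = P v ! Suc i" by simp
            moreover have "distinct (P v)" using p by (simp add: is_path_def)
            moreover have "0 < length (P v)" "i < length (P v)" using i by auto
            ultimately have "i = 0" using i by (simp add: nth_eq_iff_index_eq)
            then show False using eq v(2) False \<open>P v ! 0 = v\<close> by simp
          qed
          then show "{P v ! i, P v ! Suc i} \<in> F - {f}" using p i by (auto simp: is_path_def successively_conv_nth)
        qed
        then show ?thesis using p successively_linked[of "P v" "F - {f}"] by (auto simp: is_path_def)
      qed simp
    qed
    have "\<not> linked (F - {f}) x y" using tree_bridge[OF T] f f'(1) by auto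
    then have "\<not> (linked (F - {f}) x r \<and> linked (F - {f}) y r)" using linked_sym[of "F - {f}" y r] rtranclp_trans[of _ x r y] by blast
    then obtain v where "v \<in> f" "v \<noteq> r" "?g v = f" using avoid[of x] avoid[of y] f'(1) by blast
    then show "f \<in> ?g ` (V - {r})" using \<open>f \<subseteq> V\<close> by (intro image_eqI[of _ _ v]) auto
  qed
  then have "card F \<le> card (?g ` (V - {r}))" using V by (intro card_mono) auto
  also have "\<dots> \<le> card (V - {r})" using V by (intro card_image_le) auto
  finally show ?thesis using V by simp
qed

text \<open>Edges leave \<open>P1\<close> only through \<open>{x0, y0}\<close>, and
  \<open>F2\<close> connects \<open>P2\<close>, so \<open>P2\<close> is reached as a whole, and
  exactly when \<open>x0\<close> is. \<open>F1\<close> may be disconnected, since the lemma is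
  applied after an edge has been deleted from it.\<close>

lemma linked_join:
  assumes F1: "\<And>f. f \<in> F1 \<Longrightarrow> f \<subseteq> P1" and F2: "\<And>f. f \<in> F2 \<Longrightarrow> f \<subseteq> P2"
    and disj: "P1 \<inter> P2 = {}" and x0: "x0 \<in> P1" and y0: "y0 \<in> P2"
    and conn2: "\<And>z. z \<in> P2 \<Longrightarrow> linked F2 y0 z" and x: "x \<in> P1"
  defines "H \<equiv> insert {x0, y0} (F1 \<union> F2)"
  shows "z \<in> P1 \<Longrightarrow> linked H x z \<longleftrightarrow> linked F1 x z"
    and "z \<in> P2 \<Longrightarrow> linked H x z \<longleftrightarrow> linked F1 x x0"
proof -
  have main: "(z \<in> P1 \<and> linked F1 x z) \<or> (z \<in> P2 \<and> linked F1 x x0)" if "linked H x z" for z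
    using that
  proof (induction rule: rtranclp_induct)
    case base then show ?case using x by simp
  next
    case (step y z)
    have "{y, z} = {x0, y0} \<or> {y, z} \<in> F1 \<or> {y, z} \<in> F2" using step(2) by (auto simp: H_def)
    then show ?case
    proof (elim disjE)
      assume "{y, z} = {x0, y0}"
      then have "y = x0 \<and> z = y0 \<or> y = y0 \<and> z = x0" by (auto simp: doubleton_eq_iff)
      then show ?thesis using step(3) x0 y0 disj by auto
    next
      assume a: "{y, z} \<in> F1"
      then have "y \<in> P1" "z \<in> P1" using F1[OF a] by auto
      then have "linked F1 x y" using step(3) disj by auto
      then show ?thesis using a \<open>z \<in> P1\<close> rtranclp.rtrancl_into_rtrancl[of "\<lambda>x y. {x, y} \<in> F1"] by metis
    next
      assume a: "{y, z} \<in> F2"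
      then have "y \<in> P2" "z \<in> P2" using F2[OF a] by auto
      then show ?thesis using step(3) disj by auto
    qed
  qed
  have sub: "linked H x z" if "linked F1 x z" for z using that by (rule linked_mono) (auto simp: H_def)
  show "linked H x z \<longleftrightarrow> linked F1 x z" if "z \<in> P1" using main[of z] sub[of z] that disj by auto
  show "linked H x z \<longleftrightarrow> linked F1 x x0" if z: "z \<in> P2"
  proof
    assume "linked H x z" then show "linked F1 x x0" using main[of z] z disj by auto
  next
    assume "linked F1 x x0"
    then have "linked H x x0" by (rule sub)
    moreover have "{x0, y0} \<in> H" by (simp add: H_def)
    moreover have "linked H y0 z" using conn2[OF z] by (rule linked_mono) (auto simp: H_def)
    ultimately show "linked H x z"
      using rtranclp.rtrancl_into_rtrancl[of "\<lambda>x y. {x, y} \<in> H" x x0 y0] rtranclp_trans[of _ x y0 z] by blast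
  qed
qed

text \<open>A Gomory-Hu tree on a set \<open>A\<close> of terminals: \<open>\<pi>\<close> assigns every vertex to a terminal, so that
  the two sides of a tree edge become cuts of all of \<open>V\<close>.\<close>

definition terminal_tree ::
  "'v set \<Rightarrow> ('v set \<Rightarrow> nat) \<Rightarrow> 'v set \<Rightarrow> 'v set set \<Rightarrow> ('v \<Rightarrow> 'v) \<Rightarrow> bool" where
  "terminal_tree V d A F \<pi> \<longleftrightarrow>
     (\<forall>f\<in>F. f \<subseteq> A \<and> card f = 2) \<and> (\<forall>a\<in>A. \<forall>b\<in>A. linked F a b) \<and>
     (\<forall>v\<in>V. \<pi> v \<in> A) \<and> (\<forall>a\<in>A. \<pi> a = a) \<and>
     (\<forall>x y. {x, y} \<in> F \<longrightarrow> \<not> linked (F - {{x, y}}) x y \<and>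
        (\<forall>D\<subseteq>V. separates D x y \<longrightarrow> d {v \<in> V. linked (F - {{x, y}}) x (\<pi> v)} \<le> d D))"

context cut_function
begin

text \<open>A cut \<open>X\<close> that is minimum among all cuts splitting \<open>A\<close> can be uncrossed with any
  minimum cut between two elements of \<open>A \<inter> X\<close>.\<close>

lemma min_cut_after_contraction:
  assumes A: "A \<subseteq> V" and X: "X \<subseteq> V" and t0: "t0 \<in> A - X"
    and min: "\<And>D. D \<subseteq> V \<Longrightarrow> A \<inter> D \<noteq> {} \<Longrightarrow> A - D \<noteq> {} \<Longrightarrow> d X \<le> d D"
    and xy: "x \<in> A \<inter> X" "y \<in> A \<inter> X"
  defines "q \<equiv> \<lambda>v. if v \<in> X then v else t0"
  assumes K: "\<And>D. D \<subseteq> insert t0 X \<Longrightarrow> separates D x y \<Longrightarrow> d {v \<in> V. q v \<in> K} \<le> d {v \<in> V. q v \<in> D}"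
    and D: "D \<subseteq> V" "separates D x y"
  shows "d {v \<in> V. q v \<in> K} \<le> d D"
proof -
  \<comment> \<open>Uncross \<open>D\<close> with \<open>X\<close>: the part
    \<open>X \<inter> D\<close> is not affected by the contraction, and \<open>X \<union> D\<close>
    contains \<open>x\<close> but misses \<open>t0\<close>, so it splits \<open>A\<close> and weighs
    at least \<open>d X\<close>.\<close>
  have main: "d {v \<in> V. q v \<in> K} \<le> d D" if D: "D \<subseteq> V" "separates D x y" "t0 \<notin> D" for D
  proof -
    have "{v \<in> V. q v \<in> X \<inter> D} = X \<inter> D" using X D t0 by (auto simp: q_def split: if_splits)
    moreover have "separates (X \<inter> D) x y" using D xy by (auto simp: separates_def)
    ultimately have 1: "d {v \<in> V. q v \<in> K} \<le> d (X \<inter> D)" using K[of "X \<inter> D"] by auto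
    have "d X \<le> d (X \<union> D)" using X D t0 xy by (intro min) auto
    then show ?thesis using submod[OF X D(1)] 1 by linarith
  qed
  show ?thesis
  proof (cases "t0 \<in> D")
    case False then show ?thesis using main D by blast
  next
    case True
    have "separates (V - D) x y" using D xy A by (auto simp: separates_def)
    then show ?thesis using main[of "V - D"] sym[OF D(1)] True by auto
  qed
qed

text \<open>Deleting an edge of \<open>F1\<close> from the joined tree leaves all of
  \<open>A - X\<close> on the side of the attachment point \<open>\<pi>1 t0\<close>. This is also
  where the contracted tree puts \<open>t0\<close>, which stands for everything outside
  \<open>X\<close>; so the new cut is the preimage under \<open>q\<close> of the old one.\<close>

lemma join_edge:
  assumes A: "A \<subseteq> V" and X: "X \<subseteq> V" and t0: "t0 \<in> A - X"
    and min: "\<And>D. D \<subseteq> V \<Longrightarrow> A \<inter> D \<noteq> {} \<Longrightarrow> A - D \<noteq> {} \<Longrightarrow> d X \<le> d D"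
  defines "q \<equiv> \<lambda>v. if v \<in> X then v else t0"
  assumes T1: "terminal_tree (insert t0 X) (\<lambda>S. d {v \<in> V. q v \<in> S}) (A \<inter> X) F1 \<pi>1"
    and F2: "\<And>f. f \<in> F2 \<Longrightarrow> f \<subseteq> A - X \<and> card f = 2"
    and conn2: "\<And>z. z \<in> A - X \<Longrightarrow> linked F2 y0 z" and y0: "y0 \<in> A - X"
    and pi: "\<And>v. v \<in> X \<Longrightarrow> \<pi> v = \<pi>1 v" "\<And>v. v \<in> V - X \<Longrightarrow> \<pi> v \<in> A - X"
    and e: "{x, y} \<in> F1" and F: "F = insert {\<pi>1 t0, y0} (F1 \<union> F2)"
  shows "\<not> linked (F - {{x, y}}) x y \<and>
        (\<forall>D\<subseteq>V. separates D x y \<longrightarrow> d {v \<in> V. linked (F - {{x, y}}) x (\<pi> v)} \<le> d D)"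
proof -
  note T = T1[unfolded terminal_tree_def]
  have F1: "f \<subseteq> A \<inter> X" if "f \<in> F1" for f using T that by blast
  have x0: "\<pi>1 t0 \<in> A \<inter> X" using T by blast
  have xy: "x \<in> A \<inter> X" "y \<in> A \<inter> X" using F1[OF e] by auto
  have ne: "{x, y} \<notin> F2" "{x, y} \<noteq> {\<pi>1 t0, y0}" using F2[of "{x, y}"] xy y0 by (auto simp: doubleton_eq_iff)
  then have eq: "F - {{x, y}} = insert {\<pi>1 t0, y0} ((F1 - {{x, y}}) \<union> F2)" using F by auto
  have J1: "linked (F - {{x, y}}) x z = linked (F1 - {{x, y}}) x z" if "z \<in> A \<inter> X" for z
    unfolding eq using F1 F2 conn2 x0 y0 xy that by (intro linked_join(1)[of _ "A \<inter> X" _ "A - X"]) auto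
  have J2: "linked (F - {{x, y}}) x z = linked (F1 - {{x, y}}) x (\<pi>1 t0)" if "z \<in> A - X" for z
    unfolding eq using F1 F2 conn2 x0 y0 xy that by (intro linked_join(2)[of _ "A \<inter> X" _ "A - X"]) auto
  let ?K = "{v \<in> insert t0 X. linked (F1 - {{x, y}}) x (\<pi>1 v)}"
  have pi1: "\<pi>1 v \<in> A \<inter> X" if "v \<in> X" for v using T that by blast
  have K: "{v \<in> V. linked (F - {{x, y}}) x (\<pi> v)} = {v \<in> V. q v \<in> ?K}"
  proof (intro Collect_cong conj_cong refl)
    fix v assume v: "v \<in> V"
    show "linked (F - {{x, y}}) x (\<pi> v) = (q v \<in> ?K)"
    proof (cases "v \<in> X")
      case True
      then show ?thesis using J1[OF pi1[OF True]] pi(1) by (simp add: q_def)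
    next
      case False
      then show ?thesis using J2[of "\<pi> v"] pi(2)[of v] v by (simp add: q_def)
    qed
  qed
  have Te: "\<not> linked (F1 - {{x, y}}) x y"
     "\<And>D. D \<subseteq> insert t0 X \<Longrightarrow> separates D x y \<Longrightarrow> d {v \<in> V. q v \<in> ?K} \<le> d {v \<in> V. q v \<in> D}"
    using T e by blast+
  have "\<not> linked (F - {{x, y}}) x y" using J1[OF xy(2)] Te(1) by simp
  moreover have "d {v \<in> V. linked (F - {{x, y}}) x (\<pi> v)} \<le> d D" if "D \<subseteq> V" "separates D x y" for D
    unfolding K q_def
    by (rule min_cut_after_contraction[OF A X t0 min xy Te(2)[unfolded q_def] that])
  ultimately show ?thesis by blast
qed

end

text \<open>Induction on the number of terminals. \<open>X\<close> is lightest among all cuts that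
  split \<open>A\<close>, so it is a minimum cut for the joining edge whatever terminals that edge
  connects, and it uncrosses with the cuts inside either side. Each side is solved with the other
  one contracted.\<close>

lemma terminal_tree_exists:
  assumes "cut_function V d" "A \<subseteq> V" "A \<noteq> {}"
  shows "\<exists>F \<pi>. terminal_tree V d A F \<pi>"
  using assms
proof (induction "card A" arbitrary: V d A rule: less_induct)
  case less
  interpret cut_function V d by fact
  have fA: "finite A" using less(3) fin finite_subset by blast
  show ?case
  proof (cases "\<exists>a. A = {a}")
    case True
    then obtain a where a: "A = {a}" by blast
    have "terminal_tree V d A {} (\<lambda>_. a)" by (simp add: terminal_tree_def a)
    then show ?thesis by blast
  next
    case False
    let ?P = "\<lambda>X. X \<subseteq> V \<and> A \<inter> X \<noteq> {} \<and> A - X \<noteq> {}"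
    obtain a where a: "a \<in> A" using less by auto
    then have "?P {a}" using less False by auto
    then obtain X where PX: "?P X" and "\<forall>D. ?P D \<longrightarrow> d X \<le> d D"
      using ex_has_least_nat[of ?P "{a}" d] by blast
    then have min: "\<And>D. D \<subseteq> V \<Longrightarrow> A \<inter> D \<noteq> {} \<Longrightarrow> A - D \<noteq> {} \<Longrightarrow> d X \<le> d D" by blast
    obtain t0 s0 where t0: "t0 \<in> A - X" and s0: "s0 \<in> A \<inter> X" using PX by blast
    define X' where "X' = V - X"
    have X: "X \<subseteq> V" "X' \<subseteq> V" and AX': "A \<inter> X' = A - X" "A - X' = A \<inter> X" "V - X' = X"
      using PX less by (auto simp: X'_def)
    \<comment> \<open>The vertex \<open>t0\<close> represents the contracted side but is no terminal
      of the subproblem on \<open>A \<inter> X\<close>. Hence \<open>\<pi>1 t0\<close> tells to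
      which terminal the other side has to be attached; \<open>q'\<close> and \<open>s0\<close> do
      the same for the other side.\<close>
    define q where "q = (\<lambda>v. if v \<in> X then v else t0)"
    define q' where "q' = (\<lambda>v. if v \<in> X' then v else s0)"
    have q: "q ` V = insert t0 X" "q' ` V = insert s0 X'"
      using t0 s0 X less(3) by (auto simp: q_def q'_def X'_def)
    have "A \<inter> X \<subset> A" "A \<inter> X' \<subset> A" using t0 s0 AX' by auto
    then have lt: "card (A \<inter> X) < card A" "card (A \<inter> X') < card A" using fA psubset_card_mono by metis+
    obtain F1 \<pi>1 where T1: "terminal_tree (insert t0 X) (\<lambda>S. d {v \<in> V. q v \<in> S}) (A \<inter> X) F1 \<pi>1"
      using less(1)[OF lt(1) cut_function_vimage[OF less(2) q(1)]] s0 by blast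
    obtain F2 \<pi>2 where T2: "terminal_tree (insert s0 X') (\<lambda>S. d {v \<in> V. q' v \<in> S}) (A \<inter> X') F2 \<pi>2"
      using less(1)[OF lt(2) cut_function_vimage[OF less(2) q(2)]] t0 AX' by blast
    define x0 where "x0 = \<pi>1 t0"
    define y0 where "y0 = \<pi>2 s0"
    define F where "F = insert {x0, y0} (F1 \<union> F2)"
    define \<pi> where "\<pi> = (\<lambda>v. if v \<in> X then \<pi>1 v else \<pi>2 v)"
    note U1 = T1[unfolded terminal_tree_def]
    note U2 = T2[unfolded terminal_tree_def AX'(1)]
    have x0: "x0 \<in> A \<inter> X" unfolding x0_def using U1 by blast
    have y0: "y0 \<in> A - X" unfolding y0_def using U2 by blast
    have F1: "\<And>f. f \<in> F1 \<Longrightarrow> f \<subseteq> A \<inter> X \<and> card f = 2" using U1 by blast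
    have F2: "\<And>f. f \<in> F2 \<Longrightarrow> f \<subseteq> A - X \<and> card f = 2" using U2 by blast
    have c1: "\<And>z. z \<in> A \<inter> X \<Longrightarrow> linked F1 x0 z" using U1 x0 by blast
    have c2: "\<And>z. z \<in> A - X \<Longrightarrow> linked F2 y0 z" using U2 y0 by blast
    have pi1: "\<And>v. v \<in> X \<Longrightarrow> \<pi>1 v \<in> A \<inter> X" using U1 by blast
    have pi2: "\<And>v. v \<in> X' \<Longrightarrow> \<pi>2 v \<in> A - X" using U2 by blast
    have min': "\<And>D. D \<subseteq> V \<Longrightarrow> A \<inter> D \<noteq> {} \<Longrightarrow> A - D \<noteq> {} \<Longrightarrow> d X' \<le> d D"
      using min sym[OF X(1)] by (simp add: X'_def)
    have all: "linked F x0 z" if "z \<in> A" for z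
    proof (cases "z \<in> X")
      case True
      then show ?thesis using that unfolding F_def by (intro linked_mono[OF c1]) auto
    next
      case False
      then have "linked F y0 z" using that unfolding F_def by (intro linked_mono[OF c2]) auto
      moreover have "{x0, y0} \<in> F" by (simp add: F_def)
      ultimately show ?thesis using converse_rtranclp_into_rtranclp[of "\<lambda>x y. {x, y} \<in> F" x0 y0 z] by blast
    qed
    have "linked F a b" if "a \<in> A" "b \<in> A" for a b
      using rtranclp_trans[OF linked_sym[OF all[OF that(1)]] all[OF that(2)]] .
    moreover have "f \<subseteq> A \<and> card f = 2" if f: "f \<in> F" for f
    proof -
      have "x0 \<noteq> y0" using x0 y0 by auto
      then have "card {x0, y0} = 2" by simp
      then show ?thesis using f F1 F2 x0 y0 unfolding F_def by blast
    qed
    moreover have "\<pi> v \<in> A" if "v \<in> V" for v using that pi1 pi2 by (auto simp: \<pi>_def X'_def)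
    moreover have "\<pi> a = a" if "a \<in> A" for a
    proof (cases "a \<in> X")
      case True then show ?thesis using U1 that by (simp add: \<pi>_def)
    next
      case False then show ?thesis using U2 that by (simp add: \<pi>_def)
    qed
    moreover have "\<not> linked (F - {{x, y}}) x y \<and>
        (\<forall>D\<subseteq>V. separates D x y \<longrightarrow> d {v \<in> V. linked (F - {{x, y}}) x (\<pi> v)} \<le> d D)" if e: "{x, y} \<in> F" for x y
    proof -
      consider "{x, y} \<in> F1" | "{x, y} \<in> F2" | "{x, y} \<notin> F1" "{x, y} \<notin> F2" "{x, y} = {x0, y0}"
        using e unfolding F_def by blast
      then show ?thesis
      proof cases
        case 1
        show ?thesis
          by (rule join_edge[OF less(3) X(1) t0 min T1[unfolded q_def] F2 c2 y0 _ _ 1])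
             (use pi2 in \<open>auto simp: \<pi>_def X'_def F_def x0_def\<close>)
      next
        case 2
        have s0': "s0 \<in> A - X'" "x0 \<in> A - X'" using s0 x0 AX' by auto
        have F1': "\<And>f. f \<in> F1 \<Longrightarrow> f \<subseteq> A - X' \<and> card f = 2" using F1 AX' by auto
        have c1': "\<And>z. z \<in> A - X' \<Longrightarrow> linked F1 x0 z" using c1 AX' by auto
        have "\<And>v. v \<in> X' \<Longrightarrow> \<pi> v = \<pi>2 v" "\<And>v. v \<in> V - X' \<Longrightarrow> \<pi> v \<in> A - X'"
          "F = insert {\<pi>2 s0, x0} (F2 \<union> F1)" using pi1 AX' by (auto simp: \<pi>_def X'_def F_def y0_def)
        then show ?thesis
          using join_edge[OF less(3) X(2) s0'(1) min' T2[unfolded q'_def] F1' c1' s0'(2) _ _ 2] by blast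
      next
        case 3
        have xy: "x = x0 \<and> y = y0 \<or> x = y0 \<and> y = x0" using 3 by (auto simp: doubleton_eq_iff)
        have F': "F - {{x, y}} = F1 \<union> F2" using 3 by (auto simp: F_def)
        have inX: "linked (F1 \<union> F2) x0 z \<longleftrightarrow> z \<in> X" if "z \<in> A" for z
        proof
          assume "linked (F1 \<union> F2) x0 z"
          then show "z \<in> X"
          proof (induction rule: rtranclp_induct)
            case base then show ?case using x0 by simp
          next
            case (step y z)
            then show ?case using F1[of "{y, z}"] F2[of "{y, z}"] by auto
          qed
        next
          assume "z \<in> X" then show "linked (F1 \<union> F2) x0 z" using that by (intro linked_mono[OF c1]) auto
        qed
        have inX': "linked (F1 \<union> F2) y0 z \<longleftrightarrow> z \<notin> X" if "z \<in> A" for z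
        proof
          assume "linked (F1 \<union> F2) y0 z"
          then show "z \<notin> X"
          proof (induction rule: rtranclp_induct)
            case base then show ?case using y0 by simp
          next
            case (step y z)
            then show ?case using F1[of "{y, z}"] F2[of "{y, z}"] by auto
          qed
        next
          assume "z \<notin> X" then show "linked (F1 \<union> F2) y0 z" using that by (intro linked_mono[OF c2]) auto
        qed
        have piX: "\<pi> v \<in> A" "\<pi> v \<in> X \<longleftrightarrow> v \<in> X" if "v \<in> V" for v
          using that pi1[of v] pi2[of v] by (auto simp: \<pi>_def X'_def)
        have K: "{v \<in> V. linked (F1 \<union> F2) x0 (\<pi> v)} = X" "{v \<in> V. linked (F1 \<union> F2) y0 (\<pi> v)} = X'"
          using inX inX' piX X by (auto simp: X'_def)
        have "d X \<le> d D \<and> d X' \<le> d D" if "D \<subseteq> V" "separates D x y" for D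
        proof -
          have "A \<inter> D \<noteq> {}" "A - D \<noteq> {}" using that xy x0 y0 by (auto simp: separates_def)
          then show ?thesis using min min' that by blast
        qed
        moreover have "\<not> linked (F1 \<union> F2) x y" using xy inX[of y0] inX'[of x0] x0 y0 by auto
        ultimately show ?thesis unfolding F' using xy K by auto
      qed
    qed
    ultimately have "terminal_tree V d A F \<pi>" unfolding terminal_tree_def by blast
    then show ?thesis by blast
  qed
qed

section \<open>Cut functions of graphs and the existence of Gomory-Hu trees\<close>

abbreviation cut_weight :: "('v, 'e) mgraph \<Rightarrow> ('e \<Rightarrow> nat) \<Rightarrow> 'v set \<Rightarrow> nat" where
  "cut_weight G u C \<equiv> sum u (cut_edges G C)"

lemma sum_restrict_if: "finite E \<Longrightarrow> F \<subseteq> E \<Longrightarrow> sum u F = (\<Sum>e\<in>E. if e \<in> F then u e else (0::nat))"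
  by (simp add: sum.inter_restrict[symmetric] Int_absorb1)

lemma sum_UN_le:
  assumes "finite I" "\<And>i. i \<in> I \<Longrightarrow> finite (A i)"
  shows "sum u (\<Union>i\<in>I. A i) \<le> (\<Sum>i\<in>I. sum u (A i) :: nat)"
  using assms
proof (induction I)
  case (insert i I)
  have "sum u (\<Union>j\<in>insert i I. A j) \<le> sum u (A i) + sum u (\<Union>j\<in>I. A j)"
    using insert by (simp add: sum_Un_nat)
  also have "\<dots> \<le> sum u (A i) + (\<Sum>j\<in>I. sum u (A j))" using insert by (intro add_left_mono) blast
  finally show ?case using insert by simp
qed simp

text \<open>Both laws hold edge by edge, by the positions of the two ends relative to the
  sets.\<close>

lemma cut_function_graph:
  assumes G: "mgraph G"
  shows "cut_function (verts G) (cut_weight G u)"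
proof
  have fE: "finite (edges G)" and "finite (verts G)" using G by (auto simp: mgraph_def)
  then show "finite (verts G)" by blast
  have ends: "ends G e \<subseteq> verts G" if "e \<in> edges G" for e using G that by (simp add: mgraph_def)
  fix D assume D: "D \<subseteq> verts G"
  have "e \<in> cut_edges G (verts G - D) \<longleftrightarrow> e \<in> cut_edges G D" if e: "e \<in> edges G" for e
  proof -
    obtain v w where vw: "ends G e = {v, w}" "v \<in> verts G" "w \<in> verts G" using mgraph_edge[OF G e] by metis
    show ?thesis using vw by (auto simp: in_cut_edges[OF G e vw(1)])
  qed
  then have "cut_edges G (verts G - D) = cut_edges G D" by (auto simp: cut_edges_def)
  then show "cut_weight G u (verts G - D) = cut_weight G u D" by simp
next
  have fE: "finite (edges G)" using G by (auto simp: mgraph_def)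
  fix A B assume AB: "A \<subseteq> verts G" "B \<subseteq> verts G"
  let ?i = "\<lambda>C e. if e \<in> cut_edges G C then u e else 0"
  have "?i (A \<inter> B) e + ?i (A \<union> B) e \<le> ?i A e + ?i B e" if e: "e \<in> edges G" for e
  proof -
    obtain v w where vw: "ends G e = {v, w}" using mgraph_edge[OF G e] by metis
    show ?thesis by (auto simp: in_cut_edges[OF G e vw(1)])
  qed
  then have "(\<Sum>e\<in>edges G. ?i (A \<inter> B) e + ?i (A \<union> B) e) \<le> (\<Sum>e\<in>edges G. ?i A e + ?i B e)" by (rule sum_mono)
  then show "cut_weight G u (A \<inter> B) + cut_weight G u (A \<union> B) \<le> cut_weight G u A + cut_weight G u B"
    by (simp add: sum_restrict_if[OF fE cut_edges_subset] sum.distrib)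
qed

abbreviation mconn :: "('v, 'e) mgraph \<Rightarrow> ('e \<Rightarrow> nat) \<Rightarrow> nat \<Rightarrow> 'v \<Rightarrow> 'v \<Rightarrow> bool" where
  "mconn G u \<equiv> cut_function.conn (verts G) (cut_weight G u)"

lemma path_edges_nth: "e \<in> path_edges p \<longleftrightarrow> (\<exists>i. Suc i < length p \<and> e = {p ! i, p ! Suc i})"
  by (auto simp: path_edges_def)

lemma path_edges_nthI: "Suc i < length p \<Longrightarrow> {p ! i, p ! Suc i} \<in> path_edges p"
  by (auto simp: path_edges_nth)

lemma finite_path_edges: "finite (path_edges p)"
proof -
  have "path_edges p = (\<lambda>i. {p ! i, p ! Suc i}) ` {i. Suc i < length p}" by (auto simp: path_edges_def)
  moreover have "finite {i. Suc i < length p}" by (rule finite_subset[of _ "{..<length p}"]) auto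
  ultimately show ?thesis by simp
qed

lemma path_edges_nonempty:
  assumes "is_path F a p b" "a \<noteq> b"
  shows "path_edges p \<noteq> {}"
proof -
  obtain q where q: "p = a # q" using assms by (cases p) (auto simp: is_path_def)
  then have "Suc 0 < length p" using assms by (cases q) (auto simp: is_path_def)
  then show ?thesis by (auto simp: path_edges_def)
qed

lemma path_edges_subset: "is_path F a p b \<Longrightarrow> path_edges p \<subseteq> F"
  by (auto simp: is_path_def path_edges_def successively_conv_nth)

lemma linked_trans: "linked F x y \<Longrightarrow> linked F y z \<Longrightarrow> linked F x z"
  by (rule rtranclp_trans)

lemma linked_in:
  assumes "linked F x y" "\<And>f. f \<in> F \<Longrightarrow> f \<subseteq> V" "x \<in> V"
  shows "y \<in> V"
  using assms(1)
proof (induction rule: rtranclp_induct)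
  case (step y z)
  then show ?case using assms(2)[of "{y, z}"] by auto
qed (fact assms(3))

text \<open>With all vertices as terminals \<open>\<pi>\<close> is the identity, and the cuts of
  \<open>terminal_tree\<close> become components. Minimality for a distant pair holds because any
  cut separating it is crossed by an edge of the tree path, and that edge is at least as heavy as a
  lightest one.\<close>

lemma gomory_hu_tree_exists:
  assumes G: "mgraph G" and V: "verts G \<noteq> {}"
  shows "\<exists>T \<kappa>. gomory_hu_tree G u T \<kappa>"
proof -
  interpret cut_function "verts G" "cut_weight G u" by (rule cut_function_graph[OF G])
  obtain T \<pi> where "terminal_tree (verts G) (cut_weight G u) (verts G) T \<pi>"
    using terminal_tree_exists[OF cut_function_graph[OF G] order_refl V] by blast
  note T = this[unfolded terminal_tree_def]
  note T1 = T[THEN conjunct1, rule_format]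
  note T5 = T[THEN conjunct2, THEN conjunct2, THEN conjunct2, THEN conjunct2, rule_format]
  have tree: "is_tree (verts G) T" using T by (intro tree_intro) blast+
  define K where "K x y = component (T - {{x, y}}) x" for x y
  have K: "K x y = {v \<in> verts G. linked (T - {{x, y}}) x (\<pi> v)}" if "x \<in> verts G" for x y
  proof -
    have "v \<in> verts G" if "linked (T - {{x, y}}) x v" for v
      using that T \<open>x \<in> verts G\<close> by (intro linked_in[OF that]) auto
    then show ?thesis using T by (auto simp: K_def component_linked)
  qed
  \<comment> \<open>A tree edge is an unordered set, while \<open>K x y\<close> depends on which end
    is named first. The minimum over all separating cuts yields a weight without this
    choice.\<close>
  define \<kappa> where "\<kappa> f = (LEAST k. \<exists>D\<subseteq>verts G. card (f \<inter> D) = 1 \<and> cut_weight G u D = k)" for f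
  have sepcard: "card ({x, y} \<inter> D) = 1 \<longleftrightarrow> separates D x y" if "x \<noteq> y" for x y :: 'a and D
    using card_doubleton_Int[OF that] by (simp add: separates_def)
  have edge: "x \<in> verts G" "y \<in> verts G" "x \<noteq> y" if "{x, y} \<in> T" for x y
  proof -
    have "card {x, y} = 2" "{x, y} \<subseteq> verts G" using T1[OF that] by auto
    then show "x \<in> verts G" "y \<in> verts G" "x \<noteq> y" by auto
  qed
  have Kmin: "K x y \<subseteq> verts G" "separates (K x y) x y" "x \<in> K x y" "\<And>D. D \<subseteq> verts G \<Longrightarrow> separates D x y \<Longrightarrow> cut_weight G u (K x y) \<le> cut_weight G u D"
    if e: "{x, y} \<in> T" for x y
  proof -
    have nl: "\<not> linked (T - {{x, y}}) x y" using T5[OF e] by blast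
    show "K x y \<subseteq> verts G" "x \<in> K x y" "separates (K x y) x y"
      using K[OF edge(1)[OF e], of y] T edge[OF e] nl by (auto simp: separates_def)
    show "cut_weight G u (K x y) \<le> cut_weight G u D" if "D \<subseteq> verts G" "separates D x y" for D
      using K[OF edge(1)[OF e], of y] T5[OF e] that by simp
  qed
  have \<kappa>: "\<kappa> {x, y} = cut_weight G u (K x y)" if e: "{x, y} \<in> T" for x y
    unfolding \<kappa>_def sepcard[OF edge(3)[OF e]]
    using Kmin[OF e] by (intro Least_equality) auto
  have "is_min_cut G u w v (component (T - {e}) w) \<and> cut_weight G u (component (T - {e}) w) = \<kappa> e"
    if wv: "w \<in> verts G" "v \<in> verts G" "w \<noteq> v" and p: "is_path T w p v" and e: "e \<in> path_edges p"
      and min: "\<kappa> e = Min (\<kappa> ` path_edges p)" for w v p e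
  proof -
    obtain i where i: "Suc i < length p" "e = {p ! i, p ! Suc i}" using e by (auto simp: path_edges_nth)
    let ?x = "p ! i" let ?y = "p ! Suc i"
    have eT: "{?x, ?y} \<in> T" using e i path_edges_subset[OF p] by auto
    note s = path_edge_sides[OF p i(1)]
    have comp: "component (T - {e}) w = K ?x ?y"
      unfolding K_def component_linked i(2)
    proof (intro Collect_cong iffI)
      fix x assume "linked (T - {{?x, ?y}}) w x"
      then show "linked (T - {{?x, ?y}}) ?x x" using linked_trans[OF linked_sym[OF s(1)]] by blast
    next
      fix x assume "linked (T - {{?x, ?y}}) ?x x"
      then show "linked (T - {{?x, ?y}}) w x" using linked_trans[OF s(1)] by blast
    qed
    have "w \<in> K ?x ?y" using comp by (auto simp: component_linked)
    moreover have "v \<notin> K ?x ?y"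
    proof
      assume "v \<in> K ?x ?y"
      then have "linked (T - {{?x, ?y}}) ?x v" by (simp add: K_def component_linked)
      then have "linked (T - {{?x, ?y}}) ?x ?y" using linked_trans[OF _ linked_sym[OF s(2)]] by blast
      then show False using T5[OF eT] by blast
    qed
    ultimately have "is_cut G w v (K ?x ?y)" using Kmin(1)[OF eT] wv by (auto simp: is_cut_def)
    moreover have "cut_weight G u (K ?x ?y) \<le> cut_weight G u D" if D: "is_cut G w v D" for D
    proof -
      obtain k where k: "Suc k < length p" "p ! k \<in> D" "p ! Suc k \<notin> D"
        using path_crosses[OF p, of D] D by (auto simp: is_cut_def)
      let ?f = "{p ! k, p ! Suc k}"
      have f: "?f \<in> path_edges p" using k by (intro path_edges_nthI)
      then have fT: "?f \<in> T" using path_edges_subset[OF p] by auto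
      have "cut_weight G u (K ?x ?y) = \<kappa> e" using \<kappa>[OF eT] i by simp
      also have "\<dots> \<le> \<kappa> ?f" using min f finite_path_edges[of p] by simp
      also have "\<dots> = cut_weight G u (K (p ! k) (p ! Suc k))" by (rule \<kappa>[OF fT])
      also have "\<dots> \<le> cut_weight G u D" using k D by (intro Kmin(4)[OF fT]) (auto simp: is_cut_def separates_def)
      finally show ?thesis .
    qed
    ultimately show ?thesis unfolding comp using \<kappa>[OF eT] i by (auto simp: is_min_cut_def)
  qed
  then have "gomory_hu_tree G u T \<kappa>" unfolding gomory_hu_tree_def using tree by blast
  then show ?thesis by blast
qed

section \<open>What a Gomory-Hu tree determines independently of its choice\<close>

context
  fixes G :: "('v, 'e) mgraph" and u :: "'e \<Rightarrow> nat" and T and \<kappa>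
  assumes G: "mgraph G" and T: "gomory_hu_tree G u T \<kappa>"
begin

interpretation cut_function "verts G" "cut_weight G u" by (rule cut_function_graph[OF G])

lemma gh_tree: "is_tree (verts G) T" using T by (simp add: gomory_hu_tree_def)

lemma gh_edge:
  assumes "{x, y} \<in> T"
  shows "x \<in> verts G" "y \<in> verts G" "x \<noteq> y"
proof -
  have "card {x, y} = 2" "{x, y} \<subseteq> verts G" using assms gh_tree unfolding is_tree_def by blast+
  then show "x \<in> verts G" "y \<in> verts G" "x \<noteq> y" by auto
qed

lemma gh_path_min:
  assumes wv: "w \<in> verts G" "v \<in> verts G" "w \<noteq> v" and p: "is_path T w p v"
  obtains e where "e \<in> path_edges p" "\<And>f. f \<in> path_edges p \<Longrightarrow> \<kappa> e \<le> \<kappa> f"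
    "is_min_cut G u w v (component (T - {e}) w)" "cut_weight G u (component (T - {e}) w) = \<kappa> e"
proof -
  have "Min (\<kappa> ` path_edges p) \<in> \<kappa> ` path_edges p"
    using finite_path_edges path_edges_nonempty[OF p wv(3)] by (intro Min_in) auto
  then obtain e where e: "e \<in> path_edges p" "\<kappa> e = Min (\<kappa> ` path_edges p)" by auto
  show thesis
  proof (rule that[OF e(1)])
    show "\<kappa> e \<le> \<kappa> f" if "f \<in> path_edges p" for f using e(2) that finite_path_edges[of p] by simp
  qed (use T e wv p in \<open>auto simp: gomory_hu_tree_def\<close>)
qed

lemma min_cut_conn:
  assumes X: "is_min_cut G u x y X" and xy: "x \<in> verts G" "y \<in> verts G"
  shows "conn \<theta> x y \<longleftrightarrow> \<theta> < cut_weight G u X"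
proof
  assume "conn \<theta> x y"
  then show "\<theta> < cut_weight G u X" using X by (auto simp: conn_def is_min_cut_def is_cut_def separates_def)
next
  assume l: "\<theta> < cut_weight G u X"
  show "conn \<theta> x y" unfolding conn_def
  proof (intro allI impI)
    fix D assume D: "D \<subseteq> verts G" "separates D x y"
    have "cut_weight G u X \<le> cut_weight G u D"
      by (rule min_cut_separates[OF _ xy D]) (use X xy in \<open>auto simp: is_min_cut_def is_cut_def\<close>)
    then show "\<theta> < cut_weight G u D" using l by simp
  qed
qed

lemma gh_edge_cut:
  assumes e: "{x, y} \<in> T"
  shows "is_min_cut G u x y (component (T - {{x, y}}) x)" "cut_weight G u (component (T - {{x, y}}) x) = \<kappa> {x, y}"
    "conn \<theta> x y \<longleftrightarrow> \<theta> < \<kappa> {x, y}"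
proof -
  note xy = gh_edge[OF e]
  have p: "is_path T x [x, y] y" using e xy by (auto simp: is_path_def)
  have pe: "path_edges [x, y] = {{x, y}}" by (auto simp: path_edges_def)
  show 1: "is_min_cut G u x y (component (T - {{x, y}}) x)" "cut_weight G u (component (T - {{x, y}}) x) = \<kappa> {x, y}"
    using gh_path_min[OF xy p] unfolding pe by auto
  show "conn \<theta> x y \<longleftrightarrow> \<theta> < \<kappa> {x, y}" using min_cut_conn[OF 1(1) xy(1,2)] 1(2) by simp
qed

text \<open>The classes formed by contracting all edges heavier than \<open>\<theta>\<close> are
  connectivity classes, hence the same for every Gomory-Hu tree. This allows the program to contract
  without having one.\<close>

lemma gh_conn:
  assumes xy: "x \<in> verts G" "y \<in> verts G"
  shows "conn \<theta> x y \<longleftrightarrow> linked {e \<in> T. \<theta> < \<kappa> e} x y"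
proof
  assume "linked {e \<in> T. \<theta> < \<kappa> e} x y"
  then show "conn \<theta> x y"
  proof (induction rule: rtranclp_induct)
    case (step y z)
    then have "conn \<theta> y z" using gh_edge_cut(3)[of y z] by blast
    then show ?case using step conn_trans by blast
  qed (simp add: conn_refl)
next
  assume c: "conn \<theta> x y"
  show "linked {e \<in> T. \<theta> < \<kappa> e} x y"
  proof (cases "x = y")
    case False
    obtain p where p: "is_path T x p y" using gh_tree xy unfolding is_tree_def by blast
    obtain e where e: "\<And>f. f \<in> path_edges p \<Longrightarrow> \<kappa> e \<le> \<kappa> f"
      "is_min_cut G u x y (component (T - {e}) x)" "cut_weight G u (component (T - {e}) x) = \<kappa> e"
      using gh_path_min[OF xy False p] by blast
    then have "\<theta> < \<kappa> e" using c min_cut_conn[OF e(2) xy] by simp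
    then have "\<theta> < \<kappa> {p ! i, p ! Suc i}" if "Suc i < length p" for i
      using e(1)[OF path_edges_nthI[OF that]] by simp
    then have "successively (\<lambda>x y. {x, y} \<in> {e \<in> T. \<theta> < \<kappa> e}) p"
      using p by (auto simp: is_path_def successively_conv_nth)
    then show ?thesis using successively_linked[of p "{e \<in> T. \<theta> < \<kappa> e}"] p unfolding is_path_def by blast
  qed simp
qed

text \<open>A tree weight is the connectivity of the ends of its edge; conversely the connectivity
  of a pair is the weight of a lightest edge on its path. So the set of weights can be described
  without the tree.\<close>

lemma gh_values:
  "\<kappa> ` T = {\<theta>. \<exists>x\<in>verts G. \<exists>y\<in>verts G. x \<noteq> y \<and> (\<forall>\<theta>'. conn \<theta>' x y \<longleftrightarrow> \<theta>' < \<theta>)}"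
proof (intro equalityI subsetI)
  fix \<theta> assume "\<theta> \<in> \<kappa> ` T"
  then obtain f where f: "f \<in> T" "\<theta> = \<kappa> f" by auto
  have "card f = 2" using f gh_tree by (auto simp: is_tree_def)
  then obtain x y where "f = {x, y}" by (auto simp: card_2_iff)
  then show "\<theta> \<in> {\<theta>. \<exists>x\<in>verts G. \<exists>y\<in>verts G. x \<noteq> y \<and> (\<forall>\<theta>'. conn \<theta>' x y \<longleftrightarrow> \<theta>' < \<theta>)}"
    using f gh_edge[of x y] gh_edge_cut(3)[of x y] by auto
next
  fix \<theta> assume "\<theta> \<in> {\<theta>. \<exists>x\<in>verts G. \<exists>y\<in>verts G. x \<noteq> y \<and> (\<forall>\<theta>'. conn \<theta>' x y \<longleftrightarrow> \<theta>' < \<theta>)}"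
  then obtain x y where xy: "x \<in> verts G" "y \<in> verts G" "x \<noteq> y" and c: "\<And>\<theta>'. conn \<theta>' x y \<longleftrightarrow> \<theta>' < \<theta>" by auto
  obtain p where p: "is_path T x p y" using gh_tree xy unfolding is_tree_def by blast
  obtain e where e: "e \<in> path_edges p"
    "is_min_cut G u x y (component (T - {e}) x)" "cut_weight G u (component (T - {e}) x) = \<kappa> e"
    using gh_path_min[OF xy p] by blast
  have "\<theta>' < \<theta> \<longleftrightarrow> \<theta>' < \<kappa> e" for \<theta>' using c min_cut_conn[OF e(2) xy(1,2)] e(3) by simp
  then have "\<theta> = \<kappa> e" by (metis linorder_neq_iff)
  then show "\<theta> \<in> \<kappa> ` T" using e(1) path_edges_subset[OF p] by auto
qed

text \<open>For an edge crossing \<open>C\<close>, the tree path between its ends contains a tree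
  edge crossing \<open>C\<close>, and the graph edge lies in the fundamental cut of that tree edge.
  So the cut is covered by fundamental cuts, each as heavy as its tree edge.\<close>

lemma gh_cut_bound:
  assumes C: "C \<subseteq> verts G"
  shows "cut_weight G u C \<le> (\<Sum>f | f \<in> T \<and> card (f \<inter> C) = 1. \<kappa> f)"
proof -
  have fE: "finite (edges G)" and fV: "finite (verts G)" using G by (auto simp: mgraph_def)
  have fT: "finite T" using gh_tree fV by (intro finite_subset[of T "Pow (verts G)"]) (auto simp: is_tree_def)
  let ?X = "{f \<in> T. card (f \<inter> C) = 1}"
  \<comment> \<open>Both sides of a fundamental cut have the same edges, so an arbitrary end may be
    picked.\<close>
  define K where "K f = component (T - {f}) (SOME x. x \<in> f)" for f
  have K: "\<exists>x y. f = {x, y} \<and> K f = component (T - {{x, y}}) x" if "f \<in> T" for f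
  proof -
    have "card f = 2" using that gh_tree by (auto simp: is_tree_def)
    then obtain x y where "f = {x, y}" by (auto simp: card_2_iff)
    moreover have "(SOME x. x \<in> f) \<in> f" using calculation by (metis insertI1 someI)
    ultimately show ?thesis unfolding K_def by (metis insertE insert_commute singletonD)
  qed
  have wK: "cut_weight G u (K f) = \<kappa> f" if f: "f \<in> T" for f
    using K[OF f] gh_edge_cut(2) f by metis
  have "cut_edges G C \<subseteq> (\<Union>f\<in>?X. cut_edges G (K f))"
  proof
    fix e assume eC: "e \<in> cut_edges G C"
    then have e: "e \<in> edges G" by (simp add: cut_edges_def)
    obtain v w where vw: "ends G e = {v, w}" "v \<in> verts G" "w \<in> verts G" "v \<in> C" "w \<notin> C"
    proof -
      obtain v w where vw: "ends G e = {v, w}" "v \<in> verts G" "w \<in> verts G" using mgraph_edge[OF G e] by metis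
      moreover have "(v \<in> C) \<noteq> (w \<in> C)" using in_cut_edges[OF G e vw(1)] eC by simp
      ultimately show thesis using that[of v w] that[of w v] by (auto simp: insert_commute)
    qed
    obtain p where p: "is_path T v p w" using gh_tree vw unfolding is_tree_def by blast
    obtain i where i: "Suc i < length p" "p ! i \<in> C" "p ! Suc i \<notin> C" using path_crosses[OF p vw(4,5)] by blast
    define f where "f = {p ! i, p ! Suc i}"
    have fT: "f \<in> T" using path_edges_subset[OF p] path_edges_nthI[OF i(1)] by (auto simp: f_def)
    have "f \<inter> C = {p ! i}" using i by (auto simp: f_def)
    then have fX: "f \<in> ?X" using fT by simp
    note s = path_edge_sides[OF p i(1), folded f_def]
    have br: "\<not> linked (T - {f}) (p ! i) (p ! Suc i)" using tree_bridge[OF gh_tree] fT unfolding f_def by blast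
    obtain x y where xy: "f = {x, y}" "K f = component (T - {f}) x" using K[OF fT] by auto
    then have "x = p ! i \<or> x = p ! Suc i" unfolding f_def by (auto simp: doubleton_eq_iff)
    then have "(v \<in> K f) \<noteq> (w \<in> K f)"
    proof
      assume x: "x = p ! i"
      have "linked (T - {f}) x v" using linked_sym[OF s(1)] x by simp
      moreover have "\<not> linked (T - {f}) x w" using br linked_trans[OF _ linked_sym[OF s(2)]] x by blast
      ultimately show ?thesis using xy by (simp add: component_linked)
    next
      assume x: "x = p ! Suc i"
      have "linked (T - {f}) x w" using s(2) x by simp
      moreover have "\<not> linked (T - {f}) x v" using br linked_sym[OF linked_trans[OF _ s(1)]] x by blast
      ultimately show ?thesis using xy by (simp add: component_linked)
    qed
    then have "e \<in> cut_edges G (K f)" using in_cut_edges[OF G e vw(1)] by simp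
    then show "e \<in> (\<Union>f\<in>?X. cut_edges G (K f))" using fX by blast
  qed
  moreover have "finite (\<Union>f\<in>?X. cut_edges G (K f))"
    using fE by (rule finite_subset[rotated]) (auto dest: subsetD[OF cut_edges_subset])
  ultimately have "cut_weight G u C \<le> sum u (\<Union>f\<in>?X. cut_edges G (K f))" by (intro sum_mono2) auto
  also have "\<dots> \<le> (\<Sum>f\<in>?X. sum u (cut_edges G (K f)))"
    using fT fE by (intro sum_UN_le) (auto intro: finite_subset[OF cut_edges_subset])
  also have "\<dots> = (\<Sum>f\<in>?X. \<kappa> f)" using wK by (intro sum.cong) auto
  finally show ?thesis by simp
qed

end

section \<open>Contraction\<close>

text \<open>Edges dropped as loops have both ends in one class, so they do not cross the preimage
  either.\<close>

lemma cut_edges_contract: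
  assumes G: "mgraph G"
  shows "cut_edges (contract G P) C = cut_edges G {v \<in> verts G. contract_class G P v \<in> C}"
proof -
  let ?q = "contract_class G P"
  have "e \<in> cut_edges (contract G P) C \<longleftrightarrow> e \<in> cut_edges G {v \<in> verts G. ?q v \<in> C}" if e: "e \<in> edges G" for e
  proof -
    obtain v w where vw: "ends G e = {v, w}" "v \<noteq> w" "v \<in> verts G" "w \<in> verts G" using mgraph_edge[OF G e] by metis
    have 1: "card (?q ` ends G e) = 2 \<longleftrightarrow> ?q v \<noteq> ?q w" using vw by (auto simp: card_2_iff doubleton_eq_iff)
    have 2: "card ({?q v, ?q w} \<inter> C) = 1 \<longleftrightarrow> (?q v \<in> C) \<noteq> (?q w \<in> C)" if "?q v \<noteq> ?q w"
      using card_doubleton_Int[OF that] .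
    have "e \<in> cut_edges (contract G P) C \<longleftrightarrow> ?q v \<noteq> ?q w \<and> (?q v \<in> C) \<noteq> (?q w \<in> C)"
      using e 1 2 vw(1) by (auto simp: cut_edges_def contract_def)
    also have "\<dots> \<longleftrightarrow> e \<in> cut_edges G {v \<in> verts G. ?q v \<in> C}"
      unfolding in_cut_edges[OF G e vw(1)] using vw(3,4) by (cases "?q v = ?q w") simp_all
    finally show ?thesis .
  qed
  then show ?thesis by (auto simp: cut_edges_def contract_def)
qed

lemma with_edges_simps [simp]:
  "verts (with_edges G F) = verts G" "edges (with_edges G F) = F" "ends (with_edges G F) = ends G"
  by (simp_all add: with_edges_def)

lemma mgraph_with_edges: "mgraph G \<Longrightarrow> F \<subseteq> edges G \<Longrightarrow> mgraph (with_edges G F)"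
  by (auto simp: mgraph_def finite_subset)

lemma cut_edges_with_edges: "F \<subseteq> edges G \<Longrightarrow> cut_edges (with_edges G F) C = F \<inter> cut_edges G C"
  by (auto simp: cut_edges_def)

lemma contract_class_with_edges: "contract_class (with_edges G F) P = contract_class G P"
  by (simp add: contract_class_def fun_eq_iff)

lemma finite_arg_max_nat:
  fixes g :: "'b \<Rightarrow> nat"
  assumes "finite X" "X \<noteq> {}"
  obtains f where "f \<in> X" "\<And>x. x \<in> X \<Longrightarrow> g x \<le> g f"
proof -
  have "Max (g ` X) \<in> g ` X" using assms by (intro Max_in) auto
  then obtain f where f: "f \<in> X" "g f = Max (g ` X)" by auto
  have "g x \<le> g f" if "x \<in> X" for x using that assms(1) by (simp add: f(2))
  then show thesis using that f(1) by blast
qed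

definition low_conn :: "('v, 'e) nfi \<Rightarrow> 'e set \<Rightarrow> nat \<Rightarrow> 'v \<Rightarrow> 'v \<Rightarrow> bool" where
  "low_conn I L = mconn (with_edges (graph I) L) (cap I)"

text \<open>The edge set that the algorithm forms from a cut, expressed with a vertex set
  \<open>D\<close> of the uncontracted graph.\<close>

definition high_cut :: "('v, 'e) nfi \<Rightarrow> 'e set \<Rightarrow> 'v set \<Rightarrow> 'e set" where
  "high_cut I L D = (edges (graph I) - L) \<inter> cut_edges (graph I) D"

lemma mgraph_low: "nfi_instance I \<Longrightarrow> L \<subseteq> edges (graph I) \<Longrightarrow> mgraph (with_edges (graph I) L)"
  by (intro mgraph_with_edges) (auto simp: nfi_instance_def)

text \<open>Cuts of the contracted graph correspond to cuts of \<open>G\<close> closed under \<open>low_conn\<close>.\<close>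

definition closed_cut :: "('v, 'e) nfi \<Rightarrow> 'e set \<Rightarrow> nat \<Rightarrow> 'v set \<Rightarrow> bool" where
  "closed_cut I L \<theta> D \<longleftrightarrow> is_cut (graph I) (source I) (sink I) D \<and>
     (\<forall>v\<in>verts (graph I). \<forall>w\<in>verts (graph I). low_conn I L \<theta> v w \<longrightarrow> (v \<in> D \<longleftrightarrow> w \<in> D))"

definition threshold_cut :: "('v, 'e) nfi \<Rightarrow> 'e set \<Rightarrow> nat \<Rightarrow> 'v set \<Rightarrow> bool" where
  "threshold_cut I L \<theta> D \<longleftrightarrow> closed_cut I L \<theta> D \<and>
     (\<forall>D'. closed_cut I L \<theta> D' \<longrightarrow> sum (cost I) (high_cut I L D) \<le> sum (cost I) (high_cut I L D'))"

text \<open>The local connectivities of pairs of distinct vertices. They equal the weights of any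
  Gomory-Hu tree (\<open>thresholds_eq\<close>), yet can be read off a connectivity matrix.\<close>

definition thresholds :: "('v, 'e) nfi \<Rightarrow> 'e set \<Rightarrow> nat set" where
  "thresholds I L = {\<theta>. \<exists>x\<in>verts (graph I). \<exists>y\<in>verts (graph I). x \<noteq> y \<and>
     (\<forall>\<theta>'. low_conn I L \<theta>' x y \<longleftrightarrow> \<theta>' < \<theta>)}"

lemma low_edges_subset: "set es = edges (graph I) \<Longrightarrow> low_edges I es j e \<subseteq> edges (graph I)"
  by (auto simp: low_edges_def dest: in_set_takeD)

context
  fixes I :: "('v, 'e) nfi" and L :: "'e set" and T and \<kappa>
  assumes I: "nfi_instance I" and L: "L \<subseteq> edges (graph I)"
    and T: "gomory_hu_tree (with_edges (graph I) L) (cap I) T \<kappa>"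
begin

lemmas lowG = mgraph_low[OF I L]

interpretation cut_function "verts (graph I)" "cut_weight (with_edges (graph I) L) (cap I)"
  rewrites "cut_function.conn (verts (graph I)) (cut_weight (with_edges (graph I) L) (cap I)) = low_conn I L"
  using cut_function_graph[OF lowG] by (simp_all add: low_conn_def)

lemma thresholds_eq: "thresholds I L = \<kappa> ` T"
  using gh_values[OF lowG T] by (simp add: thresholds_def low_conn_def)

lemma contracted_vertex_eq:
  assumes "v \<in> verts (graph I)"
  shows "contracted_vertex I T \<kappa> f v = {x \<in> verts (graph I). low_conn I L (\<kappa> f) v x}"
proof -
  let ?P = "heavy_pairs T \<kappa> f"
  have "?P \<union> ?P\<inverse> = {(x, y). {x, y} \<in> {e \<in> T. \<kappa> f < \<kappa> e}}" by (auto simp: heavy_pairs_def insert_commute)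
  then have "(v, x) \<in> (?P \<union> ?P\<inverse>)\<^sup>* \<longleftrightarrow> linked {e \<in> T. \<kappa> f < \<kappa> e} v x" for x
    by (simp add: rtranclp_rtrancl_eq)
  then show ?thesis using gh_conn[OF lowG T, of v _ "\<kappa> f"] assms
    by (auto simp: contracted_vertex_def contract_class_def low_conn_def)
qed

lemma contracted_vertex_eq_iff:
  assumes "v \<in> verts (graph I)" "w \<in> verts (graph I)"
  shows "contracted_vertex I T \<kappa> f v = contracted_vertex I T \<kappa> f w \<longleftrightarrow> low_conn I L (\<kappa> f) v w"
  unfolding contracted_vertex_eq[OF assms(1)] contracted_vertex_eq[OF assms(2)]
proof
  assume eq: "{x \<in> verts (graph I). low_conn I L (\<kappa> f) v x} = {x \<in> verts (graph I). low_conn I L (\<kappa> f) w x}"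
  have "w \<in> {x \<in> verts (graph I). low_conn I L (\<kappa> f) w x}" using assms conn_refl by simp
  then show "low_conn I L (\<kappa> f) v w" unfolding eq[symmetric] by simp
next
  assume vw: "low_conn I L (\<kappa> f) v w"
  have "low_conn I L (\<kappa> f) v x \<longleftrightarrow> low_conn I L (\<kappa> f) w x" for x
    using conn_trans[OF vw] conn_trans[OF conn_sym[OF vw]] by blast
  then show "{x \<in> verts (graph I). low_conn I L (\<kappa> f) v x} = {x \<in> verts (graph I). low_conn I L (\<kappa> f) w x}" by simp
qed

abbreviation (input) "contracted f \<equiv> contracted_graph I (edges (graph I) - L) T \<kappa> f"
abbreviation (input) "cv f \<equiv> contracted_vertex I T \<kappa> f"

lemma verts_contracted: "verts (contracted f) = cv f ` verts (graph I)"
  by (simp add: contracted_graph_def contract_def contracted_vertex_def contract_class_with_edges)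

lemma cut_edges_contracted:
  "cut_edges (contracted f) C = high_cut I L {v \<in> verts (graph I). cv f v \<in> C}"
proof -
  have "mgraph (with_edges (graph I) (edges (graph I) - L))"
    using I by (intro mgraph_with_edges) (auto simp: nfi_instance_def)
  then show ?thesis
    by (simp add: contracted_graph_def cut_edges_contract contracted_vertex_def contract_class_with_edges
        cut_edges_with_edges high_cut_def)
qed

lemma is_cut_contracted:
  assumes "is_cut (contracted f) (cv f (source I)) (cv f (sink I)) C"
  shows "closed_cut I L (\<kappa> f) {v \<in> verts (graph I). cv f v \<in> C}"
proof -
  have st: "source I \<in> verts (graph I)" "sink I \<in> verts (graph I)" using I by (auto simp: nfi_instance_def)
  show ?thesis unfolding closed_cut_def
  proof (intro conjI ballI impI)
    show "is_cut (graph I) (source I) (sink I) {v \<in> verts (graph I). cv f v \<in> C}"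
      using assms st by (auto simp: is_cut_def verts_contracted)
  next
    fix v w assume vw: "v \<in> verts (graph I)" "w \<in> verts (graph I)" "low_conn I L (\<kappa> f) v w"
    then have "cv f v = cv f w" using contracted_vertex_eq_iff by blast
    then show "(v \<in> {v \<in> verts (graph I). cv f v \<in> C}) = (w \<in> {v \<in> verts (graph I). cv f v \<in> C})"
      using vw by simp
  qed
qed

lemma closed_cut_vimage:
  assumes D: "closed_cut I L (\<kappa> f) D"
  shows "{v \<in> verts (graph I). cv f v \<in> cv f ` D} = D"
proof -
  have sub: "D \<subseteq> verts (graph I)" using D by (auto simp: closed_cut_def is_cut_def)
  have "v \<in> D" if "v \<in> verts (graph I)" "w \<in> D" "cv f v = cv f w" for v w
    using that D sub contracted_vertex_eq_iff[of v w f] unfolding closed_cut_def by blast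
  then show ?thesis using sub by auto
qed

lemma closed_cut_is_cut_contracted:
  assumes D: "closed_cut I L (\<kappa> f) D"
  shows "is_cut (contracted f) (cv f (source I)) (cv f (sink I)) (cv f ` D)"
proof -
  have st: "source I \<in> verts (graph I)" "sink I \<in> verts (graph I)" using I by (auto simp: nfi_instance_def)
  have c: "D \<subseteq> verts (graph I)" "source I \<in> D" "sink I \<notin> D" using D by (auto simp: closed_cut_def is_cut_def)
  have "cv f (sink I) \<notin> cv f ` D" using closed_cut_vimage[OF D] c st by auto
  then show ?thesis using c st by (auto simp: is_cut_def verts_contracted)
qed

text \<open>This direction serves the approximation bound, where the cuts come from an arbitrary
  run.\<close>

lemma min_cut_contracted_threshold:
  assumes C: "is_min_cut (contracted f) (cost I) (cv f (source I)) (cv f (sink I)) C"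
  shows "threshold_cut I L (\<kappa> f) {v \<in> verts (graph I). cv f v \<in> C}"
  unfolding threshold_cut_def
proof (intro conjI allI impI)
  show "closed_cut I L (\<kappa> f) {v \<in> verts (graph I). cv f v \<in> C}"
    using C by (intro is_cut_contracted) (simp add: is_min_cut_def)
  fix D assume D: "closed_cut I L (\<kappa> f) D"
  then show "sum (cost I) (high_cut I L {v \<in> verts (graph I). cv f v \<in> C}) \<le> sum (cost I) (high_cut I L D)"
    using C closed_cut_is_cut_contracted[OF D] closed_cut_vimage[OF D]
    by (auto simp: is_min_cut_def cut_edges_contracted)
qed

text \<open>The converse lets cuts found by other means, in particular by the program, appear as the
  cuts of a run.\<close>

lemma threshold_min_cut_contracted:
  assumes D: "threshold_cut I L (\<kappa> f) D"
  shows "is_min_cut (contracted f) (cost I) (cv f (source I)) (cv f (sink I)) (cv f ` D)"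
proof -
  have c: "closed_cut I L (\<kappa> f) D" using D by (simp add: threshold_cut_def)
  show ?thesis unfolding is_min_cut_def cut_edges_contracted closed_cut_vimage[OF c]
    using closed_cut_is_cut_contracted[OF c] is_cut_contracted D by (auto simp: threshold_cut_def)
qed

text \<open>The tree edge of largest weight crossing \<open>S\<close> is the right choice of \<open>f\<close>.\<close>

lemma threshold_cut_bound:
  assumes S: "is_cut (graph I) (source I) (sink I) S"
    and k: "sum (cap I) (L \<inter> cut_edges (graph I) S) \<le> k"
  shows "\<exists>f\<in>T. closed_cut I L (\<kappa> f) S \<and>
    (\<forall>D. closed_cut I L (\<kappa> f) D \<longrightarrow> sum (cap I) (L \<inter> cut_edges (graph I) D) \<le> (card (verts (graph I)) - 1) * k)"
proof -
  let ?V = "verts (graph I)"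
  have st: "source I \<in> ?V" "sink I \<in> ?V" and fV: "finite ?V" using I by (auto simp: nfi_instance_def mgraph_def)
  have SV: "S \<subseteq> ?V" "source I \<in> S" "sink I \<notin> S" using S by (auto simp: is_cut_def)
  note tree = gh_tree[OF lowG T, simplified]
  have fT: "finite T" using tree fV by (intro finite_subset[of T "Pow ?V"]) (auto simp: is_tree_def)
  let ?X = "{f \<in> T. card (f \<inter> S) = 1}"
  obtain p where p: "is_path T (source I) p (sink I)" using tree st unfolding is_tree_def by blast
  obtain i where i: "Suc i < length p" "p ! i \<in> S" "p ! Suc i \<notin> S" using path_crosses[OF p SV(2,3)] by blast
  have "{p ! i, p ! Suc i} \<inter> S = {p ! i}" using i by auto
  then have "{p ! i, p ! Suc i} \<in> ?X" using path_edges_subset[OF p] path_edges_nthI[OF i(1)] by auto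
  then have "?X \<noteq> {}" by blast
  moreover have "finite ?X" using fT by simp
  ultimately obtain f where f: "f \<in> ?X" "\<And>g. g \<in> ?X \<Longrightarrow> \<kappa> g \<le> \<kappa> f"
    using finite_arg_max_nat[of ?X \<kappa>] by blast
  have edge: "\<exists>x y. g = {x, y} \<and> x \<noteq> y \<and> x \<in> ?V \<and> y \<in> ?V" if "g \<in> T" for g
  proof -
    have "card g = 2" "g \<subseteq> ?V" using tree that by (auto simp: is_tree_def)
    then show ?thesis by (auto simp: card_2_iff)
  qed
  have cross: "card ({x, y} \<inter> D) = 1 \<longleftrightarrow> (x \<in> D) \<noteq> (y \<in> D)" if "{x, y} \<in> T" for x y D
    using card_doubleton_Int[of x y D] gh_edge(3)[OF lowG T that] by simp
  \<comment> \<open>\<open>S\<close> separates the ends of \<open>f\<close> and has low capacity at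
    most \<open>k\<close>, while \<open>\<kappa> f\<close> is the smallest capacity of such a
    cut.\<close>
  have fk: "\<kappa> f \<le> k"
  proof -
    obtain x y where xy: "f = {x, y}" "x \<noteq> y" "x \<in> ?V" "y \<in> ?V" using edge[of f] f by auto
    have "separates S x y" using cross[of x y S] f(1) xy by (simp add: separates_def)
    then have "\<not> low_conn I L k x y"
      using k SV(1) L by (auto simp: conn_def cut_edges_with_edges)
    then show ?thesis using gh_edge_cut(3)[OF lowG T, of x y k] f(1) xy by (simp add: low_conn_def)
  qed
  have "closed_cut I L (\<kappa> f) S"
    unfolding closed_cut_def
  proof (intro conjI ballI impI S)
    fix v w assume vw: "v \<in> ?V" "w \<in> ?V" "low_conn I L (\<kappa> f) v w"
    then have "linked {e \<in> T. \<kappa> f < \<kappa> e} v w" using gh_conn[OF lowG T] by (simp add: low_conn_def)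
    then show "(v \<in> S) = (w \<in> S)"
    proof (induction rule: rtranclp_induct)
      case (step y z)
      then have "{y, z} \<notin> ?X" using f(2)[of "{y, z}"] by auto
      then show ?case using step cross[of y z S] by auto
    qed simp
  qed
  moreover have "sum (cap I) (L \<inter> cut_edges (graph I) D) \<le> (card ?V - 1) * k" if D: "closed_cut I L (\<kappa> f) D" for D
  proof -
    have DV: "D \<subseteq> ?V" using D by (auto simp: closed_cut_def is_cut_def)
    have "\<kappa> g \<le> k" if g: "g \<in> T" "card (g \<inter> D) = 1" for g
    proof -
      obtain x y where xy: "g = {x, y}" "x \<noteq> y" "x \<in> ?V" "y \<in> ?V" using edge[OF g(1)] by auto
      have "(x \<in> D) \<noteq> (y \<in> D)" using cross[of x y D] g xy by simp
      then have "\<not> low_conn I L (\<kappa> f) x y" using D xy by (auto simp: closed_cut_def)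
      then have "\<not> \<kappa> f < \<kappa> g" using gh_edge_cut(3)[OF lowG T, of x y] g xy by (simp add: low_conn_def)
      then show ?thesis using fk by simp
    qed
    then have "(\<Sum>g | g \<in> T \<and> card (g \<inter> D) = 1. \<kappa> g) \<le> of_nat (card {g \<in> T. card (g \<inter> D) = 1}) * k"
      by (intro sum_bounded_above) auto
    also have "\<dots> \<le> card T * k" using fT by (auto intro!: mult_right_mono card_mono)
    also have "\<dots> \<le> (card ?V - 1) * k" using card_tree_edges[OF tree fV st(1)] by simp
    finally show ?thesis using gh_cut_bound[OF lowG T, of D] DV L by (simp add: cut_edges_with_edges)
  qed
  ultimately show ?thesis using f(1) by blast
qed

end

section \<open>The optimum and the objective in terms of cuts\<close>

lemma finite_feasible: "nfi_instance I \<Longrightarrow> finite {R. feasible I R}"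
  by (rule finite_subset[of _ "Pow (edges (graph I))"]) (auto simp: feasible_def nfi_instance_def mgraph_def)

lemma OPT_attained:
  assumes "nfi_instance I"
  obtains R where "feasible I R" "OPT I = objective I R"
proof -
  have "feasible I {}" by (simp add: feasible_def)
  then have "OPT I \<in> objective I ` {R. feasible I R}"
    unfolding OPT_def using finite_feasible[OF assms] by (intro Min_in) auto
  then show thesis using that by auto
qed

lemma OPT_le: "nfi_instance I \<Longrightarrow> feasible I R \<Longrightarrow> OPT I \<le> objective I R"
  unfolding OPT_def using finite_feasible[of I] by (intro Min_le) auto

lemma objective_eq_cut:
  assumes I: "nfi_instance I"
  shows "\<exists>C. is_cut (graph I) (source I) (sink I) C \<and>
    objective I R = real (sum (cap I) (cut_edges (graph I) C - R))"
    and "is_cut (graph I) (source I) (sink I) C \<Longrightarrow>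
    objective I R \<le> real (sum (cap I) (cut_edges (graph I) C - R))"
proof -
  let ?G = "with_edges (graph I) (edges (graph I) - R)"
  have G: "mgraph ?G" and st: "source I \<in> verts ?G" "sink I \<in> verts ?G" "source I \<noteq> sink I"
    using I by (auto simp: nfi_instance_def intro: mgraph_with_edges)
  have finV: "finite (verts ?G)" using G by (simp add: mgraph_def)
  have eq: "cut_edges ?G C = cut_edges (graph I) C - R" for C by (auto simp: cut_edges_def)
  obtain D where D: "is_min_cut ?G (cap I) (source I) (sink I) D"
    using min_cut_exists[OF _ st] finV by blast
  have o: "objective I R = real (sum (cap I) (cut_edges (graph I) D - R))"
    unfolding objective_def using max_flow_value_eq_min_cut[OF G st D] by (simp add: eq)
  then show "\<exists>C. is_cut (graph I) (source I) (sink I) C \<and>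
    objective I R = real (sum (cap I) (cut_edges (graph I) C - R))"
    using D by (auto simp: is_min_cut_def is_cut_def)
  show "objective I R \<le> real (sum (cap I) (cut_edges (graph I) C - R))"
    if "is_cut (graph I) (source I) (sink I) C"
  proof -
    have "is_cut ?G (source I) (sink I) C" using that by (simp add: is_cut_def)
    then show ?thesis unfolding o using D by (simp add: is_min_cut_def eq del: of_nat_sum)
  qed
qed

section \<open>The approximation guarantee\<close>

text \<open>The convention \<open>0 / 0 = 0\<close> amounts to replacing cost \<open>0\<close> by \<open>1\<close> for edges of capacity \<open>0\<close>.\<close>

definition proper_cost :: "('v, 'e) nfi \<Rightarrow> 'e \<Rightarrow> nat" where
  "proper_cost I x = (if cap I x = 0 \<and> cost I x = 0 then 1 else cost I x)"

lemma efficiency_cases: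
  "efficiency I x = (if proper_cost I x = 0 then top else ennreal (real (cap I x) / real (proper_cost I x)))"
proof -
  have *: "of_nat a / of_nat b = ennreal (real a / real b)" if "b > 0" for a b :: nat
    using that by (simp add: ennreal_of_nat_eq_real_of_nat divide_ennreal)
  show ?thesis using *[of "cost I x" "cap I x"]
    by (auto simp: efficiency_def proper_cost_def ennreal_divide_zero ennreal_of_nat_eq_real_of_nat)
qed

text \<open>Cross-multiplication remains valid for infinite efficiency:
  \<open>proper_cost I z = 0\<close> forces positive capacity, so the product that vanishes is the
  right one. The program compares efficiencies by this test.\<close>

lemma efficiency_le_iff:
  "efficiency I x \<le> efficiency I y \<longleftrightarrow> cap I x * proper_cost I y \<le> cap I y * proper_cost I x"
proof -
  have pos: "cap I z > 0" if "proper_cost I z = 0" for z using that by (auto simp: proper_cost_def split: if_splits)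
  show ?thesis
  proof (cases "proper_cost I x = 0 \<or> proper_cost I y = 0")
    case True
    then show ?thesis using pos[of x] pos[of y] by (auto simp: efficiency_cases top_unique)
  next
    case False
    then have "efficiency I x \<le> efficiency I y \<longleftrightarrow> real (cap I x) / real (proper_cost I x) \<le> real (cap I y) / real (proper_cost I y)"
      by (simp add: efficiency_cases)
    also have "\<dots> \<longleftrightarrow> real (cap I x) * real (proper_cost I y) \<le> real (cap I y) * real (proper_cost I x)"
      using False by (simp add: field_simps)
    also have "\<dots> \<longleftrightarrow> cap I x * proper_cost I y \<le> cap I y * proper_cost I x"
      by (metis of_nat_le_iff of_nat_mult)
    finally show ?thesis .
  qed
qed

text \<open>Stop at the first prefix that covers the demand \<open>D\<close>, and let
  \<open>x\<close> be its last edge. Without \<open>x\<close> the prefix \<open>P i\<close> costs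
  less than \<open>F\<close>, and its edges have at most the efficiency of \<open>x\<close>, while
  those of \<open>F - P i\<close> have at least that efficiency; exchanging them shows that
  \<open>P i\<close> has no more capacity than \<open>F\<close>. The edge \<open>x\<close> adds at
  most \<open>U\<close>.\<close>

lemma min_knapsack_greedy:
  assumes es: "distinct es" "sorted_wrt (\<lambda>x y. efficiency I x \<le> efficiency I y) es"
    and S: "S \<subseteq> set es" and F: "F \<subseteq> S" "\<And>x. x \<in> F \<Longrightarrow> cap I x \<le> U"
    and D: "0 < D" "D \<le> sum (cost I) F"
  shows "\<exists>j\<in>{1..length es}. let P = {x \<in> set (take j es). cap I x \<le> U} \<inter> S in
     D \<le> sum (cost I) P \<and> sum (cap I) P \<le> sum (cap I) F + U"
proof -
  define P where "P j = {x \<in> set (take j es). cap I x \<le> U} \<inter> S" for j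
  have fin: "finite (P j)" "finite F" "finite S" for j
    using S F finite_subset[OF _ finite_set[of es]] by (auto simp: P_def)
  have "F \<subseteq> P (length es)" using F S by (auto simp: P_def)
  then have "D \<le> sum (cost I) (P (length es))" using D sum_mono2[OF fin(1), of F _ "cost I"] by fastforce
  define j where "j = (LEAST j. D \<le> sum (cost I) (P j))"
  have j: "D \<le> sum (cost I) (P j)" unfolding j_def by (rule LeastI) fact
  have jl: "j \<le> length es" unfolding j_def by (rule Least_le) fact
  have "j \<noteq> 0" using j D by (intro notI) (simp add: P_def)
  then obtain i where i: "j = Suc i" by (cases j) auto
  have "\<not> D \<le> sum (cost I) (P i)" using not_less_Least[of i "\<lambda>j. D \<le> sum (cost I) (P j)"] i by (simp add: j_def)
  then have less: "sum (cost I) (P i) < D" by simp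
  have il: "i < length es" using i jl by simp
  define x where "x = es ! i"
  have tk: "set (take j es) = insert x (set (take i es))" using il by (simp add: i x_def take_Suc_conv_app_nth)
  have xS: "x \<in> S" "cap I x \<le> U" and Pj: "P j = insert x (P i)"
  proof -
    have "P j \<noteq> P i" using j less by auto
    then show x: "x \<in> S" "cap I x \<le> U" unfolding P_def tk by auto
    show "P j = insert x (P i)" using x unfolding P_def tk by auto
  qed
  have xP: "x \<notin> P i" using es(1) il by (auto simp: P_def x_def in_set_conv_nth nth_eq_iff_index_eq)
  have "sum (cost I) (P j) = cost I x + sum (cost I) (P i)" using Pj xP fin by simp
  \<comment> \<open>\<open>x\<close> is the edge that lifts the cost to \<open>D\<close>, so it is
    not free, and its cost can be cancelled at the end of the exchange argument.\<close>
  then have cx: "cost I x > 0" using j less by simp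
  then have px: "proper_cost I x = cost I x" by (simp add: proper_cost_def)
  have before: "cap I y * cost I x \<le> cap I x * cost I y" if "y \<in> P i" for y
  proof -
    have "y \<in> set (take i es)" using that by (simp add: P_def)
    then obtain k where "k < i" "y = es ! k" by (auto simp: in_set_conv_nth)
    then have "efficiency I y \<le> efficiency I x" using es(2) il by (auto simp: sorted_wrt_iff_nth_less x_def)
    then have "cap I y * cost I x \<le> cap I x * proper_cost I y" by (simp add: efficiency_le_iff px)
    \<comment> \<open>\<open>proper_cost\<close> differs from \<open>cost\<close> only for edges of
      capacity 0, where the left side vanishes.\<close>
    then show ?thesis by (cases "cap I y = 0") (auto simp: proper_cost_def)
  qed
  have after: "cap I x * cost I y \<le> cap I y * cost I x" if y: "y \<in> F" "y \<notin> P i" for y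
  proof -
    obtain k where k: "k < length es" "y = es ! k" using y F S by (auto simp: in_set_conv_nth subset_iff)
    have "k \<ge> i"
    proof (rule ccontr)
      assume "\<not> i \<le> k"
      then have "y \<in> set (take i es)" using k by (auto simp: in_set_conv_nth)
      then show False using y F by (auto simp: P_def)
    qed
    then have "efficiency I x \<le> efficiency I y"
      using es(2) k by (cases "k = i") (auto simp: sorted_wrt_iff_nth_less x_def)
    then have "cap I x * proper_cost I y \<le> cap I y * cost I x" by (simp add: efficiency_le_iff px)
    moreover have "cost I y \<le> proper_cost I y" by (simp add: proper_cost_def)
    ultimately show ?thesis by (meson le_trans mult_le_mono2)
  qed
  \<comment> \<open>Removing the common part of \<open>P i\<close> and \<open>F\<close> turns the
    comparison of their costs into one of their differences, to which the efficiency bounds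
    apply.\<close>
  have "sum (cost I) (P i \<inter> F) + sum (cost I) (P i - F) \<le> sum (cost I) (F \<inter> P i) + sum (cost I) (F - P i)"
    using less D(2) fin sum.Int_Diff[of "P i" "cost I" F] sum.Int_Diff[of F "cost I" "P i"] by simp
  then have "sum (cost I) (P i - F) \<le> sum (cost I) (F - P i)" by (simp add: Int_commute)
  then have "cap I x * sum (cost I) (P i - F) \<le> cap I x * sum (cost I) (F - P i)" by simp
  moreover have "(\<Sum>y\<in>P i - F. cap I y * cost I x) \<le> (\<Sum>y\<in>P i - F. cap I x * cost I y)"
    using before by (intro sum_mono) auto
  moreover have "(\<Sum>y\<in>F - P i. cap I x * cost I y) \<le> (\<Sum>y\<in>F - P i. cap I y * cost I x)"
    using after by (intro sum_mono) auto
  ultimately have "sum (cap I) (P i - F) * cost I x \<le> sum (cap I) (F - P i) * cost I x"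
    by (simp add: sum_distrib_left sum_distrib_right)
  then have "sum (cap I) (P i - F) \<le> sum (cap I) (F - P i)" using cx by simp
  then have "sum (cap I) (P i) \<le> sum (cap I) F"
    using fin sum.Int_Diff[of "P i" "cap I" F] sum.Int_Diff[of F "cap I" "P i"] by (simp add: Int_commute)
  then have "sum (cap I) (P j) \<le> sum (cap I) F + U" using Pj xP fin xS(2) by simp
  moreover have "j \<in> {1..length es}" using i jl by simp
  ultimately show ?thesis using j unfolding P_def Let_def by blast
qed

lemma good_low_edges:
  assumes I: "nfi_instance I" and opt: "0 < OPT I"
    and es: "distinct es" "set es = edges (graph I)" "sorted_wrt (\<lambda>x y. efficiency I x \<le> efficiency I y) es"
  obtains j e S where "j \<in> {1..length es}" "e \<in> edges (graph I)" "is_cut (graph I) (source I) (sink I) S"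
    "real (sum (cap I) (low_edges I es j e \<inter> cut_edges (graph I) S)) \<le> 2 * OPT I"
    "sum (cost I) (high_cut I (low_edges I es j e) S) \<le> budget I"
proof -
  have fE: "finite (edges (graph I))" using I by (simp add: nfi_instance_def mgraph_def)
  obtain R where R: "feasible I R" "OPT I = objective I R" using OPT_attained[OF I] .
  obtain C where C: "is_cut (graph I) (source I) (sink I) C" "OPT I = real (sum (cap I) (cut_edges (graph I) C - R))"
    using objective_eq_cut(1)[OF I, of R] R(2) by auto
  define S where "S = cut_edges (graph I) C"
  define F where "F = S - R"
  have SE: "S \<subseteq> edges (graph I)" by (simp add: S_def cut_edges_subset)
  then have fin: "finite S" "finite F" using fE finite_subset by (auto simp: F_def)
  have optF: "OPT I = real (sum (cap I) F)" using C by (simp add: F_def S_def)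
  have "F \<noteq> {}" using optF opt by auto
  then obtain e where e: "e \<in> F" "\<And>x. x \<in> F \<Longrightarrow> cap I x \<le> cap I e"
    using finite_arg_max_nat[OF fin(2), of "cap I"] by blast
  define D where "D = sum (cost I) S - budget I"
  \<comment> \<open>If all of \<open>S\<close> were affordable, removing it would reduce the flow to
    0, against \<open>0 < OPT I\<close>. Hence the demand \<open>D\<close> is positive.\<close>
  have big: "budget I < sum (cost I) S"
  proof (rule ccontr)
    assume "\<not> budget I < sum (cost I) S"
    then have "feasible I S" using SE by (simp add: feasible_def)
    then have "OPT I \<le> objective I S" by (rule OPT_le[OF I])
    also have "\<dots> \<le> 0" using objective_eq_cut(2)[OF I C(1), of S] by (simp add: S_def)
    finally show False using opt by simp
  qed
  have fR: "finite R" using R(1) fE finite_subset by (auto simp: feasible_def)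
  have "sum (cost I) (S \<inter> R) \<le> budget I"
    using R(1) sum_mono2[OF fR, of "S \<inter> R" "cost I"] by (auto simp: feasible_def)
  then have "D \<le> sum (cost I) F"
    using sum.Int_Diff[OF fin(1), of "cost I" R] by (simp add: D_def F_def)
  then obtain j where j: "j \<in> {1..length es}"
    "D \<le> sum (cost I) ({x \<in> set (take j es). cap I x \<le> cap I e} \<inter> S)"
    "sum (cap I) ({x \<in> set (take j es). cap I x \<le> cap I e} \<inter> S) \<le> sum (cap I) F + cap I e"
    using min_knapsack_greedy[OF es(1,3), of S F "cap I e" D] SE es(2) e(2) big
    by (auto simp: D_def F_def Let_def)
  let ?L = "low_edges I es j e"
  \<comment> \<open>Origin of the factor 2: the greedy surplus is at most the capacity of one edge
    of \<open>F\<close>, and \<open>F\<close> as a whole has capacity \<open>OPT I\<close>.\<close>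
  have "cap I e \<le> sum (cap I) F" using e(1) fin(2) by (intro member_le_sum) auto
  then have "sum (cap I) (?L \<inter> S) \<le> 2 * sum (cap I) F" using j(3) by (simp add: low_edges_def)
  then have "real (sum (cap I) (?L \<inter> S)) \<le> 2 * OPT I" unfolding optF by linarith
  moreover have "sum (cost I) (high_cut I ?L C) \<le> budget I"
  proof -
    have "high_cut I ?L C = S - ?L" using SE by (auto simp: high_cut_def S_def)
    then have "sum (cost I) S = sum (cost I) (?L \<inter> S) + sum (cost I) (high_cut I ?L C)"
      using sum.Int_Diff[OF fin(1), of "cost I" ?L] by (simp add: Int_commute)
    then show ?thesis using j(2) by (simp add: low_edges_def D_def)
  qed
  ultimately show thesis using that[OF j(1) _ C(1)] e(1) SE by (auto simp: S_def F_def)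
qed

lemma candidate_eq:
  assumes "nfi_instance I" "set es = edges (graph I)"
    "gomory_hu_tree (with_edges (graph I) (low_edges I es j e)) (cap I) (T j e) (\<kappa> j e)"
  shows "candidate I es T \<kappa> C j e f
    = high_cut I (low_edges I es j e) {v \<in> verts (graph I). contracted_vertex I (T j e) (\<kappa> j e) f v \<in> C j e f}"
  using cut_edges_contracted[OF assms(1) low_edges_subset[OF assms(2)] assms(3)]
  by (auto simp: candidate_def high_edges_def high_cut_def)

lemma stored_good:
  assumes I: "nfi_instance I" and run: "valid_run I es T \<kappa> C" and opt: "0 < OPT I"
  shows "\<exists>R\<in>stored I es T \<kappa> C. objective I R \<le> 2 * (real (card (verts (graph I))) - 1) * OPT I"
proof -
  have es: "distinct es" "set es = edges (graph I)" "sorted_wrt (\<lambda>x y. efficiency I x \<le> efficiency I y) es"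
    using run by (auto simp: valid_run_def)
  obtain j e S where j: "j \<in> {1..length es}" and e: "e \<in> edges (graph I)"
    and S: "is_cut (graph I) (source I) (sink I) S"
    and low: "real (sum (cap I) (low_edges I es j e \<inter> cut_edges (graph I) S)) \<le> 2 * OPT I"
    and high: "sum (cost I) (high_cut I (low_edges I es j e) S) \<le> budget I"
    using good_low_edges[OF I opt es] by blast
  let ?L = "low_edges I es j e" and ?V = "verts (graph I)"
  define k where "k = sum (cap I) (?L \<inter> cut_edges (graph I) S)"
  have L: "?L \<subseteq> edges (graph I)" by (rule low_edges_subset[OF es(2)])
  have T: "gomory_hu_tree (with_edges (graph I) ?L) (cap I) (T j e) (\<kappa> j e)"
    using run j e by (auto simp: valid_run_def)
  obtain f where f: "f \<in> T j e" "closed_cut I ?L (\<kappa> j e f) S"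
    "\<And>D. closed_cut I ?L (\<kappa> j e f) D \<Longrightarrow> sum (cap I) (?L \<inter> cut_edges (graph I) D) \<le> (card ?V - 1) * k"
    using threshold_cut_bound[OF I L T S, of k] by (auto simp: k_def)
  let ?cv = "contracted_vertex I (T j e) (\<kappa> j e) f"
  have st: "source I \<in> ?V" "sink I \<in> ?V" using I by (auto simp: nfi_instance_def)
  have ne: "?cv (source I) \<noteq> ?cv (sink I)"
    using f(2) st contracted_vertex_eq_iff[OF I L T st] by (auto simp: closed_cut_def is_cut_def)
  define D where "D = {v \<in> ?V. ?cv v \<in> C j e f}"
  have cand: "candidate I es T \<kappa> C j e f = high_cut I ?L D"
    unfolding D_def by (rule candidate_eq[where ?T = T and ?\<kappa> = \<kappa>, OF I es(2) T])
  have "is_min_cut (contracted_graph I (edges (graph I) - ?L) (T j e) (\<kappa> j e) f) (cost I) (?cv (source I)) (?cv (sink I)) (C j e f)"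
    using run j e f(1) ne by (auto simp: valid_run_def Let_def high_edges_def)
  then have D: "threshold_cut I ?L (\<kappa> j e f) D" unfolding D_def by (rule min_cut_contracted_threshold[OF I L T])
  then have "sum (cost I) (high_cut I ?L D) \<le> budget I" using f(2) high by (auto simp: threshold_cut_def intro: le_trans)
  then have "high_cut I ?L D \<in> stored I es T \<kappa> C"
    unfolding stored_def using j e f(1) ne cand by (metis (mono_tags, lifting) mem_Collect_eq)
  moreover have "objective I (high_cut I ?L D) \<le> 2 * (real (card ?V) - 1) * OPT I"
  proof -
    have cD: "closed_cut I ?L (\<kappa> j e f) D" using D by (simp add: threshold_cut_def)
    \<comment> \<open>After the candidate has been removed, only low edges of the cut
      \<open>D\<close> are left, so their capacity bounds the remaining flow.\<close>
    have "cut_edges (graph I) D - high_cut I ?L D = ?L \<inter> cut_edges (graph I) D"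
      using cut_edges_subset[of "graph I" D] by (auto simp: high_cut_def)
    then have "objective I (high_cut I ?L D) \<le> real (sum (cap I) (?L \<inter> cut_edges (graph I) D))"
      using objective_eq_cut(2)[OF I, of D "high_cut I ?L D"] cD by (simp add: closed_cut_def)
    also have "\<dots> \<le> real ((card ?V - 1) * k)" using f(3)[OF cD] of_nat_le_iff by blast
    also have "\<dots> = (real (card ?V) - 1) * real k"
    proof -
      have "card ?V > 0" using st I by (auto simp: card_gt_0_iff nfi_instance_def mgraph_def)
      then show ?thesis by (simp add: of_nat_diff)
    qed
    also have "\<dots> \<le> (real (card ?V) - 1) * (2 * OPT I)"
    proof (rule mult_left_mono)
      have "card ?V > 0" using st I by (auto simp: card_gt_0_iff nfi_instance_def mgraph_def)
      then show "0 \<le> real (card ?V) - 1" by simp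
    qed (use low in \<open>simp add: k_def\<close>)
    finally show ?thesis by (simp add: algebra_simps)
  qed
  ultimately show ?thesis by blast
qed

text \<open>Turns data indexed by thresholds into a run. The trees are arbitrary Gomory-Hu trees,
  and a tree edge \<open>f\<close> receives a cut chosen for the number
  \<open>\<kappa> j e f\<close>. Premise \<open>best\<close> provides, for each triple in which the
  terminals stay apart, a minimum cost cut that does not beat the distinguished candidate, unless it
  is too expensive to be stored.\<close>

lemma algorithm_output_intro:
  assumes I: "nfi_instance I"
    and es: "distinct es" "set es = edges (graph I)" "sorted_wrt (\<lambda>x y. efficiency I x \<le> efficiency I y) es"
    and j0: "j0 \<in> {1..length es}" and e0: "e0 \<in> edges (graph I)"
    and th0: "\<theta>0 \<in> thresholds I (low_edges I es j0 e0)"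
    and D0: "threshold_cut I (low_edges I es j0 e0) \<theta>0 D0"
    and cost0: "sum (cost I) (high_cut I (low_edges I es j0 e0) D0) \<le> budget I"
    and best: "\<And>j e \<theta>. j \<in> {1..length es} \<Longrightarrow> e \<in> edges (graph I) \<Longrightarrow>
       \<theta> \<in> thresholds I (low_edges I es j e) \<Longrightarrow> \<not> low_conn I (low_edges I es j e) \<theta> (source I) (sink I) \<Longrightarrow>
       \<exists>D. threshold_cut I (low_edges I es j e) \<theta> D \<and>
         (sum (cost I) (high_cut I (low_edges I es j e) D) \<le> budget I \<longrightarrow>
          objective I (high_cut I (low_edges I es j0 e0) D0) \<le> objective I (high_cut I (low_edges I es j e) D))"
  shows "algorithm_output I (high_cut I (low_edges I es j0 e0) D0)"
proof -
  let ?L = "low_edges I es" and ?V = "verts (graph I)"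
  let ?R0 = "high_cut I (?L j0 e0) D0"
  have st: "source I \<in> ?V" "sink I \<in> ?V" using I by (auto simp: nfi_instance_def)
  have L: "?L j e \<subseteq> edges (graph I)" for j e by (rule low_edges_subset[OF es(2)])
  have "\<exists>T\<kappa>. gomory_hu_tree (with_edges (graph I) (?L j e)) (cap I) (fst T\<kappa>) (snd T\<kappa>)" for j e
  proof -
    have "verts (with_edges (graph I) (?L j e)) \<noteq> {}" using st by auto
    then obtain T0 \<kappa>0 where "gomory_hu_tree (with_edges (graph I) (?L j e)) (cap I) T0 \<kappa>0"
      using gomory_hu_tree_exists[OF mgraph_low[OF I L]] by blast
    then show ?thesis by (intro exI[of _ "(T0, \<kappa>0)"]) simp
  qed
  then obtain TK where TK: "\<And>j e. gomory_hu_tree (with_edges (graph I) (?L j e)) (cap I) (fst (TK j e)) (snd (TK j e))"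
    by metis
  define T where "T = (\<lambda>j e. fst (TK j e))"
  define \<kappa> where "\<kappa> = (\<lambda>j e. snd (TK j e))"
  have gh: "gomory_hu_tree (with_edges (graph I) (?L j e)) (cap I) (T j e) (\<kappa> j e)" for j e
    using TK by (simp add: T_def \<kappa>_def)
  define good where "good j e \<theta> D \<longleftrightarrow> threshold_cut I (?L j e) \<theta> D \<and>
    (sum (cost I) (high_cut I (?L j e) D) \<le> budget I \<longrightarrow> objective I ?R0 \<le> objective I (high_cut I (?L j e) D))"
    for j e \<theta> D
  \<comment> \<open>The distinguished cut \<open>D0\<close> has to be used at its own triple so that
    its candidate is stored; elsewhere any cut that does not beat it serves. Tree edges of equal
    weight share their cut.\<close>
  define W where "W j e \<theta> = (if (j, e, \<theta>) = (j0, e0, \<theta>0) then D0 else SOME D. good j e \<theta> D)" for j e \<theta>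
  define C where "C = (\<lambda>j e f. contracted_vertex I (T j e) (\<kappa> j e) f ` W j e (\<kappa> j e f))"
  have W: "good j e (\<kappa> j e f) (W j e (\<kappa> j e f))"
    if j: "j \<in> {1..length es}" and e: "e \<in> edges (graph I)" and f: "f \<in> T j e"
      and ne: "contracted_vertex I (T j e) (\<kappa> j e) f (source I) \<noteq> contracted_vertex I (T j e) (\<kappa> j e) f (sink I)" for j e f
  proof (cases "(j, e, \<kappa> j e f) = (j0, e0, \<theta>0)")
    case True
    then show ?thesis using D0 by (auto simp: good_def W_def)
  next
    case False
    have "\<kappa> j e f \<in> thresholds I (?L j e)" using thresholds_eq[OF I L gh] f by blast
    moreover have "\<not> low_conn I (?L j e) (\<kappa> j e f) (source I) (sink I)"
      using ne contracted_vertex_eq_iff[OF I L gh st] by blast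
    ultimately have "\<exists>D. good j e (\<kappa> j e f) D" using best[OF j e] unfolding good_def by blast
    then have "good j e (\<kappa> j e f) (SOME D. good j e (\<kappa> j e f) D)" by (rule someI_ex)
    then show ?thesis using False unfolding W_def by presburger
  qed
  have cand: "candidate I es T \<kappa> C j e f = high_cut I (?L j e) (W j e (\<kappa> j e f))"
    if "threshold_cut I (?L j e) (\<kappa> j e f) (W j e (\<kappa> j e f))" for j e f
    using candidate_eq[where ?T = T and ?\<kappa> = \<kappa>, OF I es(2) gh, of C j e f] closed_cut_vimage[OF I L gh] that
    by (simp add: C_def threshold_cut_def)
  have run: "valid_run I es T \<kappa> C"
    unfolding valid_run_def Let_def
  proof (intro conjI ballI impI es gh)
    fix j e f assume a: "j \<in> {1..length es}" "e \<in> edges (graph I)" "f \<in> T j e"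
      "contracted_vertex I (T j e) (\<kappa> j e) f (source I) \<noteq> contracted_vertex I (T j e) (\<kappa> j e) f (sink I)"
    then have "threshold_cut I (?L j e) (\<kappa> j e f) (W j e (\<kappa> j e f))" using W by (simp add: good_def)
    then show "is_min_cut (contracted_graph I (high_edges I es j e) (T j e) (\<kappa> j e) f) (cost I)
         (contracted_vertex I (T j e) (\<kappa> j e) f (source I)) (contracted_vertex I (T j e) (\<kappa> j e) f (sink I)) (C j e f)"
      unfolding high_edges_def C_def by (rule threshold_min_cut_contracted[OF I L gh])
  qed
  obtain f0 where f0: "f0 \<in> T j0 e0" "\<theta>0 = \<kappa> j0 e0 f0" using th0 thresholds_eq[OF I L gh] by blast
  have W0: "W j0 e0 (\<kappa> j0 e0 f0) = D0" using f0 by (simp add: W_def)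
  have "\<not> low_conn I (?L j0 e0) \<theta>0 (source I) (sink I)"
    using D0 st by (auto simp: threshold_cut_def closed_cut_def is_cut_def)
  then have "contracted_vertex I (T j0 e0) (\<kappa> j0 e0) f0 (source I) \<noteq> contracted_vertex I (T j0 e0) (\<kappa> j0 e0) f0 (sink I)"
    using contracted_vertex_eq_iff[OF I L gh st] f0 by blast
  moreover have c0: "candidate I es T \<kappa> C j0 e0 f0 = ?R0" using cand[of j0 e0 f0] W0 D0 f0 by simp
  ultimately have "?R0 \<in> stored I es T \<kappa> C"
    unfolding stored_def using j0 e0 f0(1) cost0 by (metis (mono_tags, lifting) mem_Collect_eq)
  moreover have "objective I ?R0 \<le> objective I R" if R: "R \<in> stored I es T \<kappa> C" for R
  proof -
    obtain j e f where a: "j \<in> {1..length es}" "e \<in> edges (graph I)" "f \<in> T j e"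
      "contracted_vertex I (T j e) (\<kappa> j e) f (source I) \<noteq> contracted_vertex I (T j e) (\<kappa> j e) f (sink I)"
      "R = candidate I es T \<kappa> C j e f" "sum (cost I) R \<le> budget I"
      using R unfolding stored_def by blast
    have g: "good j e (\<kappa> j e f) (W j e (\<kappa> j e f))" by (rule W[OF a(1-4)])
    then have "R = high_cut I (?L j e) (W j e (\<kappa> j e f))" using cand a(5) by (simp add: good_def)
    then show ?thesis using g a(6) by (simp add: good_def)
  qed
  ultimately show ?thesis unfolding algorithm_output_def using run by blast
qed

lemma threshold_cut_exists:
  assumes I: "nfi_instance I" and L: "L \<subseteq> edges (graph I)"
    and nc: "\<not> low_conn I L \<theta> (source I) (sink I)"
  shows "\<exists>D. threshold_cut I L \<theta> D"
proof -
  interpret cut_function "verts (graph I)" "cut_weight (with_edges (graph I) L) (cap I)"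
    rewrites "cut_function.conn (verts (graph I)) (cut_weight (with_edges (graph I) L) (cap I)) = low_conn I L"
    using cut_function_graph[OF mgraph_low[OF I L]] by (simp_all add: low_conn_def)
  have st: "source I \<in> verts (graph I)" "sink I \<in> verts (graph I)" using I by (auto simp: nfi_instance_def)
  have "low_conn I L \<theta> (source I) v \<longleftrightarrow> low_conn I L \<theta> (source I) w" if "low_conn I L \<theta> v w" for v w
    using conn_trans[OF _ that] conn_trans[OF _ conn_sym[OF that]] by blast
  then have "closed_cut I L \<theta> {v \<in> verts (graph I). low_conn I L \<theta> (source I) v}"
    using nc st conn_refl by (auto simp: closed_cut_def is_cut_def)
  then obtain D where "closed_cut I L \<theta> D"
    "\<forall>D'. closed_cut I L \<theta> D' \<longrightarrow> sum (cost I) (high_cut I L D) \<le> sum (cost I) (high_cut I L D')"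
    using ex_has_least_nat[of "closed_cut I L \<theta>" _ "\<lambda>D. sum (cost I) (high_cut I L D)"] by blast
  then show ?thesis by (auto simp: threshold_cut_def)
qed

text \<open>Ensures that something is stored. With the full ordering and an edge \<open>e\<close> of
  largest capacity no edge is high, and for a heaviest tree edge nothing is contracted, so source
  and sink stay apart and the empty set is a candidate.\<close>

lemma empty_candidate:
  assumes I: "nfi_instance I" and E: "edges (graph I) \<noteq> {}" and es: "set es = edges (graph I)"
  obtains e \<theta> D where "e \<in> edges (graph I)" "\<theta> \<in> thresholds I (low_edges I es (length es) e)"
    "threshold_cut I (low_edges I es (length es) e) \<theta> D" "high_cut I (low_edges I es (length es) e) D = {}"
proof -
  have "finite (edges (graph I))" using I by (simp add: nfi_instance_def mgraph_def)
  then obtain e where e: "e \<in> edges (graph I)" "\<And>x. x \<in> edges (graph I) \<Longrightarrow> cap I x \<le> cap I e"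
    using finite_arg_max_nat[OF _ E, of "cap I"] by blast
  let ?L = "low_edges I es (length es) e"
  have Leq: "?L = edges (graph I)" using e es by (auto simp: low_edges_def)
  have L: "?L \<subseteq> edges (graph I)" by (simp add: Leq)
  have st: "source I \<in> verts (graph I)" "sink I \<in> verts (graph I)" "source I \<noteq> sink I" using I by (auto simp: nfi_instance_def)
  obtain T \<kappa> where gh: "gomory_hu_tree (with_edges (graph I) ?L) (cap I) T \<kappa>"
    using gomory_hu_tree_exists[OF mgraph_low[OF I L], where u = "cap I"] st by auto
  have tree: "is_tree (verts (graph I)) T" using gh_tree[OF mgraph_low[OF I L] gh] by simp
  then obtain p where p: "is_path T (source I) p (sink I)" using st unfolding is_tree_def by blast
  have "T \<noteq> {}" using path_edges_nonempty[OF p st(3)] path_edges_subset[OF p] by auto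
  moreover have "finite T"
    using tree I by (intro finite_subset[of T "Pow (verts (graph I))"]) (auto simp: is_tree_def nfi_instance_def mgraph_def)
  ultimately obtain f where f: "f \<in> T" "\<And>g. g \<in> T \<Longrightarrow> \<kappa> g \<le> \<kappa> f" using finite_arg_max_nat[of T \<kappa>] by blast
  then have "{e \<in> T. \<kappa> f < \<kappa> e} = {}" by (auto simp: not_less)
  then have "linked {e \<in> T. \<kappa> f < \<kappa> e} (source I) x \<longleftrightarrow> x = source I" for x
    using rtranclp.cases[of "\<lambda>x y. {x, y} \<in> {e \<in> T. \<kappa> f < \<kappa> e}" "source I" x] by auto
  then have "\<not> low_conn I ?L (\<kappa> f) (source I) (sink I)"
    using gh_conn[OF mgraph_low[OF I L] gh, of "source I" "sink I" "\<kappa> f"] st by (simp add: low_conn_def)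
  then obtain D where "threshold_cut I ?L (\<kappa> f) D" using threshold_cut_exists[OF I L] by blast
  moreover have "\<kappa> f \<in> thresholds I ?L" using thresholds_eq[OF I L gh] f by blast
  moreover have "high_cut I ?L D = {}" by (simp add: high_cut_def Leq)
  ultimately show thesis using that e by blast
qed

text \<open>Minimising over the candidates of all threshold cuts at once gives one that no other
  candidate beats, so the remaining cuts of the run can be chosen freely.\<close>

lemma algorithm_output_exists:
  assumes I: "nfi_instance I" and E: "edges (graph I) \<noteq> {}"
  shows "\<exists>R. algorithm_output I R"
proof -
  have fE: "finite (edges (graph I))" using I by (simp add: nfi_instance_def mgraph_def)
  then obtain xs where xs: "set xs = edges (graph I)" "distinct xs" using finite_distinct_list by blast
  define es where "es = sort_key (efficiency I) xs"
  have es: "distinct es" "set es = edges (graph I)" "sorted_wrt (\<lambda>x y. efficiency I x \<le> efficiency I y) es"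
    using xs sorted_sort_key[of "efficiency I" xs] by (simp_all add: es_def sorted_map)
  let ?L = "low_edges I es"
  have L: "?L j e \<subseteq> edges (graph I)" for j e by (rule low_edges_subset[OF es(2)])
  have len: "length es \<in> {1..length es}" using es(2) E by (cases es) auto
  define \<R> where "\<R> = {R. \<exists>j\<in>{1..length es}. \<exists>e\<in>edges (graph I). \<exists>\<theta>\<in>thresholds I (?L j e). \<exists>D.
     threshold_cut I (?L j e) \<theta> D \<and> R = high_cut I (?L j e) D \<and> sum (cost I) R \<le> budget I}"
  have "{} \<in> \<R>"
  proof -
    obtain e \<theta> D where "e \<in> edges (graph I)" "\<theta> \<in> thresholds I (?L (length es) e)"
      "threshold_cut I (?L (length es) e) \<theta> D" "high_cut I (?L (length es) e) D = {}"
      using empty_candidate[OF I E es(2)] .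
    then show ?thesis unfolding \<R>_def using len by force
  qed
  moreover have "\<R> \<subseteq> Pow (edges (graph I))" by (auto simp: \<R>_def high_cut_def)
  then have "finite \<R>" using fE finite_subset by blast
  ultimately have "Min (objective I ` \<R>) \<in> objective I ` \<R>" by (intro Min_in) auto
  then obtain R where R: "R \<in> \<R>" "objective I R = Min (objective I ` \<R>)" by auto
  then have min: "objective I R \<le> objective I R'" if "R' \<in> \<R>" for R' using that \<open>finite \<R>\<close> by simp
  obtain j e \<theta> D where a: "j \<in> {1..length es}" "e \<in> edges (graph I)" "\<theta> \<in> thresholds I (?L j e)"
    "threshold_cut I (?L j e) \<theta> D" "R = high_cut I (?L j e) D" "sum (cost I) R \<le> budget I"
    using R(1) unfolding \<R>_def by blast
  have "algorithm_output I (high_cut I (?L j e) D)"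
  proof (rule algorithm_output_intro[OF I es a(1-4)])
    show "sum (cost I) (high_cut I (?L j e) D) \<le> budget I" using a by simp
    fix j' e' \<theta>' assume b: "j' \<in> {1..length es}" "e' \<in> edges (graph I)" "\<theta>' \<in> thresholds I (?L j' e')"
      "\<not> low_conn I (?L j' e') \<theta>' (source I) (sink I)"
    obtain D' where D': "threshold_cut I (?L j' e') \<theta>' D'" using threshold_cut_exists[OF I L b(4)] by blast
    have "objective I R \<le> objective I (high_cut I (?L j' e') D')" if "sum (cost I) (high_cut I (?L j' e') D') \<le> budget I"
    proof (rule min)
      show "high_cut I (?L j' e') D' \<in> \<R>"
        unfolding \<R>_def mem_Collect_eq using D' that
        by (intro bexI[OF _ b(1)] bexI[OF _ b(2)] bexI[OF _ b(3)] exI[of _ D'] conjI refl)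
    qed
    then show "\<exists>X. threshold_cut I (?L j' e') \<theta>' X \<and> (sum (cost I) (high_cut I (?L j' e') X) \<le> budget I \<longrightarrow>
          objective I (high_cut I (?L j e) D) \<le> objective I (high_cut I (?L j' e') X))"
      using D' a(5) by (intro exI[of _ D']) simp
  qed
  then show ?thesis by blast
qed

lemma algorithm_output_approx:
  assumes I: "nfi_instance I" and R: "algorithm_output I R"
  shows "feasible I R"
    and "0 < OPT I \<Longrightarrow> objective I R \<le> 2 * (real (card (verts (graph I))) - 1) * OPT I"
proof -
  obtain es T \<kappa> C where run: "valid_run I es T \<kappa> C" and st: "R \<in> stored I es T \<kappa> C"
    and min: "\<And>R'. R' \<in> stored I es T \<kappa> C \<Longrightarrow> objective I R \<le> objective I R'"
    using R unfolding algorithm_output_def by blast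
  show "feasible I R" using st by (auto simp: stored_def feasible_def candidate_def high_edges_def)
  show "objective I R \<le> 2 * (real (card (verts (graph I))) - 1) * OPT I" if "0 < OPT I"
    using stored_good[OF I run that] min by force
qed

section \<open>Highest-label push-relabel\<close>

text \<open>Parallel edges and contraction become addition of matrix entries, and m enters the
  analysis only through the number of nonzero entries.\<close>

locale flow_network =
  fixes n :: nat and c :: "nat \<Rightarrow> nat \<Rightarrow> nat" and s t :: nat
  assumes s: "s < n" and t: "t < n" and st: "s \<noteq> t"
    and csym: "v < n \<Longrightarrow> w < n \<Longrightarrow> c v w = c w v"
    and cdiag: "v < n \<Longrightarrow> c v v = 0"
begin

definition adj :: "nat \<Rightarrow> nat list" where
  "adj v = filter (\<lambda>w. 0 < c v w) [0..<n]"

definition cut_value :: "nat set \<Rightarrow> nat" where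
  "cut_value S = (\<Sum>v\<in>{..<n} \<inter> S. \<Sum>w\<in>{..<n} - S. c v w)"

definition active :: "(nat \<Rightarrow> nat) \<Rightarrow> (nat \<Rightarrow> nat) \<Rightarrow> nat \<Rightarrow> nat set" where
  "active ex d l = {v. v < n \<and> v \<noteq> s \<and> v \<noteq> t \<and> 0 < ex v \<and> d v = l}"

text \<open>Residual capacities \<open>r\<close>, excesses \<open>ex\<close>, labels \<open>d\<close>, current arcs \<open>cur\<close>; the stack \<open>B l\<close>
  holds the active vertices with label \<open>l\<close>, and \<open>b\<close> bounds the labels of active vertices. Vertices
  with label \<open>n\<close> are abandoned, as they cannot reach \<open>t\<close>.\<close>

definition pr_inv ::
  "(nat \<Rightarrow> nat \<Rightarrow> nat) \<Rightarrow> (nat \<Rightarrow> nat) \<Rightarrow> (nat \<Rightarrow> nat) \<Rightarrow> (nat \<Rightarrow> nat) \<Rightarrow> (nat \<Rightarrow> nat list) \<Rightarrow> nat \<Rightarrow> bool" where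
  "pr_inv r ex d cur B b \<longleftrightarrow>
     (\<forall>v<n. \<forall>w<n. r v w + r w v = 2 * c v w) \<and>
     (\<forall>v<n. v \<noteq> s \<longrightarrow> ex v + (\<Sum>w<n. c v w) = (\<Sum>w<n. r v w)) \<and>
     (\<forall>w<n. r s w = 0) \<and>
     d s = n \<and> d t = 0 \<and> (\<forall>v<n. v \<noteq> s \<longrightarrow> v \<noteq> t \<longrightarrow> 1 \<le> d v \<and> d v \<le> n) \<and>
     (\<forall>v<n. \<forall>w<n. 0 < r v w \<longrightarrow> d v \<le> d w + 1) \<and>
     (\<forall>v<n. v \<noteq> s \<longrightarrow> v \<noteq> t \<longrightarrow> cur v \<le> length (adj v) \<and>
        (\<forall>i<cur v. r v (adj v ! i) = 0 \<or> d v \<le> d (adj v ! i))) \<and>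
     (\<forall>l<n. distinct (B l) \<and> set (B l) = active ex d l) \<and>
     b < n \<and> (\<forall>l. b < l \<longrightarrow> l < n \<longrightarrow> B l = [])"

text \<open>The matrix \<open>r\<close> is \<open>c - f\<close> for a skew-symmetric preflow
  \<open>f\<close>. Natural numbers suffice: the two directions of a pair sum to
  \<open>2 * c v w\<close>, and the excess is the difference of the row sums of \<open>r\<close> and
  \<open>c\<close>.\<close>

lemma pr_invD:
  assumes "pr_inv r ex d cur B b"
  shows "v < n \<Longrightarrow> w < n \<Longrightarrow> r v w + r w v = 2 * c v w"
    and "v < n \<Longrightarrow> v \<noteq> s \<Longrightarrow> ex v + (\<Sum>w<n. c v w) = (\<Sum>w<n. r v w)"
    and "w < n \<Longrightarrow> r s w = 0"
    and "d s = n" and "d t = 0"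
    and "v < n \<Longrightarrow> v \<noteq> s \<Longrightarrow> v \<noteq> t \<Longrightarrow> 1 \<le> d v \<and> d v \<le> n"
    and "v < n \<Longrightarrow> w < n \<Longrightarrow> 0 < r v w \<Longrightarrow> d v \<le> d w + 1"
    and "v < n \<Longrightarrow> v \<noteq> s \<Longrightarrow> v \<noteq> t \<Longrightarrow> cur v \<le> length (adj v)"
    and "v < n \<Longrightarrow> v \<noteq> s \<Longrightarrow> v \<noteq> t \<Longrightarrow> i < cur v \<Longrightarrow> r v (adj v ! i) = 0 \<or> d v \<le> d (adj v ! i)"
    and "l < n \<Longrightarrow> distinct (B l)" and "l < n \<Longrightarrow> set (B l) = active ex d l"
    and "b < n" and "b < l \<Longrightarrow> l < n \<Longrightarrow> B l = []"
  using assms unfolding pr_inv_def by simp_all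

lemma in_adj: "w \<in> set (adj v) \<longleftrightarrow> w < n \<and> 0 < c v w"
  by (auto simp: adj_def)

lemma distinct_adj: "distinct (adj v)"
  by (simp add: adj_def)

lemma adj_nth: "i < length (adj v) \<Longrightarrow> adj v ! i < n \<and> 0 < c v (adj v ! i)"
  using nth_mem in_adj by blast

text \<open>Isolated vertices are left out so that the count is bounded by the number of arcs as
  well as by \<open>n\<close>; \<open>init_potential\<close> uses both bounds.\<close>

definition linked_verts :: "nat set" where
  "linked_verts = {v. v < n \<and> adj v \<noteq> []}"

text \<open>All vertices with arcs are counted, active or not. Raising the label of some vertex can
  therefore only lower the rank of a fixed level, and a relabelling increases \<open>height\<close>
  only through the relabelled vertex.\<close>

definition rank :: "(nat \<Rightarrow> nat) \<Rightarrow> nat \<Rightarrow> nat" where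
  "rank d l = card {w \<in> linked_verts. d w \<le> l}"

definition inner :: "nat set" where
  "inner = {..<n} - {s, t}"

definition relabels :: "(nat \<Rightarrow> nat) \<Rightarrow> nat" where
  "relabels d = (\<Sum>v\<in>inner. n - d v)"

text \<open>Arcs still to be passed over: a full adjacency list for each of the at most
  \<open>n - d v\<close> further labels, and the rest of the current list.\<close>

definition scans :: "(nat \<Rightarrow> nat) \<Rightarrow> (nat \<Rightarrow> nat) \<Rightarrow> nat" where
  "scans d cur = (\<Sum>v\<in>inner. (n - d v) * length (adj v) + (length (adj v) - cur v))"

definition height :: "(nat \<Rightarrow> nat) \<Rightarrow> (nat \<Rightarrow> nat) \<Rightarrow> nat" where
  "height ex d = (\<Sum>v | v \<in> inner \<and> 0 < ex v \<and> d v < n. rank d (d v))"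

text \<open>The amortisation of Cheriyan and Mehlhorn, scaled by \<open>K\<close>: a push that empties \<open>v\<close> lowers
  \<open>height\<close> by the number of vertices on the highest active level. If that number is below \<open>K\<close>, the
  push is paid for by the term \<open>min K \<dots>\<close> instead, which is refilled whenever \<open>b\<close> changes.\<close>

definition potential ::
  "nat \<Rightarrow> (nat \<Rightarrow> nat) \<Rightarrow> (nat \<Rightarrow> nat) \<Rightarrow> (nat \<Rightarrow> nat) \<Rightarrow> (nat \<Rightarrow> nat list) \<Rightarrow> nat \<Rightarrow> nat" where
  "potential K ex d cur B b =
     (K * K + 3 * K + card linked_verts) * relabels d + (card linked_verts + K) * scans d cur
     + height ex d + K * min K (length (B b)) + (K * K + K) * b"

section \<open>Invariant and potential under each kind of step\<close>

lemma finite_linked_verts [simp]: "finite linked_verts" by (simp add: linked_verts_def)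
lemma finite_inner [simp]: "finite inner" by (simp add: inner_def)

lemma rank_le: "rank d l \<le> card linked_verts"
  unfolding rank_def by (intro card_mono) auto

lemma rank_antimono: "(\<And>w. d w \<le> d' w) \<Longrightarrow> rank d' l \<le> rank d l"
  unfolding rank_def by (intro card_mono) (auto intro: order_trans)

text \<open>The stack term may rise from 0 to \<open>K * K\<close> when \<open>b\<close> drops. The
  coefficient \<open>K * K + K\<close> of \<open>b\<close> pays for this and for the step
  itself.\<close>

lemma lower_step:
  assumes inv: "pr_inv r ex d cur B b" and b: "1 \<le> b" "B b = []"
  shows "pr_inv r ex d cur B (b - 1)"
    and "potential K ex d cur B (b - 1) + K \<le> potential K ex d cur B b"
proof -
  have "B l = []" if "b - 1 < l" "l < n" for l
    using inv b that unfolding pr_inv_def by (cases "l = b") auto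
  then show "pr_inv r ex d cur B (b - 1)"
    using inv b unfolding pr_inv_def by auto
  obtain b' where b': "b = Suc b'" using b by (cases b) auto
  have "K * min K (length (B b')) \<le> K * K" by simp
  then show "potential K ex d cur B (b - 1) + K \<le> potential K ex d cur B b"
    using b by (simp add: potential_def b' algebra_simps)
qed

lemma top_vertex:
  assumes inv: "pr_inv r ex d cur B b" and b: "1 \<le> b" "B b \<noteq> []" and v: "v = last (B b)"
  shows "v < n" "v \<noteq> s" "v \<noteq> t" "0 < ex v" "d v = b" "b < n" "v \<in> linked_verts" "v \<in> inner"
proof -
  show bn: "b < n" using inv by (simp add: pr_inv_def)
  have "v \<in> set (B b)" using b v by simp
  then have "v \<in> active ex d b" using inv bn by (simp add: pr_inv_def)
  then show *: "v < n" "v \<noteq> s" "v \<noteq> t" "0 < ex v" "d v = b" by (auto simp: active_def)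
  then show "v \<in> inner" by (simp add: inner_def)
  have "ex v + (\<Sum>w<n. c v w) = (\<Sum>w<n. r v w)" using inv * by (simp add: pr_inv_def)
  then have "(\<Sum>w<n. r v w) \<noteq> 0" using *(4) by linarith
  then obtain w where w: "w < n" "r v w \<noteq> 0" using sum.neutral[of "{..<n}" "r v"] by auto
  moreover have "r v w + r w v = 2 * c v w" using pr_invD(1)[OF inv *(1) w(1)] .
  ultimately have "w \<in> set (adj v)" by (simp add: in_adj)
  then show "v \<in> linked_verts" using * by (auto simp: linked_verts_def)
qed

lemma sum_upd: 
  fixes f :: "nat \<Rightarrow> nat"
  assumes "finite X" "v \<in> X" "\<And>x. x \<in> X \<Longrightarrow> x \<noteq> v \<Longrightarrow> g x = f x"
  shows "sum f X + g v = sum g X + f v"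
proof -
  have "sum f (X - {v}) = sum g (X - {v})" using assms(3) by (intro sum.cong) auto
  then show ?thesis using assms(1,2) by (simp add: sum.remove[of X v])
qed

text \<open>All arcs of \<open>v\<close> have been passed, so residual arcs lead to labels at least
  \<open>b\<close> and the label \<open>b + 1\<close> is valid. The coefficient of
  \<open>relabels\<close> is the bill: \<open>K * K + K\<close> for raising \<open>b\<close>,
  \<open>K\<close> for the new top stack that holds only \<open>v\<close>, \<open>K\<close> for the
  step, and \<open>card linked_verts\<close> for the rank of \<open>v\<close>. The restart of the
  list is covered inside \<open>scans\<close>, as one label fewer remains. At label \<open>n\<close>
  the vertex is stacked nowhere.\<close>

lemma relabel_step:
  assumes inv: "pr_inv r ex d cur B b" and b: "1 \<le> b" "B b \<noteq> []" and v: "v = last (B b)"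
    and cur: "\<not> cur v < length (adj v)" and K: "1 \<le> K"
  defines "d' \<equiv> d(v := b + 1)" and "cur' \<equiv> cur(v := 0)" and "B1 \<equiv> B(b := butlast (B b))"
  shows "b + 1 < n \<Longrightarrow> pr_inv r ex d' cur' (B1(b + 1 := B1 (b + 1) @ [v])) (b + 1)"
    and "b + 1 < n \<Longrightarrow> potential K ex d' cur' (B1(b + 1 := B1 (b + 1) @ [v])) (b + 1) + K \<le> potential K ex d cur B b"
    and "\<not> b + 1 < n \<Longrightarrow> pr_inv r ex d' cur' B1 b"
    and "\<not> b + 1 < n \<Longrightarrow> potential K ex d' cur' B1 b + K \<le> potential K ex d cur B b"
proof -
  note I = pr_invD[OF inv]
  note V = top_vertex[OF inv b v]
  have cv: "cur v = length (adj v)" using I(8)[of v] V cur by simp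
  have dle: "d x \<le> d' x" for x using V by (simp add: d'_def)
  have res: "b \<le> d w" if "w < n" "0 < r v w" for w
  proof -
    have "r v w + r w v = 2 * c v w" using I(1)[of v w] V that by simp
    then have "w \<in> set (adj v)" using that by (simp add: in_adj)
    then obtain i where i: "i < length (adj v)" "adj v ! i = w" by (auto simp: in_set_conv_nth)
    show ?thesis using I(9)[of v i] i cv that V by auto
  qed
  have valid: "d' x \<le> d' w + 1" if "x < n" "w < n" "0 < r x w" for x w
  proof (cases "x = v")
    case True then show ?thesis using res[of w] that dle[of w] by (simp add: d'_def)
  next
    case False
    then have "d x \<le> d w + 1" using I(7) that by blast
    then show ?thesis using False dle[of w] by (simp add: d'_def)
  qed
  have curr: "cur' x \<le> length (adj x) \<and> (\<forall>i<cur' x. r x (adj x ! i) = 0 \<or> d' x \<le> d' (adj x ! i))"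
    if "x < n" "x \<noteq> s" "x \<noteq> t" for x
  proof (cases "x = v")
    case True then show ?thesis by (simp add: cur'_def)
  next
    case False
    have "r x (adj x ! i) = 0 \<or> d x \<le> d' (adj x ! i)" if "i < cur x" for i
      using I(9)[OF \<open>x < n\<close> \<open>x \<noteq> s\<close> \<open>x \<noteq> t\<close> that] le_trans[OF _ dle] by blast
    then show ?thesis using False I(8)[OF that] by (simp add: cur'_def d'_def)
  qed
  have lab: "1 \<le> d' x \<and> d' x \<le> n" if "x < n" "x \<noteq> s" "x \<noteq> t" for x
    using I(6)[of x] that V by (auto simp: d'_def)
  have dst: "d' s = n" "d' t = 0" using I(4,5) V by (auto simp: d'_def)
  have Bb: "B b = butlast (B b) @ [v]" using b v by simp
  have db: "distinct (B b)" "set (B b) = active ex d b" using I(10,11) V by blast+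
  have vb: "v \<notin> set (butlast (B b))" using db(1) by (subst (asm) Bb) simp
  have bl: "distinct (butlast (B b))" "set (butlast (B b)) = active ex d' b"
  proof -
    show "distinct (butlast (B b))" using db(1) distinct_butlast by blast
    have "set (B b) = insert v (set (butlast (B b)))" by (subst Bb) simp
    then have "set (butlast (B b)) = active ex d b - {v}" using vb db(2) by auto
    also have "\<dots> = active ex d' b" using V by (auto simp: active_def d'_def)
    finally show "set (butlast (B b)) = active ex d' b" .
  qed
  have B1: "distinct (B1 l) \<and> set (B1 l) = active ex d' l" if "l < n" "l \<noteq> b + 1" for l
  proof (cases "l = b")
    case True then show ?thesis using bl by (simp add: B1_def)
  next
    case False
    have "active ex d' l = active ex d l" using False that V by (auto simp: active_def d'_def)
    then show ?thesis using I(10,11)[of l] that False by (simp add: B1_def)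
  qed
  have above: "B1 l = []" if "b < l" "l < n" for l using I(13)[of l] that by (simp add: B1_def)
  have nv: "set (B1 (b + 1)) = active ex d' (b + 1) - {v} \<and> v \<in> active ex d' (b + 1)" if "b + 1 < n"
  proof -
    have "B (b + 1) = []" using I(13)[of "b + 1"] that by simp
    then have "active ex d (b + 1) = {}" using I(11)[of "b + 1"] that by simp
    then show ?thesis using above[of "b + 1"] that V by (auto simp: active_def d'_def)
  qed
  show "pr_inv r ex d' cur' (B1(b + 1 := B1 (b + 1) @ [v])) (b + 1)" if bn: "b + 1 < n"
    unfolding pr_inv_def
  proof (intro conjI)
    show "\<forall>l<n. distinct ((B1(b + 1 := B1 (b + 1) @ [v])) l) \<and> set ((B1(b + 1 := B1 (b + 1) @ [v])) l) = active ex d' l"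
      using B1 nv[OF bn] above[of "b + 1"] bn by auto
    show "\<forall>l. b + 1 < l \<longrightarrow> l < n \<longrightarrow> (B1(b + 1 := B1 (b + 1) @ [v])) l = []" using above by auto
  qed (use I(1-3) valid curr lab dst bn in auto)
  show "pr_inv r ex d' cur' B1 b" if bn: "\<not> b + 1 < n"
    unfolding pr_inv_def
  proof (intro conjI)
    show "\<forall>l<n. distinct (B1 l) \<and> set (B1 l) = active ex d' l" using B1 bn by auto
    show "\<forall>l. b < l \<longrightarrow> l < n \<longrightarrow> B1 l = []" using above by auto
  qed (use I(1-3,12) valid curr lab dst in auto)
  have R: "relabels d = relabels d' + 1"
  proof -
    have "relabels d + (n - d' v) = relabels d' + (n - d v)"
      unfolding relabels_def by (rule sum_upd) (use V in \<open>auto simp: d'_def\<close>)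
    then show ?thesis using V by (simp add: d'_def)
  qed
  have S: "scans d' cur' = scans d cur"
  proof -
    have "scans d cur + ((n - d' v) * length (adj v) + (length (adj v) - cur' v))
        = scans d' cur' + ((n - d v) * length (adj v) + (length (adj v) - cur v))"
      unfolding scans_def by (rule sum_upd) (use V in \<open>auto simp: d'_def cur'_def\<close>)
    moreover have "(n - d v) * length (adj v) = (n - d' v) * length (adj v) + length (adj v)"
    proof -
      have "n - d v = Suc (n - d' v)" using V by (simp add: d'_def)
      then show ?thesis by simp
    qed
    ultimately show ?thesis using cv by (simp add: cur'_def)
  qed
  let ?A = "{x. x \<in> inner \<and> 0 < ex x \<and> d x < n}"
  have H: "height ex d' \<le> height ex d + card linked_verts"
  proof -
    have "height ex d' \<le> (\<Sum>x\<in>?A. rank d' (d' x))"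
      unfolding height_def using dle by (intro sum_mono2) (auto intro: le_less_trans)
    also have "\<dots> = rank d' (d' v) + (\<Sum>x\<in>?A - {v}. rank d' (d' x))"
      using V by (intro sum.remove) auto
    also have "\<dots> \<le> card linked_verts + (\<Sum>x\<in>?A - {v}. rank d (d x))"
    proof (rule add_mono[OF rank_le sum_mono])
      fix x assume "x \<in> ?A - {v}"
      then show "rank d' (d' x) \<le> rank d (d x)" using rank_antimono[of d d', OF dle] by (simp add: d'_def)
    qed
    also have "\<dots> \<le> card linked_verts + height ex d"
      unfolding height_def by (intro add_left_mono sum_mono2) auto
    finally show ?thesis by simp
  qed
  show "potential K ex d' cur' (B1(b + 1 := B1 (b + 1) @ [v])) (b + 1) + K \<le> potential K ex d cur B b" if bn: "b + 1 < n"
  proof -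
    have "B1 (Suc b) = []" using above[of "Suc b"] bn by simp
    moreover have "min K (Suc 0) = Suc 0" using K by simp
    ultimately show ?thesis using H unfolding potential_def S R by (simp add: algebra_simps)
  qed
  show "potential K ex d' cur' B1 b + K \<le> potential K ex d cur B b" if bn: "\<not> b + 1 < n"
  proof -
    have "length (B1 b) \<le> length (B b)" by (simp add: B1_def)
    then have "K * min K (length (B1 b)) \<le> K * min K (length (B b))" by (intro mult_le_mono2) auto
    then show ?thesis using H unfolding potential_def S R distrib_left mult_1_right by linarith
  qed
qed

text \<open>A residual arc that is not admissible leads to a label at least \<open>d v\<close>; this
  is what the current-arc invariant records when the arc is passed. The step is paid for by
  \<open>scans\<close>.\<close>

lemma advance_step:
  assumes inv: "pr_inv r ex d cur B b" and b: "1 \<le> b" "B b \<noteq> []" and v: "v = last (B b)"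
    and cur: "cur v < length (adj v)" and w: "w = adj v ! cur v"
    and na: "\<not> (0 < r v w \<and> d v = d w + 1)"
  shows "pr_inv r ex d (cur(v := cur v + 1)) B b"
    and "potential K ex d (cur(v := cur v + 1)) B b + K \<le> potential K ex d cur B b"
proof -
  note I = pr_invD[OF inv]
  note V = top_vertex[OF inv b v]
  have wn: "w < n" using adj_nth[OF cur] w by simp
  have "r v w = 0 \<or> d v \<le> d w" 
  proof (cases "r v w = 0")
    case False
    then have "d v \<le> d w + 1" using I(7)[of v w] V wn by simp
    then show ?thesis using na False by auto
  qed simp
  then have "\<forall>i<cur v + 1. r v (adj v ! i) = 0 \<or> d v \<le> d (adj v ! i)"
    using I(9)[of v] V w by (auto simp: less_Suc_eq)
  then show "pr_inv r ex d (cur(v := cur v + 1)) B b"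
    using inv cur unfolding pr_inv_def by auto
  have "scans d cur + ((n - d v) * length (adj v) + (length (adj v) - (cur(v := cur v + 1)) v))
      = scans d (cur(v := cur v + 1)) + ((n - d v) * length (adj v) + (length (adj v) - cur v))"
    unfolding scans_def by (rule sum_upd) (use V in auto)
  then have "scans d cur = scans d (cur(v := cur v + 1)) + 1" using cur by simp
  then show "potential K ex d (cur(v := cur v + 1)) B b + K \<le> potential K ex d cur B b"
    by (simp add: potential_def algebra_simps)
qed

text \<open>An emptying push takes the rank of level \<open>b\<close> out of \<open>height\<close>
  and adds at most that of level \<open>b - 1\<close>. The difference is the number of vertices with
  arcs on level \<open>b\<close>, which is at least the length of \<open>B b\<close>. If it is below
  \<open>K\<close>, then so is the stack, and losing \<open>v\<close> lowers the \<open>min\<close>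
  term by a full \<open>K\<close>. Any other push saturates the arc, advances \<open>cur\<close> and
  is paid for by \<open>scans\<close>, including the rank of a newly active
  \<open>w\<close>.\<close>

lemma push_step:
  assumes inv: "pr_inv r ex d cur B b" and b: "1 \<le> b" "B b \<noteq> []" and v: "v = last (B b)"
    and cur: "cur v < length (adj v)" and w: "w = adj v ! cur v"
    and ad: "0 < r v w" "d v = d w + 1"
  defines "\<delta> \<equiv> min (ex v) (r v w)"
  defines "r' \<equiv> r(v := (r v)(w := r v w - \<delta>), w := (r w)(v := r w v + \<delta>))"
    and "ex' \<equiv> ex(v := ex v - \<delta>, w := ex w + \<delta>)"
    and "B1 \<equiv> (if w \<noteq> t \<and> ex w = 0 then B(d w := B (d w) @ [w]) else B)"
  shows "w < n" "w \<noteq> v" "w \<noteq> s" "d w < n"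
    and "ex v \<le> r v w \<Longrightarrow> pr_inv r' ex' d cur (B1(b := butlast (B1 b))) b"
    and "ex v \<le> r v w \<Longrightarrow> potential K ex' d cur (B1(b := butlast (B1 b))) b + K \<le> potential K ex d cur B b"
    and "\<not> ex v \<le> r v w \<Longrightarrow> pr_inv r' ex' d (cur(v := cur v + 1)) B1 b"
    and "\<not> ex v \<le> r v w \<Longrightarrow> potential K ex' d (cur(v := cur v + 1)) B1 b + K \<le> potential K ex d cur B b"
proof -
  note I = pr_invD[OF inv]
  note V = top_vertex[OF inv b v]
  show wn: "w < n" using adj_nth[OF cur] w by simp
  show wv: "w \<noteq> v" using ad by auto
  have dw: "Suc (d w) = b" using V ad by simp
  show ws: "w \<noteq> s" using dw V I(4) by auto
  show dwn: "d w < n" using dw V by simp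
  have \<delta>: "0 < \<delta>" "\<delta> \<le> ex v" "\<delta> \<le> r v w" using V ad by (auto simp: \<delta>_def)
  have r': "r' x y = (if x = v \<and> y = w then r v w - \<delta> else if x = w \<and> y = v then r w v + \<delta> else r x y)" for x y
    using wv by (auto simp: r'_def)
  have ex': "ex' x = (if x = v then ex v - \<delta> else if x = w then ex w + \<delta> else ex x)" for x
    using wv by (auto simp: ex'_def)
  have pair: "r' x y + r' y x = 2 * c x y" if "x < n" "y < n" for x y
    using I(1)[OF that] \<delta> wv by (auto simp: r')
  have exc: "ex' x + (\<Sum>y<n. c x y) = (\<Sum>y<n. r' x y)" if x: "x < n" "x \<noteq> s" for x
  proof -
    have "sum (r x) {..<n} + r' x w = sum (r' x) {..<n} + r x w" if "x = v"
      using that wn wv by (intro sum_upd) (auto simp: r')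
    moreover have "sum (r x) {..<n} + r' x v = sum (r' x) {..<n} + r x v" if "x = w"
      using that V(1) wv by (intro sum_upd) (auto simp: r')
    moreover have "sum (r x) {..<n} = sum (r' x) {..<n}" if "x \<noteq> v" "x \<noteq> w"
      using that by (intro sum.cong) (auto simp: r')
    ultimately show ?thesis using I(2)[OF x] \<delta> wv by (auto simp: ex' r' split: if_splits)
  qed
  have src: "r' s x = 0" if "x < n" for x using I(3)[OF that] V(2) ws by (simp add: r')
  have valid: "d x \<le> d y + 1" if "x < n" "y < n" "0 < r' x y" for x y
    using I(7)[OF that(1,2)] that(3) ad wv by (auto simp: r' split: if_splits)
  \<comment> \<open>The push creates residual capacity only on the reverse arc from \<open>w\<close>
    to \<open>v\<close>, and there \<open>d w < d v\<close>, so arcs already passed at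
    \<open>w\<close> stay inadmissible.\<close>
  have arc: "r' x (adj x ! i) = 0 \<or> d x \<le> d (adj x ! i)" if x: "x < n" "x \<noteq> s" "x \<noteq> t" "i < cur x" for x i
  proof -
    have "x = v \<Longrightarrow> adj x ! i \<noteq> w"
      using w cur x(4) distinct_adj[of v] by (auto simp: nth_eq_iff_index_eq)
    then show ?thesis using I(9)[OF x] ad wv by (auto simp: r')
  qed
  have act: "active ex' d l = (if l = b then active ex d b - (if ex v \<le> r v w then {v} else {})
      else if l = d w \<and> w \<noteq> t then insert w (active ex d l) else active ex d l)" for l
    using V wn ws wv \<delta> dw unfolding active_def ex' by (auto simp: \<delta>_def)
  have B1b: "B1 b = B b" using dw by (auto simp: B1_def)
  have B1: "distinct (B1 l) \<and> set (B1 l) = active ex' d l" if l: "l < n" "l \<noteq> b" for l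
  proof -
    have "w \<in> active ex d (d w)" if "w \<noteq> t" "0 < ex w" using that wn ws by (simp add: active_def)
    moreover have "w \<notin> active ex d (d w)" if "ex w = 0" using that by (simp add: active_def)
    ultimately show ?thesis using I(10,11)[OF l(1)] l(2) act[of l] by (auto simp: B1_def)
  qed
  have Bb: "B b = butlast (B b) @ [v]" using b v by simp
  have db: "distinct (B b)" "set (B b) = active ex d b" using I(10,11) V by blast+
  have vb: "v \<notin> set (butlast (B b))" using db(1) by (subst (asm) Bb) simp
  have sb: "set (butlast (B b)) = active ex d b - {v}"
  proof -
    have "set (B b) = insert v (set (butlast (B b)))" by (subst Bb) simp
    then show ?thesis using vb db(2) by auto
  qed
  have above: "B1 l = []" if "b < l" "l < n" for l using I(13)[OF that] that dw by (auto simp: B1_def)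
  let ?A = "{x. x \<in> inner \<and> 0 < ex x \<and> d x < n}"
  let ?A' = "{x. x \<in> inner \<and> 0 < ex' x \<and> d x < n}"
  show "pr_inv r' ex' d cur (B1(b := butlast (B1 b))) b" if em: "ex v \<le> r v w"
    unfolding pr_inv_def
  proof (intro conjI)
    show "\<forall>l<n. distinct ((B1(b := butlast (B1 b))) l) \<and> set ((B1(b := butlast (B1 b))) l) = active ex' d l"
    proof (intro allI impI)
      fix l assume "l < n"
      moreover have "active ex' d b = active ex d b - {v}" using act[of b] em by simp
      ultimately show "distinct ((B1(b := butlast (B1 b))) l) \<and> set ((B1(b := butlast (B1 b))) l) = active ex' d l"
        using B1[of l] B1b sb distinct_butlast[OF db(1)] by (cases "l = b") simp_all
    qed
    show "\<forall>l. b < l \<longrightarrow> l < n \<longrightarrow> (B1(b := butlast (B1 b))) l = []" using above by auto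
  qed (use I(4-6,8,12) pair exc src valid arc in auto)
  show "pr_inv r' ex' d (cur(v := cur v + 1)) B1 b" if em: "\<not> ex v \<le> r v w"
    unfolding pr_inv_def
  proof (intro conjI)
    show "\<forall>l<n. distinct (B1 l) \<and> set (B1 l) = active ex' d l"
    proof (intro allI impI)
      fix l assume "l < n"
      moreover have "active ex' d b = active ex d b" using act[of b] em by simp
      ultimately show "distinct (B1 l) \<and> set (B1 l) = active ex' d l"
        using B1[of l] B1b db by (cases "l = b") simp_all
    qed
    show "\<forall>l. b < l \<longrightarrow> l < n \<longrightarrow> B1 l = []" using above by auto
    have "r' v w = 0" using em by (simp add: r' \<delta>_def)
    then show "\<forall>x<n. x \<noteq> s \<longrightarrow> x \<noteq> t \<longrightarrow> (cur(v := cur v + 1)) x \<le> length (adj x) \<and>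
        (\<forall>i<(cur(v := cur v + 1)) x. r' x (adj x ! i) = 0 \<or> d x \<le> d (adj x ! i))"
      using I(8) arc cur w V by (auto simp: less_Suc_eq)
  qed (use I(4-6,12) pair exc src valid in auto)
  have rb: "rank d b = rank d (d w) + card {x \<in> linked_verts. d x = b}"
  proof -
    have "{x \<in> linked_verts. d x \<le> b} = {x \<in> linked_verts. d x \<le> d w} \<union> {x \<in> linked_verts. d x = b}"
      using dw by auto
    moreover have "{x \<in> linked_verts. d x \<le> d w} \<inter> {x \<in> linked_verts. d x = b} = {}" using dw by auto
    ultimately show ?thesis by (simp add: rank_def card_Un_disjoint)
  qed
  have fA: "finite ?A" "finite ?A'" by simp_all
  have "x \<in> linked_verts" if x: "x \<in> active ex d b" for x
  proof (rule ccontr)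
    assume "x \<notin> linked_verts"
    then have "adj x = []" using x by (simp add: active_def linked_verts_def)
    then have "r x y = 0" if "y < n" for y
      using I(1)[of x y] in_adj[of y x] x that by (auto simp: active_def)
    then have "(\<Sum>y<n. r x y) = 0" by simp
    then show False using I(2)[of x] x by (simp add: active_def)
  qed
  then have lenB: "length (B b) \<le> card {x \<in> linked_verts. d x = b}"
    using db by (auto simp: distinct_card[symmetric] active_def intro!: card_mono)
  show "potential K ex' d cur (B1(b := butlast (B1 b))) b + K \<le> potential K ex d cur B b" if em: "ex v \<le> r v w"
  proof -
    let ?L = "card {x \<in> linked_verts. d x = b}"
    have "?A' \<subseteq> insert w (?A - {v})" using em by (auto simp: ex' \<delta>_def split: if_splits)
    then have "height ex' d \<le> (\<Sum>x\<in>insert w (?A - {v}). rank d (d x))"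
      unfolding height_def by (intro sum_mono2) auto
    also have "\<dots> \<le> rank d (d w) + (\<Sum>x\<in>?A - {v}. rank d (d x))"
      by (simp add: sum.insert_if fA)
    finally have "height ex' d + ?L \<le> rank d (d v) + (\<Sum>x\<in>?A - {v}. rank d (d x))"
      using rb V(5) by simp
    also have "\<dots> = height ex d"
      unfolding height_def using V by (intro sum.remove[symmetric]) auto
    finally have H: "height ex' d + ?L \<le> height ex d" .
    have len: "length (B b) = Suc (length (butlast (B b)))" using b by simp
    have "height ex' d + K * min K (length (butlast (B b))) + K \<le> height ex d + K * min K (length (B b))"
    proof (cases "K \<le> ?L")
      case True
      have "K * min K (length (butlast (B b))) \<le> K * min K (length (B b))"
        by (intro mult_le_mono2) auto
      then show ?thesis using H True by linarith
    next
      case False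
      then have l1: "length (B b) \<le> K" using lenB by linarith
      then have l2: "length (butlast (B b)) \<le> K" by simp
      have "K * length (B b) = K + K * length (butlast (B b))" by (subst len) simp
      then show ?thesis using H unfolding min_absorb2[OF l1] min_absorb2[OF l2] by linarith
    qed
    then show ?thesis by (simp add: potential_def B1b)
  qed
  show "potential K ex' d (cur(v := cur v + 1)) B1 b + K \<le> potential K ex d cur B b" if em: "\<not> ex v \<le> r v w"
  proof -
    have "?A' \<subseteq> insert w ?A" by (auto simp: ex' split: if_splits)
    then have "height ex' d \<le> (\<Sum>x\<in>insert w ?A. rank d (d x))"
      unfolding height_def by (intro sum_mono2) auto
    also have "\<dots> \<le> rank d (d w) + height ex d"
      unfolding height_def by (simp add: sum.insert_if fA)
    also have "\<dots> \<le> card linked_verts + height ex d" using rank_le by simp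
    finally have H: "height ex' d \<le> card linked_verts + height ex d" .
    have "scans d cur + ((n - d v) * length (adj v) + (length (adj v) - (cur(v := cur v + 1)) v))
      = scans d (cur(v := cur v + 1)) + ((n - d v) * length (adj v) + (length (adj v) - cur v))"
      unfolding scans_def by (rule sum_upd) (use V in auto)
    then have "scans d cur = scans d (cur(v := cur v + 1)) + 1" using cur by simp
    then show ?thesis using H by (simp add: potential_def B1b algebra_simps)
  qed
qed

section \<open>From final labels to a minimum cut\<close>

lemma sum_symmetric_pairs:
  fixes g :: "nat \<Rightarrow> nat \<Rightarrow> nat"
  assumes "\<And>x y. x \<in> D \<Longrightarrow> y \<in> D \<Longrightarrow> g x y + g y x = 2 * c x y"
  shows "(\<Sum>x\<in>D. \<Sum>y\<in>D. g x y) = (\<Sum>x\<in>D. \<Sum>y\<in>D. c x y)"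
proof -
  have "2 * (\<Sum>x\<in>D. \<Sum>y\<in>D. g x y) = (\<Sum>x\<in>D. \<Sum>y\<in>D. g x y) + (\<Sum>y\<in>D. \<Sum>x\<in>D. g x y)"
    using sum.swap[of g D D] by simp
  also have "\<dots> = (\<Sum>x\<in>D. \<Sum>y\<in>D. g x y + g y x)" by (simp add: sum.distrib)
  also have "\<dots> = (\<Sum>x\<in>D. \<Sum>y\<in>D. 2 * c x y)" using assms by (intro sum.cong refl) simp
  also have "\<dots> = 2 * (\<Sum>x\<in>D. \<Sum>y\<in>D. c x y)" by (simp add: sum_distrib_left)
  finally show ?thesis by simp
qed

text \<open>Add up the excess equations on the side without \<open>s\<close>. Within that side
  \<open>r\<close> and \<open>c\<close> have equal totals because opposite entries of
  \<open>r\<close> sum to \<open>2 * c v w\<close>, so only pairs across the cut remain.\<close>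

lemma excess_across_cut:
  assumes inv: "pr_inv r ex d cur B b" and S: "s \<in> S"
  defines "D \<equiv> {..<n} - S"
  shows "(\<Sum>v\<in>D. ex v) + cut_value S = (\<Sum>v\<in>D. \<Sum>w\<in>{..<n} \<inter> S. r v w)"
proof -
  note I = pr_invD[OF inv]
  have split: "(\<Sum>w<n. g w) = (\<Sum>w\<in>D. g w) + (\<Sum>w\<in>{..<n} \<inter> S. g w)" for g :: "nat \<Rightarrow> nat"
    using sum.Int_Diff[of "{..<n}" g S] by (simp add: D_def)
  have "(\<Sum>v\<in>D. ex v) + (\<Sum>v\<in>D. \<Sum>w<n. c v w) = (\<Sum>v\<in>D. ex v + (\<Sum>w<n. c v w))" by (simp add: sum.distrib)
  also have "\<dots> = (\<Sum>v\<in>D. \<Sum>w<n. r v w)" using I(2) S by (intro sum.cong) (auto simp: D_def)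
  finally have "(\<Sum>v\<in>D. ex v) + ((\<Sum>v\<in>D. \<Sum>w\<in>D. c v w) + (\<Sum>v\<in>D. \<Sum>w\<in>{..<n} \<inter> S. c v w))
    = (\<Sum>v\<in>D. \<Sum>w\<in>D. r v w) + (\<Sum>v\<in>D. \<Sum>w\<in>{..<n} \<inter> S. r v w)"
    by (simp add: split sum.distrib)
  moreover have "(\<Sum>v\<in>D. \<Sum>w\<in>D. r v w) = (\<Sum>v\<in>D. \<Sum>w\<in>D. c v w)"
    using I(1) by (intro sum_symmetric_pairs) (auto simp: D_def)
  moreover have "(\<Sum>v\<in>D. \<Sum>w\<in>{..<n} \<inter> S. c v w) = cut_value S"
  proof -
    have "(\<Sum>v\<in>D. \<Sum>w\<in>{..<n} \<inter> S. c v w) = (\<Sum>w\<in>{..<n} \<inter> S. \<Sum>v\<in>D. c v w)" by (rule sum.swap)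
    also have "\<dots> = cut_value S" unfolding cut_value_def D_def using csym by (intro sum.cong refl) auto
    finally show ?thesis .
  qed
  ultimately show ?thesis by simp
qed

text \<open>Weak duality: a residual capacity is at most twice the capacity, so by the identity
  above the total excess beyond the cut is at most the cut.\<close>

lemma excess_le_cut:
  assumes inv: "pr_inv r ex d cur B b" and S: "s \<in> S" "t \<notin> S"
  shows "ex t \<le> cut_value S"
proof -
  note I = pr_invD[OF inv]
  let ?D = "{..<n} - S"
  have "(\<Sum>v\<in>?D. \<Sum>w\<in>{..<n} \<inter> S. r v w) \<le> (\<Sum>v\<in>?D. \<Sum>w\<in>{..<n} \<inter> S. 2 * c w v)"
  proof (intro sum_mono)
    fix v w assume "v \<in> ?D" "w \<in> {..<n} \<inter> S"
    then show "r v w \<le> 2 * c w v" using I(1)[of w v] by auto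
  qed
  also have "\<dots> = 2 * (\<Sum>v\<in>?D. \<Sum>w\<in>{..<n} \<inter> S. c w v)" by (simp add: sum_distrib_left)
  also have "(\<Sum>v\<in>?D. \<Sum>w\<in>{..<n} \<inter> S. c w v) = cut_value S" unfolding cut_value_def by (rule sum.swap)
  finally have "(\<Sum>v\<in>?D. ex v) \<le> cut_value S" using excess_across_cut[OF inv S(1)] by simp
  moreover have "ex t \<le> (\<Sum>v\<in>?D. ex v)" using t S by (intro member_le_sum) auto
  ultimately show ?thesis by simp
qed

text \<open>Pigeonhole: there are \<open>n - 1\<close> labels from 1 to \<open>n - 1\<close>, but
  only \<open>n - 2\<close> vertices besides the terminals, whose labels are \<open>n\<close> and
  0.\<close>

lemma gap_exists:
  assumes inv: "pr_inv r ex d cur B b"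
  shows "\<exists>k. 1 \<le> k \<and> k < n \<and> (\<forall>v<n. d v \<noteq> k)"
proof (rule ccontr)
  note I = pr_invD[OF inv]
  assume no: "\<not> ?thesis"
  have "{1..<n} \<subseteq> d ` inner"
  proof
    fix k assume k: "k \<in> {1..<n}"
    then obtain v where v: "v < n" "d v = k" using no by auto
    then have "v \<noteq> s" "v \<noteq> t" using I(4,5) k by auto
    then show "k \<in> d ` inner" using v by (auto simp: inner_def)
  qed
  then have "card {1..<n} \<le> card (d ` inner)" by (intro card_mono) auto
  also have "\<dots> \<le> card inner" by (rule card_image_le) simp
  also have "\<dots> = n - 2" using s t st by (simp add: inner_def card_Diff_subset)
  finally show False using s t st by simp
qed

text \<open>Residual arcs descend by at most one label, so none crosses the gap downwards and the
  cut is saturated. Since \<open>b = 0\<close>, the only excess below the gap sits at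
  \<open>t\<close>. The excess of abandoned vertices lies above the gap and need not be returned to
  the source.\<close>

lemma gap_min_cut:
  assumes inv: "pr_inv r ex d cur B 0" and k: "1 \<le> k" "k < n" "\<And>v. v < n \<Longrightarrow> d v \<noteq> k"
  defines "S \<equiv> {v. v < n \<and> k < d v}"
  shows "s \<in> S" "t \<notin> S" "cut_value S = ex t" "s \<in> S' \<Longrightarrow> t \<notin> S' \<Longrightarrow> cut_value S \<le> cut_value S'"
proof -
  note I = pr_invD[OF inv]
  show sS: "s \<in> S" using s k I(4) by (simp add: S_def)
  show tS: "t \<notin> S" using I(5) by (simp add: S_def)
  let ?D = "{..<n} - S"
  have noact: "ex v = 0" if "v < n" "v \<noteq> s" "v \<noteq> t" "d v < n" for v
  proof (rule ccontr)
    assume "ex v \<noteq> 0"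
    then have "v \<in> set (B (d v))" using that I(11)[of "d v"] by (simp add: active_def)
    moreover have "1 \<le> d v" using I(6) that by simp
    ultimately show False using I(13)[of "d v"] that by simp
  qed
  have "(\<Sum>v\<in>?D. ex v) = (\<Sum>v\<in>{t}. ex v)"
  proof (intro sum.mono_neutral_right ballI)
    fix v assume "v \<in> ?D - {t}"
    then show "ex v = 0" using sS k by (intro noact) (auto simp: S_def)
  qed (use t tS in auto)
  then have "ex t + cut_value S = (\<Sum>v\<in>?D. \<Sum>w\<in>{..<n} \<inter> S. r v w)"
    using excess_across_cut[OF inv sS] by simp
  also have "\<dots> = (\<Sum>v\<in>?D. \<Sum>w\<in>{..<n} \<inter> S. 2 * c w v)"
  proof (intro sum.cong refl)
    fix v w assume vw: "v \<in> ?D" "w \<in> {..<n} \<inter> S"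
    then have "d v < k" using k(3)[of v] by (auto simp: S_def not_less le_less)
    then have "r w v = 0" using I(7)[of w v] vw by (auto simp: S_def)
    then show "r v w = 2 * c w v" using I(1)[of w v] vw by auto
  qed
  also have "\<dots> = 2 * (\<Sum>v\<in>?D. \<Sum>w\<in>{..<n} \<inter> S. c w v)" by (simp add: sum_distrib_left)
  also have "(\<Sum>v\<in>?D. \<Sum>w\<in>{..<n} \<inter> S. c w v) = cut_value S" unfolding cut_value_def by (rule sum.swap)
  finally show "cut_value S = ex t" by simp
  then show "cut_value S \<le> cut_value S'" if "s \<in> S'" "t \<notin> S'" using excess_le_cut[OF inv that] by simp
qed

section \<open>Initial state and initial potential\<close>

definition init_r :: "nat \<Rightarrow> nat \<Rightarrow> nat" where
  "init_r v w = (if v = s then 0 else if w = s then 2 * c v w else c v w)"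

text \<open>The value 1 is a lower bound for the distance of any other vertex from \<open>t\<close>.
  It leaves level 0 to \<open>t\<close> alone, so \<open>b = 0\<close> means that the algorithm is
  finished.\<close>

definition init_d :: "nat \<Rightarrow> nat" where
  "init_d v = (if v = s then n else if v = t then 0 else 1)"

definition init_B :: "nat \<Rightarrow> nat list" where
  "init_B l = (if l = 1 then filter (\<lambda>w. w \<noteq> t \<and> 0 < c s w) [0..<n] else [])"

lemma init_inv: "pr_inv init_r (c s) init_d (\<lambda>_. 0) init_B 1"
  unfolding pr_inv_def
proof (intro conjI)
  show "\<forall>v<n. \<forall>w<n. init_r v w + init_r w v = 2 * c v w"
    using csym s cdiag by (auto simp: init_r_def)
  show "\<forall>v<n. v \<noteq> s \<longrightarrow> c s v + (\<Sum>w<n. c v w) = (\<Sum>w<n. init_r v w)"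
  proof (intro allI impI)
    fix v assume v: "v < n" "v \<noteq> s"
    have "sum (c v) {..<n} + init_r v s = sum (init_r v) {..<n} + c v s"
      using s v by (intro sum_upd) (auto simp: init_r_def)
    then show "c s v + (\<Sum>w<n. c v w) = (\<Sum>w<n. init_r v w)" using v csym[OF v(1) s] by (simp add: init_r_def)
  qed
  show "\<forall>v<n. \<forall>w<n. 0 < init_r v w \<longrightarrow> init_d v \<le> init_d w + 1" by (auto simp: init_d_def init_r_def)
  show "\<forall>l<n. distinct (init_B l) \<and> set (init_B l) = active (c s) init_d l"
  proof (intro allI impI)
    fix l assume "l < n"
    have "s < n" "c s s = 0" using s cdiag by auto
    then show "distinct (init_B l) \<and> set (init_B l) = active (c s) init_d l"
      using \<open>l < n\<close> st by (auto simp: init_B_def active_def init_d_def)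
  qed
qed (use s t st in \<open>auto simp: init_r_def init_d_def init_B_def\<close>)

text \<open>Every step lowers the potential by \<open>K\<close>, so this bound means O(K n^2) steps.
  The delicate summand is \<open>K\<close> times \<open>scans\<close>, about \<open>K * n\<close>
  times the number of arcs.\<close>

lemma init_potential:
  assumes K: "1 \<le> K" and M: "card {(v, w). v < n \<and> w < n \<and> 0 < c v w} \<le> 2 * (K * K)"
  shows "potential K (c s) init_d (\<lambda>_. 0) init_B 1 \<le> 18 * (K * K * (n * n))"
proof -
  define M where "M = (\<Sum>v<n. length (adj v))"
  define \<nu> where "\<nu> = card linked_verts"
  have len: "length (adj v) \<le> n" for v unfolding adj_def by (metis diff_zero length_filter_le length_upt)
  have setadj: "set (adj v) = {w. w < n \<and> 0 < c v w}" for v by (auto simp: in_adj)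
  have M_card: "M = card {(v, w). v < n \<and> w < n \<and> 0 < c v w}"
  proof -
    have "{(v, w). v < n \<and> w < n \<and> 0 < c v w} = (SIGMA v:{..<n}. set (adj v))" by (auto simp: in_adj)
    then show ?thesis by (simp add: M_def card_SigmaI distinct_card[OF distinct_adj])
  qed
  have M1: "M \<le> 2 * (K * K)" using M M_card by simp
  have M2: "M \<le> n * n" unfolding M_def using sum_bounded_above[of "{..<n}" "\<lambda>v. length (adj v)" n] len by simp
  \<comment> \<open>The geometric mean of the bounds \<open>2 * (K * K)\<close> and
    \<open>n * n\<close>, rounded up; it keeps the factor \<open>K\<close> from being wasted on
    dense or multi-edge inputs.\<close>
  have M3: "M \<le> 2 * K * n"
  proof (rule ccontr)
    assume "\<not> M \<le> 2 * K * n"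
    then have "2 * K * n * (2 * K * n) < M * M" by (intro mult_strict_mono) auto
    also have "\<dots> \<le> (2 * (K * K)) * (n * n)" by (rule mult_le_mono[OF M1 M2])
    finally show False by (simp add: algebra_simps)
  qed
  have nu1: "\<nu> \<le> n" unfolding \<nu>_def using card_mono[of "{..<n}" linked_verts] by (auto simp: linked_verts_def)
  have nu2: "\<nu> \<le> M"
  proof -
    have "\<nu> = (\<Sum>v\<in>linked_verts. 1)" by (simp add: \<nu>_def)
    also have "\<dots> \<le> (\<Sum>v\<in>linked_verts. length (adj v))" by (intro sum_mono) (auto simp: linked_verts_def Suc_le_eq)
    also have "\<dots> \<le> M" unfolding M_def by (intro sum_mono2) (auto simp: linked_verts_def)
    finally show ?thesis .
  qed
  have n1: "1 \<le> n" using s by simp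
  have ci: "card inner \<le> n" using card_mono[of "{..<n}" inner] by (auto simp: inner_def)
  have R: "relabels init_d \<le> n * n"
  proof -
    have "relabels init_d \<le> of_nat (card inner) * n" unfolding relabels_def by (rule sum_bounded_above) simp
    then show ?thesis by (rule order_trans) (simp add: ci mult_le_mono1)
  qed
  have Sc: "scans init_d (\<lambda>_. 0) \<le> (n + 1) * M"
  proof -
    have "scans init_d (\<lambda>_. 0) \<le> (\<Sum>v\<in>inner. (n + 1) * length (adj v))"
      unfolding scans_def by (intro sum_mono) (simp add: algebra_simps)
    also have "\<dots> \<le> (\<Sum>v<n. (n + 1) * length (adj v))" by (intro sum_mono2) (auto simp: inner_def)
    also have "\<dots> = (n + 1) * M" by (simp add: M_def sum_distrib_left)
    finally show ?thesis .
  qed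
  have H: "height (c s) init_d \<le> n * n"
  proof -
    have "height (c s) init_d \<le> (\<Sum>x\<in>inner. n)" unfolding height_def
      using rank_le nu1 by (intro order_trans[OF sum_mono2[of inner] sum_mono]) (auto simp: \<nu>_def intro: order_trans)
    then show ?thesis using ci by (simp add: mult_le_mono1 order_trans)
  qed
  have nn: "1 \<le> n * n" "1 \<le> K * K" using n1 K by simp_all
  have KK: "K \<le> K * K" using K by simp
  have a: "(K * K + 3 * K + \<nu>) * relabels init_d \<le> 6 * (K * K) * (n * n)"
    using KK nu2 M1 R by (intro mult_le_mono) linarith+
  have b: "(\<nu> + K) * scans init_d (\<lambda>_. 0) \<le> 8 * (K * K * (n * n))"
  proof -
    have "\<nu> * ((n + 1) * M) \<le> n * ((2 * n) * (2 * (K * K)))" using nu1 M1 n1 by (intro mult_le_mono) auto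
    moreover have "K * ((n + 1) * M) \<le> K * ((2 * n) * (2 * K * n))" using M3 n1 by (intro mult_le_mono) auto
    moreover have "(\<nu> + K) * scans init_d (\<lambda>_. 0) \<le> (\<nu> + K) * ((n + 1) * M)" using Sc by (rule mult_le_mono2)
    ultimately show ?thesis by (simp add: algebra_simps)
  qed
  have e1: "n * n \<le> K * K * (n * n)" using mult_le_mono[OF nn(2) order_refl[of "n * n"]] by simp
  have e2: "K * K \<le> K * K * (n * n)" using mult_le_mono[OF order_refl[of "K * K"] nn(1)] by simp
  have h: "height (c s) init_d \<le> K * K * (n * n)" using H e1 by linarith
  have m: "K * min K (length (init_B 1)) \<le> K * K * (n * n)"
    using e2 mult_le_mono2[of "min K (length (init_B 1))" K K] by linarith
  have l: "(K * K + K) * 1 \<le> 2 * (K * K * (n * n))" unfolding mult_1_right using e2 KK by linarith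
  show ?thesis unfolding potential_def \<nu>_def[symmetric] using a b h m l by linarith
qed

end

section \<open>Reasoning about programs\<close>

definition runs :: "com \<Rightarrow> state \<Rightarrow> nat \<Rightarrow> (state \<Rightarrow> bool) \<Rightarrow> bool" where
  "runs p \<sigma> k Q \<longleftrightarrow> (\<exists>l \<tau>. exec p \<sigma> l \<tau> \<and> l \<le> k \<and> Q \<tau>)"

primrec writes :: "com \<Rightarrow> string set" where
  "writes Skip = {}"
| "writes (Assign x a b) = {x}"
| "writes (Seq p q) = writes p \<union> writes q"
| "writes (If b p q) = writes p \<union> writes q"
| "writes (While b p) = writes p"

definition agree :: "string set \<Rightarrow> state \<Rightarrow> state \<Rightarrow> bool" where
  "agree W \<sigma> \<tau> \<longleftrightarrow> (\<forall>x. x \<notin> W \<longrightarrow> \<tau> x = \<sigma> x)"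

lemma agree_refl [simp]: "agree W \<sigma> \<sigma>" by (simp add: agree_def)

lemma agree_trans: "agree W \<sigma> \<tau> \<Longrightarrow> agree W' \<tau> \<rho> \<Longrightarrow> agree (W \<union> W') \<sigma> \<rho>"
  by (simp add: agree_def)

lemma agreeD: "agree W \<sigma> \<tau> \<Longrightarrow> x \<notin> W \<Longrightarrow> \<tau> x = \<sigma> x"
  by (simp add: agree_def)

lemma agree_mono: "agree W \<sigma> \<tau> \<Longrightarrow> W \<subseteq> W' \<Longrightarrow> agree W' \<sigma> \<tau>"
  by (auto simp: agree_def)

lemma exec_agree: "exec p \<sigma> k \<tau> \<Longrightarrow> agree (writes p) \<sigma> \<tau>"
  by (induction rule: exec.induct) (auto simp: agree_def)

text \<open>The frame information \<open>agree\<close> is passed to the continuation, here and in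
  \<open>runs_Seq\<close>, so that postconditions need not list what a program leaves alone.\<close>

lemma runs_weaken: "runs p \<sigma> k Q \<Longrightarrow> k \<le> k' \<Longrightarrow> (\<And>\<tau>. Q \<tau> \<Longrightarrow> agree (writes p) \<sigma> \<tau> \<Longrightarrow> Q' \<tau>) \<Longrightarrow> runs p \<sigma> k' Q'"
  unfolding runs_def using exec_agree le_trans by blast

lemma runs_Seq:
  assumes "runs p \<sigma> k Q" "\<And>\<tau>. Q \<tau> \<Longrightarrow> agree (writes p) \<sigma> \<tau> \<Longrightarrow> runs q \<tau> l Q'"
  shows "runs (Seq p q) \<sigma> (k + l) Q'"
proof -
  obtain k' \<tau> where 1: "exec p \<sigma> k' \<tau>" "k' \<le> k" "Q \<tau>" using assms(1) by (auto simp: runs_def)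
  obtain l' \<rho> where 2: "exec q \<tau> l' \<rho>" "l' \<le> l" "Q' \<rho>"
    using assms(2)[OF 1(3) exec_agree[OF 1(1)]] by (auto simp: runs_def)
  then show ?thesis using exec.Seq[OF 1(1) 2(1)] 1 2 by (auto simp: runs_def intro!: exI[of _ "k' + l'"])
qed

lemma runs_If:
  assumes "bval b \<sigma> \<Longrightarrow> runs p \<sigma> k Q" "\<not> bval b \<sigma> \<Longrightarrow> runs q \<sigma> k Q"
  shows "runs (If b p q) \<sigma> (Suc k) Q"
proof (cases "bval b \<sigma>")
  case True
  then obtain k' \<tau> where 1: "exec p \<sigma> k' \<tau>" "k' \<le> k" "Q \<tau>" using assms(1) by (auto simp: runs_def)
  then show ?thesis using exec.IfTrue[OF True 1(1)] by (auto simp: runs_def)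
next
  case False
  then obtain k' \<tau> where 1: "exec q \<sigma> k' \<tau>" "k' \<le> k" "Q \<tau>" using assms(2) by (auto simp: runs_def)
  then show ?thesis using exec.IfFalse[OF False 1(1)] by (auto simp: runs_def)
qed

text \<open>\<open>Inv\<close> relates a state to a value of the potential instead of computing one
  from it, so abstract data such as labels and stacks can stay existentially quantified. Each round
  lowers the value by \<open>K\<close>, hence \<open>k div K\<close> rounds.\<close>

lemma runs_While:
  assumes K: "0 < K"
    and body: "\<And>\<tau> k. Inv \<tau> k \<Longrightarrow> agree (writes p) \<sigma> \<tau> \<Longrightarrow> bval b \<tau> \<Longrightarrow> runs p \<tau> c (\<lambda>\<rho>. \<exists>l. Inv \<rho> l \<and> l + K \<le> k)"
    and init: "Inv \<sigma> k"
  shows "runs (While b p) \<sigma> (Suc c * (k div K) + 1) (\<lambda>\<tau>. \<exists>k. Inv \<tau> k \<and> \<not> bval b \<tau>)"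
proof -
  have "runs (While b p) \<tau> (Suc c * (k div K) + 1) (\<lambda>\<rho>. \<exists>k. Inv \<rho> k \<and> \<not> bval b \<rho>)"
    if "Inv \<tau> k" "agree (writes p) \<sigma> \<tau>" for \<tau> k
    using that
  proof (induction k arbitrary: \<tau> rule: less_induct)
    case (less k)
    show ?case
    proof (cases "bval b \<tau>")
      case False
      then show ?thesis using exec.WhileFalse[OF False] less by (auto simp: runs_def)
    next
      case True
      obtain j \<rho> l where 1: "exec p \<tau> j \<rho>" "j \<le> c" "Inv \<rho> l" "l + K \<le> k"
        using body[OF less(2,3) True] by (auto simp: runs_def)
      have a: "agree (writes p) \<sigma> \<rho>" using agree_trans[OF less(3) exec_agree[OF 1(1)]] by simp
      have lt: "l < k" using 1(4) K by linarith
      obtain i \<rho>' where 2: "exec (While b p) \<rho> i \<rho>'" "i \<le> Suc c * (l div K) + 1" "\<exists>k. Inv \<rho>' k \<and> \<not> bval b \<rho>'"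
        using less(1)[OF lt 1(3) a] by (auto simp: runs_def)
      have "(l + K) div K \<le> k div K" using 1(4) by (rule div_le_mono)
      then have "l div K + 1 \<le> k div K" using K by simp
      then have "Suc c * (l div K + 1) \<le> Suc c * (k div K)" by (rule mult_le_mono2)
      then have "Suc (j + i) \<le> Suc c * (k div K) + 1" using 1(2) 2(2) by simp
      then show ?thesis using exec.WhileTrue[OF True 1(1) 2(1)] 2(3) unfolding runs_def by blast
    qed
  qed
  then show ?thesis using init by simp
qed

abbreviation var :: "string \<Rightarrow> aexp" where "var x \<equiv> Read x (Const 0)"
abbreviation set_var :: "string \<Rightarrow> aexp \<Rightarrow> com" (infix "::=" 61) where "x ::= a \<equiv> Assign x (Const 0) a"
abbreviation seq (infixr ";;" 60) where "p ;; q \<equiv> Seq p q"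
abbreviation Less :: "aexp \<Rightarrow> aexp \<Rightarrow> bexp" where "Less a b \<equiv> Not (Leq b a)"
abbreviation Equal :: "aexp \<Rightarrow> aexp \<Rightarrow> bexp" where "Equal a b \<equiv> And (Leq a b) (Leq b a)"
abbreviation IfThen :: "bexp \<Rightarrow> com \<Rightarrow> com" where "IfThen b p \<equiv> If b p Skip"

text \<open>Entry \<open>(i, j)\<close> of an \<open>n \<times> n\<close> matrix is kept at index \<open>i * n + j\<close>; the array \<open>row\<close> tabulates
  \<open>i * n\<close>.\<close>

abbreviation entry :: "aexp \<Rightarrow> aexp \<Rightarrow> aexp" where "entry i j \<equiv> Plus (Read ''row'' i) j"

definition For :: "string \<Rightarrow> aexp \<Rightarrow> aexp \<Rightarrow> com \<Rightarrow> com" where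
  "For x a N p = (x ::= a ;; While (Less (var x) N) (p ;; x ::= Plus (var x) (Const 1)))"

lemma writes_For [simp]: "writes (For x a N p) = insert x (writes p)"
  by (auto simp: For_def)

text \<open>Applied only to loop-free code, so a loop gets the precondition \<open>False\<close>.
  This makes \<open>runs_wp\<close> hold with the purely syntactic bound \<open>steps\<close>, which
  adds up both branches of a conditional.\<close>

primrec wp :: "com \<Rightarrow> (state \<Rightarrow> bool) \<Rightarrow> state \<Rightarrow> bool" where
  "wp Skip Q \<sigma> = Q \<sigma>"
| "wp (Assign x a b) Q \<sigma> = Q (\<sigma>(x := (\<sigma> x)(aval a \<sigma> := aval b \<sigma>)))"
| "wp (Seq p q) Q \<sigma> = wp p (wp q Q) \<sigma>"
| "wp (If b p q) Q \<sigma> = (if bval b \<sigma> then wp p Q \<sigma> else wp q Q \<sigma>)"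
| "wp (While b p) Q \<sigma> = False"

primrec steps :: "com \<Rightarrow> nat" where
  "steps Skip = 1"
| "steps (Assign x a b) = 1"
| "steps (Seq p q) = steps p + steps q"
| "steps (If b p q) = Suc (steps p + steps q)"
| "steps (While b p) = 0"

lemma runs_wp: "wp p Q \<sigma> \<Longrightarrow> runs p \<sigma> (steps p) Q"
proof (induction p arbitrary: Q \<sigma>)
  case Skip then show ?case using exec.Skip by (auto simp: runs_def)
next
  case (Assign x a b)
  then show ?case using exec.Assign[of x a b \<sigma>] by (auto simp: runs_def)
next
  case (Seq p q)
  then have "runs p \<sigma> (steps p) (wp q Q)" by simp
  then have "runs (p ;; q) \<sigma> (steps p + steps q) Q" by (rule runs_Seq) (rule Seq.IH(2))
  then show ?case by simp
next
  case (If b p q)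
  have "runs (If b p q) \<sigma> (Suc (steps p + steps q)) Q"
  proof (rule runs_If)
    assume "bval b \<sigma>"
    then have "runs p \<sigma> (steps p) Q" using If by simp
    then show "runs p \<sigma> (steps p + steps q) Q" by (rule runs_weaken) auto
  next
    assume "\<not> bval b \<sigma>"
    then have "runs q \<sigma> (steps q) Q" using If by simp
    then show "runs q \<sigma> (steps p + steps q) Q" by (rule runs_weaken) auto
  qed
  then show ?case by simp
qed simp

lemma runs_wpI: "wp p Q \<sigma> \<Longrightarrow> steps p \<le> k \<Longrightarrow> runs p \<sigma> k Q"
  using runs_wp runs_weaken by blast

text \<open>\<open>c + 2\<close> counts the body, the test and the increment. The invariant is
  required of the state after the increment, with the counter written out, so it may speak of the
  counter as well.\<close>

lemma runs_For:
  assumes x: "x \<notin> writes p"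
    and N: "\<And>\<tau>. agree (insert x (writes p)) \<sigma> \<tau> \<Longrightarrow> aval N \<tau> = n"
    and init: "Inv (aval a \<sigma>) (\<sigma>(x := (\<sigma> x)(0 := aval a \<sigma>)))"
    and body: "\<And>i \<tau>. aval a \<sigma> \<le> i \<Longrightarrow> i < n \<Longrightarrow> Inv i \<tau> \<Longrightarrow> \<tau> x 0 = i \<Longrightarrow> agree (insert x (writes p)) \<sigma> \<tau> \<Longrightarrow>
       runs p \<tau> c (\<lambda>\<rho>. Inv (Suc i) (\<rho>(x := (\<rho> x)(0 := Suc i))))"
    and le: "aval a \<sigma> \<le> n"
    and post: "\<And>\<tau>. Inv n \<tau> \<Longrightarrow> agree (insert x (writes p)) \<sigma> \<tau> \<Longrightarrow> Q \<tau>"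
  shows "runs (For x a N p) \<sigma> ((c + 2) * n + 2) Q"
proof -
  let ?W = "insert x (writes p)"
  let ?\<sigma> = "\<sigma>(x := (\<sigma> x)(0 := aval a \<sigma>))"
  define J where "J \<tau> k \<longleftrightarrow> Inv (\<tau> x 0) \<tau> \<and> aval a \<sigma> \<le> \<tau> x 0 \<and> \<tau> x 0 \<le> n \<and> agree ?W \<sigma> \<tau> \<and> k = n - \<tau> x 0" for \<tau> k
  let ?Q = "\<lambda>\<tau>. \<exists>k. J \<tau> k \<and> \<not> bval (Less (var x) N) \<tau>"
  have W: "runs (While (Less (var x) N) (p ;; x ::= Plus (var x) (Const 1))) ?\<sigma>
      (Suc (c + 1) * ((n - aval a \<sigma>) div 1) + 1) ?Q"
  proof (rule runs_While)
    show "J ?\<sigma> (n - aval a \<sigma>)" using init le by (simp add: J_def agree_def)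
    fix \<tau> k assume J: "J \<tau> k" and b: "bval (Less (var x) N) \<tau>"
    have ag: "agree ?W \<sigma> \<tau>" using J by (simp add: J_def)
    have lt: "\<tau> x 0 < n" using b N[OF ag] by simp
    have r: "runs p \<tau> c (\<lambda>\<rho>. Inv (Suc (\<tau> x 0)) (\<rho>(x := (\<rho> x)(0 := Suc (\<tau> x 0)))))"
      using J lt ag by (intro body) (auto simp: J_def)
    show "runs (p ;; x ::= Plus (var x) (Const 1)) \<tau> (c + 1) (\<lambda>\<rho>. \<exists>l. J \<rho> l \<and> l + 1 \<le> k)"
    proof (rule runs_Seq[OF r])
      fix \<rho> assume I: "Inv (Suc (\<tau> x 0)) (\<rho>(x := (\<rho> x)(0 := Suc (\<tau> x 0))))" and a: "agree (writes p) \<tau> \<rho>"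
      have eq: "\<rho> x = \<tau> x" using agreeD[OF a x] .
      have "agree ?W \<sigma> \<rho>" using agree_trans[OF ag a] by simp
      then have "J (\<rho>(x := (\<rho> x)(0 := Suc (\<tau> x 0)))) (n - Suc (\<tau> x 0))" using I lt J by (simp add: J_def agree_def)
      moreover have "n - Suc (\<tau> x 0) + 1 \<le> k" using J lt by (simp add: J_def)
      ultimately show "runs (x ::= Plus (var x) (Const 1)) \<rho> 1 (\<lambda>\<rho>. \<exists>l. J \<rho> l \<and> l + 1 \<le> k)"
        using eq by (intro runs_wpI) auto
    qed
  qed simp
  have "runs (For x a N p) \<sigma> (1 + (Suc (c + 1) * ((n - aval a \<sigma>) div 1) + 1)) ?Q"
    unfolding For_def
    by (rule runs_Seq[where Q = "\<lambda>\<tau>. \<tau> = ?\<sigma>"]) (use W in \<open>auto intro: runs_wpI\<close>)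
  then show ?thesis
  proof (rule runs_weaken)
    have "Suc (c + 1) * ((n - aval a \<sigma>) div 1) \<le> Suc (c + 1) * n" by (intro mult_le_mono2) simp
    then show "1 + (Suc (c + 1) * ((n - aval a \<sigma>) div 1) + 1) \<le> (c + 2) * n + 2" by simp
    fix \<tau> assume "?Q \<tau>"
    then obtain k where a: "J \<tau> k" "\<not> bval (Less (var x) N) \<tau>" by blast
    then have "\<tau> x 0 = n" using N[of \<tau>] by (simp add: J_def)
    then show "Q \<tau>" using a post by (simp add: J_def)
  qed
qed

definition mat :: "nat \<Rightarrow> (nat \<Rightarrow> nat) \<Rightarrow> nat \<Rightarrow> nat \<Rightarrow> nat" where
  "mat n f i j = f (i * n + j)"

lemma mat_index: "j < n \<Longrightarrow> l < n \<Longrightarrow> i * n + j = k * n + l \<longleftrightarrow> i = k \<and> j = l" for n :: nat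
  by (metis add.commute div_mult_self1 less_nat_zero_code mod_less mod_mult_self1 div_less add_0 mult.commute)

lemma mat_index_less: "i < n \<Longrightarrow> j < n \<Longrightarrow> i * n + j < n * (n::nat)"
proof -
  assume "i < n" "j < n"
  then have "i * n + j < Suc i * n" by simp
  also have "\<dots> \<le> n * n" using \<open>i < n\<close> by (intro mult_le_mono1) simp
  finally show ?thesis .
qed

section \<open>A push-relabel program\<close>

definition prepare_arc :: com where
  "prepare_arc =
     (Assign ''r'' (entry (var ''x'') (var ''y'')) (Read ''c'' (entry (var ''x'') (var ''y''))) ;;
      IfThen (Less (Const 0) (Read ''c'' (entry (var ''x'') (var ''y''))))
        (Assign ''adj'' (entry (var ''x'') (Read ''deg'' (var ''x''))) (var ''y'') ;;
         Assign ''deg'' (var ''x'') (Plus (Read ''deg'' (var ''x'')) (Const 1))))"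

definition prepare_vertex :: com where
  "prepare_vertex =
     (Assign ''ex'' (var ''x'') (Const 0) ;; Assign ''d'' (var ''x'') (Const 1) ;;
      Assign ''cur'' (var ''x'') (Const 0) ;; Assign ''deg'' (var ''x'') (Const 0) ;;
      Assign ''cnt'' (var ''x'') (Const 0))"

definition flow_prepare :: com where
  "flow_prepare = For ''x'' (Const 0) (var ''n'')
     (prepare_vertex ;; For ''y'' (Const 0) (var ''n'') prepare_arc)"

text \<open>The doubled entry is formed by addition, as stored numbers cannot be multiplied.\<close>

definition saturate_arc :: com where
  "saturate_arc =
     IfThen (Less (Const 0) (Read ''c'' (entry (var ''fs'') (var ''y''))))
       (Assign ''r'' (entry (var ''fs'') (var ''y'')) (Const 0) ;;
        Assign ''r'' (entry (var ''y'') (var ''fs''))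
          (Plus (Read ''c'' (entry (var ''y'') (var ''fs''))) (Read ''c'' (entry (var ''y'') (var ''fs'')))) ;;
        Assign ''ex'' (var ''y'') (Read ''c'' (entry (var ''fs'') (var ''y''))) ;;
        IfThen (Not (Equal (var ''y'') (var ''ft'')))
          (Assign ''bk'' (entry (Const 1) (Read ''cnt'' (Const 1))) (var ''y'') ;;
           Assign ''cnt'' (Const 1) (Plus (Read ''cnt'' (Const 1)) (Const 1))))"

definition flow_saturate :: com where
  "flow_saturate =
     (Assign ''d'' (var ''fs'') (var ''n'') ;; Assign ''d'' (var ''ft'') (Const 0) ;; ''top'' ::= Const 1 ;;
      For ''y'' (Const 0) (var ''n'') saturate_arc)"

definition flow_relabel :: com where
  "flow_relabel =
     (Assign ''cnt'' (var ''top'') (Minus (Read ''cnt'' (var ''top'')) (Const 1)) ;;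
      Assign ''d'' (var ''v'') (Plus (var ''top'') (Const 1)) ;;
      Assign ''cur'' (var ''v'') (Const 0) ;;
      IfThen (Less (Plus (var ''top'') (Const 1)) (var ''n''))
        (''top'' ::= Plus (var ''top'') (Const 1) ;;
         Assign ''bk'' (entry (var ''top'') (Read ''cnt'' (var ''top''))) (var ''v'') ;;
         Assign ''cnt'' (var ''top'') (Plus (Read ''cnt'' (var ''top'')) (Const 1))))"

text \<open>The minimum is found by comparison. The tests and the stacking of \<open>w\<close> come
  before the updates because they refer to the old excesses and the old residual capacity.\<close>

definition flow_push :: com where
  "flow_push =
     (If (Leq (Read ''ex'' (var ''v'')) (Read ''r'' (entry (var ''v'') (var ''w''))))
        (''dl'' ::= Read ''ex'' (var ''v'')) (''dl'' ::= Read ''r'' (entry (var ''v'') (var ''w''))) ;;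
      If (And (Not (Equal (var ''w'') (var ''ft''))) (Equal (Read ''ex'' (var ''w'')) (Const 0)))
        (Assign ''bk'' (entry (Read ''d'' (var ''w'')) (Read ''cnt'' (Read ''d'' (var ''w'')))) (var ''w'') ;;
         Assign ''cnt'' (Read ''d'' (var ''w'')) (Plus (Read ''cnt'' (Read ''d'' (var ''w''))) (Const 1)))
        Skip ;;
      If (Leq (Read ''ex'' (var ''v'')) (Read ''r'' (entry (var ''v'') (var ''w''))))
        (Assign ''cnt'' (var ''top'') (Minus (Read ''cnt'' (var ''top'')) (Const 1)))
        (Assign ''cur'' (var ''v'') (Plus (Read ''cur'' (var ''v'')) (Const 1))) ;;
      Assign ''r'' (entry (var ''v'') (var ''w'')) (Minus (Read ''r'' (entry (var ''v'') (var ''w''))) (var ''dl'')) ;;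
      Assign ''r'' (entry (var ''w'') (var ''v'')) (Plus (Read ''r'' (entry (var ''w'') (var ''v''))) (var ''dl'')) ;;
      Assign ''ex'' (var ''v'') (Minus (Read ''ex'' (var ''v'')) (var ''dl'')) ;;
      Assign ''ex'' (var ''w'') (Plus (Read ''ex'' (var ''w'')) (var ''dl'')))"

definition flow_arc :: com where
  "flow_arc =
     (''w'' ::= Read ''adj'' (entry (var ''v'') (Read ''cur'' (var ''v''))) ;;
      If (And (Less (Const 0) (Read ''r'' (entry (var ''v'') (var ''w''))))
              (Equal (Read ''d'' (var ''v'')) (Plus (Read ''d'' (var ''w'')) (Const 1))))
        flow_push
        (Assign ''cur'' (var ''v'') (Plus (Read ''cur'' (var ''v'')) (Const 1))))"

definition flow_step :: com where
  "flow_step =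
     If (Leq (Read ''cnt'' (var ''top'')) (Const 0)) (''top'' ::= Minus (var ''top'') (Const 1))
       (''v'' ::= Read ''bk'' (entry (var ''top'') (Minus (Read ''cnt'' (var ''top'')) (Const 1))) ;;
        If (Leq (Read ''deg'' (var ''v'')) (Read ''cur'' (var ''v''))) flow_relabel flow_arc)"

definition flow_side :: com where
  "flow_side = If (Less (var ''g'') (Read ''d'' (var ''x'')))
     (Assign ''side'' (var ''x'') (Const 1)) (Assign ''side'' (var ''x'') (Const 0))"

definition flow_finish :: com where
  "flow_finish =
     (For ''x'' (Const 0) (var ''n'') (Assign ''lev'' (var ''x'') (Const 0)) ;;
      For ''x'' (Const 0) (var ''n'') (Assign ''lev'' (Read ''d'' (var ''x'')) (Const 1)) ;;
      ''g'' ::= Const 1 ;;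
      While (Leq (Const 1) (Read ''lev'' (var ''g''))) (''g'' ::= Plus (var ''g'') (Const 1)) ;;
      For ''x'' (Const 0) (var ''n'') flow_side ;;
      ''val'' ::= Read ''ex'' (var ''ft''))"

definition flow_program :: com where
  "flow_program = (flow_prepare ;; flow_saturate ;; While (Leq (Const 1) (var ''top'')) flow_step ;; flow_finish)"

lemma writes_flow [simp]:
  "writes prepare_arc = {''r'', ''adj'', ''deg''}"
  "writes prepare_vertex = {''ex'', ''d'', ''cur'', ''deg'', ''cnt''}"
  "writes flow_prepare = {''x'', ''y'', ''r'', ''adj'', ''deg'', ''ex'', ''d'', ''cur'', ''cnt''}"
  "writes saturate_arc = {''r'', ''ex'', ''bk'', ''cnt''}"
  "writes flow_saturate = {''d'', ''top'', ''y'', ''r'', ''ex'', ''bk'', ''cnt''}"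
  "writes flow_relabel = {''cnt'', ''d'', ''cur'', ''top'', ''bk''}"
  "writes flow_push = {''dl'', ''bk'', ''cnt'', ''cur'', ''r'', ''ex''}"
  "writes flow_step = {''v'', ''w'', ''d'', ''top'', ''dl'', ''bk'', ''cnt'', ''cur'', ''r'', ''ex''}"
  "writes flow_side = {''side''}"
  "writes flow_finish = {''x'', ''lev'', ''g'', ''side'', ''val''}"
  by (auto simp: prepare_arc_def prepare_vertex_def flow_prepare_def saturate_arc_def flow_saturate_def
      flow_relabel_def flow_push_def flow_arc_def flow_step_def flow_side_def flow_finish_def)

lemma writes_flow_program [simp]:
  "writes flow_program = {''x'', ''y'', ''r'', ''adj'', ''deg'', ''ex'', ''d'', ''cur'', ''cnt'', ''top'', ''bk'',
     ''v'', ''w'', ''dl'', ''lev'', ''g'', ''side'', ''val''}"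
  by (auto simp: flow_program_def)

section \<open>Machine states and the push-relabel data they represent\<close>

definition rows :: "nat \<Rightarrow> state \<Rightarrow> bool" where
  "rows n \<sigma> \<longleftrightarrow> \<sigma> ''n'' 0 = n \<and> (\<forall>i<n. \<sigma> ''row'' i = i * n)"

definition flow_input :: "nat \<Rightarrow> (nat \<Rightarrow> nat \<Rightarrow> nat) \<Rightarrow> nat \<Rightarrow> nat \<Rightarrow> state \<Rightarrow> bool" where
  "flow_input n c s t \<sigma> \<longleftrightarrow> rows n \<sigma> \<and> \<sigma> ''fs'' 0 = s \<and> \<sigma> ''ft'' 0 = t \<and> (\<forall>i<n. \<forall>j<n. \<sigma> ''c'' (i * n + j) = c i j)"

lemma agree_upd: "agree W \<sigma> \<tau> \<Longrightarrow> x \<in> W \<Longrightarrow> agree W \<sigma> (\<tau>(x := f))"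
  by (auto simp: agree_def)

definition mat_rel :: "nat \<Rightarrow> (nat \<Rightarrow> nat) \<Rightarrow> (nat \<Rightarrow> nat \<Rightarrow> nat) \<Rightarrow> bool" where
  "mat_rel n f r \<longleftrightarrow> (\<forall>v<n. \<forall>w<n. f (v * n + w) = r v w)"

lemma mat_relD: "mat_rel n f r \<Longrightarrow> v < n \<Longrightarrow> w < n \<Longrightarrow> f (v * n + w) = r v w"
  by (simp add: mat_rel_def)

lemma mat_rel_upd:
  assumes "mat_rel n f r" "w < n"
  shows "mat_rel n (f(v * n + w := u)) (r(v := (r v)(w := u)))"
  unfolding mat_rel_def
proof (intro allI impI)
  fix x y assume "x < n" "y < n"
  then show "(f(v * n + w := u)) (x * n + y) = (r(v := (r v)(w := u))) x y"
    using assms mat_index[of y n w x v] by (simp add: mat_rel_def)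
qed

definition stacks :: "nat \<Rightarrow> (nat \<Rightarrow> nat) \<Rightarrow> (nat \<Rightarrow> nat) \<Rightarrow> (nat \<Rightarrow> nat list) \<Rightarrow> bool" where
  "stacks n cnt bk B \<longleftrightarrow> (\<forall>l<n. cnt l = length (B l) \<and> (\<forall>i<length (B l). bk (l * n + i) = B l ! i))"

lemma stacks_pop: "stacks n cnt bk B \<Longrightarrow> stacks n (cnt(b := cnt b - Suc 0)) bk (B(b := butlast (B b)))"
  by (auto simp: stacks_def nth_butlast)

text \<open>The length bound keeps the new entry within its own row of the matrix, so the other
  stacks are not overwritten.\<close>

lemma stacks_push:
  assumes "stacks n cnt bk B" "\<And>l. l < n \<Longrightarrow> length (B l) < n" "l < n"
  shows "stacks n (cnt(l := Suc (cnt l))) (bk(l * n + cnt l := v)) (B(l := B l @ [v]))"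
  unfolding stacks_def
proof (intro allI impI conjI)
  fix k i assume k: "k < n" and i: "i < length ((B(l := B l @ [v])) k)"
  have len: "length (B k) < n" "length (B l) < n" "cnt l = length (B l)" using assms k by (auto simp: stacks_def)
  have "i < n" using i len by (auto split: if_splits)
  then show "(bk(l * n + cnt l := v)) (k * n + i) = (B(l := B l @ [v])) k ! i"
    using assms(1) k i len mat_index[of i n "length (B l)" k l]
    by (auto simp: stacks_def nth_append less_Suc_eq split: if_splits)
qed (use assms in \<open>auto simp: stacks_def\<close>)

lemma stacks_top: "stacks n cnt bk B \<Longrightarrow> b < n \<Longrightarrow> B b \<noteq> [] \<Longrightarrow> bk (b * n + (cnt b - Suc 0)) = last (B b)"
  by (simp add: stacks_def last_conv_nth)

context flow_network
begin

definition adj_ok :: "state \<Rightarrow> bool" where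
  "adj_ok \<sigma> \<longleftrightarrow> (\<forall>v<n. \<sigma> ''deg'' v = length (adj v) \<and> (\<forall>i<length (adj v). \<sigma> ''adj'' (v * n + i) = adj v ! i))"

definition flow_rel ::
  "state \<Rightarrow> (nat \<Rightarrow> nat \<Rightarrow> nat) \<Rightarrow> (nat \<Rightarrow> nat) \<Rightarrow> (nat \<Rightarrow> nat) \<Rightarrow> (nat \<Rightarrow> nat) \<Rightarrow> (nat \<Rightarrow> nat list) \<Rightarrow> nat \<Rightarrow> bool" where
  "flow_rel \<sigma> r ex d cur B b \<longleftrightarrow>
     mat_rel n (\<sigma> ''r'') r \<and> (\<forall>v<n. \<sigma> ''ex'' v = ex v) \<and> (\<forall>v<n. \<sigma> ''d'' v = d v) \<and> (\<forall>v<n. \<sigma> ''cur'' v = cur v) \<and>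
     stacks n (\<sigma> ''cnt'') (\<sigma> ''bk'') B \<and> \<sigma> ''top'' 0 = b"

lemma stack_length:
  assumes inv: "pr_inv r ex d cur B b" and l: "l < n"
  shows "length (B l) < n"
proof -
  note I = pr_invD[OF inv]
  have "length (B l) = card (active ex d l)" using I(10,11)[OF l] distinct_card by metis
  also have "\<dots> \<le> card ({..<n} - {s})" by (intro card_mono) (auto simp: active_def)
  also have "\<dots> < n" using s by simp
  finally show ?thesis .
qed

definition filled :: "state \<Rightarrow> nat \<Rightarrow> nat \<Rightarrow> bool" where
  "filled \<sigma> x y \<longleftrightarrow> (let A = filter (\<lambda>w. 0 < c x w) [0..<y] in
     (\<forall>j<y. \<sigma> ''r'' (x * n + j) = c x j) \<and> \<sigma> ''deg'' x = length A \<and> (\<forall>i<length A. \<sigma> ''adj'' (x * n + i) = A ! i))"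

lemma filled_cong:
  assumes "filled \<sigma> x y" "\<And>j. j < n \<Longrightarrow> \<tau> ''r'' (x * n + j) = \<sigma> ''r'' (x * n + j)" "\<tau> ''deg'' x = \<sigma> ''deg'' x"
    "\<And>j. j < n \<Longrightarrow> \<tau> ''adj'' (x * n + j) = \<sigma> ''adj'' (x * n + j)" "y \<le> n"
  shows "filled \<tau> x y"
proof -
  have "length (filter (\<lambda>w. 0 < c x w) [0..<y]) \<le> y" by (metis diff_zero length_filter_le length_upt)
  then show ?thesis using assms by (simp add: filled_def Let_def)
qed

lemma prepare_arc_wp:
  assumes x: "x < n" and y: "y < n" "\<rho> ''x'' 0 = x" "\<rho> ''y'' 0 = y" "\<rho> ''row'' x = x * n" "\<rho> ''c'' (x * n + y) = c x y"
    and f: "filled \<rho> x y"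
  shows "wp prepare_arc (\<lambda>\<tau>. filled \<tau> x (Suc y) \<and> (\<forall>z. z \<noteq> x \<longrightarrow> filled \<rho> z n \<longrightarrow> filled \<tau> z n)) \<rho>"
proof -
  let ?l = "length (filter (\<lambda>w. 0 < c x w) [0..<y])"
  have fl: "?l \<le> y" by (metis diff_zero length_filter_le length_upt)
  have F: "\<And>j. j < y \<Longrightarrow> \<rho> ''r'' (x * n + j) = c x j" "\<rho> ''deg'' x = ?l"
    "\<And>i. i < ?l \<Longrightarrow> \<rho> ''adj'' (x * n + i) = filter (\<lambda>w. 0 < c x w) [0..<y] ! i"
    using f by (auto simp: filled_def Let_def)
  have ne: "z * n + j \<noteq> x * n + k" if "z \<noteq> x" "j < n" "k < n" for z j k
    using mat_index[of j n k z x] that by simp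
  have other: "filled \<tau> z n" if "z \<noteq> x" "filled \<rho> z n"
    "\<tau> = \<rho>(''r'' := (\<rho> ''r'')(x * n + y := u)) \<or> \<tau> = \<rho>(''r'' := (\<rho> ''r'')(x * n + y := u), ''adj'' := (\<rho> ''adj'')(x * n + ?l := w), ''deg'' := (\<rho> ''deg'')(x := k))"
    for \<tau> z u w k
  proof (rule filled_cong[OF that(2)])
    show "\<tau> ''r'' (z * n + j) = \<rho> ''r'' (z * n + j)" if "j < n" for j
      using \<open>\<tau> = _ \<or> _\<close> ne[OF \<open>z \<noteq> x\<close> that y(1)] by auto
    show "\<tau> ''adj'' (z * n + j) = \<rho> ''adj'' (z * n + j)" if "j < n" for j
      using \<open>\<tau> = _ \<or> _\<close> ne[OF \<open>z \<noteq> x\<close> that, of ?l] y(1) fl by auto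
  qed (use that in auto)
  show ?thesis
  proof (cases "0 < c x y")
    case True
    let ?\<tau> = "\<rho>(''r'' := (\<rho> ''r'')(x * n + y := c x y), ''adj'' := (\<rho> ''adj'')(x * n + ?l := y), ''deg'' := (\<rho> ''deg'')(x := Suc ?l))"
    have "wp prepare_arc P \<rho> = P ?\<tau>" for P
      using True y F(2) by (simp add: prepare_arc_def)
    moreover have "filled ?\<tau> x (Suc y)"
      using True F by (simp add: filled_def Let_def nth_append less_Suc_eq)
    moreover have "filled ?\<tau> z n" if "z \<noteq> x" "filled \<rho> z n" for z
      by (rule other[OF that]) (rule disjI2, rule refl)
    ultimately show ?thesis by simp
  next
    case False
    let ?\<tau> = "\<rho>(''r'' := (\<rho> ''r'')(x * n + y := c x y))"
    have "wp prepare_arc P \<rho> = P ?\<tau>" for P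
      using False y by (simp add: prepare_arc_def)
    moreover have "filled ?\<tau> x (Suc y)"
      using False F by (simp add: filled_def Let_def less_Suc_eq)
    moreover have "filled ?\<tau> z n" if "z \<noteq> x" "filled \<rho> z n" for z
      by (rule other[OF that]) (rule disjI1, rule refl)
    ultimately show ?thesis by simp
  qed
qed

lemma prepare_runs:
  assumes inp: "flow_input n c s t \<sigma>"
  shows "runs flow_prepare \<sigma> (20 * (n * n)) (\<lambda>\<tau>. adj_ok \<tau> \<and>
     (\<forall>v<n. \<forall>w<n. \<tau> ''r'' (v * n + w) = c v w) \<and>
     (\<forall>v<n. \<tau> ''ex'' v = 0 \<and> \<tau> ''d'' v = 1 \<and> \<tau> ''cur'' v = 0 \<and> \<tau> ''cnt'' v = 0))"
proof -
  have I: "\<sigma> ''n'' 0 = n" "\<And>i. i < n \<Longrightarrow> \<sigma> ''row'' i = i * n" "\<And>i j. i < n \<Longrightarrow> j < n \<Longrightarrow> \<sigma> ''c'' (i * n + j) = c i j"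
    using inp by (auto simp: flow_input_def rows_def)
  define J where "J x \<tau> \<longleftrightarrow> (\<forall>z<x. filled \<tau> z n \<and> \<tau> ''ex'' z = 0 \<and> \<tau> ''d'' z = 1 \<and> \<tau> ''cur'' z = 0 \<and> \<tau> ''cnt'' z = 0)"
    for x :: nat and \<tau> :: state
  have "1 \<le> n" using s by simp
  have c: "((5 + ((5 + 2) * n + 2)) + 2) * n + 2 \<le> 20 * (n * n)"
  proof -
    have "n \<le> n * n" "1 \<le> n * n" using s by auto
    moreover have "((5 + ((5 + 2) * n + 2)) + 2) * n + 2 = 7 * (n * n) + 9 * n + 2" by (simp add: algebra_simps)
    ultimately show ?thesis by linarith
  qed
  show ?thesis unfolding flow_prepare_def
  proof (rule runs_weaken[OF _ c])
    show "runs (For ''x'' (Const 0) (var ''n'') (prepare_vertex ;; For ''y'' (Const 0) (var ''n'') prepare_arc)) \<sigma>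
       (((5 + ((5 + 2) * n + 2)) + 2) * n + 2) (J n)"
    proof (rule runs_For[where Inv = J])
      fix x \<tau> assume x: "x < n" "J x \<tau>" "\<tau> ''x'' 0 = x"
        and ag: "agree (insert ''x'' (writes (prepare_vertex ;; For ''y'' (Const 0) (var ''n'') prepare_arc))) \<sigma> \<tau>"
      note A = agreeD[OF ag, simplified]
      let ?Q = "\<lambda>\<rho>. J x \<rho> \<and> filled \<rho> x 0 \<and> \<rho> ''ex'' x = 0 \<and> \<rho> ''d'' x = 1 \<and> \<rho> ''cur'' x = 0 \<and> \<rho> ''cnt'' x = 0"
      have J_upd: "J x \<rho>" if "J x \<tau>" "\<And>y z. z < x \<Longrightarrow> y \<in> {''ex'', ''d'', ''cur'', ''cnt'', ''deg''} \<Longrightarrow> \<rho> y z = \<tau> y z"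
        "\<rho> ''r'' = \<tau> ''r''" "\<rho> ''adj'' = \<tau> ''adj''" for \<rho>
        using that by (simp add: J_def filled_def Let_def)
      have "runs prepare_vertex \<tau> 5 ?Q"
      proof (rule runs_wpI)
        have "J x (\<tau>(''ex'' := (\<tau> ''ex'')(x := 0), ''d'' := (\<tau> ''d'')(x := 1), ''cur'' := (\<tau> ''cur'')(x := 0),
            ''deg'' := (\<tau> ''deg'')(x := 0), ''cnt'' := (\<tau> ''cnt'')(x := 0)))"
          by (rule J_upd[OF x(2)]) auto
        then show "wp prepare_vertex ?Q \<tau>" by (simp add: prepare_vertex_def filled_def x(3))
      qed (simp add: prepare_vertex_def)
      then show "runs (prepare_vertex ;; For ''y'' (Const 0) (var ''n'') prepare_arc) \<tau> (5 + ((5 + 2) * n + 2))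
          (\<lambda>\<rho>. J (Suc x) (\<rho>(''x'' := (\<rho> ''x'')(0 := Suc x))))"
      proof (rule runs_Seq)
        fix \<rho> assume Q: "?Q \<rho>" and ag': "agree (writes prepare_vertex) \<tau> \<rho>"
        note B = agreeD[OF ag', simplified]
        show "runs (For ''y'' (Const 0) (var ''n'') prepare_arc) \<rho> ((5 + 2) * n + 2)
          (\<lambda>\<rho>. J (Suc x) (\<rho>(''x'' := (\<rho> ''x'')(0 := Suc x))))"
        proof (rule runs_For[where Inv = "\<lambda>y \<upsilon>. (\<forall>z<x. filled \<upsilon> z n) \<and> filled \<upsilon> x y"])
          show "(\<forall>z<x. filled (\<rho>(''y'' := (\<rho> ''y'')(0 := aval (Const 0) \<rho>))) z n) \<and>
            filled (\<rho>(''y'' := (\<rho> ''y'')(0 := aval (Const 0) \<rho>))) x (aval (Const 0) \<rho>)"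
            using Q by (simp add: J_def filled_def)
        next
          fix y \<upsilon> assume y: "y < n" "(\<forall>z<x. filled \<upsilon> z n) \<and> filled \<upsilon> x y" "\<upsilon> ''y'' 0 = y"
            and ag3: "agree (insert ''y'' (writes prepare_arc)) \<rho> \<upsilon>"
          note C = agreeD[OF ag3, simplified]
          have "wp prepare_arc (\<lambda>\<tau>. filled \<tau> x (Suc y) \<and> (\<forall>z. z \<noteq> x \<longrightarrow> filled \<upsilon> z n \<longrightarrow> filled \<tau> z n)) \<upsilon>"
            by (rule prepare_arc_wp) (use x y I in \<open>simp_all add: A B C\<close>)
          then have "runs prepare_arc \<upsilon> 5 (\<lambda>\<tau>. filled \<tau> x (Suc y) \<and> (\<forall>z. z \<noteq> x \<longrightarrow> filled \<upsilon> z n \<longrightarrow> filled \<tau> z n))"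
            by (rule runs_wpI) (simp add: prepare_arc_def)
          then show "runs prepare_arc \<upsilon> 5 (\<lambda>\<rho>. (\<forall>z<x. filled (\<rho>(''y'' := (\<rho> ''y'')(0 := Suc y))) z n) \<and>
            filled (\<rho>(''y'' := (\<rho> ''y'')(0 := Suc y))) x (Suc y))"
            by (rule runs_weaken) (use y in \<open>auto simp: filled_def\<close>)
        next
          fix \<upsilon> assume y: "(\<forall>z<x. filled \<upsilon> z n) \<and> filled \<upsilon> x n"
            and ag3: "agree (insert ''y'' (writes prepare_arc)) \<rho> \<upsilon>"
          note C = agreeD[OF ag3, simplified]
          show "J (Suc x) (\<upsilon>(''x'' := (\<upsilon> ''x'')(0 := Suc x)))"
            using Q y by (auto simp: J_def filled_def C less_Suc_eq)
        next
          fix \<upsilon> assume ag3: "agree (insert ''y'' (writes prepare_arc)) \<rho> \<upsilon>"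
          show "aval (var ''n'') \<upsilon> = n" by (simp add: agreeD[OF ag3, simplified] A B I)
        qed simp_all
      qed
    next
      fix \<tau> assume ag: "agree (insert ''x'' (writes (prepare_vertex ;; For ''y'' (Const 0) (var ''n'') prepare_arc))) \<sigma> \<tau>"
      show "aval (var ''n'') \<tau> = n" by (simp add: agreeD[OF ag, simplified] I)
    qed (simp_all add: J_def)
  next
    fix \<tau> assume "J n \<tau>"
    then show "adj_ok \<tau> \<and> (\<forall>v<n. \<forall>w<n. \<tau> ''r'' (v * n + w) = c v w) \<and>
     (\<forall>v<n. \<tau> ''ex'' v = 0 \<and> \<tau> ''d'' v = 1 \<and> \<tau> ''cur'' v = 0 \<and> \<tau> ''cnt'' v = 0)"
      by (auto simp: J_def filled_def Let_def adj_ok_def adj_def)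
  qed
qed

definition saturated :: "state \<Rightarrow> nat \<Rightarrow> bool" where
  "saturated \<tau> y \<longleftrightarrow>
     mat_rel n (\<tau> ''r'') (\<lambda>v w. if v = s then if w < y then 0 else c v w
        else if w = s \<and> v < y then 2 * c v w else c v w) \<and>
     (\<forall>v<n. \<tau> ''ex'' v = (if v < y then c s v else 0)) \<and>
     stacks n (\<tau> ''cnt'') (\<tau> ''bk'') (\<lambda>l. if l = 1 then filter (\<lambda>w. w \<noteq> t \<and> 0 < c s w) [0..<y] else [])"

lemma n_ge_2: "2 \<le> n"
  using s t st by simp

lemma saturate_arc_wp:
  assumes y: "y < n" "\<rho> ''y'' 0 = y" and I: "flow_input n c s t \<rho>" and S: "saturated \<rho> y"
  shows "wp saturate_arc (\<lambda>\<tau>. saturated \<tau> (Suc y)) \<rho>"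
proof -
  have I: "\<rho> ''fs'' 0 = s" "\<rho> ''ft'' 0 = t" "\<rho> ''row'' s = s * n" "\<rho> ''row'' y = y * n" "\<rho> ''row'' (Suc 0) = n"
    "\<rho> ''c'' (s * n + y) = c s y" "\<rho> ''c'' (y * n + s) = c y s"
    using I s y n_ge_2 by (auto simp: flow_input_def rows_def)
  let ?B = "\<lambda>y l. if l = (1::nat) then filter (\<lambda>w. w \<noteq> t \<and> 0 < c s w) [0..<y] else []"
  let ?r = "\<lambda>y v w. if v = s then if w < y then 0 else c v w else if w = s \<and> v < y then 2 * c v w else c v w"
  have R: "mat_rel n (\<rho> ''r'') (?r y)" and E: "\<And>v. v < n \<Longrightarrow> \<rho> ''ex'' v = (if v < y then c s v else 0)"
    and B: "stacks n (\<rho> ''cnt'') (\<rho> ''bk'') (?B y)"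
    using S by (auto simp: saturated_def)
  have cys: "c y s = c s y" using csym s y by simp
  have len: "length (?B y l) < n" for l
  proof -
    have "length (filter (\<lambda>w. w \<noteq> t \<and> 0 < c s w) [0..<y]) \<le> y" by (metis diff_zero length_filter_le length_upt)
    then show ?thesis using y by simp
  qed
  show ?thesis
  proof (cases "0 < c s y")
    case False
    have "mat_rel n (\<rho> ''r'') (?r (Suc y))"
      unfolding mat_rel_def using R False cys by (auto simp: mat_rel_def less_Suc_eq)
    moreover have "?B (Suc y) = ?B y" using False by auto
    moreover have "wp saturate_arc P \<rho> = P \<rho>" for P using False y I by (simp add: saturate_arc_def)
    ultimately show ?thesis using E B False by (auto simp: saturated_def less_Suc_eq)
  next
    case True
    have ys: "y \<noteq> s" using True cdiag s by auto
    let ?f = "(\<rho> ''r'')(s * n + y := 0, y * n + s := c y s + c y s)"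
    let ?e = "(\<rho> ''ex'')(y := c s y)"
    have R': "mat_rel n ?f (?r (Suc y))"
    proof -
      have "mat_rel n ?f ((?r y)(s := (?r y s)(y := 0), y := (((?r y)(s := (?r y s)(y := 0))) y)(s := c y s + c y s)))"
        by (intro mat_rel_upd R y s)
      then show ?thesis using ys by (auto simp: mat_rel_def less_Suc_eq split: if_splits)
    qed
    have E': "\<forall>v<n. ?e v = (if v < Suc y then c s v else 0)" using E by (auto simp: less_Suc_eq)
    show ?thesis
    proof (cases "y = t")
      case tr: True
      let ?\<tau> = "\<rho>(''r'' := ?f, ''ex'' := ?e)"
      have "wp saturate_arc P \<rho> = P ?\<tau>" for P using True tr y I by (simp add: saturate_arc_def)
      moreover have "?B (Suc y) = ?B y" using tr by auto
      ultimately show ?thesis using R' E' B by (simp add: saturated_def)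
    next
      case False
      let ?c = "(\<rho> ''cnt'')(1 := Suc ((\<rho> ''cnt'') 1))"
      let ?b = "(\<rho> ''bk'')(1 * n + (\<rho> ''cnt'') 1 := y)"
      let ?\<tau> = "\<rho>(''r'' := ?f, ''ex'' := ?e, ''bk'' := ?b, ''cnt'' := ?c)"
      have "wp saturate_arc P \<rho> = P ?\<tau>" for P using True False y I by (auto simp: saturate_arc_def)
      moreover have "stacks n ?c ?b ((?B y)(1 := ?B y 1 @ [y]))"
        using len n_ge_2 by (intro stacks_push B) auto
      moreover have "(?B y)(1 := ?B y 1 @ [y]) = ?B (Suc y)" using True False by auto
      ultimately show ?thesis using R' E' by (simp add: saturated_def)
    qed
  qed
qed

lemma saturate_runs:
  assumes inp: "flow_input n c s t \<sigma>" and r: "\<forall>v<n. \<forall>w<n. \<sigma> ''r'' (v * n + w) = c v w"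
    and z: "\<forall>v<n. \<sigma> ''ex'' v = 0 \<and> \<sigma> ''d'' v = 1 \<and> \<sigma> ''cur'' v = 0 \<and> \<sigma> ''cnt'' v = 0"
  shows "runs flow_saturate \<sigma> (19 * (n * n)) (\<lambda>\<tau>. flow_rel \<tau> init_r (c s) init_d (\<lambda>_. 0) init_B 1)"
proof -
  let ?\<sigma> = "\<sigma>(''d'' := (\<sigma> ''d'')(s := n, t := 0), ''top'' := (\<sigma> ''top'')(0 := 1))"
  have I: "\<sigma> ''n'' 0 = n" "\<sigma> ''fs'' 0 = s" "\<sigma> ''ft'' 0 = t" using inp by (auto simp: flow_input_def rows_def)
  have inp': "flow_input n c s t ?\<sigma>" using inp by (simp add: flow_input_def rows_def)
  have loop: "runs (For ''y'' (Const 0) (var ''n'') saturate_arc) ?\<sigma> ((12 + 2) * n + 2) (\<lambda>\<tau>. flow_rel \<tau> init_r (c s) init_d (\<lambda>_. 0) init_B 1)"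
  proof (rule runs_For[where Inv = "\<lambda>y \<tau>. saturated \<tau> y"])
    show "saturated (?\<sigma>(''y'' := (?\<sigma> ''y'')(0 := aval (Const 0) ?\<sigma>))) (aval (Const 0) ?\<sigma>)"
      using r z by (simp add: saturated_def mat_rel_def stacks_def)
  next
    fix y \<tau> assume y: "y < n" "saturated \<tau> y" "\<tau> ''y'' 0 = y" and ag: "agree (insert ''y'' (writes saturate_arc)) ?\<sigma> \<tau>"
    have "flow_input n c s t \<tau>" using inp' by (simp add: flow_input_def rows_def agreeD[OF ag, simplified])
    then have "wp saturate_arc (\<lambda>\<tau>. saturated \<tau> (Suc y)) \<tau>" using y by (intro saturate_arc_wp)
    then have "runs saturate_arc \<tau> 12 (\<lambda>\<tau>. saturated \<tau> (Suc y))" by (rule runs_wpI) (simp add: saturate_arc_def)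
    then show "runs saturate_arc \<tau> 12 (\<lambda>\<rho>. saturated (\<rho>(''y'' := (\<rho> ''y'')(0 := Suc y))) (Suc y))"
      by (rule runs_weaken) (auto simp: saturated_def)
  next
    fix \<tau> assume S: "saturated \<tau> n" and ag: "agree (insert ''y'' (writes saturate_arc)) ?\<sigma> \<tau>"
    note A = agreeD[OF ag, simplified]
    have "mat_rel n (\<tau> ''r'') init_r" using S by (auto simp: saturated_def mat_rel_def init_r_def)
    moreover have "stacks n (\<tau> ''cnt'') (\<tau> ''bk'') init_B" using S by (auto simp: saturated_def stacks_def init_B_def)
    moreover have "\<forall>v<n. \<tau> ''ex'' v = c s v" using S by (auto simp: saturated_def)
    moreover have "\<forall>v<n. \<tau> ''d'' v = init_d v" using z st by (auto simp: A init_d_def)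
    moreover have "\<forall>v<n. \<tau> ''cur'' v = 0" using z by (simp add: A)
    ultimately show "flow_rel \<tau> init_r (c s) init_d (\<lambda>_. 0) init_B 1" by (simp add: flow_rel_def A)
  next
    fix \<tau> assume ag: "agree (insert ''y'' (writes saturate_arc)) ?\<sigma> \<tau>"
    show "aval (var ''n'') \<tau> = n" by (simp add: agreeD[OF ag, simplified] I)
  qed simp_all
  have "runs flow_saturate \<sigma> (1 + (1 + (1 + ((12 + 2) * n + 2)))) (\<lambda>\<tau>. flow_rel \<tau> init_r (c s) init_d (\<lambda>_. 0) init_B 1)"
    unfolding flow_saturate_def
  proof (rule runs_Seq[where Q = "\<lambda>\<tau>. \<tau> = \<sigma>(''d'' := (\<sigma> ''d'')(s := n))"], goal_cases)
    case 1 show ?case by (intro runs_wpI) (simp_all add: I)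
  next
    case (2 \<tau>)
    show ?case
    proof (rule runs_Seq[where Q = "\<lambda>\<tau>. \<tau> = \<sigma>(''d'' := (\<sigma> ''d'')(s := n, t := 0))"], goal_cases)
      case 1 show ?case using 2 by (intro runs_wpI) (simp_all add: I)
    next
      case (2 \<tau>)
      show ?case
        by (rule runs_Seq[where Q = "\<lambda>\<tau>. \<tau> = ?\<sigma>"]) (use 2 loop in \<open>auto intro!: runs_wpI\<close>)
    qed
  qed
  then show ?thesis
  proof (rule runs_weaken)
    have "n \<le> n * n" "1 \<le> n * n" using s by auto
    moreover have "1 + (1 + (1 + ((12 + 2) * n + 2))) = 14 * n + 5" by simp
    ultimately show "1 + (1 + (1 + ((12 + 2) * n + 2))) \<le> 19 * (n * n)" by linarith
  qed
qed

text \<open>The body performs one of the abstract steps: leaving an empty level, relabelling,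
  passing an arc, or pushing. In each case the final state is written out and \<open>wp\<close>
  collapses to it for every postcondition; 40 is a generous count of the steps of the code.\<close>

lemma step_runs:
  assumes inv: "pr_inv r ex d cur B b" and rel: "flow_rel \<tau> r ex d cur B b" and b: "1 \<le> b"
    and inp: "flow_input n c s t \<tau>" and adj: "adj_ok \<tau>" and K: "1 \<le> K"
  shows "runs flow_step \<tau> 40 (\<lambda>\<rho>. \<exists>r' ex' d' cur' B' b'. pr_inv r' ex' d' cur' B' b' \<and> flow_rel \<rho> r' ex' d' cur' B' b' \<and>
     potential K ex' d' cur' B' b' + K \<le> potential K ex d cur B b)"
    (is "runs _ _ _ ?Q")
proof (rule runs_wpI)
  note P = pr_invD[OF inv]
  have bn: "b < n" by (rule P)
  have R: "mat_rel n (\<tau> ''r'') r" "\<And>v. v < n \<Longrightarrow> \<tau> ''ex'' v = ex v" "\<And>v. v < n \<Longrightarrow> \<tau> ''d'' v = d v"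
    "\<And>v. v < n \<Longrightarrow> \<tau> ''cur'' v = cur v" "stacks n (\<tau> ''cnt'') (\<tau> ''bk'') B" "\<tau> ''top'' 0 = b"
    using rel by (auto simp: flow_rel_def)
  have I: "\<tau> ''n'' 0 = n" "\<tau> ''ft'' 0 = t" "\<And>i. i < n \<Longrightarrow> \<tau> ''row'' i = i * n"
    using inp by (auto simp: flow_input_def rows_def)
  have cnt: "\<tau> ''cnt'' l = length (B l)" if "l < n" for l using R(5) that by (simp add: stacks_def)
  have wit: "wp flow_step ?Q \<tau>" if "\<And>Q. wp flow_step Q \<tau> = Q \<rho>" "flow_rel \<rho> r' ex' d' cur' B' b'"
    "pr_inv r' ex' d' cur' B' b'" "potential K ex' d' cur' B' b' + K \<le> potential K ex d cur B b" for \<rho> r' ex' d' cur' B' b'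
    unfolding that(1) using that(2-4) by blast
  show "wp flow_step ?Q \<tau>"
  proof (cases "B b = []")
    case True
    have "wp flow_step Q \<tau> = Q (\<tau>(''top'' := (\<tau> ''top'')(0 := b - 1)))" for Q
      using cnt[OF bn] True by (simp add: flow_step_def R)
    moreover have "flow_rel (\<tau>(''top'' := (\<tau> ''top'')(0 := b - 1))) r ex d cur B (b - 1)"
      using rel by (simp add: flow_rel_def)
    ultimately show ?thesis by (rule wit[OF _ _ lower_step[OF inv b True]])
  next
    case ne: False
    define v where "v = last (B b)"
    note V = top_vertex[OF inv b ne v_def]
    have top: "\<tau> ''bk'' (b * n + (\<tau> ''cnt'' b - Suc 0)) = v" using stacks_top[OF R(5) bn ne] by (simp add: v_def)
    have cb: "\<tau> ''cnt'' b \<noteq> 0" using cnt[OF bn] ne by simp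
    have A: "\<tau> ''deg'' v = length (adj v)" "\<And>i. i < length (adj v) \<Longrightarrow> \<tau> ''adj'' (v * n + i) = adj v ! i"
      using adj V by (auto simp: adj_ok_def)
    let ?\<tau> = "\<tau>(''v'' := (\<tau> ''v'')(0 := v))"
    have lens: "length (B l) < n" if "l < n" for l using stack_length[OF inv that] .
    show ?thesis
    proof (cases "cur v < length (adj v)")
      case False
      define B1 where "B1 = B(b := butlast (B b))"
      let ?cnt = "(\<tau> ''cnt'')(b := \<tau> ''cnt'' b - Suc 0)"
      have pop: "stacks n ?cnt (\<tau> ''bk'') B1" unfolding B1_def by (rule stacks_pop[OF R(5)])
      have lens1: "length (B1 l) < n" if "l < n" for l
        using lens[OF that] lens[OF bn] by (auto simp: B1_def)
      have c0: "Suc b < n \<Longrightarrow> \<tau> ''cnt'' (Suc b) = length (B1 (Suc b))" using cnt by (simp add: B1_def)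
      note rs = relabel_step[OF inv b ne v_def False K, folded B1_def]
      show ?thesis
      proof (cases "b + 1 < n")
        case True
        let ?\<rho> = "?\<tau>(''cnt'' := ?cnt(b + 1 := Suc (?cnt (b + 1))), ''d'' := (\<tau> ''d'')(v := b + 1), ''cur'' := (\<tau> ''cur'')(v := 0),
           ''top'' := (\<tau> ''top'')(0 := b + 1), ''bk'' := (\<tau> ''bk'')((b + 1) * n + ?cnt (b + 1) := v))"
        have "wp flow_step Q \<tau> = Q ?\<rho>" for Q
          using False True V cb top bn by (simp add: flow_step_def flow_relabel_def R I A fun_upd_twist)
        moreover have "flow_rel ?\<rho> r ex (d(v := b + 1)) (cur(v := 0)) (B1(b + 1 := B1 (b + 1) @ [v])) (b + 1)"
          using stacks_push[OF pop lens1 True, of v] R by (simp add: flow_rel_def)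
        ultimately show ?thesis by (rule wit[OF _ _ rs(1,2)[OF True]])
      next
        case nT: False
        let ?\<rho> = "?\<tau>(''cnt'' := ?cnt, ''d'' := (\<tau> ''d'')(v := b + 1), ''cur'' := (\<tau> ''cur'')(v := 0))"
        have "wp flow_step Q \<tau> = Q ?\<rho>" for Q
          using False nT V cb top bn by (simp add: flow_step_def flow_relabel_def R I A fun_upd_twist)
        moreover have "flow_rel ?\<rho> r ex (d(v := b + 1)) (cur(v := 0)) B1 b"
          using pop R by (simp add: flow_rel_def)
        ultimately show ?thesis by (rule wit[OF _ _ rs(3,4)[OF nT]])
      qed
    next
      case cur: True
      define w where "w = adj v ! cur v"
      have wn: "w < n" using adj_nth[OF cur] by (simp add: w_def)
      let ?\<tau>w = "?\<tau>(''w'' := (\<tau> ''w'')(0 := w))"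
      have step1: "wp flow_step Q \<tau> = wp flow_arc Q ?\<tau>" for Q
        using cur V cb top bn by (simp add: flow_step_def R I A)
      have rvw: "\<tau> ''r'' (v * n + w) = r v w" "\<tau> ''r'' (w * n + v) = r w v" using R(1) V(1) wn by (auto simp: mat_rel_def)
      show ?thesis
      proof (cases "0 < r v w \<and> d v = d w + 1")
        case False
        let ?\<rho> = "?\<tau>w(''cur'' := (\<tau> ''cur'')(v := cur v + 1))"
        have "wp flow_step Q \<tau> = Q ?\<rho>" for Q
          unfolding step1 using False cur V wn by (auto simp: flow_arc_def R I A rvw w_def[symmetric])
        moreover have "flow_rel ?\<rho> r ex d (cur(v := cur v + 1)) B b"
          using R by (simp add: flow_rel_def)
        ultimately show ?thesis by (rule wit[OF _ _ advance_step[OF inv b ne v_def cur w_def False]])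
      next
        case ad: True
        note ps = push_step[OF inv b ne v_def cur w_def conjunct1[OF ad] conjunct2[OF ad]]
        note ps1 = ps(1-4)
        define \<delta> where "\<delta> = min (ex v) (r v w)"
        define r' where "r' = r(v := (r v)(w := r v w - \<delta>), w := (r w)(v := r w v + \<delta>))"
        define ex' where "ex' = ex(v := ex v - \<delta>, w := ex w + \<delta>)"
        define B1 where "B1 = (if w \<noteq> t \<and> ex w = 0 then B(d w := B (d w) @ [w]) else B)"
        note ps = ps(5-8)[folded \<delta>_def, folded r'_def ex'_def B1_def]
        define cnt1 where "cnt1 = (if w \<noteq> t \<and> ex w = 0 then (\<tau> ''cnt'')(d w := Suc (\<tau> ''cnt'' (d w))) else \<tau> ''cnt'')"
        define bk1 where "bk1 = (if w \<noteq> t \<and> ex w = 0 then (\<tau> ''bk'')(d w * n + \<tau> ''cnt'' (d w) := w) else \<tau> ''bk'')"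
        have st1: "stacks n cnt1 bk1 B1"
          using stacks_push[OF R(5) lens ps1(4), of w] R(5) by (auto simp: cnt1_def bk1_def B1_def)
        let ?f = "(\<tau> ''r'')(v * n + w := r v w - \<delta>, w * n + v := r w v + \<delta>)"
        let ?e = "(\<tau> ''ex'')(v := ex v - \<delta>, w := ex w + \<delta>)"
        have f: "mat_rel n ?f r'"
        proof -
          have "mat_rel n ?f (r(v := (r v)(w := r v w - \<delta>), w := ((r(v := (r v)(w := r v w - \<delta>))) w)(v := r w v + \<delta>)))"
            using R(1) V(1) wn by (intro mat_rel_upd)
          then show ?thesis using ps1(2) by (simp add: r'_def)
        qed
        have e: "\<forall>v<n. ?e v = ex' v" using R(2) by (simp add: ex'_def)
        have neq: "w * n + v \<noteq> v * n + w" using mat_index[OF V(1) wn] ps1(2) by simp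
        have db: "d w \<noteq> b" using ad V by simp
        let ?base = "?\<tau>w(''dl'' := (\<tau> ''dl'')(0 := \<delta>), ''bk'' := bk1)"
        have step2: "wp flow_step Q \<tau> = wp flow_push Q ?\<tau>w" for Q
          unfolding step1 using ad cur V wn by (simp add: flow_arc_def R I A rvw w_def[symmetric])
        show ?thesis
        proof (cases "ex v \<le> r v w")
          case True
          let ?\<rho> = "?base(''cnt'' := cnt1(b := cnt1 b - Suc 0), ''r'' := ?f, ''ex'' := ?e)"
          have dl: "\<delta> = ex v" using True by (simp add: \<delta>_def)
          have "wp flow_step Q \<tau> = Q ?\<rho>" for Q
          proof (cases "w \<noteq> t \<and> ex w = 0")
            case w: True
            then show ?thesis unfolding step2 using True V wn ps1 db neq
              by (simp add: flow_push_def R I rvw dl cnt1_def bk1_def fun_upd_twist)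
          next
            case w: False
            \<comment> \<open>Nothing is stacked in this case, so the code writes neither
              \<open>bk\<close> nor the count of the level of \<open>w\<close>; the updates by
              \<open>bk1\<close> and \<open>cnt1\<close> are then trivial and the two states are
              equal as functions.\<close>
            let ?small = "?\<tau>w(''dl'' := (\<tau> ''dl'')(0 := \<delta>), ''cnt'' := (\<tau> ''cnt'')(b := \<tau> ''cnt'' b - Suc 0), ''r'' := ?f, ''ex'' := ?e)"
            have e: "?small = ?\<rho>" using w by (auto simp: fun_eq_iff cnt1_def bk1_def)
            have "wp flow_step Q \<tau> = Q ?small"
              unfolding step2 using w True V wn ps1 db neq
              by (cases "t = w") (simp_all add: flow_push_def R I rvw dl fun_upd_twist)
            then show ?thesis by (rule trans) (rule arg_cong[OF e, of Q])
          qed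
          moreover have "flow_rel ?\<rho> r' ex' d cur (B1(b := butlast (B1 b))) b"
            unfolding flow_rel_def
          proof (intro conjI)
            show "stacks n (?\<rho> ''cnt'') (?\<rho> ''bk'') (B1(b := butlast (B1 b)))" using stacks_pop[OF st1, of b] by simp
            show "mat_rel n (?\<rho> ''r'') r'" using f by simp
            show "\<forall>v<n. ?\<rho> ''ex'' v = ex' v" using e by simp
          qed (simp_all add: R)
          ultimately show ?thesis by (rule wit[OF _ _ ps(1,2)[OF True]])
        next
          case False
          let ?\<rho> = "?base(''cnt'' := cnt1, ''cur'' := (\<tau> ''cur'')(v := cur v + 1), ''r'' := ?f, ''ex'' := ?e)"
          have dl: "\<delta> = r v w" using False by (simp add: \<delta>_def)
          have "wp flow_step Q \<tau> = Q ?\<rho>" for Q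
          proof (cases "w \<noteq> t \<and> ex w = 0")
            case w: True
            then show ?thesis unfolding step2 using False V wn ps1 db neq
              by (simp add: flow_push_def R I rvw dl cnt1_def bk1_def fun_upd_twist)
          next
            case w: False
            let ?small = "?\<tau>w(''dl'' := (\<tau> ''dl'')(0 := \<delta>), ''cur'' := (\<tau> ''cur'')(v := cur v + 1), ''r'' := ?f, ''ex'' := ?e)"
            have e: "?small = ?\<rho>" using w by (auto simp: fun_eq_iff cnt1_def bk1_def)
            have "wp flow_step Q \<tau> = Q ?small"
              unfolding step2 using w False V wn ps1 db neq
              by (cases "t = w") (simp_all add: flow_push_def R I rvw dl fun_upd_twist)
            then show ?thesis by (rule trans) (rule arg_cong[OF e, of Q])
          qed
          moreover have "flow_rel ?\<rho> r' ex' d (cur(v := cur v + 1)) B1 b"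
            unfolding flow_rel_def
          proof (intro conjI)
            show "stacks n (?\<rho> ''cnt'') (?\<rho> ''bk'') B1" using st1 by simp
            show "mat_rel n (?\<rho> ''r'') r'" using f by simp
            show "\<forall>v<n. ?\<rho> ''ex'' v = ex' v" using e by simp
          qed (simp_all add: R)
          ultimately show ?thesis by (rule wit[OF _ _ ps(3,4)[OF False]])
        qed
      qed
    qed
  qed
qed (simp add: flow_step_def flow_arc_def flow_push_def flow_relabel_def)

lemma finish_runs:
  assumes inv: "pr_inv r ex d cur B 0" and rel: "flow_rel \<sigma> r ex d cur B 0"
    and inp: "flow_input n c s t \<sigma>"
  shows "runs flow_finish \<sigma> (40 * (n * n)) (\<lambda>\<tau>. let S = {v. v < n \<and> \<tau> ''side'' v \<noteq> 0} in
     (\<forall>v<n. \<tau> ''side'' v \<le> 1) \<and> s \<in> S \<and> t \<notin> S \<and> \<tau> ''val'' 0 = cut_value S \<and>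
     (\<forall>S'. s \<in> S' \<longrightarrow> t \<notin> S' \<longrightarrow> cut_value S \<le> cut_value S'))" (is "runs _ _ _ ?Q")
proof -
  have I: "\<sigma> ''n'' 0 = n" "\<sigma> ''ft'' 0 = t" using inp by (auto simp: flow_input_def rows_def)
  have d: "\<And>v. v < n \<Longrightarrow> \<sigma> ''d'' v = d v" and ex: "\<sigma> ''ex'' t = ex t" using rel t by (auto simp: flow_rel_def)
  obtain g where g: "1 \<le> g" "g < n" "\<forall>v<n. d v \<noteq> g" using gap_exists[OF inv] by blast
  define W where "W = {''x'', ''lev'', ''g'', ''side'', ''val''}"
  have p1: "runs (For ''x'' (Const 0) (var ''n'') (Assign ''lev'' (var ''x'') (Const 0))) \<sigma> ((1 + 2) * n + 2)
      (\<lambda>\<tau>. \<forall>l<n. \<tau> ''lev'' l = 0)"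
  proof (rule runs_For[where Inv = "\<lambda>x \<tau>. \<forall>l<x. \<tau> ''lev'' l = 0"])
    fix \<tau> assume ag: "agree (insert ''x'' (writes (Assign ''lev'' (var ''x'') (Const 0)))) \<sigma> \<tau>"
    show "aval (var ''n'') \<tau> = n" by (simp add: agreeD[OF ag, simplified] I)
  qed (auto intro!: runs_wpI simp: less_Suc_eq)
  have p2: "runs (For ''x'' (Const 0) (var ''n'') (Assign ''lev'' (Read ''d'' (var ''x'')) (Const 1))) \<tau> ((1 + 2) * n + 2)
      (\<lambda>\<tau>. \<forall>l<n. \<tau> ''lev'' l = (if \<exists>v<n. d v = l then 1 else 0))"
    if z: "\<forall>l<n. \<tau> ''lev'' l = 0" and a: "agree W \<sigma> \<tau>" for \<tau>
  proof (rule runs_For[where Inv = "\<lambda>x \<tau>. \<forall>l<n. \<tau> ''lev'' l = (if \<exists>v<x. d v = l then 1 else 0)"])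
    show "\<forall>l<n. (\<tau>(''x'' := (\<tau> ''x'')(0 := aval (Const 0) \<tau>))) ''lev'' l = (if \<exists>v<aval (Const 0) \<tau>. d v = l then 1 else 0)"
      using z by simp
  next
    fix x \<rho> assume x: "x < n" "\<forall>l<n. \<rho> ''lev'' l = (if \<exists>v<x. d v = l then 1 else 0)" "\<rho> ''x'' 0 = x"
      and ag: "agree (insert ''x'' (writes (Assign ''lev'' (Read ''d'' (var ''x'')) (Const 1)))) \<tau> \<rho>"
    have dx: "\<rho> ''d'' x = d x" using d[OF x(1)] by (simp add: agreeD[OF ag, simplified] agreeD[OF a, unfolded W_def, simplified])
    show "runs (Assign ''lev'' (Read ''d'' (var ''x'')) (Const 1)) \<rho> 1
      (\<lambda>\<rho>. \<forall>l<n. (\<rho>(''x'' := (\<rho> ''x'')(0 := Suc x))) ''lev'' l = (if \<exists>v<Suc x. d v = l then 1 else 0))"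
      using x dx by (intro runs_wpI) (auto simp: less_Suc_eq)
  next
    fix \<rho> assume ag: "agree (insert ''x'' (writes (Assign ''lev'' (Read ''d'' (var ''x'')) (Const 1)))) \<tau> \<rho>"
    show "aval (var ''n'') \<rho> = n" by (simp add: agreeD[OF ag, simplified] agreeD[OF a, unfolded W_def, simplified] I)
  qed simp_all
  have p3: "runs (While (Leq (Const 1) (Read ''lev'' (var ''g''))) (''g'' ::= Plus (var ''g'') (Const 1))) \<tau> (Suc 1 * (n div 1) + 1)
      (\<lambda>\<tau>. 1 \<le> \<tau> ''g'' 0 \<and> \<tau> ''g'' 0 < n \<and> (\<forall>v<n. d v \<noteq> \<tau> ''g'' 0))"
    if z: "\<forall>l<n. \<tau> ''lev'' l = (if \<exists>v<n. d v = l then 1 else 0)" "\<tau> ''g'' 0 = 1" for \<tau>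
  proof -
    \<comment> \<open>\<open>g\<close> is one gap known to exist, and \<open>k\<close> bounds the
      distance of the counter from it. The loop may stop earlier, at a smaller gap.\<close>
    let ?Inv = "\<lambda>\<rho> k. 1 \<le> \<rho> ''g'' 0 \<and> \<rho> ''g'' 0 \<le> g \<and> g \<le> k + \<rho> ''g'' 0 \<and> (\<forall>l<n. \<rho> ''lev'' l = (if \<exists>v<n. d v = l then 1 else 0))"
    have "runs (While (Leq (Const 1) (Read ''lev'' (var ''g''))) (''g'' ::= Plus (var ''g'') (Const 1))) \<tau> (Suc 1 * (n div 1) + 1)
       (\<lambda>\<tau>. \<exists>k. ?Inv \<tau> k \<and> \<not> bval (Leq (Const 1) (Read ''lev'' (var ''g''))) \<tau>)"
    proof (rule runs_While)
      show "?Inv \<tau> n" using z g by simp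
      fix \<rho> k assume J: "?Inv \<rho> k" and b: "bval (Leq (Const 1) (Read ''lev'' (var ''g''))) \<rho>"
      have "\<rho> ''g'' 0 \<noteq> g" using J b g by (auto split: if_splits)
      then have lt: "\<rho> ''g'' 0 < g" using J by simp
      let ?\<rho> = "\<rho>(''g'' := (\<rho> ''g'')(0 := Suc (\<rho> ''g'' 0)))"
      have "?Inv ?\<rho> (k - 1)" "k - 1 + 1 \<le> k" using J lt by auto
      then have "\<exists>l. ?Inv ?\<rho> l \<and> l + 1 \<le> k" by blast
      then have "wp (''g'' ::= Plus (var ''g'') (Const 1)) (\<lambda>\<rho>. \<exists>l. ?Inv \<rho> l \<and> l + 1 \<le> k) \<rho>" by simp
      then show "runs (''g'' ::= Plus (var ''g'') (Const 1)) \<rho> 1 (\<lambda>\<rho>. \<exists>l. ?Inv \<rho> l \<and> l + 1 \<le> k)"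
        by (rule runs_wpI) simp
    qed simp
    then show ?thesis
    proof (rule runs_weaken)
      fix \<rho> assume "\<exists>k. ?Inv \<rho> k \<and> \<not> bval (Leq (Const 1) (Read ''lev'' (var ''g''))) \<rho>"
      then have J: "1 \<le> \<rho> ''g'' 0" "\<rho> ''g'' 0 \<le> g" "\<forall>l<n. \<rho> ''lev'' l = (if \<exists>v<n. d v = l then 1 else 0)"
        and "\<rho> ''lev'' (\<rho> ''g'' 0) = 0" by auto
      moreover have "\<rho> ''g'' 0 < n" using J g by simp
      ultimately have "\<not> (\<exists>v<n. d v = \<rho> ''g'' 0)" by (metis zero_neq_one)
      then show "1 \<le> \<rho> ''g'' 0 \<and> \<rho> ''g'' 0 < n \<and> (\<forall>v<n. d v \<noteq> \<rho> ''g'' 0)" using J \<open>\<rho> ''g'' 0 < n\<close> by blast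
    qed simp
  qed
  have p4: "runs (For ''x'' (Const 0) (var ''n'') flow_side) \<tau> ((3 + 2) * n + 2)
      (\<lambda>\<rho>. \<forall>v<n. \<rho> ''side'' v = (if \<tau> ''g'' 0 < d v then 1 else 0))" if a: "agree W \<sigma> \<tau>" for \<tau>
  proof (rule runs_For[where Inv = "\<lambda>x \<rho>. \<forall>v<x. \<rho> ''side'' v = (if \<tau> ''g'' 0 < d v then 1 else 0)"])
    fix x \<rho> assume x: "x < n" "\<forall>v<x. \<rho> ''side'' v = (if \<tau> ''g'' 0 < d v then 1 else 0)" "\<rho> ''x'' 0 = x"
      and ag: "agree (insert ''x'' (writes flow_side)) \<tau> \<rho>"
    have dx: "\<rho> ''d'' x = d x" "\<rho> ''g'' = \<tau> ''g''"
      using d[OF x(1)] by (simp_all add: agreeD[OF ag, simplified] agreeD[OF a, unfolded W_def, simplified])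
    show "runs flow_side \<rho> 3
      (\<lambda>\<rho>. \<forall>v<Suc x. (\<rho>(''x'' := (\<rho> ''x'')(0 := Suc x))) ''side'' v = (if \<tau> ''g'' 0 < d v then 1 else 0))"
      using x dx by (intro runs_wpI) (auto simp: less_Suc_eq flow_side_def)
  next
    fix \<rho> assume ag: "agree (insert ''x'' (writes flow_side)) \<tau> \<rho>"
    show "aval (var ''n'') \<rho> = n" by (simp add: agreeD[OF ag, simplified] agreeD[OF a, unfolded W_def, simplified] I)
  qed simp_all
  have ag_step: "agree W \<sigma> \<rho>" if "agree W \<sigma> \<tau>" "agree X \<tau> \<rho>" "X \<subseteq> W" for X \<tau> \<rho>
    using agree_trans[OF that(1,2)] that(3) by (auto elim!: agree_mono)
  have "runs flow_finish \<sigma> (((1 + 2) * n + 2) + (((1 + 2) * n + 2) + (1 + ((Suc 1 * (n div 1) + 1) + (((3 + 2) * n + 2) + 1))))) ?Q"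
    unfolding flow_finish_def
  proof (rule runs_Seq[OF p1])
    fix \<tau> assume 1: "\<forall>l<n. \<tau> ''lev'' l = 0" "agree (writes (For ''x'' (Const 0) (var ''n'') (Assign ''lev'' (var ''x'') (Const 0)))) \<sigma> \<tau>"
    have a1: "agree W \<sigma> \<tau>" using 1(2) by (rule agree_mono) (simp add: W_def)
    show "runs (For ''x'' (Const 0) (var ''n'') (Assign ''lev'' (Read ''d'' (var ''x'')) (Const 1)) ;; ''g'' ::= Const 1 ;;
      While (Leq (Const 1) (Read ''lev'' (var ''g''))) (''g'' ::= Plus (var ''g'') (Const 1)) ;;
      For ''x'' (Const 0) (var ''n'') flow_side ;; ''val'' ::= Read ''ex'' (var ''ft'')) \<tau>
      (((1 + 2) * n + 2) + (1 + ((Suc 1 * (n div 1) + 1) + (((3 + 2) * n + 2) + 1)))) ?Q"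
    proof (rule runs_Seq[OF p2[OF 1(1) a1]], goal_cases)
      case (1 \<tau>2)
      have a2: "agree W \<sigma> \<tau>2" using ag_step[OF a1 1(2)] by (simp add: W_def)
      show ?case
      proof (rule runs_Seq[where Q = "\<lambda>\<rho>. \<rho> = \<tau>2(''g'' := (\<tau>2 ''g'')(0 := 1))"], goal_cases)
        case 1 show ?case by (intro runs_wpI) simp_all
      next
        case (2 \<tau>3)
        have a3: "agree W \<sigma> \<tau>3" unfolding 2(1) by (rule agree_upd[OF a2]) (simp add: W_def)
        have "\<forall>l<n. \<tau>3 ''lev'' l = (if \<exists>v<n. d v = l then 1 else 0)" "\<tau>3 ''g'' 0 = 1" using 1(1) 2(1) by simp_all
        note p3' = p3[OF this]
        show ?case
        proof (rule runs_Seq[OF p3'], goal_cases)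
          case (1 \<tau>4)
          have a4: "agree W \<sigma> \<tau>4" using ag_step[OF a3 1(2)] by (simp add: W_def)
          show ?case
          proof (rule runs_Seq[OF p4[OF a4]], goal_cases)
            case (1 \<tau>5)
            have a5: "agree W \<sigma> \<tau>5" using ag_step[OF a4 1(2)] by (simp add: W_def)
            note A = agreeD[OF a5, unfolded W_def, simplified]
            have S: "{v. v < n \<and> \<tau>5 ''side'' v \<noteq> 0} = {v. v < n \<and> \<tau>4 ''g'' 0 < d v}" using 1(1) by (auto split: if_splits)
            have g4: "1 \<le> \<tau>4 ''g'' 0" "\<tau>4 ''g'' 0 < n" "\<And>v. v < n \<Longrightarrow> d v \<noteq> \<tau>4 ''g'' 0"
              using \<open>1 \<le> \<tau>4 ''g'' 0 \<and> \<tau>4 ''g'' 0 < n \<and> (\<forall>v<n. d v \<noteq> \<tau>4 ''g'' 0)\<close> by auto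
            note gm = gap_min_cut[OF inv g4]
            show ?case
            proof (rule runs_wpI)
              let ?S = "{v. v < n \<and> \<tau>4 ''g'' 0 < d v}"
              have "wp (''val'' ::= Read ''ex'' (var ''ft'')) P \<tau>5 = P (\<tau>5(''val'' := (\<tau>5 ''val'')(0 := ex t)))" for P
                by (simp add: A I ex)
              moreover have "{v. v < n \<and> (\<tau>5(''val'' := (\<tau>5 ''val'')(0 := ex t))) ''side'' v \<noteq> 0} = ?S" using S by simp
              moreover have "\<forall>v<n. \<tau>5 ''side'' v \<le> 1" using 1(1) by auto
              ultimately show "wp (''val'' ::= Read ''ex'' (var ''ft'')) ?Q \<tau>5"
                using gm by (simp only: Let_def fun_upd_same) simp
            qed simp
          qed
        qed
      qed
    qed
  qed
  then show ?thesis
  proof (rule runs_weaken)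
    have "n \<le> n * n" "1 \<le> n * n" using s by auto
    moreover have "((1 + 2) * n + 2) + (((1 + 2) * n + 2) + (1 + ((Suc 1 * (n div 1) + 1) + (((3 + 2) * n + 2) + 1)))) = 13 * n + 9" by simp
    ultimately show "((1 + 2) * n + 2) + (((1 + 2) * n + 2) + (1 + ((Suc 1 * (n div 1) + 1) + (((3 + 2) * n + 2) + 1)))) \<le> 40 * (n * n)" by linarith
  qed
qed

text \<open>The potential starts at no more than \<open>18 * (K * K * (n * n))\<close> and each
  round of at most 41 steps consumes \<open>K\<close>. Leaving \<open>K\<close> free lets one value,
  chosen for the whole input, serve all matrices of subgraphs and contractions.\<close>

theorem flow_program_runs:
  assumes inp: "flow_input n c s t \<sigma>" and K: "1 \<le> K"
    and M: "card {(v, w). v < n \<and> w < n \<and> 0 < c v w} \<le> 2 * (K * K)"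
  shows "runs flow_program \<sigma> (1000 * (K * (n * n))) (\<lambda>\<tau>. let S = {v. v < n \<and> \<tau> ''side'' v \<noteq> 0} in
     (\<forall>v<n. \<tau> ''side'' v \<le> 1) \<and> s \<in> S \<and> t \<notin> S \<and> \<tau> ''val'' 0 = cut_value S \<and>
     (\<forall>S'. s \<in> S' \<longrightarrow> t \<notin> S' \<longrightarrow> cut_value S \<le> cut_value S'))" (is "runs _ _ _ ?Q")
proof -
  have inp_cong: "flow_input n c s t \<tau>" if "agree W \<rho> \<tau>" "W \<inter> {''n'', ''row'', ''fs'', ''ft'', ''c''} = {}" "flow_input n c s t \<rho>" for W \<rho> \<tau>
  proof -
    have "\<tau> x = \<rho> x" if "x \<in> {''n'', ''row'', ''fs'', ''ft'', ''c''}" for x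
      using \<open>agree W \<rho> \<tau>\<close> \<open>W \<inter> _ = {}\<close> that by (auto simp: agree_def)
    then show ?thesis using that(3) by (simp add: flow_input_def rows_def)
  qed
  have adj_cong: "adj_ok \<tau>" if "agree W \<rho> \<tau>" "W \<inter> {''deg'', ''adj''} = {}" "adj_ok \<rho>" for W \<rho> \<tau>
  proof -
    have "\<tau> x = \<rho> x" if "x \<in> {''deg'', ''adj''}" for x
      using \<open>agree W \<rho> \<tau>\<close> \<open>W \<inter> _ = {}\<close> that by (auto simp: agree_def)
    then show ?thesis using that(3) by (simp add: adj_ok_def)
  qed
  let ?p0 = "potential K (c s) init_d (\<lambda>_. 0) init_B 1"
  let ?Inv = "\<lambda>\<tau> k. \<exists>r ex d cur B b. pr_inv r ex d cur B b \<and> flow_rel \<tau> r ex d cur B b \<and> k = potential K ex d cur B b"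
  have loop: "runs (While (Leq (Const 1) (var ''top'')) flow_step) \<tau> (Suc 40 * (?p0 div K) + 1)
     (\<lambda>\<tau>. \<exists>k. ?Inv \<tau> k \<and> \<not> bval (Leq (Const 1) (var ''top'')) \<tau>)"
    if I: "flow_input n c s t \<tau>" "adj_ok \<tau>" and R: "flow_rel \<tau> init_r (c s) init_d (\<lambda>_. 0) init_B 1" for \<tau>
  proof (rule runs_While)
    show "?Inv \<tau> ?p0" using init_inv R by blast
    fix \<rho> k assume J: "?Inv \<rho> k" and ag: "agree (writes flow_step) \<tau> \<rho>" and b: "bval (Leq (Const 1) (var ''top'')) \<rho>"
    obtain r ex d cur B b where J: "pr_inv r ex d cur B b" "flow_rel \<rho> r ex d cur B b" "k = potential K ex d cur B b" using J by blast
    have "1 \<le> b" using b J(2) by (simp add: flow_rel_def)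
    moreover have "flow_input n c s t \<rho>" by (rule inp_cong[OF ag _ I(1)]) simp
    moreover have "adj_ok \<rho>" by (rule adj_cong[OF ag _ I(2)]) simp
    ultimately have "runs flow_step \<rho> 40 (\<lambda>\<rho>. \<exists>r' ex' d' cur' B' b'. pr_inv r' ex' d' cur' B' b' \<and> flow_rel \<rho> r' ex' d' cur' B' b' \<and>
       potential K ex' d' cur' B' b' + K \<le> potential K ex d cur B b)"
      using step_runs[OF J(1,2) _ _ _ K] by blast
    then show "runs flow_step \<rho> 40 (\<lambda>\<rho>. \<exists>l. ?Inv \<rho> l \<and> l + K \<le> k)"
    proof (rule runs_weaken)
      fix \<upsilon> assume "\<exists>r' ex' d' cur' B' b'. pr_inv r' ex' d' cur' B' b' \<and> flow_rel \<upsilon> r' ex' d' cur' B' b' \<and>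
       potential K ex' d' cur' B' b' + K \<le> potential K ex d cur B b"
      then show "\<exists>l. ?Inv \<upsilon> l \<and> l + K \<le> k" unfolding J(3) by blast
    qed simp
  qed (use K in simp)
  have "runs flow_program \<sigma> (20 * (n * n) + (19 * (n * n) + ((Suc 40 * (?p0 div K) + 1) + 40 * (n * n)))) ?Q"
    unfolding flow_program_def
  proof (rule runs_Seq[OF prepare_runs[OF inp]], goal_cases)
    case (1 \<tau>)
    have i1: "flow_input n c s t \<tau>" by (rule inp_cong[OF 1(2) _ inp]) simp
    have "\<forall>v<n. \<forall>w<n. \<tau> ''r'' (v * n + w) = c v w"
      "\<forall>v<n. \<tau> ''ex'' v = 0 \<and> \<tau> ''d'' v = 1 \<and> \<tau> ''cur'' v = 0 \<and> \<tau> ''cnt'' v = 0" and a1: "adj_ok \<tau>"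
      using 1(1) by auto
    note sr = saturate_runs[OF i1 this(1,2)]
    show ?case
    proof (rule runs_Seq[OF sr], goal_cases)
      case (1 \<tau>2)
      have i2: "flow_input n c s t \<tau>2" by (rule inp_cong[OF 1(2) _ i1]) simp
      have a2: "adj_ok \<tau>2" by (rule adj_cong[OF 1(2) _ a1]) simp
      show ?case
      proof (rule runs_Seq[OF loop[OF i2 a2 1(1)]], goal_cases)
        case (1 \<tau>3)
        have i3: "flow_input n c s t \<tau>3" by (rule inp_cong[OF 1(2) _ i2]) simp
        obtain r ex d cur B b where J: "pr_inv r ex d cur B b" "flow_rel \<tau>3 r ex d cur B b" and nb: "\<not> bval (Leq (Const 1) (var ''top'')) \<tau>3"
          using 1(1) by blast
        have "b = 0" using J(2) nb by (simp add: flow_rel_def)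
        then show ?case using finish_runs J i3 by blast
      qed
    qed
  qed
  then show ?thesis
  proof (rule runs_weaken)
    have "?p0 \<le> 18 * (K * K * (n * n))" by (rule init_potential[OF K M])
    also have "\<dots> = K * (18 * (K * (n * n)))" by simp
    finally have "?p0 div K \<le> K * (18 * (K * (n * n))) div K" by (rule div_le_mono)
    then have p: "?p0 div K \<le> 18 * (K * (n * n))" using K by simp
    have "1 * (n * n) \<le> K * (n * n)" using K by (rule mult_le_mono1)
    then have "n * n \<le> K * (n * n)" by simp
    moreover have "1 \<le> n * n" using s by auto
    moreover have "Suc 40 * (?p0 div K) = 41 * (?p0 div K)" by simp
    ultimately show "20 * (n * n) + (19 * (n * n) + ((Suc 40 * (?p0 div K) + 1) + 40 * (n * n))) \<le> 1000 * (K * (n * n))"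
      using p by linarith
  qed
qed

end

section \<open>Numbered instances and their weight matrices\<close>

text \<open>\<open>cut_value\<close> does not involve the terminals of the locale, so only the size
  and the matrix are arguments here.\<close>

abbreviation matrix_cut :: "nat \<Rightarrow> (nat \<Rightarrow> nat \<Rightarrow> nat) \<Rightarrow> nat set \<Rightarrow> nat" where
  "matrix_cut \<equiv> flow_network.cut_value"

definition matrix_min_cut :: "nat \<Rightarrow> (nat \<Rightarrow> nat \<Rightarrow> nat) \<Rightarrow> nat \<Rightarrow> nat \<Rightarrow> nat set \<Rightarrow> bool" where
  "matrix_min_cut n c s t S \<longleftrightarrow> S \<subseteq> {..<n} \<and> s \<in> S \<and> t \<notin> S \<and>
     (\<forall>S'. s \<in> S' \<longrightarrow> t \<notin> S' \<longrightarrow> matrix_cut n c S \<le> matrix_cut n c S')"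

definition support :: "nat \<Rightarrow> (nat \<Rightarrow> nat \<Rightarrow> nat) \<Rightarrow> (nat \<times> nat) set" where
  "support n c = {(v, w). v < n \<and> w < n \<and> 0 < c v w}"

lemma finite_support [simp]: "finite (support n c)"
  by (rule finite_subset[of _ "{..<n} \<times> {..<n}"]) (auto simp: support_def)

locale numbered_nfi =
  fixes I :: "(nat, nat) nfi" and n m :: nat and a b :: "nat \<Rightarrow> nat"
  assumes I: "nfi_instance I" and num: "numbered I n m a b" and m: "0 < m"
begin

abbreviation "G \<equiv> graph I"

lemma G: "mgraph G" "verts G = {..<n}" "edges G = {..<m}" "\<And>e. e < m \<Longrightarrow> ends G e = {a e, b e}"
  "source I < n" "sink I < n" "source I \<noteq> sink I"
  using I num by (auto simp: nfi_instance_def numbered_def)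

lemma n_pos: "2 \<le> n" using G(5-7) by simp

lemma ends_less: assumes "e < m" shows "a e < n" "b e < n" "a e \<noteq> b e"
proof -
  have "ends G e \<subseteq> verts G" "card (ends G e) = 2" using G(1,3) assms by (auto simp: mgraph_def)
  then have "{a e, b e} \<subseteq> {..<n}" "card {a e, b e} = 2" using G(2) G(4)[OF assms] by auto
  then show "a e < n" "b e < n" "a e \<noteq> b e" by auto
qed

definition wmat :: "nat set \<Rightarrow> (nat \<Rightarrow> nat) \<Rightarrow> nat \<Rightarrow> nat \<Rightarrow> nat" where
  "wmat F w x y = (\<Sum>e\<in>F. if {a e, b e} = {x, y} then w e else 0)"

lemma wmat_network:
  assumes "F \<subseteq> {..<m}" "s < n" "t < n" "s \<noteq> t"
  shows "flow_network n (wmat F w) s t"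
proof
  show "wmat F w x y = wmat F w y x" for x y by (simp add: wmat_def insert_commute)
  show "wmat F w x x = 0" for x
  proof -
    have "{a e, b e} \<noteq> {x, x}" if "e \<in> F" for e using ends_less(3)[of e] assms(1) that by auto
    then show ?thesis unfolding wmat_def by (intro sum.neutral ballI) auto
  qed
qed (use assms in auto)

lemma matrix_cut_wmat:
  assumes F: "F \<subseteq> {..<m}"
  shows "matrix_cut n (wmat F w) D = sum w (F \<inter> cut_edges G D)"
proof -
  have fF: "finite F" using F finite_subset by blast
  \<comment> \<open>The terminals 0 and 1 are arbitrary; some network is required to unfold
    \<open>cut_value\<close>.\<close>
  have net: "flow_network n (wmat F w) 0 1" using wmat_network[OF F, of 0 1] n_pos by simp
  have "matrix_cut n (wmat F w) D = (\<Sum>x\<in>{..<n} \<inter> D. \<Sum>y\<in>{..<n} - D. \<Sum>e\<in>F. if {a e, b e} = {x, y} then w e else 0)"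
    unfolding flow_network.cut_value_def[OF net] wmat_def ..
  also have "\<dots> = (\<Sum>x\<in>{..<n} \<inter> D. \<Sum>e\<in>F. \<Sum>y\<in>{..<n} - D. if {a e, b e} = {x, y} then w e else 0)"
    by (intro sum.cong refl sum.swap)
  also have "\<dots> = (\<Sum>e\<in>F. \<Sum>x\<in>{..<n} \<inter> D. \<Sum>y\<in>{..<n} - D. if {a e, b e} = {x, y} then w e else 0)"
    by (rule sum.swap)
  also have "\<dots> = (\<Sum>e\<in>F. if e \<in> cut_edges G D then w e else 0)"
  proof (intro sum.cong refl)
    fix e assume "e \<in> F"
    then have e: "e < m" using F by auto
    note ab = ends_less[OF e]
    have cut: "e \<in> cut_edges G D \<longleftrightarrow> (a e \<in> D) \<noteq> (b e \<in> D)" using in_cut_edges[OF G(1) _ G(4)[OF e]] G(3) e by simp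
    have single: "(\<Sum>x\<in>{..<n} \<inter> D. \<Sum>y\<in>{..<n} - D. if {a e, b e} = {x, y} then w e else 0) = w e"
      if p: "{p, q} = {a e, b e}" "p \<in> D" "q \<notin> D" for p q
    proof -
      have pq: "p < n" "q < n" using p ab by (auto simp: doubleton_eq_iff)
      have "(\<Sum>x\<in>{..<n} \<inter> D. \<Sum>y\<in>{..<n} - D. if {a e, b e} = {x, y} then w e else 0)
          = (\<Sum>x\<in>{..<n} \<inter> D. \<Sum>y\<in>{..<n} - D. if x = p then if y = q then w e else 0 else 0)"
      proof (intro sum.cong refl)
        fix x y assume "x \<in> {..<n} \<inter> D" "y \<in> {..<n} - D"
        then show "(if {a e, b e} = {x, y} then w e else 0) = (if x = p then if y = q then w e else 0 else 0)"
          using p by (auto simp: p(1)[symmetric] doubleton_eq_iff)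
      qed
      also have "\<dots> = (\<Sum>x\<in>{..<n} \<inter> D. if x = p then \<Sum>y\<in>{..<n} - D. if y = q then w e else 0 else 0)"
        by (intro sum.cong refl) auto
      also have "\<dots> = w e" using pq p(2,3) by simp
      finally show ?thesis .
    qed
    show "(\<Sum>x\<in>{..<n} \<inter> D. \<Sum>y\<in>{..<n} - D. if {a e, b e} = {x, y} then w e else 0) = (if e \<in> cut_edges G D then w e else 0)"
    proof (cases "(a e \<in> D) \<noteq> (b e \<in> D)")
      case True
      then show ?thesis using single[of "a e" "b e"] single[of "b e" "a e"] cut by (cases "a e \<in> D") (auto simp: insert_commute)
    next
      case False
      have "{a e, b e} \<noteq> {x, y}" if "x \<in> D" "y \<notin> D" for x y using False that by (auto simp: doubleton_eq_iff)
      then have "(\<Sum>x\<in>{..<n} \<inter> D. \<Sum>y\<in>{..<n} - D. if {a e, b e} = {x, y} then w e else 0) = 0" by (intro sum.neutral ballI) auto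
      then show ?thesis using False cut by simp
    qed
  qed
  also have "\<dots> = sum w (F \<inter> cut_edges G D)" using fF by (simp add: sum.inter_restrict)
  finally show ?thesis .
qed

lemma card_support_wmat:
  assumes F: "F \<subseteq> {..<m}"
  shows "card (support n (wmat F w)) \<le> 2 * m"
proof -
  have "support n (wmat F w) \<subseteq> (\<lambda>e. (a e, b e)) ` {..<m} \<union> (\<lambda>e. (b e, a e)) ` {..<m}"
  proof
    fix p assume "p \<in> support n (wmat F w)"
    then obtain x y where p: "p = (x, y)" "wmat F w x y \<noteq> 0" by (auto simp: support_def)
    have "\<exists>e\<in>F. {a e, b e} = {x, y}"
    proof (rule ccontr)
      assume "\<not> ?thesis"
      then have "wmat F w x y = 0" by (simp add: wmat_def)
      then show False using p by simp
    qed
    then obtain e where "e < m" "{a e, b e} = {x, y}" using F by auto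
    then show "p \<in> (\<lambda>e. (a e, b e)) ` {..<m} \<union> (\<lambda>e. (b e, a e)) ` {..<m}"
      using p by (auto simp: doubleton_eq_iff)
  qed
  then have "card (support n (wmat F w)) \<le> card ((\<lambda>e. (a e, b e)) ` {..<m} \<union> (\<lambda>e. (b e, a e)) ` {..<m})"
    by (intro card_mono) auto
  also have "\<dots> \<le> card ((\<lambda>e. (a e, b e)) ` {..<m}) + card ((\<lambda>e. (b e, a e)) ` {..<m})" by (rule card_Un_le)
  also have "\<dots> \<le> m + m" using card_image_le[of "{..<m}"] by (intro add_mono) (auto intro: order_trans[OF card_image_le])
  finally show ?thesis by simp
qed

lemma wmat_insert: "finite F \<Longrightarrow> z \<notin> F \<Longrightarrow> wmat (insert z F) w x y = wmat F w x y + (if {a z, b z} = {x, y} then w z else 0)"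
  by (simp add: wmat_def)

lemma wmat_remove: "finite F \<Longrightarrow> z \<in> F \<Longrightarrow> wmat (F - {z}) w x y = wmat F w x y - (if {a z, b z} = {x, y} then w z else 0)"
  by (simp add: wmat_def sum_diff1_nat)

lemma mat_rel_edge:
  assumes f: "mat_rel n f (wmat F w)" and z: "z < m"
    and new: "\<And>x y. wmat F' w x y = (if {a z, b z} = {x, y} then g (wmat F w x y) else wmat F w x y)"
  shows "mat_rel n (f(a z * n + b z := g (f (a z * n + b z)), b z * n + a z := g (f (b z * n + a z)))) (wmat F' w)"
  unfolding mat_rel_def
proof (intro allI impI)
  fix x y assume xy: "x < n" "y < n"
  note ab = ends_less[OF z]
  have 1: "x * n + y = a z * n + b z \<longleftrightarrow> x = a z \<and> y = b z" by (rule mat_index) (use xy ab in auto)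
  have 2: "x * n + y = b z * n + a z \<longleftrightarrow> x = b z \<and> y = a z" by (rule mat_index) (use xy ab in auto)
  have f': "f (x * n + y) = wmat F w x y" using mat_relD[OF f xy] .
  show "(f(a z * n + b z := g (f (a z * n + b z)), b z * n + a z := g (f (b z * n + a z)))) (x * n + y) = wmat F' w x y"
  proof (cases "x = a z \<and> y = b z \<or> x = b z \<and> y = a z")
    case True
    then show ?thesis
    proof
      assume xy: "x = a z \<and> y = b z"
      then have "a z * n + b z \<noteq> b z * n + a z" using 2 ab(3) by auto
      then show ?thesis using xy f' by (simp add: new)
    next
      assume xy: "x = b z \<and> y = a z"
      then have "{a z, b z} = {x, y}" by auto
      then show ?thesis using xy f' by (simp add: new)
    qed
  next
    case False
    then have "{a z, b z} \<noteq> {x, y}" by (auto simp: doubleton_eq_iff)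
    moreover have "x * n + y \<noteq> a z * n + b z" "x * n + y \<noteq> b z * n + a z" using False 1 2 by auto
    ultimately show ?thesis using f' by (simp add: new)
  qed
qed

lemma mat_rel_add_edge:
  assumes "mat_rel n f (wmat F w)" "z < m" "finite F" "z \<notin> F"
  shows "mat_rel n (f(a z * n + b z := f (a z * n + b z) + w z, b z * n + a z := f (b z * n + a z) + w z)) (wmat (insert z F) w)"
  by (rule mat_rel_edge[OF assms(1,2), of "insert z F" "\<lambda>k. k + w z"]) (simp add: wmat_insert[OF assms(3,4)])

lemma mat_rel_remove_edge:
  assumes "mat_rel n f (wmat F w)" "z < m" "finite F" "z \<in> F"
  shows "mat_rel n (f(a z * n + b z := f (a z * n + b z) - w z, b z * n + a z := f (b z * n + a z) - w z)) (wmat (F - {z}) w)"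
  by (rule mat_rel_edge[OF assms(1,2), of "F - {z}" "\<lambda>k. k - w z"]) (simp add: wmat_remove[OF assms(3,4)])

subsection \<open>Local connectivity by minimum cuts of the matrix\<close>

lemma cut_low:
  assumes L: "L \<subseteq> {..<m}"
  shows "cut_weight (with_edges G L) (cap I) D = matrix_cut n (wmat L (cap I)) D"
  using L G(3) by (simp add: matrix_cut_wmat cut_edges_with_edges)

lemma low_conn_step:
  assumes L: "L \<subseteq> {..<m}" and X: "matrix_min_cut n (wmat L (cap I)) s t X" and st: "s < n" "t < n"
    and ab: "x \<in> X" "y \<notin> X" "y < n"
  shows "low_conn I L \<theta> x y \<longleftrightarrow> low_conn I L \<theta> x s \<and> \<theta> < matrix_cut n (wmat L (cap I)) X \<and> low_conn I L \<theta> t y"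
proof -
  have L': "L \<subseteq> edges G" using L G(3) by simp
  interpret cut_function "{..<n}" "cut_weight (with_edges G L) (cap I)"
    rewrites "cut_function.conn {..<n} (cut_weight (with_edges G L) (cap I)) = low_conn I L"
    using cut_function_graph[OF mgraph_low[OF I L'], of "cap I"] by (simp_all add: low_conn_def G(2))
  have "X \<subseteq> {..<n}" "s \<in> X" "t \<notin> X" "\<And>D. s \<in> D \<Longrightarrow> t \<notin> D \<Longrightarrow> matrix_cut n (wmat L (cap I)) X \<le> matrix_cut n (wmat L (cap I)) D"
    using X by (auto simp: matrix_min_cut_def)
  then show ?thesis
    using conn_across_min_cut[of X s t x y \<theta>] st ab by (simp add: cut_low[OF L])
qed

lemma low_conn_equiv:
  assumes L: "L \<subseteq> {..<m}"
  shows "low_conn I L \<theta> x x" "low_conn I L \<theta> x y \<Longrightarrow> low_conn I L \<theta> y x"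
    "low_conn I L \<theta> x y \<Longrightarrow> low_conn I L \<theta> y z \<Longrightarrow> low_conn I L \<theta> x z"
proof -
  have L': "L \<subseteq> edges G" using L G(3) by simp
  interpret cut_function "{..<n}" "cut_weight (with_edges G L) (cap I)"
    rewrites "cut_function.conn {..<n} (cut_weight (with_edges G L) (cap I)) = low_conn I L"
    using cut_function_graph[OF mgraph_low[OF I L'], of "cap I"] by (simp_all add: low_conn_def G(2))
  show "low_conn I L \<theta> x x" "low_conn I L \<theta> x y \<Longrightarrow> low_conn I L \<theta> y x"
    "low_conn I L \<theta> x y \<Longrightarrow> low_conn I L \<theta> y z \<Longrightarrow> low_conn I L \<theta> x z"
    using conn_refl conn_sym conn_trans by blast+
qed

text \<open>Invariant of the flow-equivalent tree construction: the vertices below \<open>i\<close> represent the groups of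
  the current partition, and all connectivities between different groups are determined by those
  inside the groups and by the matrix \<open>\<Lambda>\<close> on the representatives.\<close>

definition rep_of :: "nat \<Rightarrow> (nat \<Rightarrow> nat) \<Rightarrow> nat \<Rightarrow> nat" where
  "rep_of i par x = (if x < i then x else par x)"

definition tree_inv :: "nat set \<Rightarrow> nat \<Rightarrow> (nat \<Rightarrow> nat) \<Rightarrow> (nat \<Rightarrow> nat \<Rightarrow> nat) \<Rightarrow> bool" where
  "tree_inv L i par \<Lambda> \<longleftrightarrow> (\<forall>x. i \<le> x \<longrightarrow> x < n \<longrightarrow> par x < i) \<and>
     (\<forall>x<n. \<forall>y<n. \<forall>\<theta>. rep_of i par x \<noteq> rep_of i par y \<longrightarrow>
        (low_conn I L \<theta> x y \<longleftrightarrow> low_conn I L \<theta> x (rep_of i par x) \<and>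
           \<theta> < \<Lambda> (rep_of i par x) (rep_of i par y) \<and> low_conn I L \<theta> (rep_of i par y) y))"

text \<open>Gusfield's step: only the group of \<open>par i\<close> is split, by moving its members
  in \<open>X\<close> to \<open>i\<close>, although \<open>X\<close> may cut through other groups as
  well. By \<open>conn_across_min_cut\<close> this is harmless for connectivities. The resulting
  tree is right in its values, while its edges need not induce minimum cuts.\<close>

lemma tree_inv_step:
  assumes L: "L \<subseteq> {..<m}" and inv: "tree_inv L i par \<Lambda>" and i: "1 \<le> i" "i < n"
    and X: "matrix_min_cut n (wmat L (cap I)) i (par i) X"
    and sym: "\<And>x y. x < i \<Longrightarrow> y < i \<Longrightarrow> x \<noteq> y \<Longrightarrow> \<Lambda> x y = \<Lambda> y x"
  defines "val \<equiv> matrix_cut n (wmat L (cap I)) X"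
  assumes par': "\<And>x. i < x \<Longrightarrow> x < n \<Longrightarrow> par' x = (if x \<in> X \<and> par x = par i then i else par x)"
    and old: "\<And>x y. x < i \<Longrightarrow> y < i \<Longrightarrow> x \<noteq> y \<Longrightarrow> \<Lambda>' x y = \<Lambda> x y"
    and new: "\<And>x. x < i \<Longrightarrow> \<Lambda>' i x = (if x = par i then val else min val (\<Lambda> (par i) x))"
      "\<And>x. x < i \<Longrightarrow> \<Lambda>' x i = \<Lambda>' i x"
  shows "tree_inv L (Suc i) par' \<Lambda>'"
proof -
  define t where "t = par i"
  let ?r = "rep_of i par" and ?r' = "rep_of (Suc i) par'"
  note equiv = low_conn_equiv[OF L]
  have ti: "t < i" using inv i by (auto simp: tree_inv_def t_def)
  then have tn: "t < n" using i by simp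
  have parlt: "par x < i" if "i \<le> x" "x < n" for x using inv that by (auto simp: tree_inv_def)
  have rlt: "?r x < i" if "x < n" for x using parlt that by (auto simp: rep_of_def)
  have iX: "i \<in> X" "t \<notin> X" using X by (auto simp: matrix_min_cut_def t_def)
  have rt: "?r i = t" by (simp add: rep_of_def t_def)
  have I1: "low_conn I L \<theta> x y \<longleftrightarrow> low_conn I L \<theta> x (?r x) \<and> \<theta> < \<Lambda> (?r x) (?r y) \<and> low_conn I L \<theta> (?r y) y"
    if "x < n" "y < n" "?r x \<noteq> ?r y" for x y \<theta> using inv that by (simp add: tree_inv_def)
  have split: "low_conn I L \<theta> x y \<longleftrightarrow> low_conn I L \<theta> x i \<and> \<theta> < val \<and> low_conn I L \<theta> t y"
    if "x \<in> X" "y \<notin> X" "y < n" for x y \<theta>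
    unfolding val_def using low_conn_step[OF L X, of x y \<theta>] i tn that by (simp add: t_def)
  have r': "?r' x = (if x = i \<or> (x \<in> X \<and> ?r x = t \<and> i < x) then i else ?r x)" if "x < n" for x
  proof -
    consider "x < i" | "x = i" | "i < x" by linarith
    then show ?thesis using par'[of x] that by cases (simp_all add: rep_of_def t_def)
  qed
  have inside: "x \<in> X \<and> ?r x = t" if "x < n" "?r' x = i" for x
    using r'[OF that(1)] that rlt[OF that(1)] iX rt by (auto split: if_splits)
  have outside: "?r' x = ?r x \<and> (?r x = t \<longrightarrow> x \<notin> X)" if "x < n" "?r' x \<noteq> i" for x
  proof -
    have "x \<noteq> i" using r'[OF that(1)] that by auto
    moreover have "x \<notin> X" if "x < i" "?r x = t" using that iX by (simp add: rep_of_def)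
    ultimately show ?thesis using r'[OF that(1)] that by (auto split: if_splits)
  qed
  have main: "low_conn I L \<theta> x y \<longleftrightarrow> low_conn I L \<theta> x i \<and> \<theta> < \<Lambda>' i (?r' y) \<and> low_conn I L \<theta> (?r' y) y"
    if xy: "x < n" "y < n" and rx: "?r' x = i" and ry: "?r' y \<noteq> i" for x y \<theta>
  proof -
    have x: "x \<in> X" "?r x = t" using inside[OF xy(1) rx] by auto
    have y: "?r' y = ?r y" "?r y = t \<Longrightarrow> y \<notin> X" using outside[OF xy(2) ry] by auto
    show ?thesis
    proof (cases "?r y = t")
      case True
      have "\<Lambda>' i t = val" using new(1)[OF ti] by (simp add: t_def)
      then show ?thesis using split[OF x(1) y(2)[OF True] xy(2), of \<theta>] y(1) True by simp
    next
      case False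
      have L1: "\<Lambda>' i (?r y) = min val (\<Lambda> t (?r y))" using new(1)[OF rlt[OF xy(2)]] False by (simp add: t_def)
      have "low_conn I L \<theta> x y \<longleftrightarrow> low_conn I L \<theta> x t \<and> \<theta> < \<Lambda> t (?r y) \<and> low_conn I L \<theta> (?r y) y"
        using I1[OF xy, of \<theta>] x(2) False by simp
      \<comment> \<open>Since \<open>t\<close> is outside \<open>X\<close>, the cut also decomposes
        the connectivity of \<open>x\<close> and \<open>t\<close>; this is where the minimum of
        \<open>val\<close> and \<open>\<Lambda> t (?r y)\<close> comes from.\<close>
      moreover have "low_conn I L \<theta> x t \<longleftrightarrow> low_conn I L \<theta> x i \<and> \<theta> < val"
        using split[OF x(1) iX(2) tn, of \<theta>] equiv(1) by simp
      ultimately show ?thesis using y(1) L1 by auto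
    qed
  qed
  have sym': "low_conn I L \<theta> x y = low_conn I L \<theta> y x" for x y \<theta> using equiv(2) by blast
  show ?thesis unfolding tree_inv_def
  proof (intro conjI allI impI)
    fix x assume "Suc i \<le> x" "x < n"
    then show "par' x < Suc i" using par'[of x] parlt[of x] by auto
  next
    fix x y \<theta> assume xy: "x < n" "y < n" and ne: "?r' x \<noteq> ?r' y"
    show "low_conn I L \<theta> x y \<longleftrightarrow> low_conn I L \<theta> x (?r' x) \<and> \<theta> < \<Lambda>' (?r' x) (?r' y) \<and> low_conn I L \<theta> (?r' y) y"
    proof (cases "?r' x = i")
      case True
      then show ?thesis using main[OF xy] ne by simp
    next
      case nx: False
      show ?thesis
      proof (cases "?r' y = i")
        case True
        have "?r' x < i" using outside[OF xy(1) nx] rlt[OF xy(1)] by simp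
        then have "\<Lambda>' (?r' x) i = \<Lambda>' i (?r' x)" using new(2) by simp
        then show ?thesis using main[OF xy(2,1) True nx, of \<theta>] True sym'[of \<theta> x y] sym'[of \<theta> y i] sym'[of \<theta> "?r' x" x] by auto
      next
        case False
        have e: "?r' x = ?r x" "?r' y = ?r y" using outside[OF xy(1) nx] outside[OF xy(2) False] by auto
        then have "\<Lambda>' (?r x) (?r y) = \<Lambda> (?r x) (?r y)" using old rlt xy ne by simp
        then show ?thesis using I1[OF xy, of \<theta>] ne e by simp
      qed
    qed
  qed
qed

lemma tree_inv_final:
  assumes "tree_inv L n par \<Lambda>" "x < n" "y < n" "x \<noteq> y" "L \<subseteq> {..<m}"
  shows "low_conn I L \<theta> x y \<longleftrightarrow> \<theta> < \<Lambda> x y"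
  using assms low_conn_equiv(1)[OF assms(5)] by (auto simp: tree_inv_def rep_of_def)

lemma thresholds_matrix:
  assumes "\<And>x y \<theta>. x < n \<Longrightarrow> y < n \<Longrightarrow> x \<noteq> y \<Longrightarrow> low_conn I L \<theta> x y \<longleftrightarrow> \<theta> < \<Lambda> x y"
  shows "thresholds I L = {\<Lambda> x y | x y. x < n \<and> y < n \<and> x \<noteq> y}"
proof (intro equalityI subsetI)
  fix \<theta> assume "\<theta> \<in> thresholds I L"
  then obtain x y where xy: "x < n" "y < n" "x \<noteq> y" "\<forall>\<theta>'. low_conn I L \<theta>' x y \<longleftrightarrow> \<theta>' < \<theta>"
    by (auto simp: thresholds_def G(2))
  then have "\<theta>' < \<Lambda> x y \<longleftrightarrow> \<theta>' < \<theta>" for \<theta>' using assms by blast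
  then have "\<Lambda> x y = \<theta>" by (metis linorder_neq_iff)
  then show "\<theta> \<in> {\<Lambda> x y | x y. x < n \<and> y < n \<and> x \<noteq> y}" using xy by blast
next
  fix \<theta> assume "\<theta> \<in> {\<Lambda> x y | x y. x < n \<and> y < n \<and> x \<noteq> y}"
  then obtain x y where xy: "\<theta> = \<Lambda> x y" "x < n" "y < n" "x \<noteq> y" by blast
  show "\<theta> \<in> thresholds I L" unfolding xy(1) thresholds_def mem_Collect_eq G(2)
  proof (rule bexI[of _ x], rule bexI[of _ y], intro conjI allI)
    show "low_conn I L \<theta>' x y \<longleftrightarrow> \<theta>' < \<Lambda> x y" for \<theta>' by (rule assms[OF xy(2-4)])
  qed (use xy in auto)
qed

subsection \<open>Contracted matrices\<close>

text \<open>The contraction keeps the vertex set \<open>{..<n}\<close>: representatives carry the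
  summed weights and all other vertices become isolated, so the flow program can be used
  unchanged.\<close>

definition contracted_mat :: "(nat \<Rightarrow> nat) \<Rightarrow> (nat \<Rightarrow> nat \<Rightarrow> nat) \<Rightarrow> nat \<Rightarrow> nat \<Rightarrow> nat" where
  "contracted_mat rep h x y = (\<Sum>v<n. \<Sum>w<n. if rep v \<noteq> rep w \<and> rep v = x \<and> rep w = y then h v w else 0)"

lemma contracted_network:
  assumes sym: "\<And>v w. v < n \<Longrightarrow> w < n \<Longrightarrow> h v w = h w v" and st: "s < n" "t < n" "s \<noteq> t"
  shows "flow_network n (contracted_mat rep h) s t"
proof
  show "contracted_mat rep h x y = contracted_mat rep h y x" for x y
  proof -
    have "contracted_mat rep h x y = (\<Sum>w<n. \<Sum>v<n. if rep v \<noteq> rep w \<and> rep v = x \<and> rep w = y then h v w else 0)"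
      unfolding contracted_mat_def by (rule sum.swap)
    also have "\<dots> = contracted_mat rep h y x"
      unfolding contracted_mat_def using sym by (intro sum.cong refl) auto
    finally show ?thesis .
  qed
  show "contracted_mat rep h x x = 0" for x
    unfolding contracted_mat_def by (intro sum.neutral ballI) auto
qed (use st in auto)

lemma contracted_cut:
  assumes rep: "\<And>v. v < n \<Longrightarrow> rep v < n"
    and net: "flow_network n (contracted_mat rep h) s t" "flow_network n h s' t'"
  shows "matrix_cut n (contracted_mat rep h) S = matrix_cut n h {v. v < n \<and> rep v \<in> S}"
proof -
  let ?A = "{..<n} \<inter> S" and ?B = "{..<n} - S"
  let ?f = "\<lambda>x y v w. if rep v \<noteq> rep w \<and> rep v = x \<and> rep w = y then h v w else 0"
  have inner: "(\<Sum>x\<in>?A. \<Sum>y\<in>?B. ?f x y v w) = (if rep v \<in> S \<and> rep w \<notin> S then h v w else 0)"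
    if "v < n" "w < n" for v w
  proof -
    have "(\<Sum>x\<in>?A. \<Sum>y\<in>?B. ?f x y v w)
        = (\<Sum>x\<in>?A. if x = rep v then \<Sum>y\<in>?B. if y = rep w then h v w else 0 else 0)"
    proof (intro sum.cong refl)
      fix x assume x: "x \<in> ?A"
      show "(\<Sum>y\<in>?B. ?f x y v w) = (if x = rep v then \<Sum>y\<in>?B. if y = rep w then h v w else 0 else 0)"
      proof (cases "x = rep v")
        case True
        then have "(\<Sum>y\<in>?B. ?f x y v w) = (\<Sum>y\<in>?B. if y = rep w then h v w else 0)"
          using x by (intro sum.cong refl) auto
        then show ?thesis using True by simp
      qed (auto intro!: sum.neutral)
    qed
    then show ?thesis using rep that by auto
  qed
  have "matrix_cut n (contracted_mat rep h) S = (\<Sum>x\<in>?A. \<Sum>y\<in>?B. \<Sum>v<n. \<Sum>w<n. ?f x y v w)"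
    unfolding flow_network.cut_value_def[OF net(1)] contracted_mat_def ..
  also have "\<dots> = (\<Sum>x\<in>?A. \<Sum>v<n. \<Sum>y\<in>?B. \<Sum>w<n. ?f x y v w)" by (intro sum.cong refl sum.swap)
  also have "\<dots> = (\<Sum>v<n. \<Sum>x\<in>?A. \<Sum>y\<in>?B. \<Sum>w<n. ?f x y v w)" by (rule sum.swap)
  also have "\<dots> = (\<Sum>v<n. \<Sum>x\<in>?A. \<Sum>w<n. \<Sum>y\<in>?B. ?f x y v w)" by (intro sum.cong refl sum.swap)
  also have "\<dots> = (\<Sum>v<n. \<Sum>w<n. \<Sum>x\<in>?A. \<Sum>y\<in>?B. ?f x y v w)" by (intro sum.cong refl sum.swap)
  also have "\<dots> = (\<Sum>v<n. \<Sum>w<n. if rep v \<in> S \<and> rep w \<notin> S then h v w else 0)" using inner by (intro sum.cong refl) auto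
  also have "\<dots> = (\<Sum>v\<in>{..<n} \<inter> {v. v < n \<and> rep v \<in> S}. \<Sum>w\<in>{..<n} - {v. v < n \<and> rep v \<in> S}. h v w)"
  proof -
    have filter: "(\<Sum>w<n. if P w then g w else 0) = (\<Sum>w\<in>{w. w < n \<and> P w}. g w)" for P and g :: "nat \<Rightarrow> nat"
      using sum.inter_filter[of "{..<n}" g P] by simp
    have "(\<Sum>v<n. \<Sum>w<n. if rep v \<in> S \<and> rep w \<notin> S then h v w else 0)
        = (\<Sum>v<n. if rep v \<in> S then \<Sum>w<n. if rep w \<notin> S then h v w else 0 else 0)"
      by (intro sum.cong refl) auto
    also have "\<dots> = (\<Sum>v\<in>{v. v < n \<and> rep v \<in> S}. \<Sum>w\<in>{w. w < n \<and> rep w \<notin> S}. h v w)"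
      by (simp only: filter)
    finally have "(\<Sum>v<n. \<Sum>w<n. if rep v \<in> S \<and> rep w \<notin> S then h v w else 0)
        = (\<Sum>v\<in>{v. v < n \<and> rep v \<in> S}. \<Sum>w\<in>{w. w < n \<and> rep w \<notin> S}. h v w)" .
    moreover have "{w. w < n \<and> rep w \<notin> S} = {..<n} - {v. v < n \<and> rep v \<in> S}"
      "{..<n} \<inter> {v. v < n \<and> rep v \<in> S} = {v. v < n \<and> rep v \<in> S}" by auto
    ultimately show ?thesis by (simp only:)
  qed
  also have "\<dots> = matrix_cut n h {v. v < n \<and> rep v \<in> S}" unfolding flow_network.cut_value_def[OF net(2)] ..
  finally show ?thesis .
qed

lemma card_support_contracted:
  "card (support n (contracted_mat rep h)) \<le> card (support n h)"
proof -
  have "support n (contracted_mat rep h) \<subseteq> (\<lambda>(v, w). (rep v, rep w)) ` support n h"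
  proof
    fix p assume "p \<in> support n (contracted_mat rep h)"
    then obtain x y where p: "p = (x, y)" "contracted_mat rep h x y \<noteq> 0" by (auto simp: support_def)
    obtain v where v: "v \<in> {..<n}" "(\<Sum>w<n. if rep v \<noteq> rep w \<and> rep v = x \<and> rep w = y then h v w else 0) \<noteq> 0"
      using p(2) unfolding contracted_mat_def by (rule sum.not_neutral_contains_not_neutral)
    obtain w where w: "w \<in> {..<n}" "(if rep v \<noteq> rep w \<and> rep v = x \<and> rep w = y then h v w else 0) \<noteq> 0"
      using v(2) by (rule sum.not_neutral_contains_not_neutral)
    then have "(v, w) \<in> support n h" "p = (\<lambda>(v, w). (rep v, rep w)) (v, w)"
      using p v by (auto simp: support_def split: if_splits)
    then show "p \<in> (\<lambda>(v, w). (rep v, rep w)) ` support n h" by (rule rev_image_eqI)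
  qed
  then have "card (support n (contracted_mat rep h)) \<le> card ((\<lambda>(v, w). (rep v, rep w)) ` support n h)"
    by (intro card_mono) auto
  also have "\<dots> \<le> card (support n h)" by (intro card_image_le) simp
  finally show ?thesis .
qed

text \<open>Preimages under \<open>rep\<close> are closed cuts, and a closed \<open>D'\<close> is
  the preimage of its image, so minimising over sets of representatives minimises over closed cuts.
  Vertices representing nobody are isolated and do not affect the weight.\<close>

lemma threshold_cut_of_matrix:
  assumes L: "L \<subseteq> {..<m}" and rep: "\<And>v. v < n \<Longrightarrow> rep v < n"
    and conn: "\<And>v w. v < n \<Longrightarrow> w < n \<Longrightarrow> low_conn I L \<theta> v w \<longleftrightarrow> rep v = rep w"
    and ne: "rep (source I) \<noteq> rep (sink I)"
    and S: "matrix_min_cut n (contracted_mat rep (wmat ({..<m} - L) (cost I))) (rep (source I)) (rep (sink I)) S"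
  defines "D \<equiv> {v. v < n \<and> rep v \<in> S}"
  shows "threshold_cut I L \<theta> D"
    and "sum (cost I) (high_cut I L D) = matrix_cut n (contracted_mat rep (wmat ({..<m} - L) (cost I))) S"
proof -
  let ?h = "wmat ({..<m} - L) (cost I)"
  have net: "flow_network n (contracted_mat rep ?h) (rep (source I)) (rep (sink I))"
    using rep G(5,6) ne by (intro contracted_network) (auto simp: wmat_def insert_commute)
  have neth: "flow_network n ?h (source I) (sink I)" using G(5-7) by (intro wmat_network) auto
  have high: "sum (cost I) (high_cut I L {v. v < n \<and> rep v \<in> S'}) = matrix_cut n (contracted_mat rep ?h) S'" for S'
  proof -
    have "matrix_cut n (contracted_mat rep ?h) S' = matrix_cut n ?h {v. v < n \<and> rep v \<in> S'}"
      by (rule contracted_cut) (use rep net neth in auto)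
    then show ?thesis by (simp add: matrix_cut_wmat high_cut_def G(3))
  qed
  then show "sum (cost I) (high_cut I L D) = matrix_cut n (contracted_mat rep ?h) S" by (simp add: D_def)
  have S': "rep (source I) \<in> S" "rep (sink I) \<notin> S"
    "\<And>S'. rep (source I) \<in> S' \<Longrightarrow> rep (sink I) \<notin> S' \<Longrightarrow> matrix_cut n (contracted_mat rep ?h) S \<le> matrix_cut n (contracted_mat rep ?h) S'"
    using S by (auto simp: matrix_min_cut_def)
  show "threshold_cut I L \<theta> D" unfolding threshold_cut_def
  proof (intro conjI allI impI)
    show "closed_cut I L \<theta> D" using S' G(5,6) conn by (auto simp: closed_cut_def is_cut_def G(2) D_def)
    fix D' assume D': "closed_cut I L \<theta> D'"
    then have c: "D' \<subseteq> {..<n}" "source I \<in> D'" "sink I \<notin> D'" by (simp_all add: closed_cut_def is_cut_def G(2))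
    have c4: "v \<in> D' \<longleftrightarrow> w \<in> D'" if "v < n" "w < n" "rep v = rep w" for v w
    proof -
      have "low_conn I L \<theta> v w" using conn that by simp
      then show ?thesis using D' that unfolding closed_cut_def G(2) by blast
    qed
    have eq: "{v. v < n \<and> rep v \<in> rep ` D'} = D'"
    proof (intro equalityI subsetI)
      fix v assume "v \<in> {v. v < n \<and> rep v \<in> rep ` D'}"
      then obtain w where "v < n" "w \<in> D'" "rep v = rep w" by auto
      then show "v \<in> D'" using c4[of v w] c(1) by auto
    qed (use c(1) in auto)
    have "rep (sink I) \<notin> rep ` D'" using eq c(3) G(6) by auto
    then have "matrix_cut n (contracted_mat rep ?h) S \<le> matrix_cut n (contracted_mat rep ?h) (rep ` D')" using S'(3) c(2) by blast
    then show "sum (cost I) (high_cut I L D) \<le> sum (cost I) (high_cut I L D')"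
      using high[of S] high[of "rep ` D'"] eq by (simp add: D_def)
  qed
qed

subsection \<open>Evaluating a candidate\<close>

text \<open>Once the candidate is removed, all low edges remain, and a high edge remains exactly if
  it does not cross \<open>D\<close>. So the matrix for the evaluation is obtained in one pass over
  matrix entries instead of over edges.\<close>

lemma wmat_evaluation:
  assumes L: "L \<subseteq> {..<m}"
  shows "wmat L w x y + (if x \<in> D \<longleftrightarrow> y \<in> D then wmat ({..<m} - L) w x y else 0) = wmat ({..<m} - high_cut I L D) w x y"
proof -
  have fin: "finite L" using L finite_subset by blast
  have cut: "e \<in> cut_edges G D \<longleftrightarrow> (a e \<in> D) \<noteq> (b e \<in> D)" if "e < m" for e
    using in_cut_edges[OF G(1) _ G(4)[OF that]] G(3) that by simp
  let ?N = "{..<m} - L - cut_edges G D"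
  have "{..<m} - high_cut I L D = L \<union> ?N" using L by (auto simp: high_cut_def G(3))
  then have "wmat ({..<m} - high_cut I L D) w x y = wmat L w x y + wmat ?N w x y"
    using fin by (simp add: wmat_def) (subst sum.union_disjoint; auto)
  moreover have "wmat ?N w x y = (if x \<in> D \<longleftrightarrow> y \<in> D then wmat ({..<m} - L) w x y else 0)"
  proof (cases "x \<in> D \<longleftrightarrow> y \<in> D")
    case True
    have "wmat ({..<m} - L) w x y = wmat ?N w x y" unfolding wmat_def
    proof (rule sum.mono_neutral_right)
      show "\<forall>e\<in>{..<m} - L - ?N. (if {a e, b e} = {x, y} then w e else 0) = 0"
        using True cut by (auto simp: doubleton_eq_iff)
    qed auto
    then show ?thesis using True by simp
  next
    case False
    have "wmat ?N w x y = 0" unfolding wmat_def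
      using False cut by (intro sum.neutral) (auto simp: doubleton_eq_iff)
    then show ?thesis using False by simp
  qed
  ultimately show ?thesis by simp
qed

lemma objective_of_matrix:
  assumes S: "matrix_min_cut n (wmat ({..<m} - R) (cap I)) (source I) (sink I) S"
  shows "objective I R = real (matrix_cut n (wmat ({..<m} - R) (cap I)) S)"
proof -
  let ?H = "with_edges G (edges G - R)"
  have H: "mgraph ?H" using G(1) by (intro mgraph_with_edges) auto
  have w: "cut_weight ?H (cap I) D = matrix_cut n (wmat ({..<m} - R) (cap I)) D" for D
    by (simp add: matrix_cut_wmat cut_edges_with_edges G(3))
  have "is_min_cut ?H (cap I) (source I) (sink I) S"
    using S G(5,6) by (auto simp: is_min_cut_def is_cut_def w matrix_min_cut_def G(2))
  then show ?thesis
    unfolding objective_def w[symmetric] using G(2,5-7) by (intro max_flow_value_eq_min_cut[OF H]) simp_all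
qed

end

section \<open>Computing local connectivities\<close>

text \<open>The flow values are kept in \<open>fl\<close>, which later serves as the list of
  thresholds.\<close>

definition gh_flow :: com where
  "gh_flow = (''fs'' ::= var ''i'' ;; ''ft'' ::= Read ''par'' (var ''i'') ;; flow_program ;;
     Assign ''fl'' (var ''i'') (var ''val''))"

definition gh_regroup :: com where
  "gh_regroup = IfThen (And (Leq (Const 1) (Read ''side'' (var ''x''))) (Equal (Read ''par'' (var ''x'')) (var ''ft'')))
     (Assign ''par'' (var ''x'') (var ''i''))"

definition gh_connect :: com where
  "gh_connect =
     (If (Equal (var ''x'') (var ''ft'')) (''u'' ::= var ''val'')
        (If (Leq (var ''val'') (Read ''lam'' (entry (var ''ft'') (var ''x'')))) (''u'' ::= var ''val'')
           (''u'' ::= Read ''lam'' (entry (var ''ft'') (var ''x'')))) ;;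
      Assign ''lam'' (entry (var ''i'') (var ''x'')) (var ''u'') ;;
      Assign ''lam'' (entry (var ''x'') (var ''i'')) (var ''u''))"

definition gh_step :: com where
  "gh_step = (gh_flow ;; For ''x'' (Plus (var ''i'') (Const 1)) (var ''n'') gh_regroup ;;
     For ''x'' (Const 0) (var ''i'') gh_connect)"

definition gh_program :: com where
  "gh_program =
     (For ''q'' (Const 0) (Read ''row'' (var ''n'')) (Assign ''c'' (var ''q'') (Read ''lo'' (var ''q''))) ;;
      For ''x'' (Const 0) (var ''n'') (Assign ''par'' (var ''x'') (Const 0)) ;;
      For ''i'' (Const 1) (var ''n'') gh_step)"

definition flow_vars :: "string set" where
  "flow_vars = {''x'', ''y'', ''r'', ''adj'', ''deg'', ''ex'', ''d'', ''cur'', ''cnt'', ''top'', ''bk'',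
     ''v'', ''w'', ''dl'', ''lev'', ''g'', ''side'', ''val''}"

lemma writes_gh [simp]:
  "writes gh_flow = {''fs'', ''ft'', ''fl''} \<union> flow_vars"
  "writes gh_regroup = {''par''}"
  "writes gh_connect = {''u'', ''lam''}"
  "writes gh_step = {''fs'', ''ft'', ''fl'', ''par'', ''u'', ''lam''} \<union> flow_vars"
  "writes gh_program = {''q'', ''c'', ''i'', ''fs'', ''ft'', ''fl'', ''par'', ''u'', ''lam''} \<union> flow_vars"
  by (auto simp: gh_flow_def gh_regroup_def gh_connect_def gh_step_def gh_program_def flow_vars_def)

lemma not_flow_vars [simp]:
  "x \<notin> flow_vars" if "x \<in> {''n'', ''m'', ''row'', ''source'', ''sink'', ''budget'', ''a'', ''b'', ''cap'', ''cost'', ''c'', ''i'', ''e'', ''j'', ''k'',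
     ''fs'', ''ft'', ''fl'', ''par'', ''u'', ''lam'', ''lo'', ''hi'', ''hc'', ''rep'', ''theta'', ''ord'', ''found'', ''best'', ''be'', ''bj'', ''bs'', ''ds''}"
  using that by (auto simp: flow_vars_def)

lemma flow_runs:
  assumes \<sigma>: "rows n \<sigma>" "mat_rel n (\<sigma> ''c'') c" and net: "flow_network n c (\<sigma> ''fs'' 0) (\<sigma> ''ft'' 0)"
    and K: "1 \<le> K" "card (support n c) \<le> 2 * (K * K)"
  shows "runs flow_program \<sigma> (1000 * (K * (n * n))) (\<lambda>\<tau>. let S = {v. v < n \<and> \<tau> ''side'' v \<noteq> 0} in
     (\<forall>v<n. \<tau> ''side'' v \<le> 1) \<and> matrix_min_cut n c (\<sigma> ''fs'' 0) (\<sigma> ''ft'' 0) S \<and> \<tau> ''val'' 0 = matrix_cut n c S)"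
proof -
  have "flow_input n c (\<sigma> ''fs'' 0) (\<sigma> ''ft'' 0) \<sigma>" using \<sigma> by (simp add: flow_input_def mat_rel_def)
  from flow_network.flow_program_runs[OF net this K(1)] show ?thesis
    by (rule runs_weaken) (use K(2) in \<open>auto simp: Let_def matrix_min_cut_def support_def\<close>)
qed

context numbered_nfi
begin

definition inst :: "state \<Rightarrow> bool" where
  "inst \<sigma> \<longleftrightarrow> rows n \<sigma> \<and> \<sigma> ''row'' n = n * n \<and> \<sigma> ''m'' 0 = m \<and> \<sigma> ''source'' 0 = source I \<and> \<sigma> ''sink'' 0 = sink I \<and>
     \<sigma> ''budget'' 0 = budget I \<and>
     (\<forall>e<m. \<sigma> ''a'' e = a e \<and> \<sigma> ''b'' e = b e \<and> \<sigma> ''cap'' e = cap I e \<and> \<sigma> ''cost'' e = cost I e)"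

lemma inst_cong:
  assumes "agree W \<sigma> \<tau>" "inst \<sigma>"
    "W \<inter> {''n'', ''row'', ''m'', ''source'', ''sink'', ''budget'', ''a'', ''b'', ''cap'', ''cost''} = {}"
  shows "inst \<tau>"
proof -
  have "\<tau> x = \<sigma> x" if "x \<in> {''n'', ''row'', ''m'', ''source'', ''sink'', ''budget'', ''a'', ''b'', ''cap'', ''cost''}" for x
    using assms(1,3) that by (auto simp: agree_def)
  then show ?thesis using assms(2) by (simp add: inst_def rows_def)
qed

lemma instD:
  assumes "inst \<sigma>"
  shows "rows n \<sigma>" "\<sigma> ''n'' 0 = n" "\<And>i. i < n \<Longrightarrow> \<sigma> ''row'' i = i * n" "\<sigma> ''row'' n = n * n" "\<sigma> ''m'' 0 = m"
    "\<sigma> ''source'' 0 = source I" "\<sigma> ''sink'' 0 = sink I" "\<sigma> ''budget'' 0 = budget I"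
    "\<And>e. e < m \<Longrightarrow> \<sigma> ''a'' e = a e" "\<And>e. e < m \<Longrightarrow> \<sigma> ''b'' e = b e"
    "\<And>e. e < m \<Longrightarrow> \<sigma> ''cap'' e = cap I e" "\<And>e. e < m \<Longrightarrow> \<sigma> ''cost'' e = cost I e"
  using assms by (auto simp: inst_def rows_def)

text \<open>The last conjunct makes the flow values found so far a complete list of the entries of
  \<open>\<Lambda>\<close>. In the end \<open>n - 1\<close> numbers cover all thresholds, and the
  matrix has not to be sorted or searched for distinct values.\<close>

definition gh_inv :: "nat set \<Rightarrow> nat \<Rightarrow> state \<Rightarrow> bool" where
  "gh_inv L i \<tau> \<longleftrightarrow> (let \<Lambda> = mat n (\<tau> ''lam'') in
     tree_inv L i (\<tau> ''par'') \<Lambda> \<and> (\<forall>x<i. \<forall>y<i. x \<noteq> y \<longrightarrow> \<Lambda> x y = \<Lambda> y x) \<and>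
     {\<tau> ''fl'' k | k. 1 \<le> k \<and> k < i} = {\<Lambda> x y | x y. x < i \<and> y < i \<and> x \<noteq> y})"

lemma gh_step_runs:
  assumes L: "L \<subseteq> {..<m}" and K: "1 \<le> K" "m \<le> K * K" and i: "1 \<le> i" "i < n"
    and \<sigma>: "inst \<sigma>" "mat_rel n (\<sigma> ''c'') (wmat L (cap I))" "\<sigma> ''i'' 0 = i" "gh_inv L i \<sigma>"
  shows "runs gh_step \<sigma> (1020 * (K * (n * n))) (gh_inv L (Suc i))"
proof -
  define t where "t = \<sigma> ''par'' i"
  define \<Lambda> where "\<Lambda> = mat n (\<sigma> ''lam'')"
  have inv: "tree_inv L i (\<sigma> ''par'') \<Lambda>" and sym: "\<And>x y. x < i \<Longrightarrow> y < i \<Longrightarrow> x \<noteq> y \<Longrightarrow> \<Lambda> x y = \<Lambda> y x"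
    and fl: "{\<sigma> ''fl'' k | k. 1 \<le> k \<and> k < i} = {\<Lambda> x y | x y. x < i \<and> y < i \<and> x \<noteq> y}"
    using \<sigma>(4) by (auto simp: gh_inv_def \<Lambda>_def Let_def)
  have ti: "t < i" using inv i by (auto simp: tree_inv_def t_def)
  note I\<sigma> = instD[OF \<sigma>(1)]
  define X where "X \<tau> = {v. v < n \<and> \<tau> ''side'' v \<noteq> (0::nat)}" for \<tau> :: state
  define val where "val \<tau> = matrix_cut n (wmat L (cap I)) (X \<tau>)" for \<tau>
  let ?F = "{''fs'', ''ft'', ''fl''} \<union> flow_vars"
  let ?Q1 = "\<lambda>\<tau>. matrix_min_cut n (wmat L (cap I)) i t (X \<tau>) \<and> \<tau> ''val'' 0 = val \<tau> \<and> \<tau> ''ft'' 0 = t \<and> \<tau> ''fl'' = (\<sigma> ''fl'')(i := val \<tau>)"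
  have flow: "runs gh_flow \<sigma> (1 + (1 + (1000 * (K * (n * n)) + 1))) ?Q1"
  proof -
    let ?\<sigma> = "\<sigma>(''fs'' := (\<sigma> ''fs'')(0 := i), ''ft'' := (\<sigma> ''ft'')(0 := t))"
    have net: "flow_network n (wmat L (cap I)) i t" using i ti by (intro wmat_network[OF L]) auto
    have "card (support n (wmat L (cap I))) \<le> 2 * (K * K)" using card_support_wmat[OF L, of "cap I"] K(2) by linarith
    then have fr: "runs flow_program ?\<sigma> (1000 * (K * (n * n))) (\<lambda>\<tau>. let S = {v. v < n \<and> \<tau> ''side'' v \<noteq> 0} in
       (\<forall>v<n. \<tau> ''side'' v \<le> 1) \<and> matrix_min_cut n (wmat L (cap I)) (?\<sigma> ''fs'' 0) (?\<sigma> ''ft'' 0) S \<and> \<tau> ''val'' 0 = matrix_cut n (wmat L (cap I)) S)"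
      using K net \<sigma>(2) I\<sigma>(1) by (intro flow_runs) (auto simp: rows_def)
    have fr': "runs (flow_program ;; Assign ''fl'' (var ''i'') (var ''val'')) ?\<sigma> (1000 * (K * (n * n)) + 1) ?Q1"
    proof (rule runs_Seq[OF fr], goal_cases)
      case (1 \<tau>)
      note A = agreeD[OF 1(2), simplified]
      show ?case by (rule runs_wpI) (use 1(1) \<sigma>(3) in \<open>simp_all add: A Let_def X_def val_def\<close>)
    qed
    show ?thesis unfolding gh_flow_def
    proof (rule runs_Seq[where Q = "\<lambda>\<tau>. \<tau> = \<sigma>(''fs'' := (\<sigma> ''fs'')(0 := i))"], goal_cases)
      case 1 show ?case by (intro runs_wpI) (simp_all add: \<sigma>(3))
    next
      case (2 \<tau>)
      show ?case
        by (rule runs_Seq[where Q = "\<lambda>\<tau>. \<tau> = ?\<sigma>"]) (use 2 fr' \<sigma>(3) in \<open>auto intro!: runs_wpI simp: t_def\<close>)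
    qed
  qed
  have regroup: "runs (For ''x'' (Plus (var ''i'') (Const 1)) (var ''n'') gh_regroup) \<tau> ((3 + 2) * n + 2)
      (\<lambda>\<rho>. \<forall>x. \<rho> ''par'' x = (if i < x \<and> x < n \<and> x \<in> X \<tau> \<and> \<sigma> ''par'' x = t then i else \<sigma> ''par'' x))"
    if Q: "?Q1 \<tau>" and ag: "agree ?F \<sigma> \<tau>" for \<tau>
  proof -
    note A = agreeD[OF ag, simplified]
    have c: "\<tau> ''i'' 0 = i" "\<tau> ''n'' 0 = n" using \<sigma>(3) I\<sigma> by (simp_all add: A)
    show ?thesis
    proof (rule runs_For[where Inv = "\<lambda>y \<rho>. \<forall>x. \<rho> ''par'' x = (if i < x \<and> x < y \<and> x \<in> X \<tau> \<and> \<sigma> ''par'' x = t then i else \<sigma> ''par'' x)"])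
      fix \<rho> assume ag2: "agree (insert ''x'' (writes gh_regroup)) \<tau> \<rho>"
      show "aval (var ''n'') \<rho> = n" by (simp add: agreeD[OF ag2, simplified] c)
    next
      fix y \<rho> assume y: "aval (Plus (var ''i'') (Const 1)) \<tau> \<le> y" "y < n"
        "\<forall>x. \<rho> ''par'' x = (if i < x \<and> x < y \<and> x \<in> X \<tau> \<and> \<sigma> ''par'' x = t then i else \<sigma> ''par'' x)" "\<rho> ''x'' 0 = y"
        and ag2: "agree (insert ''x'' (writes gh_regroup)) \<tau> \<rho>"
      note B = agreeD[OF ag2, simplified]
      have py: "\<rho> ''par'' y = \<sigma> ''par'' y" using y(3) by simp
      have iy: "i < y" using y(1) c by simp
      have ft: "\<rho> ''ft'' 0 = t" "\<rho> ''i'' 0 = i" "\<rho> ''side'' y = \<tau> ''side'' y" using Q c by (simp_all add: B)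
      have yX: "y \<in> X \<tau> \<longleftrightarrow> \<tau> ''side'' y \<noteq> 0" using y(2) by (simp add: X_def)
      show "runs gh_regroup \<rho> 3 (\<lambda>\<rho>. \<forall>x. (\<rho>(''x'' := (\<rho> ''x'')(0 := Suc y))) ''par'' x =
          (if i < x \<and> x < Suc y \<and> x \<in> X \<tau> \<and> \<sigma> ''par'' x = t then i else \<sigma> ''par'' x))"
      proof (rule runs_wpI)
        show "wp gh_regroup (\<lambda>\<rho>. \<forall>x. (\<rho>(''x'' := (\<rho> ''x'')(0 := Suc y))) ''par'' x =
          (if i < x \<and> x < Suc y \<and> x \<in> X \<tau> \<and> \<sigma> ''par'' x = t then i else \<sigma> ''par'' x)) \<rho>"
          using y(3) iy by (cases "y \<in> X \<tau> \<and> \<sigma> ''par'' y = t")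
            (auto simp: gh_regroup_def y(4) py ft yX less_Suc_eq)
      qed (simp add: gh_regroup_def)
    qed (use c i in \<open>auto simp: A\<close>)
  qed
  define V where "V \<tau> x = (if x = t then val \<tau> else min (val \<tau>) (\<Lambda> t x))" for \<tau> x
  have connect: "runs (For ''x'' (Const 0) (var ''i'') gh_connect) \<rho> ((7 + 2) * i + 2)
      (\<lambda>\<upsilon>. (\<forall>x<i. \<forall>y<i. \<upsilon> ''lam'' (x * n + y) = \<Lambda> x y) \<and> (\<forall>x<i. \<upsilon> ''lam'' (i * n + x) = V \<tau> x \<and> \<upsilon> ''lam'' (x * n + i) = V \<tau> x))"
    if Q: "?Q1 \<tau>" and ag: "agree ?F \<sigma> \<tau>" and ag2: "agree {''x'', ''par''} \<tau> \<rho>" for \<tau> \<rho>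
  proof -
    note A = agreeD[OF ag, simplified] and B = agreeD[OF ag2, simplified]
    have c: "\<rho> ''i'' 0 = i" "\<rho> ''ft'' 0 = t" "\<rho> ''val'' 0 = val \<tau>" "\<rho> ''row'' = \<sigma> ''row''" "\<rho> ''lam'' = \<sigma> ''lam''"
      using \<sigma>(3) Q by (simp_all add: A B)
    show ?thesis
    proof (rule runs_For[where Inv = "\<lambda>z \<upsilon>. (\<forall>x<i. \<forall>y<i. \<upsilon> ''lam'' (x * n + y) = \<Lambda> x y) \<and>
        (\<forall>x<z. \<upsilon> ''lam'' (i * n + x) = V \<tau> x \<and> \<upsilon> ''lam'' (x * n + i) = V \<tau> x)"])
      fix \<upsilon> assume ag3: "agree (insert ''x'' (writes gh_connect)) \<rho> \<upsilon>"
      show "aval (var ''i'') \<upsilon> = i" by (simp add: agreeD[OF ag3, simplified] c)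
    next
      fix z \<upsilon> assume z: "z < i" "(\<forall>x<i. \<forall>y<i. \<upsilon> ''lam'' (x * n + y) = \<Lambda> x y) \<and>
        (\<forall>x<z. \<upsilon> ''lam'' (i * n + x) = V \<tau> x \<and> \<upsilon> ''lam'' (x * n + i) = V \<tau> x)" "\<upsilon> ''x'' 0 = z"
        and ag3: "agree (insert ''x'' (writes gh_connect)) \<rho> \<upsilon>"
      note D = agreeD[OF ag3, simplified]
      have r: "\<upsilon> ''i'' 0 = i" "\<upsilon> ''ft'' 0 = t" "\<upsilon> ''val'' 0 = val \<tau>" "\<upsilon> ''row'' i = i * n" "\<upsilon> ''row'' z = z * n" "\<upsilon> ''row'' t = t * n"
        using c i z(1) ti by (simp_all add: D I\<sigma>)
      have tz: "\<upsilon> ''lam'' (t * n + z) = \<Lambda> t z" using z ti by simp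
      let ?u = "\<upsilon>(''u'' := (\<upsilon> ''u'')(0 := V \<tau> z), ''lam'' := (\<upsilon> ''lam'')(i * n + z := V \<tau> z, z * n + i := V \<tau> z))"
      have wpu: "wp gh_connect P \<upsilon> = P ?u" for P
        using tz r z(3) by (auto simp: gh_connect_def V_def min_def)
      have ix: "x * n + y = i * n + z \<longleftrightarrow> x = i \<and> y = z" "x * n + y = z * n + i \<longleftrightarrow> x = z \<and> y = i" if "y < n" for x y
        using mat_index[OF that, of z x i] mat_index[OF that, of i x z] z(1) i by auto
      show "runs gh_connect \<upsilon> 7 (\<lambda>\<upsilon>. (\<forall>x<i. \<forall>y<i. (\<upsilon>(''x'' := (\<upsilon> ''x'')(0 := Suc z))) ''lam'' (x * n + y) = \<Lambda> x y) \<and>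
        (\<forall>x<Suc z. (\<upsilon>(''x'' := (\<upsilon> ''x'')(0 := Suc z))) ''lam'' (i * n + x) = V \<tau> x \<and> (\<upsilon>(''x'' := (\<upsilon> ''x'')(0 := Suc z))) ''lam'' (x * n + i) = V \<tau> x))"
      proof (rule runs_wpI)
        have "\<forall>x<i. \<forall>y<i. ?u ''lam'' (x * n + y) = \<Lambda> x y" using z(2) ix i by auto
        moreover have "\<forall>x<Suc z. ?u ''lam'' (i * n + x) = V \<tau> x \<and> ?u ''lam'' (x * n + i) = V \<tau> x"
          using z(1,2) ix i by (auto simp: less_Suc_eq)
        ultimately show "wp gh_connect (\<lambda>\<upsilon>. (\<forall>x<i. \<forall>y<i. (\<upsilon>(''x'' := (\<upsilon> ''x'')(0 := Suc z))) ''lam'' (x * n + y) = \<Lambda> x y) \<and>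
        (\<forall>x<Suc z. (\<upsilon>(''x'' := (\<upsilon> ''x'')(0 := Suc z))) ''lam'' (i * n + x) = V \<tau> x \<and> (\<upsilon>(''x'' := (\<upsilon> ''x'')(0 := Suc z))) ''lam'' (x * n + i) = V \<tau> x)) \<upsilon>"
          unfolding wpu by simp
      qed (simp add: gh_connect_def)
    qed (simp_all add: c \<Lambda>_def mat_def)
  qed
  have final: "gh_inv L (Suc i) \<upsilon>"
    if Q: "?Q1 \<tau>"
      and par: "\<forall>x. \<upsilon> ''par'' x = (if i < x \<and> x < n \<and> x \<in> X \<tau> \<and> \<sigma> ''par'' x = t then i else \<sigma> ''par'' x)"
      and lam: "(\<forall>x<i. \<forall>y<i. \<upsilon> ''lam'' (x * n + y) = \<Lambda> x y) \<and> (\<forall>x<i. \<upsilon> ''lam'' (i * n + x) = V \<tau> x \<and> \<upsilon> ''lam'' (x * n + i) = V \<tau> x)"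
      and f: "\<upsilon> ''fl'' = \<tau> ''fl''" for \<tau> \<upsilon>
  proof -
    let ?L = "mat n (\<upsilon> ''lam'')"
    have l: "\<And>x y. x < i \<Longrightarrow> y < i \<Longrightarrow> ?L x y = \<Lambda> x y" "\<And>x. x < i \<Longrightarrow> ?L i x = V \<tau> x" "\<And>x. x < i \<Longrightarrow> ?L x i = V \<tau> x"
      using lam by (auto simp: mat_def)
    have "tree_inv L (Suc i) (\<upsilon> ''par'') ?L"
      by (rule tree_inv_step[OF L inv i _ sym, of "X \<tau>"])
         (use Q par l in \<open>auto simp: t_def[symmetric] V_def val_def\<close>)
    moreover have "\<forall>x<Suc i. \<forall>y<Suc i. x \<noteq> y \<longrightarrow> ?L x y = ?L y x"
      using l sym by (auto simp: less_Suc_eq)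
    moreover have "{\<upsilon> ''fl'' k | k. 1 \<le> k \<and> k < Suc i} = {?L x y | x y. x < Suc i \<and> y < Suc i \<and> x \<noteq> y}"
    proof -
      have fl': "\<upsilon> ''fl'' = (\<sigma> ''fl'')(i := val \<tau>)" using f Q by simp
      have "{\<upsilon> ''fl'' k | k. 1 \<le> k \<and> k < Suc i} = insert (val \<tau>) {\<sigma> ''fl'' k | k. 1 \<le> k \<and> k < i}"
        unfolding fl' using i by (auto simp: less_Suc_eq)
      also have "\<dots> = insert (val \<tau>) {\<Lambda> x y | x y. x < i \<and> y < i \<and> x \<noteq> y}" by (simp only: fl)
      also have "\<dots> = {?L x y | x y. x < Suc i \<and> y < Suc i \<and> x \<noteq> y}"
      proof (intro equalityI subsetI)
        fix k assume "k \<in> insert (val \<tau>) {\<Lambda> x y | x y. x < i \<and> y < i \<and> x \<noteq> y}"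
        then consider "k = val \<tau>" | x y where "x < i" "y < i" "x \<noteq> y" "k = \<Lambda> x y" by auto
        then show "k \<in> {?L x y | x y. x < Suc i \<and> y < Suc i \<and> x \<noteq> y}"
        proof cases
          case 1
          then have "k = ?L i t" using l(2)[OF ti] by (simp add: V_def)
          then show ?thesis using ti less_SucI by blast
        next
          case 2
          then have "k = ?L x y" using l(1) by simp
          then show ?thesis using 2(1-3) less_SucI by blast
        qed
      next
        fix k assume "k \<in> {?L x y | x y. x < Suc i \<and> y < Suc i \<and> x \<noteq> y}"
        then obtain x y where xy: "x < Suc i" "y < Suc i" "x \<noteq> y" "k = ?L x y" by blast
        \<comment> \<open>A new entry is either the new flow value or an old entry in the row of
          \<open>t\<close>, so no value arises that \<open>fl\<close> misses.\<close>
        have VV: "V \<tau> z \<in> insert (val \<tau>) {\<Lambda> x y | x y. x < i \<and> y < i \<and> x \<noteq> y}" if "z < i" for z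
        proof (cases "z = t \<or> val \<tau> \<le> \<Lambda> t z")
          case True
          then have "V \<tau> z = val \<tau>" by (auto simp: V_def min_def)
          then show ?thesis by simp
        next
          case False
          then have "V \<tau> z = \<Lambda> t z" "t \<noteq> z" by (simp_all add: V_def min_def)
          then show ?thesis using ti that by blast
        qed
        consider "x < i" "y < i" | "x = i" "y < i" | "x < i" "y = i" using xy by linarith
        then show "k \<in> insert (val \<tau>) {\<Lambda> x y | x y. x < i \<and> y < i \<and> x \<noteq> y}"
        proof cases
          case 1 then show ?thesis using l(1) xy by blast
        next
          case 2 then show ?thesis using l(2)[of y] VV[of y] xy by simp
        next
          case 3 then show ?thesis using l(3)[of x] VV[of x] xy by simp
        qed
      qed
      finally show ?thesis .
    qed
    ultimately show ?thesis by (simp add: gh_inv_def Let_def)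
  qed
  have "runs gh_step \<sigma> ((1 + (1 + (1000 * (K * (n * n)) + 1))) + (((3 + 2) * n + 2) + ((7 + 2) * i + 2))) (gh_inv L (Suc i))"
    unfolding gh_step_def
  proof (rule runs_Seq[OF flow], goal_cases)
    case (1 \<tau>)
    have ag1: "agree ?F \<sigma> \<tau>" using 1(2) by simp
    note Q = 1(1)
    show ?case
    proof (rule runs_Seq[OF regroup[OF Q ag1]], goal_cases)
      case (1 \<rho>)
      have ag2: "agree {''x'', ''par''} \<tau> \<rho>" using 1(2) by simp
      show ?case
      proof (rule runs_weaken[OF connect[OF Q ag1 ag2] order_refl])
        fix \<upsilon> assume lam: "(\<forall>x<i. \<forall>y<i. \<upsilon> ''lam'' (x * n + y) = \<Lambda> x y) \<and> (\<forall>x<i. \<upsilon> ''lam'' (i * n + x) = V \<tau> x \<and> \<upsilon> ''lam'' (x * n + i) = V \<tau> x)"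
          and ag3: "agree (writes (For ''x'' (Const 0) (var ''i'') gh_connect)) \<rho> \<upsilon>"
        note D = agreeD[OF ag3, simplified]
        show "gh_inv L (Suc i) \<upsilon>"
          by (rule final[of \<tau> \<upsilon>, OF Q _ lam]) (use 1(1) in \<open>simp_all add: D agreeD[OF ag2, simplified]\<close>)
      qed
    qed
  qed
  then show ?thesis
  proof (rule runs_weaken)
    have "n * 1 \<le> n * n" by (rule mult_le_mono2) (use i in simp)
    then have 1: "n \<le> n * n" by simp
    have "1 * (n * n) \<le> K * (n * n)" using K(1) by (rule mult_le_mono1)
    then have 2: "n * n \<le> K * (n * n)" by simp
    have "(1 + (1 + (1000 * (K * (n * n)) + 1))) + (((3 + 2) * n + 2) + ((7 + 2) * i + 2)) = 1000 * (K * (n * n)) + 5 * n + 9 * i + 7" by simp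
    moreover have "1 \<le> n" using i by simp
    ultimately show "(1 + (1 + (1000 * (K * (n * n)) + 1))) + (((3 + 2) * n + 2) + ((7 + 2) * i + 2)) \<le> 1020 * (K * (n * n))"
      using 1 2 i by linarith
  qed
qed

definition gh_done :: "nat set \<Rightarrow> state \<Rightarrow> bool" where
  "gh_done L \<tau> \<longleftrightarrow> (\<forall>x<n. \<forall>y<n. x \<noteq> y \<longrightarrow> (\<forall>\<theta>. low_conn I L \<theta> x y \<longleftrightarrow> \<theta> < \<tau> ''lam'' (x * n + y))) \<and>
     thresholds I L = {\<tau> ''fl'' k | k. 1 \<le> k \<and> k < n}"

lemma gh_inv_done:
  assumes L: "L \<subseteq> {..<m}" and inv: "gh_inv L n \<tau>"
  shows "gh_done L \<tau>"
proof -
  let ?L = "mat n (\<tau> ''lam'')"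
  have c: "low_conn I L \<theta> x y \<longleftrightarrow> \<theta> < ?L x y" if "x < n" "y < n" "x \<noteq> y" for x y \<theta>
    using tree_inv_final[OF _ that L, of "\<tau> ''par''" ?L \<theta>] inv unfolding gh_inv_def Let_def by blast
  have "thresholds I L = {?L x y | x y. x < n \<and> y < n \<and> x \<noteq> y}" by (rule thresholds_matrix[OF c])
  then show ?thesis using inv c by (auto simp: gh_done_def gh_inv_def Let_def mat_def)
qed

lemma gh_program_runs:
  assumes L: "L \<subseteq> {..<m}" and K: "1 \<le> K" "m \<le> K * K"
    and \<sigma>: "inst \<sigma>" "mat_rel n (\<sigma> ''lo'') (wmat L (cap I))"
  shows "runs gh_program \<sigma> (1040 * (K * (n * n * n))) (gh_done L)"
proof -
  note I\<sigma> = instD[OF \<sigma>(1)]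
  have p1: "runs (For ''q'' (Const 0) (Read ''row'' (var ''n'')) (Assign ''c'' (var ''q'') (Read ''lo'' (var ''q'')))) \<sigma> ((1 + 2) * (n * n) + 2)
      (\<lambda>\<tau>. \<forall>q<n*n. \<tau> ''c'' q = \<sigma> ''lo'' q)"
  proof (rule runs_For[where Inv = "\<lambda>z \<tau>. \<forall>q<z. \<tau> ''c'' q = \<sigma> ''lo'' q"])
    fix \<tau> assume ag: "agree (insert ''q'' (writes (Assign ''c'' (var ''q'') (Read ''lo'' (var ''q''))))) \<sigma> \<tau>"
    note A = agreeD[OF ag, simplified]
    show "aval (Read ''row'' (var ''n'')) \<tau> = n * n" by (simp add: A I\<sigma>)
    fix z assume z: "z < n * n" "\<forall>q<z. \<tau> ''c'' q = \<sigma> ''lo'' q" "\<tau> ''q'' 0 = z"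
    show "runs (Assign ''c'' (var ''q'') (Read ''lo'' (var ''q''))) \<tau> 1 (\<lambda>\<tau>. \<forall>q<Suc z. (\<tau>(''q'' := (\<tau> ''q'')(0 := Suc z))) ''c'' q = \<sigma> ''lo'' q)"
      using z by (intro runs_wpI) (auto simp: A less_Suc_eq)
  qed simp_all
  have p2: "runs (For ''x'' (Const 0) (var ''n'') (Assign ''par'' (var ''x'') (Const 0))) \<tau> ((1 + 2) * n + 2)
      (\<lambda>\<tau>. \<forall>x<n. \<tau> ''par'' x = 0)" if n: "\<tau> ''n'' 0 = n" for \<tau>
  proof (rule runs_For[where Inv = "\<lambda>z \<tau>. \<forall>x<z. \<tau> ''par'' x = 0"])
    fix \<rho> assume ag: "agree (insert ''x'' (writes (Assign ''par'' (var ''x'') (Const 0)))) \<tau> \<rho>"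
    show "aval (var ''n'') \<rho> = n" by (simp add: agreeD[OF ag, simplified] n)
    fix z assume z: "z < n" "\<forall>x<z. \<rho> ''par'' x = 0" "\<rho> ''x'' 0 = z"
    show "runs (Assign ''par'' (var ''x'') (Const 0)) \<rho> 1 (\<lambda>\<rho>. \<forall>x<Suc z. (\<rho>(''x'' := (\<rho> ''x'')(0 := Suc z))) ''par'' x = 0)"
      using z by (intro runs_wpI) (auto simp: less_Suc_eq)
  qed simp_all
  have p3: "runs (For ''i'' (Const 1) (var ''n'') gh_step) \<tau> ((1020 * (K * (n * n)) + 2) * n + 2) (gh_done L)"
    if i: "inst \<tau>" and c: "mat_rel n (\<tau> ''c'') (wmat L (cap I))" and par: "\<forall>x<n. \<tau> ''par'' x = 0" for \<tau>
  proof (rule runs_For[where Inv = "gh_inv L"])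
    show "gh_inv L (aval (Const 1) \<tau>) (\<tau>(''i'' := (\<tau> ''i'')(0 := aval (Const 1) \<tau>)))"
      using par by (auto simp: gh_inv_def tree_inv_def rep_of_def Let_def)
  next
    fix i \<rho> assume j: "aval (Const 1) \<tau> \<le> i" "i < n" "gh_inv L i \<rho>" "\<rho> ''i'' 0 = i" and ag: "agree (insert ''i'' (writes gh_step)) \<tau> \<rho>"
    have "inst \<rho>" by (rule inst_cong[OF ag i]) (auto simp: flow_vars_def)
    moreover have "mat_rel n (\<rho> ''c'') (wmat L (cap I))" using c by (simp add: agreeD[OF ag, simplified])
    ultimately have "runs gh_step \<rho> (1020 * (K * (n * n))) (gh_inv L (Suc i))"
      using j by (intro gh_step_runs[OF L K]) auto
    then show "runs gh_step \<rho> (1020 * (K * (n * n))) (\<lambda>\<rho>. gh_inv L (Suc i) (\<rho>(''i'' := (\<rho> ''i'')(0 := Suc i))))"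
      by (rule runs_weaken) (simp_all add: gh_inv_def)
  next
    fix \<rho> assume "gh_inv L n \<rho>"
    then show "gh_done L \<rho>" by (rule gh_inv_done[OF L])
  next
    fix \<rho> assume ag: "agree (insert ''i'' (writes gh_step)) \<tau> \<rho>"
    show "aval (var ''n'') \<rho> = n" using instD(2)[OF i] by (simp add: agreeD[OF ag, simplified])
  qed (use n_pos in \<open>simp_all add: flow_vars_def\<close>)
  have "runs gh_program \<sigma> (((1 + 2) * (n * n) + 2) + (((1 + 2) * n + 2) + ((1020 * (K * (n * n)) + 2) * n + 2))) (gh_done L)"
    unfolding gh_program_def
  proof (rule runs_Seq[OF p1], goal_cases)
    case (1 \<tau>)
    note A = agreeD[OF 1(2), simplified]
    have i1: "inst \<tau>" by (rule inst_cong[OF 1(2) \<sigma>(1)]) simp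
    have c1: "mat_rel n (\<tau> ''c'') (wmat L (cap I))"
      unfolding mat_rel_def
    proof (intro allI impI)
      fix v w assume vw: "v < n" "w < n"
      show "\<tau> ''c'' (v * n + w) = wmat L (cap I) v w"
        using 1(1) mat_index_less[OF vw] mat_relD[OF \<sigma>(2) vw] by simp
    qed
    show ?case
    proof (rule runs_Seq[OF p2[of \<tau>, OF instD(2)[OF i1]]], goal_cases)
      case (1 \<rho>)
      have "inst \<rho>" by (rule inst_cong[OF 1(2) i1]) simp
      moreover have "mat_rel n (\<rho> ''c'') (wmat L (cap I))" using c1 by (simp add: agreeD[OF 1(2), simplified])
      ultimately show ?case using p3 1(1) by blast
    qed
  qed
  then show ?thesis
  proof (rule runs_weaken)
    have n1: "1 \<le> n" using n_pos by simp
    have "n * n * 1 \<le> n * n * n" by (rule mult_le_mono2) (rule n1)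
    then have 1: "n * n \<le> n * n * n" by simp
    have "n * 1 \<le> n * n" by (rule mult_le_mono2) (rule n1)
    then have 2: "n \<le> n * n" by simp
    have "1 * (n * n * n) \<le> K * (n * n * n)" using K(1) by (rule mult_le_mono1)
    then have 3: "n * n * n \<le> K * (n * n * n)" by simp
    have "((1 + 2) * (n * n) + 2) + (((1 + 2) * n + 2) + ((1020 * (K * (n * n)) + 2) * n + 2))
       = 1020 * (K * (n * n * n)) + 3 * (n * n) + 5 * n + 6" by (simp add: algebra_simps)
    then show "((1 + 2) * (n * n) + 2) + (((1 + 2) * n + 2) + ((1020 * (K * (n * n)) + 2) * n + 2)) \<le> 1040 * (K * (n * n * n))"
      using 1 2 3 n1 by linarith
  qed
qed

end

section \<open>Processing one threshold\<close>

text \<open>One invariant in row-major order serves both loops; by \<open>nxt\<close>, the end of a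
  row counts as the start of the next.\<close>

lemma runs_For2:
  assumes xy: "x \<noteq> y" "x \<notin> writes p" "y \<notin> writes p"
    and N: "\<And>\<tau>. agree (insert x (insert y (writes p))) \<sigma> \<tau> \<Longrightarrow> aval N \<tau> = n"
    and upd: "\<And>i j \<tau> f. Inv i j \<tau> \<Longrightarrow> Inv i j (\<tau>(x := f))" "\<And>i j \<tau> f. Inv i j \<tau> \<Longrightarrow> Inv i j (\<tau>(y := f))"
    and init: "Inv 0 0 \<sigma>"
    and body: "\<And>i j \<tau>. i < n \<Longrightarrow> j < n \<Longrightarrow> Inv i j \<tau> \<Longrightarrow> \<tau> x 0 = i \<Longrightarrow> \<tau> y 0 = j \<Longrightarrow>
       agree (insert x (insert y (writes p))) \<sigma> \<tau> \<Longrightarrow> runs p \<tau> c (Inv i (Suc j))"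
    and nxt: "\<And>i \<tau>. i < n \<Longrightarrow> Inv i n \<tau> \<Longrightarrow> Inv (Suc i) 0 \<tau>"
  shows "runs (For x (Const 0) N (For y (Const 0) N p)) \<sigma> (((c + 2) * n + 2 + 2) * n + 2) (Inv n 0)"
proof (rule runs_For[where Inv = "\<lambda>i. Inv i 0"])
  let ?W = "insert x (insert y (writes p))"
  show "x \<notin> writes (For y (Const 0) N p)" using xy by simp
  show "aval N \<tau> = n" if "agree (insert x (writes (For y (Const 0) N p))) \<sigma> \<tau>" for \<tau>
    using N that by simp
  fix i \<tau> assume i: "i < n" "Inv i 0 \<tau>" "\<tau> x 0 = i" and ag: "agree (insert x (writes (For y (Const 0) N p))) \<sigma> \<tau>"
  have ag': "agree ?W \<sigma> \<tau>" using ag by simp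
  have "runs (For y (Const 0) N p) \<tau> ((c + 2) * n + 2) (Inv (Suc i) 0)"
  proof (rule runs_For[where Inv = "Inv i"])
    have ext: "agree ?W \<sigma> \<rho>" if "agree (insert y (writes p)) \<tau> \<rho>" for \<rho>
      using agree_trans[OF ag' that] by (rule agree_mono) auto
    show "aval N \<rho> = n" if "agree (insert y (writes p)) \<tau> \<rho>" for \<rho> using N[OF ext[OF that]] .
    fix j \<rho> assume j: "j < n" "Inv i j \<rho>" "\<rho> y 0 = j" and a: "agree (insert y (writes p)) \<tau> \<rho>"
    have "\<rho> x 0 = i" using agreeD[OF a, of x] xy i(3) by simp
    then have "runs p \<rho> c (Inv i (Suc j))" using body i j ext[OF a] by blast
    then show "runs p \<rho> c (\<lambda>\<rho>. Inv i (Suc j) (\<rho>(y := (\<rho> y)(0 := Suc j))))" by (rule runs_weaken) (auto intro: upd)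
  next
    show "Inv (Suc i) 0 \<rho>" if "Inv i n \<rho>" for \<rho> using nxt i that by blast
  qed (use xy i upd in auto)
  then show "runs (For y (Const 0) N p) \<tau> ((c + 2) * n + 2) (\<lambda>\<rho>. Inv (Suc i) 0 (\<rho>(x := (\<rho> x)(0 := Suc i))))"
    by (rule runs_weaken) (auto intro: upd)
qed (use init upd in auto)

text \<open>As \<open>rep x\<close> starts at \<open>x\<close> and only decreases, the first test
  admits only \<open>y < x\<close>. The diagonal of \<open>lam\<close>, which carries no
  connectivity, thus has no influence.\<close>

definition rep_entry :: com where
  "rep_entry = IfThen (And (Less (var ''y'') (Read ''rep'' (var ''x'')))
       (Less (var ''theta'') (Read ''lam'' (entry (var ''x'') (var ''y'')))))
     (Assign ''rep'' (var ''x'') (var ''y''))"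

definition rep_program :: com where
  "rep_program =
     (For ''x'' (Const 0) (var ''n'') (Assign ''rep'' (var ''x'') (var ''x'')) ;;
      For ''x'' (Const 0) (var ''n'') (For ''y'' (Const 0) (var ''n'') rep_entry))"

definition contract_entry :: com where
  "contract_entry = IfThen (Not (Equal (Read ''rep'' (var ''x'')) (Read ''rep'' (var ''y''))))
     (Assign ''c'' (entry (Read ''rep'' (var ''x'')) (Read ''rep'' (var ''y'')))
        (Plus (Read ''c'' (entry (Read ''rep'' (var ''x'')) (Read ''rep'' (var ''y'')))) (Read ''hc'' (entry (var ''x'') (var ''y'')))))"

definition contract_program :: com where
  "contract_program =
     (For ''q'' (Const 0) (Read ''row'' (var ''n'')) (Assign ''c'' (var ''q'') (Const 0)) ;;
      For ''x'' (Const 0) (var ''n'') (For ''y'' (Const 0) (var ''n'') contract_entry))"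

definition eval_entry :: com where
  "eval_entry = If (Equal (Read ''ds'' (var ''x'')) (Read ''ds'' (var ''y'')))
     (Assign ''c'' (entry (var ''x'') (var ''y''))
        (Plus (Read ''lo'' (entry (var ''x'') (var ''y''))) (Read ''hi'' (entry (var ''x'') (var ''y'')))))
     (Assign ''c'' (entry (var ''x'') (var ''y'')) (Read ''lo'' (entry (var ''x'') (var ''y''))))"

definition eval_program :: com where
  "eval_program =
     (For ''x'' (Const 0) (var ''n'') (Assign ''ds'' (var ''x'') (Read ''side'' (Read ''rep'' (var ''x'')))) ;;
      For ''x'' (Const 0) (var ''n'') (For ''y'' (Const 0) (var ''n'') eval_entry))"

text \<open>The side of the cut is saved, not the edge set: copying m entries for every improvement
  would break the time bound. Loop counters start at 0 while positions in \<open>low_edges\<close>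
  start at 1, hence \<open>j + 1\<close>.\<close>

definition save_program :: com where
  "save_program =
     (''found'' ::= Const 1 ;; ''best'' ::= var ''val'' ;; ''be'' ::= var ''e'' ;; ''bj'' ::= Plus (var ''j'') (Const 1) ;;
      For ''x'' (Const 0) (var ''n'') (Assign ''bs'' (var ''x'') (Read ''ds'' (var ''x''))))"

definition compare_program :: com where
  "compare_program =
     (eval_program ;; ''fs'' ::= var ''source'' ;; ''ft'' ::= var ''sink'' ;; flow_program ;;
      IfThen (Not (And (Leq (Const 1) (var ''found'')) (Leq (var ''best'') (var ''val'')))) save_program)"

definition cut_program :: com where
  "cut_program =
     (contract_program ;; ''fs'' ::= Read ''rep'' (var ''source'') ;; ''ft'' ::= Read ''rep'' (var ''sink'') ;; flow_program ;;
      IfThen (Leq (var ''val'') (var ''budget'')) compare_program)"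

definition threshold_step :: com where
  "threshold_step =
     (''theta'' ::= Read ''fl'' (var ''k'') ;; rep_program ;;
      IfThen (Not (Equal (Read ''rep'' (var ''source'')) (Read ''rep'' (var ''sink'')))) cut_program)"

lemma writes_threshold_parts [simp]:
  "writes rep_entry = {''rep''}"
  "writes contract_entry = {''c''}"
  "writes eval_entry = {''c''}"
  by (auto simp: rep_entry_def contract_entry_def eval_entry_def)

lemma writes_threshold_programs [simp]:
  "writes rep_program = {''x'', ''y'', ''rep''}"
  "writes contract_program = {''q'', ''c'', ''x'', ''y''}"
  "writes eval_program = {''x'', ''ds'', ''y'', ''c''}"
  "writes save_program = {''found'', ''best'', ''be'', ''bj'', ''x'', ''bs''}"
  by (auto simp: rep_program_def contract_program_def eval_program_def save_program_def)

declare writes_flow_program [simp del]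

lemma writes_flow_program_vars [simp]: "writes flow_program = flow_vars"
  by (simp add: writes_flow_program flow_vars_def)

lemma writes_threshold_step [simp]:
  "writes compare_program = {''x'', ''ds'', ''y'', ''c'', ''fs'', ''ft'', ''found'', ''best'', ''be'', ''bj'', ''bs''} \<union> flow_vars"
  "writes cut_program = {''q'', ''x'', ''ds'', ''y'', ''c'', ''fs'', ''ft'', ''found'', ''best'', ''be'', ''bj'', ''bs''} \<union> flow_vars"
  "writes threshold_step = {''theta'', ''rep'', ''q'', ''x'', ''ds'', ''y'', ''c'', ''fs'', ''ft'', ''found'', ''best'', ''be'', ''bj'', ''bs''} \<union> flow_vars"
  unfolding compare_program_def cut_program_def threshold_step_def by auto

lemma flow_call_runs:
  assumes \<sigma>: "rows n \<sigma>" "mat_rel n (\<sigma> ''c'') c" and st: "aval A \<sigma> = s" "\<And>f. aval B (\<sigma>(''fs'' := f)) = t"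
    and net: "flow_network n c s t" and K: "1 \<le> K" "card (support n c) \<le> 2 * (K * K)"
    and q: "\<And>\<tau>. agree ({''fs'', ''ft''} \<union> flow_vars) \<sigma> \<tau> \<Longrightarrow> \<forall>v<n. \<tau> ''side'' v \<le> 1 \<Longrightarrow>
      matrix_min_cut n c s t {v. v < n \<and> \<tau> ''side'' v \<noteq> 0} \<Longrightarrow> \<tau> ''val'' 0 = matrix_cut n c {v. v < n \<and> \<tau> ''side'' v \<noteq> 0} \<Longrightarrow>
      runs q \<tau> l Q"
  shows "runs (''fs'' ::= A ;; ''ft'' ::= B ;; flow_program ;; q) \<sigma> (1 + (1 + (1000 * (K * (n * n)) + l))) Q"
proof (rule runs_Seq[where Q = "\<lambda>\<tau>. \<tau> = \<sigma>(''fs'' := (\<sigma> ''fs'')(0 := s))"], goal_cases)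
  case 1 show ?case by (intro runs_wpI) (simp_all add: st)
next
  case (2 \<tau>)
  let ?\<sigma> = "\<sigma>(''fs'' := (\<sigma> ''fs'')(0 := s), ''ft'' := (\<sigma> ''ft'')(0 := t))"
  have flow: "runs flow_program ?\<sigma> (1000 * (K * (n * n))) (\<lambda>\<tau>. let S = {v. v < n \<and> \<tau> ''side'' v \<noteq> 0} in
      (\<forall>v<n. \<tau> ''side'' v \<le> 1) \<and> matrix_min_cut n c (?\<sigma> ''fs'' 0) (?\<sigma> ''ft'' 0) S \<and> \<tau> ''val'' 0 = matrix_cut n c S)"
    using \<sigma> net K by (intro flow_runs) (simp_all add: rows_def)
  show ?case
  proof (rule runs_Seq[where Q = "\<lambda>\<tau>. \<tau> = ?\<sigma>"], goal_cases)
    case 1 show ?case by (intro runs_wpI) (simp_all add: 2 st)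
  next
    case (2 \<rho>)
    show ?case unfolding 2(1)
    proof (rule runs_Seq[OF flow], goal_cases)
      case (1 \<upsilon>)
      have "agree ({''fs'', ''ft''} \<union> flow_vars) \<sigma> \<upsilon>" using 1(2) by (simp add: agree_def)
      then show ?case using 1(1) by (intro q) (simp_all add: Let_def)
    qed
  qed
qed

lemma save_runs:
  assumes "\<sigma> ''n'' 0 = n"
  shows "runs save_program \<sigma> (1 + (1 + (1 + (1 + ((1 + 2) * n + 2))))) (\<lambda>\<tau>. \<tau> ''found'' 0 = 1 \<and> \<tau> ''best'' 0 = \<sigma> ''val'' 0 \<and>
     \<tau> ''be'' 0 = \<sigma> ''e'' 0 \<and> \<tau> ''bj'' 0 = Suc (\<sigma> ''j'' 0) \<and> (\<forall>x<n. \<tau> ''bs'' x = \<sigma> ''ds'' x))"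
proof -
  let ?f = "\<sigma>(''found'' := (\<sigma> ''found'')(0 := 1))"
  let ?g = "?f(''best'' := (\<sigma> ''best'')(0 := \<sigma> ''val'' 0))"
  let ?h = "?g(''be'' := (\<sigma> ''be'')(0 := \<sigma> ''e'' 0))"
  let ?k = "?h(''bj'' := (\<sigma> ''bj'')(0 := Suc (\<sigma> ''j'' 0)))"
  have copy: "runs (For ''x'' (Const 0) (var ''n'') (Assign ''bs'' (var ''x'') (Read ''ds'' (var ''x'')))) ?k ((1 + 2) * n + 2)
     (\<lambda>\<tau>. \<tau> ''found'' 0 = 1 \<and> \<tau> ''best'' 0 = \<sigma> ''val'' 0 \<and> \<tau> ''be'' 0 = \<sigma> ''e'' 0 \<and> \<tau> ''bj'' 0 = Suc (\<sigma> ''j'' 0) \<and>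
        (\<forall>x<n. \<tau> ''bs'' x = \<sigma> ''ds'' x))"
  proof (rule runs_For[where Inv = "\<lambda>i \<tau>. \<forall>x<i. \<tau> ''bs'' x = \<sigma> ''ds'' x"])
    fix \<tau> assume ag: "agree (insert ''x'' (writes (Assign ''bs'' (var ''x'') (Read ''ds'' (var ''x''))))) ?k \<tau>"
    note A = agreeD[OF ag, simplified]
    show "aval (var ''n'') \<tau> = n" using assms by (simp add: A)
    { fix i assume i: "\<forall>x<i. \<tau> ''bs'' x = \<sigma> ''ds'' x" "\<tau> ''x'' 0 = i"
      show "runs (Assign ''bs'' (var ''x'') (Read ''ds'' (var ''x''))) \<tau> 1 (\<lambda>\<tau>. \<forall>x<Suc i. (\<tau>(''x'' := (\<tau> ''x'')(0 := Suc i))) ''bs'' x = \<sigma> ''ds'' x)"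
        using i by (intro runs_wpI) (auto simp: A less_Suc_eq) }
    assume "\<forall>x<n. \<tau> ''bs'' x = \<sigma> ''ds'' x"
    then show "\<tau> ''found'' 0 = 1 \<and> \<tau> ''best'' 0 = \<sigma> ''val'' 0 \<and> \<tau> ''be'' 0 = \<sigma> ''e'' 0 \<and> \<tau> ''bj'' 0 = Suc (\<sigma> ''j'' 0) \<and>
        (\<forall>x<n. \<tau> ''bs'' x = \<sigma> ''ds'' x)" by (simp add: A)
  qed simp_all
  have set: "runs (x ::= A) \<tau> 1 (\<lambda>\<rho>. \<rho> = \<tau>(x := (\<tau> x)(0 := aval A \<tau>)))" for x A \<tau> by (intro runs_wpI) simp_all
  show ?thesis unfolding save_program_def
  proof (rule runs_Seq[OF set], goal_cases)
    case (1 \<tau>)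
    show ?case unfolding 1(1)
    proof (rule runs_Seq[OF set], goal_cases)
      case (1 \<tau>)
      show ?case unfolding 1(1)
      proof (rule runs_Seq[OF set], goal_cases)
        case (1 \<tau>)
        show ?case unfolding 1(1)
        proof (rule runs_Seq[OF set], goal_cases)
          case (1 \<tau>)
          show ?case unfolding 1(1) using copy by simp
        qed
      qed
    qed
  qed
qed

context numbered_nfi
begin

definition low_rep :: "nat set \<Rightarrow> nat \<Rightarrow> nat \<Rightarrow> nat" where
  "low_rep L \<theta> x = Min {z. z < n \<and> low_conn I L \<theta> x z}"

lemma low_rep:
  assumes L: "L \<subseteq> {..<m}"
  shows "x < n \<Longrightarrow> low_rep L \<theta> x < n"
    and "x < n \<Longrightarrow> y < n \<Longrightarrow> low_conn I L \<theta> x y \<longleftrightarrow> low_rep L \<theta> x = low_rep L \<theta> y"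
proof -
  note equiv = low_conn_equiv[OF L]
  have in_set: "low_rep L \<theta> x \<in> {z. z < n \<and> low_conn I L \<theta> x z}" if "x < n" for x
    unfolding low_rep_def using that equiv(1) by (intro Min_in) auto
  then show "x < n \<Longrightarrow> low_rep L \<theta> x < n" by auto
  show "low_conn I L \<theta> x y \<longleftrightarrow> low_rep L \<theta> x = low_rep L \<theta> y" if xy: "x < n" "y < n"
  proof
    assume c: "low_conn I L \<theta> x y"
    have "low_conn I L \<theta> x z \<longleftrightarrow> low_conn I L \<theta> y z" for z
      using equiv(3)[OF c] equiv(3)[OF equiv(2)[OF c]] by blast
    then show "low_rep L \<theta> x = low_rep L \<theta> y" by (simp add: low_rep_def)
  next
    assume e: "low_rep L \<theta> x = low_rep L \<theta> y"
    have x: "low_conn I L \<theta> x (low_rep L \<theta> y)" and y: "low_conn I L \<theta> y (low_rep L \<theta> y)"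
      using in_set[OF xy(1)] in_set[OF xy(2)] by (simp_all add: e)
    show "low_conn I L \<theta> x y" by (rule equiv(3)[OF x equiv(2)[OF y]])
  qed
qed

lemma rep_runs:
  assumes L: "L \<subseteq> {..<m}" and \<sigma>: "inst \<sigma>" "gh_done L \<sigma>" "\<sigma> ''theta'' 0 = \<theta>"
  shows "runs rep_program \<sigma> (20 * (n * n)) (\<lambda>\<tau>. \<forall>x<n. \<tau> ''rep'' x = low_rep L \<theta> x)"
proof -
  note I\<sigma> = instD[OF \<sigma>(1)]
  have n1: "1 \<le> n" using n_pos by simp
  have lam: "low_conn I L \<theta> x y \<longleftrightarrow> \<theta> < \<sigma> ''lam'' (x * n + y)" if "x < n" "y < n" "x \<noteq> y" for x y
    using \<sigma>(2) that by (simp add: gh_done_def)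
  have p1: "runs (For ''x'' (Const 0) (var ''n'') (Assign ''rep'' (var ''x'') (var ''x''))) \<sigma> ((1 + 2) * n + 2) (\<lambda>\<tau>. \<forall>x<n. \<tau> ''rep'' x = x)"
  proof (rule runs_For[where Inv = "\<lambda>i \<tau>. \<forall>x<i. \<tau> ''rep'' x = x"])
    fix \<tau> assume ag: "agree (insert ''x'' (writes (Assign ''rep'' (var ''x'') (var ''x'')))) \<sigma> \<tau>"
    show "aval (var ''n'') \<tau> = n" by (simp add: agreeD[OF ag, simplified] I\<sigma>)
  qed (auto intro!: runs_wpI simp: less_Suc_eq)
  \<comment> \<open>\<open>x\<close> belongs to its class without any test. For \<open>j = n\<close>
    this is the whole class, whose minimum is \<open>low_rep\<close>.\<close>
  define S where "S x j = insert x {z. z < j \<and> low_conn I L \<theta> x z}" for x j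
  define Inv where "Inv i j \<tau> \<longleftrightarrow> (\<forall>x<n. \<tau> ''rep'' x = Min (S x (if x < i then n else if x = i then j else 0)))"
    for i j and \<tau> :: state
  have finS: "finite (S x j)" for x j by (simp add: S_def)
  have p2: "runs (For ''x'' (Const 0) (var ''n'') (For ''y'' (Const 0) (var ''n'') rep_entry)) \<tau> (((4 + 2) * n + 2 + 2) * n + 2) (Inv n 0)"
    if r: "\<forall>x<n. \<tau> ''rep'' x = x" and ag0: "agree {''x'', ''rep''} \<sigma> \<tau>" for \<tau>
  proof (rule runs_For2)
    note A = agreeD[OF ag0, simplified]
    show "Inv 0 0 \<tau>" using r by (simp add: Inv_def S_def)
    show "Inv i j (\<rho>(''x'' := f))" "Inv i j (\<rho>(''y'' := f))" if "Inv i j \<rho>" for i j \<rho> f using that by (simp_all add: Inv_def)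
    show "aval (var ''n'') \<rho> = n" if ag: "agree (insert ''x'' (insert ''y'' (writes rep_entry))) \<tau> \<rho>" for \<rho>
      by (simp add: agreeD[OF ag, simplified] A I\<sigma>)
    show "Inv (Suc i) 0 \<rho>" if "Inv i n \<rho>" for i \<rho>
      unfolding Inv_def
    proof (intro allI impI)
      fix x assume x: "x < n"
      have "\<rho> ''rep'' x = Min (S x (if x < i then n else if x = i then n else 0))" using that x by (simp add: Inv_def)
      then show "\<rho> ''rep'' x = Min (S x (if x < Suc i then n else if x = Suc i then 0 else 0))"
        by (cases "x < i"; cases "x = i") simp_all
    qed
    fix i j \<rho> assume ij: "i < n" "j < n" "Inv i j \<rho>" "\<rho> ''x'' 0 = i" "\<rho> ''y'' 0 = j"
      and ag: "agree (insert ''x'' (insert ''y'' (writes rep_entry))) \<tau> \<rho>"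
    note B = agreeD[OF ag, simplified]
    have ri: "\<rho> ''rep'' i = Min (S i j)" using ij by (simp add: Inv_def)
    have le: "Min (S i j) \<le> i" using finS[of i j] by (intro Min_le) (auto simp: S_def)
    have row: "\<rho> ''row'' i = i * n" "\<rho> ''theta'' 0 = \<theta>" "\<rho> ''lam'' = \<sigma> ''lam''" using ij \<sigma>(3) by (simp_all add: A B I\<sigma>)
    let ?new = "if j < Min (S i j) \<and> \<theta> < \<sigma> ''lam'' (i * n + j) then j else Min (S i j)"
    have new: "?new = Min (S i (Suc j))"
    proof (cases "low_conn I L \<theta> i j")
      case True
      then have "S i (Suc j) = insert j (S i j)" by (auto simp: S_def less_Suc_eq)
      then have "Min (S i (Suc j)) = min j (Min (S i j))" using finS[of i j] by (simp add: S_def)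
      moreover have "\<theta> < \<sigma> ''lam'' (i * n + j)" if "j < Min (S i j)" using lam[of i j] True ij le that by simp
      ultimately show ?thesis by (simp add: min_def)
    next
      case False
      then have "S i (Suc j) = S i j" by (auto simp: S_def less_Suc_eq)
      moreover have "\<not> \<theta> < \<sigma> ''lam'' (i * n + j)" if "j < Min (S i j)" using lam[of i j] False ij le that by simp
      ultimately show ?thesis by auto
    qed
    show "runs rep_entry \<rho> 4 (Inv i (Suc j))"
    proof (rule runs_wpI)
      have "Inv i (Suc j) (\<rho>(''rep'' := (\<rho> ''rep'')(i := ?new)))"
        unfolding new Inv_def using ij(3) by (auto simp: Inv_def)
      moreover have "\<rho>(''rep'' := (\<rho> ''rep'')(i := Min (S i j))) = \<rho>" using ri by (simp add: fun_eq_iff)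
      ultimately show "wp rep_entry (Inv i (Suc j)) \<rho>"
        using ij(4,5) row ri by (auto simp: rep_entry_def split: if_splits)
    qed (simp add: rep_entry_def)
  qed simp_all
  have "runs rep_program \<sigma> (((1 + 2) * n + 2) + (((4 + 2) * n + 2 + 2) * n + 2)) (Inv n 0)"
    unfolding rep_program_def
  proof (rule runs_Seq[OF p1], goal_cases)
    case (1 \<tau>)
    then show ?case by (intro p2) simp_all
  qed
  then show ?thesis
  proof (rule runs_weaken)
    have "n * 1 \<le> n * n" by (rule mult_le_mono2) (rule n1)
    moreover have "((1 + 2) * n + 2) + (((4 + 2) * n + 2 + 2) * n + 2) = 6 * (n * n) + 7 * n + 4" by (simp add: algebra_simps)
    ultimately show "((1 + 2) * n + 2) + (((4 + 2) * n + 2 + 2) * n + 2) \<le> 20 * (n * n)" using n1 by linarith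
    fix \<tau> assume J: "Inv n 0 \<tau>"
    have "S x n = {z. z < n \<and> low_conn I L \<theta> x z}" if "x < n" for x using that low_conn_equiv(1)[OF L] by (auto simp: S_def)
    then show "\<forall>x<n. \<tau> ''rep'' x = low_rep L \<theta> x" using J by (simp add: Inv_def low_rep_def)
  qed
qed

lemma contract_runs:
  assumes \<sigma>: "inst \<sigma>" "mat_rel n (\<sigma> ''hc'') h" and rep: "\<forall>x<n. \<sigma> ''rep'' x = rep x" "\<And>x. x < n \<Longrightarrow> rep x < n"
  shows "runs contract_program \<sigma> (24 * (n * n)) (\<lambda>\<tau>. mat_rel n (\<tau> ''c'') (contracted_mat rep h))"
proof -
  note I\<sigma> = instD[OF \<sigma>(1)]
  have n1: "1 \<le> n" using n_pos by simp
  have p1: "runs (For ''q'' (Const 0) (Read ''row'' (var ''n'')) (Assign ''c'' (var ''q'') (Const 0))) \<sigma> ((1 + 2) * (n * n) + 2) (\<lambda>\<tau>. \<forall>q<n*n. \<tau> ''c'' q = 0)"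
  proof (rule runs_For[where Inv = "\<lambda>z \<tau>. \<forall>q<z. \<tau> ''c'' q = 0"])
    fix \<tau> assume ag: "agree (insert ''q'' (writes (Assign ''c'' (var ''q'') (Const 0)))) \<sigma> \<tau>"
    show "aval (Read ''row'' (var ''n'')) \<tau> = n * n" by (simp add: agreeD[OF ag, simplified] I\<sigma>)
  qed (auto intro!: runs_wpI simp: less_Suc_eq)
  define f where "f x y v w = (if rep v \<noteq> rep w \<and> rep v = x \<and> rep w = y then h v w else 0)" for x y v w
  define Inv where "Inv i j \<tau> \<longleftrightarrow> mat_rel n (\<tau> ''c'') (\<lambda>x y. (\<Sum>v<i. \<Sum>w<n. f x y v w) + (\<Sum>w<j. f x y i w))"
    for i j and \<tau> :: state
  have p2: "runs (For ''x'' (Const 0) (var ''n'') (For ''y'' (Const 0) (var ''n'') contract_entry)) \<tau> (((4 + 2) * n + 2 + 2) * n + 2) (Inv n 0)"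
    if z: "\<forall>q<n*n. \<tau> ''c'' q = 0" and ag0: "agree {''q'', ''c''} \<sigma> \<tau>" for \<tau>
  proof (rule runs_For2)
    note A = agreeD[OF ag0, simplified]
    show "Inv 0 0 \<tau>" using z mat_index_less by (simp add: Inv_def mat_rel_def)
    show "Inv i j (\<rho>(''x'' := g))" "Inv i j (\<rho>(''y'' := g))" if "Inv i j \<rho>" for i j \<rho> g using that by (simp_all add: Inv_def)
    show "aval (var ''n'') \<rho> = n" if ag: "agree (insert ''x'' (insert ''y'' (writes contract_entry))) \<tau> \<rho>" for \<rho>
      by (simp add: agreeD[OF ag, simplified] A I\<sigma>)
    show "Inv (Suc i) 0 \<rho>" if "Inv i n \<rho>" for i \<rho> using that by (simp add: Inv_def add.commute)
    fix i j \<rho> assume ij: "i < n" "j < n" "Inv i j \<rho>" "\<rho> ''x'' 0 = i" "\<rho> ''y'' 0 = j"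
      and ag: "agree (insert ''x'' (insert ''y'' (writes contract_entry))) \<tau> \<rho>"
    note B = agreeD[OF ag, simplified]
    have rr: "\<rho> ''rep'' i = rep i" "\<rho> ''rep'' j = rep j" "\<rho> ''row'' i = i * n" "\<rho> ''row'' (rep i) = rep i * n" "\<rho> ''hc'' (i * n + j) = h i j"
      using rep ij(1,2) mat_relD[OF \<sigma>(2)] by (simp_all add: A B I\<sigma>)
    define P where "P = (\<lambda>x y. (\<Sum>v<i. \<Sum>w<n. f x y v w) + (\<Sum>w<j. f x y i w))"
    have J: "mat_rel n (\<rho> ''c'') P" using ij(3) by (simp add: Inv_def P_def)
    have nxt: "Inv i (Suc j) \<upsilon> \<longleftrightarrow> mat_rel n (\<upsilon> ''c'') (\<lambda>x y. P x y + f x y i j)" for \<upsilon>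
      by (simp add: Inv_def P_def add.assoc)
    show "runs contract_entry \<rho> 4 (Inv i (Suc j))"
    proof (rule runs_wpI)
      show "wp contract_entry (Inv i (Suc j)) \<rho>"
      proof (cases "rep i = rep j")
        case True
        then have "(\<lambda>x y. P x y + f x y i j) = P" by (simp add: f_def fun_eq_iff)
        then have "Inv i (Suc j) \<rho>" using J nxt by simp
        then show ?thesis using True rr ij by (simp add: contract_entry_def)
      next
        case False
        let ?c = "(\<rho> ''c'')(rep i * n + rep j := P (rep i) (rep j) + h i j)"
        have "(\<lambda>x y. P x y + f x y i j) = P(rep i := (P (rep i))(rep j := P (rep i) (rep j) + h i j))"
          using False by (auto simp: f_def fun_eq_iff)
        moreover have "mat_rel n ?c (P(rep i := (P (rep i))(rep j := P (rep i) (rep j) + h i j)))"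
          using J rep(2)[OF ij(2)] by (rule mat_rel_upd)
        ultimately have "Inv i (Suc j) (\<rho>(''c'' := ?c))" unfolding nxt by simp
        moreover have "\<rho> ''c'' (rep i * n + rep j) = P (rep i) (rep j)" using mat_relD[OF J] rep(2) ij(1,2) by simp
        ultimately show ?thesis using False rr ij by (auto simp: contract_entry_def)
      qed
    qed (simp add: contract_entry_def)
  qed simp_all
  have "runs contract_program \<sigma> (((1 + 2) * (n * n) + 2) + (((4 + 2) * n + 2 + 2) * n + 2)) (Inv n 0)"
    unfolding contract_program_def
  proof (rule runs_Seq[OF p1], goal_cases)
    case (1 \<tau>)
    then show ?case by (intro p2) simp_all
  qed
  then show ?thesis
  proof (rule runs_weaken)
    have "n * 1 \<le> n * n" by (rule mult_le_mono2) (rule n1)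
    moreover have "((1 + 2) * (n * n) + 2) + (((4 + 2) * n + 2 + 2) * n + 2) = 9 * (n * n) + 4 * n + 4" by (simp add: algebra_simps)
    ultimately show "((1 + 2) * (n * n) + 2) + (((4 + 2) * n + 2 + 2) * n + 2) \<le> 24 * (n * n)" using n1 by linarith
    fix \<tau> assume "Inv n 0 \<tau>"
    then show "mat_rel n (\<tau> ''c'') (contracted_mat rep h)" by (simp add: Inv_def mat_rel_def contracted_mat_def f_def)
  qed
qed

lemma eval_runs:
  assumes L: "L \<subseteq> {..<m}" and \<sigma>: "inst \<sigma>" "mat_rel n (\<sigma> ''lo'') (wmat L (cap I))" "mat_rel n (\<sigma> ''hi'') (wmat ({..<m} - L) (cap I))"
    and rep: "\<forall>x<n. \<sigma> ''rep'' x = rep x" "\<And>x. x < n \<Longrightarrow> rep x < n" and side: "\<forall>x<n. \<sigma> ''side'' x \<le> 1"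
  defines "D \<equiv> {x. x < n \<and> \<sigma> ''side'' (rep x) \<noteq> 0}"
  shows "runs eval_program \<sigma> (20 * (n * n)) (\<lambda>\<tau>. mat_rel n (\<tau> ''c'') (wmat ({..<m} - high_cut I L D) (cap I)) \<and>
     (\<forall>x<n. \<tau> ''ds'' x = (if x \<in> D then 1 else 0)))"
proof -
  note I\<sigma> = instD[OF \<sigma>(1)]
  have n1: "1 \<le> n" using n_pos by simp
  \<comment> \<open>Sides are 0 or 1, so \<open>eval_entry\<close> can decide by equality of numbers
    whether two vertices lie on the same side.\<close>
  have sd: "\<sigma> ''side'' (rep x) = (if x \<in> D then 1 else 0)" if "x < n" for x
    using side rep(2)[OF that] that le_Suc_eq by (auto simp: D_def)
  have p1: "runs (For ''x'' (Const 0) (var ''n'') (Assign ''ds'' (var ''x'') (Read ''side'' (Read ''rep'' (var ''x''))))) \<sigma> ((1 + 2) * n + 2)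
      (\<lambda>\<tau>. \<forall>x<n. \<tau> ''ds'' x = (if x \<in> D then 1 else 0))"
  proof (rule runs_For[where Inv = "\<lambda>i \<tau>. \<forall>x<i. \<tau> ''ds'' x = (if x \<in> D then 1 else 0)"])
    fix \<tau> assume ag: "agree (insert ''x'' (writes (Assign ''ds'' (var ''x'') (Read ''side'' (Read ''rep'' (var ''x'')))))) \<sigma> \<tau>"
    note A = agreeD[OF ag, simplified]
    show "aval (var ''n'') \<tau> = n" by (simp add: A I\<sigma>)
    fix i assume i: "i < n" "\<forall>x<i. \<tau> ''ds'' x = (if x \<in> D then 1 else 0)" "\<tau> ''x'' 0 = i"
    show "runs (Assign ''ds'' (var ''x'') (Read ''side'' (Read ''rep'' (var ''x'')))) \<tau> 1
        (\<lambda>\<tau>. \<forall>x<Suc i. (\<tau>(''x'' := (\<tau> ''x'')(0 := Suc i))) ''ds'' x = (if x \<in> D then 1 else 0))"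
      using i rep(1) sd[OF i(1)] by (intro runs_wpI) (auto simp: A less_Suc_eq)
  qed simp_all
  define g where "g = wmat ({..<m} - high_cut I L D) (cap I)"
  define Inv where "Inv i j \<tau> \<longleftrightarrow> (\<forall>x<n. \<forall>y<n. x < i \<or> (x = i \<and> y < j) \<longrightarrow> \<tau> ''c'' (x * n + y) = g x y)" for i j and \<tau> :: state
  have p2: "runs (For ''x'' (Const 0) (var ''n'') (For ''y'' (Const 0) (var ''n'') eval_entry)) \<tau> (((3 + 2) * n + 2 + 2) * n + 2) (Inv n 0)"
    if ds: "\<forall>x<n. \<tau> ''ds'' x = (if x \<in> D then 1 else 0)" and ag0: "agree {''x'', ''ds''} \<sigma> \<tau>" for \<tau>
  proof (rule runs_For2)
    note A = agreeD[OF ag0, simplified]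
    show "Inv 0 0 \<tau>" by (simp add: Inv_def)
    show "Inv i j (\<rho>(''x'' := h))" "Inv i j (\<rho>(''y'' := h))" if "Inv i j \<rho>" for i j \<rho> h using that by (simp_all add: Inv_def)
    show "aval (var ''n'') \<rho> = n" if ag: "agree (insert ''x'' (insert ''y'' (writes eval_entry))) \<tau> \<rho>" for \<rho>
      by (simp add: agreeD[OF ag, simplified] A I\<sigma>)
    show "Inv (Suc i) 0 \<rho>" if "Inv i n \<rho>" for i \<rho> using that by (simp add: Inv_def less_Suc_eq)
    fix i j \<rho> assume ij: "i < n" "j < n" "Inv i j \<rho>" "\<rho> ''x'' 0 = i" "\<rho> ''y'' 0 = j"
      and ag: "agree (insert ''x'' (insert ''y'' (writes eval_entry))) \<tau> \<rho>"
    note B = agreeD[OF ag, simplified]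
    have rr: "\<rho> ''row'' i = i * n" "\<rho> ''ds'' i = (if i \<in> D then 1 else 0)" "\<rho> ''ds'' j = (if j \<in> D then 1 else 0)"
      "\<rho> ''lo'' (i * n + j) = wmat L (cap I) i j" "\<rho> ''hi'' (i * n + j) = wmat ({..<m} - L) (cap I) i j"
      using ds ij(1,2) mat_relD[OF \<sigma>(2)] mat_relD[OF \<sigma>(3)] by (simp_all add: A B I\<sigma>)
    have gij: "g i j = wmat L (cap I) i j + (if i \<in> D \<longleftrightarrow> j \<in> D then wmat ({..<m} - L) (cap I) i j else 0)"
      unfolding g_def wmat_evaluation[OF L] ..
    let ?\<rho> = "\<rho>(''c'' := (\<rho> ''c'')(i * n + j := g i j))"
    have "Inv i (Suc j) ?\<rho>"
      unfolding Inv_def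
    proof (intro allI impI)
      fix x y assume xy: "x < n" "y < n" "x < i \<or> x = i \<and> y < Suc j"
      show "?\<rho> ''c'' (x * n + y) = g x y"
      proof (cases "x = i \<and> y = j")
        case False
        then have "x * n + y \<noteq> i * n + j" using mat_index[OF xy(2) ij(2)] by simp
        moreover have "x < i \<or> x = i \<and> y < j" using xy(3) False by auto
        ultimately show ?thesis using ij(3)[unfolded Inv_def, rule_format, OF xy(1,2)] by simp
      qed simp
    qed
    moreover have "wp eval_entry P \<rho> = P ?\<rho>" for P
      unfolding gij eval_entry_def by (cases "i \<in> D"; cases "j \<in> D") (simp_all add: rr ij(4,5))
    ultimately show "runs eval_entry \<rho> 3 (Inv i (Suc j))" by (intro runs_wpI) (simp_all add: eval_entry_def)
  qed simp_all
  have "runs eval_program \<sigma> (((1 + 2) * n + 2) + (((3 + 2) * n + 2 + 2) * n + 2)) (\<lambda>\<tau>. Inv n 0 \<tau> \<and> (\<forall>x<n. \<tau> ''ds'' x = (if x \<in> D then 1 else 0)))"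
    unfolding eval_program_def
  proof (rule runs_Seq[OF p1], goal_cases)
    case (1 \<tau>)
    then have "runs (For ''x'' (Const 0) (var ''n'') (For ''y'' (Const 0) (var ''n'') eval_entry)) \<tau> (((3 + 2) * n + 2 + 2) * n + 2) (Inv n 0)"
      by (intro p2) simp_all
    then show ?case
    proof (rule runs_weaken)
      fix \<rho> assume J: "Inv n 0 \<rho>" and ag: "agree (writes (For ''x'' (Const 0) (var ''n'') (For ''y'' (Const 0) (var ''n'') eval_entry))) \<tau> \<rho>"
      show "Inv n 0 \<rho> \<and> (\<forall>x<n. \<rho> ''ds'' x = (if x \<in> D then 1 else 0))" using 1(1) J by (simp add: agreeD[OF ag, simplified])
    qed simp
  qed
  then show ?thesis
  proof (rule runs_weaken)
    have "n * 1 \<le> n * n" by (rule mult_le_mono2) (rule n1)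
    moreover have "((1 + 2) * n + 2) + (((3 + 2) * n + 2 + 2) * n + 2) = 5 * (n * n) + 7 * n + 4" by (simp add: algebra_simps)
    ultimately show "((1 + 2) * n + 2) + (((3 + 2) * n + 2 + 2) * n + 2) \<le> 20 * (n * n)" using n1 by linarith
  qed (simp add: Inv_def g_def mat_rel_def)
qed

text \<open>What \<open>best\<close> in \<open>algorithm_output_intro\<close> demands of a triple,
  with the best value so far in the role of the distinguished objective. Some threshold cut is
  enough because a run may use any minimum cut.\<close>

definition covered :: "nat list \<Rightarrow> state \<Rightarrow> nat \<Rightarrow> nat \<Rightarrow> nat \<Rightarrow> bool" where
  "covered es \<tau> j e \<theta> \<longleftrightarrow> (let L = low_edges I es j e in \<not> low_conn I L \<theta> (source I) (sink I) \<longrightarrow>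
     (\<exists>D. threshold_cut I L \<theta> D \<and> (sum (cost I) (high_cut I L D) \<le> budget I \<longrightarrow>
        \<tau> ''found'' 0 \<noteq> 0 \<and> real (\<tau> ''best'' 0) \<le> objective I (high_cut I L D))))"

text \<open>The record is the distinguished candidate of \<open>algorithm_output_intro\<close>. The
  threshold itself is not stored and hence quantified. The bound 1 on \<open>bs\<close> lets the
  output compare sides by equality.\<close>

definition recorded :: "nat list \<Rightarrow> state \<Rightarrow> bool" where
  "recorded es \<tau> \<longleftrightarrow> (let j = \<tau> ''bj'' 0; e = \<tau> ''be'' 0; L = low_edges I es j e; D = {x. x < n \<and> \<tau> ''bs'' x \<noteq> 0} in
     1 \<le> j \<and> j \<le> m \<and> e < m \<and> (\<exists>\<theta>\<in>thresholds I L. threshold_cut I L \<theta> D) \<and>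
     sum (cost I) (high_cut I L D) \<le> budget I \<and> objective I (high_cut I L D) = real (\<tau> ''best'' 0) \<and> (\<forall>x<n. \<tau> ''bs'' x \<le> 1))"

definition best_ok :: "nat list \<Rightarrow> (nat \<times> nat \<times> nat) set \<Rightarrow> state \<Rightarrow> bool" where
  "best_ok es Done \<tau> \<longleftrightarrow> (\<forall>(j, e, \<theta>)\<in>Done. covered es \<tau> j e \<theta>) \<and> (\<tau> ''found'' 0 \<noteq> 0 \<longrightarrow> recorded es \<tau>)"

lemma best_ok_cong:
  assumes "agree W \<sigma> \<tau>" "best_ok es Done \<sigma>" "W \<inter> {''found'', ''best'', ''be'', ''bj'', ''bs''} = {}"
  shows "best_ok es Done \<tau>"
proof -
  have "\<tau> x = \<sigma> x" if "x \<in> {''found'', ''best'', ''be'', ''bj'', ''bs''}" for x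
    using assms(1,3) that by (auto simp: agree_def)
  then show ?thesis using assms(2) by (simp add: best_ok_def covered_def recorded_def)
qed

lemma best_ok_insert: "best_ok es Done \<tau> \<Longrightarrow> covered es \<tau> j e \<theta> \<Longrightarrow> best_ok es (insert (j, e, \<theta>) Done) \<tau>"
  by (simp add: best_ok_def)

text \<open>Covered triples stay covered, since a recorded best value is never replaced by a larger
  one.\<close>

lemma best_ok_improve:
  assumes ok: "best_ok es Done \<sigma>" and imp: "\<sigma> ''found'' 0 = 0 \<or> \<tau> ''best'' 0 \<le> \<sigma> ''best'' 0"
    and \<tau>: "\<tau> ''found'' 0 \<noteq> 0" "recorded es \<tau>" and new: "covered es \<tau> j e \<theta>"
  shows "best_ok es (insert (j, e, \<theta>) Done) \<tau>"
proof -
  have "covered es \<tau> i d \<eta>" if "covered es \<sigma> i d \<eta>" for i d \<eta>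
    using that imp \<tau>(1) unfolding covered_def Let_def by (smt (verit, ccfv_threshold) of_nat_le_iff)
  then show ?thesis using ok \<tau> new by (auto simp: best_ok_def)
qed

lemma compare_runs:
  assumes K: "1 \<le> K" "m \<le> K * K" and es: "set es = {..<m}" and \<sigma>: "inst \<sigma>" "\<sigma> ''e'' 0 = e" "\<sigma> ''j'' 0 = j"
    and ej: "e < m" "j < m" and L_def: "L = low_edges I es (Suc j) e" and th: "\<theta> \<in> thresholds I L"
    and mats: "mat_rel n (\<sigma> ''lo'') (wmat L (cap I))" "mat_rel n (\<sigma> ''hi'') (wmat ({..<m} - L) (cap I))"
    and rep: "\<forall>x<n. \<sigma> ''rep'' x = rep x" "\<And>x. x < n \<Longrightarrow> rep x < n" and side: "\<forall>x<n. \<sigma> ''side'' x \<le> 1"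
    and D: "D = {x. x < n \<and> \<sigma> ''side'' (rep x) \<noteq> 0}" "threshold_cut I L \<theta> D" "sum (cost I) (high_cut I L D) \<le> budget I"
    and ok: "best_ok es Done \<sigma>"
  shows "runs compare_program \<sigma> (20 * (n * n) + (1 + (1 + (1000 * (K * (n * n)) + Suc (1 + (1 + (1 + (1 + ((1 + 2) * n + 2)))))))))
     (best_ok es (insert (Suc j, e, \<theta>) Done))"
proof -
  have L: "L \<subseteq> {..<m}" unfolding L_def using low_edges_subset[of es I] es G(3) by simp
  define R where "R = high_cut I L D"
  note ev = eval_runs[OF L \<sigma>(1) mats rep side, folded D(1), folded R_def]
  show ?thesis unfolding compare_program_def
  proof (rule runs_Seq[OF ev], goal_cases)
    case (1 x) then show ?case .
  next
    case (2 \<tau>)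
    note A = agreeD[OF 2(2), simplified]
    have i\<tau>: "inst \<tau>" using 2(2) \<sigma>(1) by (rule inst_cong) simp
    have ok\<tau>: "best_ok es Done \<tau>" using 2(2) ok by (rule best_ok_cong) simp
    note I\<tau> = instD[OF i\<tau>]
    show ?case
    proof (rule flow_call_runs[OF I\<tau>(1) 2(1)[THEN conjunct1] _ _ _ K(1)])
      show "aval (var ''source'') \<tau> = source I" "aval (var ''sink'') (\<tau>(''fs'' := f)) = sink I" for f by (simp_all add: I\<tau>)
      show "flow_network n (wmat ({..<m} - R) (cap I)) (source I) (sink I)" using G(5-7) by (intro wmat_network) auto
      show "card (support n (wmat ({..<m} - R) (cap I))) \<le> 2 * (K * K)"
        using card_support_wmat[of "{..<m} - R" "cap I"] K(2) by auto
      fix \<rho> assume ag: "agree ({''fs'', ''ft''} \<union> flow_vars) \<tau> \<rho>"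
        and S: "matrix_min_cut n (wmat ({..<m} - R) (cap I)) (source I) (sink I) {v. v < n \<and> \<rho> ''side'' v \<noteq> 0}"
        and val: "\<rho> ''val'' 0 = matrix_cut n (wmat ({..<m} - R) (cap I)) {v. v < n \<and> \<rho> ''side'' v \<noteq> 0}"
      note B = agreeD[OF ag, simplified]
      have obj: "objective I R = real (\<rho> ''val'' 0)" using objective_of_matrix[OF S] val by simp
      have ok\<rho>: "best_ok es Done \<rho>" using ag ok\<tau> by (rule best_ok_cong) simp
      let ?b = "And (Leq (Const 1) (var ''found'')) (Leq (var ''best'') (var ''val''))"
      show "runs (IfThen (Not ?b) save_program) \<rho> (Suc (1 + (1 + (1 + (1 + ((1 + 2) * n + 2)))))) (best_ok es (insert (Suc j, e, \<theta>) Done))"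
      proof (rule runs_If)
        assume b: "bval (Not ?b) \<rho>"
        show "runs save_program \<rho> (1 + (1 + (1 + (1 + ((1 + 2) * n + 2))))) (best_ok es (insert (Suc j, e, \<theta>) Done))"
        proof (rule runs_weaken[OF save_runs])
          show "\<rho> ''n'' 0 = n" by (simp add: B I\<tau>)
          fix \<upsilon> assume u: "\<upsilon> ''found'' 0 = 1 \<and> \<upsilon> ''best'' 0 = \<rho> ''val'' 0 \<and> \<upsilon> ''be'' 0 = \<rho> ''e'' 0 \<and>
             \<upsilon> ''bj'' 0 = Suc (\<rho> ''j'' 0) \<and> (\<forall>x<n. \<upsilon> ''bs'' x = \<rho> ''ds'' x)"
          have bs: "\<upsilon> ''bs'' x = (if x \<in> D then 1 else 0)" if "x < n" for x using u 2(1) that by (simp add: B)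
          have Deq: "{x. x < n \<and> \<upsilon> ''bs'' x \<noteq> 0} = D" using bs by (auto simp: D(1) split: if_splits)
          have be: "\<upsilon> ''bj'' 0 = Suc j" "\<upsilon> ''be'' 0 = e" using u by (simp_all add: A B \<sigma>)
          show "best_ok es (insert (Suc j, e, \<theta>) Done) \<upsilon>"
          proof (rule best_ok_improve[OF ok\<rho>])
            show "\<rho> ''found'' 0 = 0 \<or> \<upsilon> ''best'' 0 \<le> \<rho> ''best'' 0" using b u by auto
            show "\<upsilon> ''found'' 0 \<noteq> 0" using u by simp
            show "recorded es \<upsilon>" unfolding recorded_def Let_def be Deq L_def[symmetric] R_def[symmetric]
              proof (intro conjI allI impI bexI[OF _ th])
              show "\<upsilon> ''bs'' x \<le> 1" if "x < n" for x using bs[OF that] by simp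
            qed (use ej D(2,3) obj u in \<open>auto simp: R_def\<close>)
            have "real (\<upsilon> ''best'' 0) \<le> objective I (high_cut I L D)" using obj u by (simp add: R_def)
            then show "covered es \<upsilon> (Suc j) e \<theta>" unfolding covered_def Let_def L_def[symmetric]
              using D(2) u by auto
          qed
        qed simp
      next
        assume "\<not> bval (Not ?b) \<rho>"
        then have "\<rho> ''found'' 0 \<noteq> 0" "real (\<rho> ''best'' 0) \<le> objective I R" by (simp_all add: obj)
        then have "covered es \<rho> (Suc j) e \<theta>" unfolding covered_def Let_def L_def[symmetric] R_def using D(2) by blast
        then have "best_ok es (insert (Suc j, e, \<theta>) Done) \<rho>" by (rule best_ok_insert[OF ok\<rho>])
        then show "runs Skip \<rho> (1 + (1 + (1 + (1 + ((1 + 2) * n + 2))))) (best_ok es (insert (Suc j, e, \<theta>) Done))"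
          by (intro runs_wpI) simp_all
      qed
    qed
  qed
qed

lemma cut_runs:
  assumes K: "1 \<le> K" "m \<le> K * K" and es: "set es = {..<m}" and \<sigma>: "inst \<sigma>" "\<sigma> ''e'' 0 = e" "\<sigma> ''j'' 0 = j"
    and ej: "e < m" "j < m" and L_def: "L = low_edges I es (Suc j) e" and th: "\<theta> \<in> thresholds I L"
    and mats: "mat_rel n (\<sigma> ''lo'') (wmat L (cap I))" "mat_rel n (\<sigma> ''hi'') (wmat ({..<m} - L) (cap I))"
      "mat_rel n (\<sigma> ''hc'') (wmat ({..<m} - L) (cost I))"
    and rep: "\<forall>x<n. \<sigma> ''rep'' x = low_rep L \<theta> x" and ne: "low_rep L \<theta> (source I) \<noteq> low_rep L \<theta> (sink I)"
    and ok: "best_ok es Done \<sigma>"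
  shows "runs cut_program \<sigma> (24 * (n * n) + (1 + (1 + (1000 * (K * (n * n)) +
       Suc (20 * (n * n) + (1 + (1 + (1000 * (K * (n * n)) + Suc (1 + (1 + (1 + (1 + ((1 + 2) * n + 2)))))))))))))
     (best_ok es (insert (Suc j, e, \<theta>) Done))"
proof -
  have L: "L \<subseteq> {..<m}" unfolding L_def using low_edges_subset[of es I] es G(3) by simp
  let ?rep = "low_rep L \<theta>" and ?h = "wmat ({..<m} - L) (cost I)"
  let ?c = "contracted_mat ?rep ?h"
  have rn: "?rep x < n" if "x < n" for x using low_rep(1)[OF L that] .
  note con = contract_runs[OF \<sigma>(1) mats(3) rep rn]
  show ?thesis unfolding cut_program_def
  proof (rule runs_Seq[OF con], goal_cases)
    case (1 x) then show ?case .
  next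
    case (2 \<tau>)
    note A = agreeD[OF 2(2), simplified]
    have i\<tau>: "inst \<tau>" using 2(2) \<sigma>(1) by (rule inst_cong) simp
    have ok\<tau>: "best_ok es Done \<tau>" using 2(2) ok by (rule best_ok_cong) simp
    note I\<tau> = instD[OF i\<tau>]
    show ?case
    proof (rule flow_call_runs[OF I\<tau>(1) 2(1) _ _ _ K(1)])
      show "aval (Read ''rep'' (var ''source'')) \<tau> = ?rep (source I)" "aval (Read ''rep'' (var ''sink'')) (\<tau>(''fs'' := f)) = ?rep (sink I)" for f
        using rep G(5,6) by (simp_all add: I\<tau>, simp_all add: A)
      show "flow_network n ?c (?rep (source I)) (?rep (sink I))"
        using rn G(5,6) ne by (intro contracted_network) (auto simp: wmat_def insert_commute)
      have "card (support n ?c) \<le> card (support n ?h)" by (rule card_support_contracted)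
      also have "\<dots> \<le> 2 * m" by (rule card_support_wmat) auto
      finally show "card (support n ?c) \<le> 2 * (K * K)" using K(2) by linarith
      fix \<rho> assume ag: "agree ({''fs'', ''ft''} \<union> flow_vars) \<tau> \<rho>" and side: "\<forall>v<n. \<rho> ''side'' v \<le> 1"
        and S: "matrix_min_cut n ?c (?rep (source I)) (?rep (sink I)) {v. v < n \<and> \<rho> ''side'' v \<noteq> 0}"
        and val: "\<rho> ''val'' 0 = matrix_cut n ?c {v. v < n \<and> \<rho> ''side'' v \<noteq> 0}"
      note B = agreeD[OF ag, simplified]
      define D where "D = {x. x < n \<and> \<rho> ''side'' (?rep x) \<noteq> 0}"
      have Deq: "{v. v < n \<and> ?rep v \<in> {v. v < n \<and> \<rho> ''side'' v \<noteq> 0}} = D" using rn by (auto simp: D_def)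
      note tc = threshold_cut_of_matrix[OF L rn low_rep(2)[OF L] ne S, unfolded Deq]
      have i\<rho>: "inst \<rho>" using ag i\<tau> by (rule inst_cong) simp
      have ok\<rho>: "best_ok es Done \<rho>" using ag ok\<tau> by (rule best_ok_cong) simp
      have val': "\<rho> ''val'' 0 = sum (cost I) (high_cut I L D)" using tc(2) val by simp
      let ?k = "20 * (n * n) + (1 + (1 + (1000 * (K * (n * n)) + Suc (1 + (1 + (1 + (1 + ((1 + 2) * n + 2))))))))"
      show "runs (IfThen (Leq (var ''val'') (var ''budget'')) compare_program) \<rho> (Suc ?k) (best_ok es (insert (Suc j, e, \<theta>) Done))"
      proof (rule runs_If)
        assume "bval (Leq (var ''val'') (var ''budget'')) \<rho>"
        then have D3: "sum (cost I) (high_cut I L D) \<le> budget I" using val' instD(8)[OF i\<rho>] by simp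
        have e: "\<rho> ''e'' 0 = e" "\<rho> ''j'' 0 = j" "\<rho> ''lo'' = \<sigma> ''lo''" "\<rho> ''hi'' = \<sigma> ''hi''" "\<rho> ''rep'' = \<sigma> ''rep''"
          by (simp_all add: A B \<sigma>)
        show "runs compare_program \<rho> ?k (best_ok es (insert (Suc j, e, \<theta>) Done))"
          by (rule compare_runs[OF K es i\<rho> e(1,2) ej L_def th _ _ _ rn side D_def tc(1) D3 ok\<rho>]) (simp_all add: e mats rep)
      next
        assume "\<not> bval (Leq (var ''val'') (var ''budget'')) \<rho>"
        then have "\<not> sum (cost I) (high_cut I L D) \<le> budget I" using val' instD(8)[OF i\<rho>] by simp
        \<comment> \<open>The cheapest cut exceeds the budget, so nothing is stored for this triple
          and the implication in \<open>covered\<close> holds vacuously.\<close>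
        then have "covered es \<rho> (Suc j) e \<theta>" unfolding covered_def Let_def L_def[symmetric] using tc(1) by blast
        then have "best_ok es (insert (Suc j, e, \<theta>) Done) \<rho>" by (rule best_ok_insert[OF ok\<rho>])
        then show "runs Skip \<rho> ?k (best_ok es (insert (Suc j, e, \<theta>) Done))" by (intro runs_wpI) simp_all
      qed
    qed
  qed
qed

text \<open>At most two maximum flows, for the minimum cost cut and for the evaluation, at
  \<open>1000 * (K * (n * n))\<close> steps each; all other passes are quadratic in
  \<open>n\<close>. If source and sink are identified, there is nothing to cover.\<close>

lemma threshold_step_runs:
  assumes K: "1 \<le> K" "m \<le> K * K" and es: "set es = {..<m}" and \<sigma>: "inst \<sigma>" "\<sigma> ''e'' 0 = e" "\<sigma> ''j'' 0 = j" "\<sigma> ''k'' 0 = k"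
    and ej: "e < m" "j < m" and k: "1 \<le> k" "k < n" and L_def: "L = low_edges I es (Suc j) e" and gh: "gh_done L \<sigma>"
    and mats: "mat_rel n (\<sigma> ''lo'') (wmat L (cap I))" "mat_rel n (\<sigma> ''hi'') (wmat ({..<m} - L) (cap I))"
      "mat_rel n (\<sigma> ''hc'') (wmat ({..<m} - L) (cost I))"
    and ok: "best_ok es Done \<sigma>"
  shows "runs threshold_step \<sigma> (2100 * (K * (n * n))) (best_ok es (insert (Suc j, e, \<sigma> ''fl'' k) Done))"
proof -
  have L: "L \<subseteq> {..<m}" unfolding L_def using low_edges_subset[of es I] es G(3) by simp
  define \<theta> where "\<theta> = \<sigma> ''fl'' k"
  have th: "\<theta> \<in> thresholds I L" using gh k by (auto simp: gh_done_def \<theta>_def)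
  let ?\<sigma> = "\<sigma>(''theta'' := (\<sigma> ''theta'')(0 := \<theta>))"
  let ?k = "24 * (n * n) + (1 + (1 + (1000 * (K * (n * n)) +
       Suc (20 * (n * n) + (1 + (1 + (1000 * (K * (n * n)) + Suc (1 + (1 + (1 + (1 + ((1 + 2) * n + 2))))))))))))"
  have "runs threshold_step \<sigma> (1 + (20 * (n * n) + Suc ?k)) (best_ok es (insert (Suc j, e, \<theta>) Done))"
    unfolding threshold_step_def
  proof (rule runs_Seq[where Q = "\<lambda>\<tau>. \<tau> = ?\<sigma>"], goal_cases)
    case 1 show ?case by (intro runs_wpI) (simp_all add: \<sigma> \<theta>_def)
  next
    case (2 \<tau>)
    have i\<tau>: "inst \<tau>" using 2(2) \<sigma>(1) by (rule inst_cong) simp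
    have ok\<tau>: "best_ok es Done \<tau>" using 2(2) ok by (rule best_ok_cong) simp
    have rr: "runs rep_program \<tau> (20 * (n * n)) (\<lambda>\<tau>. \<forall>x<n. \<tau> ''rep'' x = low_rep L \<theta> x)"
      using L i\<tau> by (rule rep_runs) (use gh in \<open>simp_all add: 2(1) gh_done_def\<close>)
    show ?case
    proof (rule runs_Seq[OF rr], goal_cases)
      case (1 \<rho>)
      note A = agreeD[OF 1(2), simplified]
      have i\<rho>: "inst \<rho>" using 1(2) i\<tau> by (rule inst_cong) simp
      have ok\<rho>: "best_ok es Done \<rho>" using 1(2) ok\<tau> by (rule best_ok_cong) simp
      have e: "\<rho> ''e'' 0 = e" "\<rho> ''j'' 0 = j" "\<rho> ''lo'' = \<sigma> ''lo''" "\<rho> ''hi'' = \<sigma> ''hi''" "\<rho> ''hc'' = \<sigma> ''hc''"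
        by (simp_all add: A 2 \<sigma>)
      have r: "\<rho> ''rep'' (source I) = low_rep L \<theta> (source I)" "\<rho> ''rep'' (sink I) = low_rep L \<theta> (sink I)"
        using 1(1) G(5,6) by simp_all
      let ?b = "Equal (Read ''rep'' (var ''source'')) (Read ''rep'' (var ''sink''))"
      have b: "bval (Not ?b) \<rho> \<longleftrightarrow> low_rep L \<theta> (source I) \<noteq> low_rep L \<theta> (sink I)" using r instD(6,7)[OF i\<rho>] by auto
      show ?case
      proof (rule runs_If)
        assume "bval (Not ?b) \<rho>"
        then have ne: "low_rep L \<theta> (source I) \<noteq> low_rep L \<theta> (sink I)" using b by simp
        show "runs cut_program \<rho> ?k (best_ok es (insert (Suc j, e, \<theta>) Done))"
          by (rule cut_runs[OF K es i\<rho> e(1,2) ej L_def th _ _ _ 1(1) ne ok\<rho>]) (simp_all add: e mats)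
      next
        assume "\<not> bval (Not ?b) \<rho>"
        then have "low_conn I L \<theta> (source I) (sink I)" using b low_rep(2)[OF L] G(5,6) by simp
        then have "covered es \<rho> (Suc j) e \<theta>" by (simp add: covered_def L_def)
        then have "best_ok es (insert (Suc j, e, \<theta>) Done) \<rho>" by (rule best_ok_insert[OF ok\<rho>])
        then show "runs Skip \<rho> ?k (best_ok es (insert (Suc j, e, \<theta>) Done))" by (intro runs_wpI) simp_all
      qed
    qed
  qed
  then show ?thesis unfolding \<theta>_def
  proof (rule runs_weaken)
    have n1: "1 \<le> n" using n_pos by simp
    have "n * 1 \<le> n * n" by (rule mult_le_mono2) (rule n1)
    moreover have "1 * (n * n) \<le> K * (n * n)" by (rule mult_le_mono1) (rule K(1))
    moreover have "1 + (20 * (n * n) + Suc ?k) = 2000 * (K * (n * n)) + 64 * (n * n) + 3 * n + 14" by simp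
    ultimately show "1 + (20 * (n * n) + Suc ?k) \<le> 2100 * (K * (n * n))" using n1 by linarith
  qed
qed

end

section \<open>The whole algorithm\<close>

text \<open>Multiples of \<open>n\<close> by repeated addition. The entry at \<open>n\<close>, which
  is \<open>n * n\<close>, bounds the loops over whole matrices.\<close>

definition rows_program :: com where
  "rows_program = For ''i'' (Const 0) (var ''n'') (Assign ''row'' (Plus (var ''i'') (Const 1)) (Plus (Read ''row'' (var ''i'')) (var ''n'')))"

definition proper_cost_program :: com where
  "proper_cost_program = For ''x'' (Const 0) (var ''m'')
     (If (And (Leq (Read ''cap'' (var ''x'')) (Const 0)) (Leq (Read ''cost'' (var ''x'')) (Const 0)))
        (Assign ''pc'' (var ''x'') (Const 1)) (Assign ''pc'' (var ''x'') (Read ''cost'' (var ''x''))))"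

definition efficiency_leq :: "string \<Rightarrow> string \<Rightarrow> bexp" where
  "efficiency_leq x y = LeqProd (Read ''cap'' (var x)) (Read ''pc'' (var y)) (Read ''cap'' (var y)) (Read ''pc'' (var x))"

definition rank_entry :: com where
  "rank_entry = IfThen (And (efficiency_leq ''y'' ''x'') (Not (And (efficiency_leq ''x'' ''y'') (Leq (var ''x'') (var ''y'')))))
     (Assign ''rk'' (var ''x'') (Plus (Read ''rk'' (var ''x'')) (Const 1)))"

text \<open>The position of an edge is found by counting its predecessors. Quadratic sorting is good
  enough, as m^2 is below the bound to be shown.\<close>

definition order_program :: com where
  "order_program =
     (For ''x'' (Const 0) (var ''m'') (For ''y'' (Const 0) (var ''m'') rank_entry) ;;
      For ''x'' (Const 0) (var ''m'') (Assign ''ord'' (Read ''rk'' (var ''x'')) (var ''x'')))"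

definition add_edge :: "string \<Rightarrow> string \<Rightarrow> com" where
  "add_edge X W =
     (Assign X (entry (Read ''a'' (var ''z'')) (Read ''b'' (var ''z'')))
        (Plus (Read X (entry (Read ''a'' (var ''z'')) (Read ''b'' (var ''z'')))) (Read W (var ''z''))) ;;
      Assign X (entry (Read ''b'' (var ''z'')) (Read ''a'' (var ''z'')))
        (Plus (Read X (entry (Read ''b'' (var ''z'')) (Read ''a'' (var ''z'')))) (Read W (var ''z''))))"

definition remove_edge :: "string \<Rightarrow> string \<Rightarrow> com" where
  "remove_edge X W =
     (Assign X (entry (Read ''a'' (var ''z'')) (Read ''b'' (var ''z'')))
        (Minus (Read X (entry (Read ''a'' (var ''z'')) (Read ''b'' (var ''z'')))) (Read W (var ''z''))) ;;
      Assign X (entry (Read ''b'' (var ''z'')) (Read ''a'' (var ''z'')))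
        (Minus (Read X (entry (Read ''b'' (var ''z'')) (Read ''a'' (var ''z'')))) (Read W (var ''z''))))"

definition clear_entry :: com where
  "clear_entry = (Assign ''lo'' (var ''q'') (Const 0) ;; Assign ''hi'' (var ''q'') (Const 0) ;; Assign ''hc'' (var ''q'') (Const 0))"

definition reset_program :: com where
  "reset_program =
     (For ''q'' (Const 0) (Read ''row'' (var ''n'')) clear_entry ;;
      For ''z'' (Const 0) (var ''m'') (add_edge ''hi'' ''cap'' ;; add_edge ''hc'' ''cost''))"

text \<open>From one position to the next \<open>low_edges\<close> gains at most one edge, so the
  matrices are updated in constant time. Rebuilding them would cost m for each of the m^2 pairs, and
  m^3 is too much when parallel edges abound.\<close>

definition move_program :: com where
  "move_program =
     (''z'' ::= Read ''ord'' (var ''j'') ;;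
      IfThen (Leq (Read ''cap'' (var ''z'')) (Read ''cap'' (var ''e'')))
        (add_edge ''lo'' ''cap'' ;; remove_edge ''hi'' ''cap'' ;; remove_edge ''hc'' ''cost''))"

definition position_step :: com where
  "position_step = (move_program ;; gh_program ;; For ''k'' (Const 1) (var ''n'') threshold_step)"

text \<open>For a fixed \<open>e\<close> the low edges grow monotonically with \<open>j\<close>.
  Putting \<open>e\<close> outside therefore limits the rebuilding of the matrices to m
  times.\<close>

definition edge_step :: com where
  "edge_step = (reset_program ;; For ''j'' (Const 0) (var ''m'') position_step)"

text \<open>Whether an edge is low is decided from its position and the capacity of the saved edge.
  Only here, once, is the vertex side turned into a set of edges.\<close>

definition output_entry :: com where
  "output_entry =
     (''z'' ::= Read ''ord'' (var ''x'') ;;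
      If (And (Not (And (Less (var ''x'') (var ''bj'')) (Leq (Read ''cap'' (var ''z'')) (Read ''cap'' (var ''be'')))))
           (Not (Equal (Read ''bs'' (Read ''a'' (var ''z''))) (Read ''bs'' (Read ''b'' (var ''z''))))))
        (Assign ''out'' (var ''z'') (Const 1)) (Assign ''out'' (var ''z'') (Const 0)))"

definition nfi_program :: com where
  "nfi_program =
     (rows_program ;; proper_cost_program ;; order_program ;; For ''e'' (Const 0) (var ''m'') edge_step ;;
      For ''x'' (Const 0) (var ''m'') output_entry)"

lemma writes_main [simp]:
  "writes rows_program = {''i'', ''row''}"
  "writes proper_cost_program = {''x'', ''pc''}"
  "writes rank_entry = {''rk''}"
  "writes order_program = {''x'', ''y'', ''rk'', ''ord''}"
  "writes (add_edge X W) = {X}"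
  "writes (remove_edge X W) = {X}"
  "writes clear_entry = {''lo'', ''hi'', ''hc''}"
  "writes reset_program = {''q'', ''lo'', ''hi'', ''hc'', ''z''}"
  "writes move_program = {''z'', ''lo'', ''hi'', ''hc''}"
  "writes output_entry = {''z'', ''out''}"
  by (auto simp: rows_program_def proper_cost_program_def rank_entry_def order_program_def add_edge_def remove_edge_def
      clear_entry_def reset_program_def move_program_def output_entry_def)

lemma writes_steps [simp]:
  "writes position_step = {''z'', ''lo'', ''hi'', ''hc''} \<union> writes gh_program \<union> insert ''k'' (writes threshold_step)"
  "writes edge_step = {''q'', ''lo'', ''hi'', ''hc'', ''z''} \<union> insert ''j'' (writes position_step)"
  unfolding position_step_def edge_step_def by auto

lemma not_flow_vars_main [simp]: "x \<notin> flow_vars" if "x \<in> {''pc'', ''rk'', ''z'', ''out''}"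
  using that by (auto simp: flow_vars_def)

section \<open>Sorting by efficiency\<close>

lemma rank_bij:
  fixes R :: "nat \<Rightarrow> nat \<Rightarrow> bool"
  assumes irrefl: "\<And>x. \<not> R x x" and trans: "\<And>x y z. R x y \<Longrightarrow> R y z \<Longrightarrow> R x z" and total: "\<And>x y. x \<noteq> y \<Longrightarrow> R x y \<or> R y x"
    and rk: "\<And>x. x < m \<Longrightarrow> rk x = card {y. y < m \<and> R y x}"
  shows "bij_betw rk {..<m} {..<m}" and "\<And>x y. x < m \<Longrightarrow> y < m \<Longrightarrow> rk x < rk y \<Longrightarrow> R x y"
proof -
  have mono: "rk x < rk y" if "x < m" "y < m" "R x y" for x y
  proof -
    have "{z. z < m \<and> R z x} \<subseteq> {z. z < m \<and> R z y}" using trans that(3) by blast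
    moreover have "x \<in> {z. z < m \<and> R z y}" "x \<notin> {z. z < m \<and> R z x}" using that irrefl by auto
    ultimately show ?thesis unfolding rk[OF that(1)] rk[OF that(2)] by (intro psubset_card_mono) (simp, blast)
  qed
  have inj: "inj_on rk {..<m}"
  proof (rule inj_onI)
    fix x y assume xy: "x \<in> {..<m}" "y \<in> {..<m}" "rk x = rk y"
    then show "x = y" using mono[of x y] mono[of y x] total[of x y] by auto
  qed
  have "rk x < m" if x: "x < m" for x
  proof -
    have "card {y. y < m \<and> R y x} < card {..<m}" using x irrefl by (intro psubset_card_mono) auto
    then show ?thesis using rk[OF x] by simp
  qed
  then have "rk ` {..<m} \<subseteq> {..<m}" by auto
  then have "rk ` {..<m} = {..<m}" using inj by (intro card_subset_eq) (auto simp: card_image)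
  then show "bij_betw rk {..<m} {..<m}" using inj by (simp add: bij_betw_def)
  show "R x y" if xy: "x < m" "y < m" "rk x < rk y" for x y
    using mono[OF xy(2,1)] total[of x y] xy(3) by (cases "x = y") auto
qed

context numbered_nfi
begin

definition sorted_order :: "(nat \<Rightarrow> nat) \<Rightarrow> bool" where
  "sorted_order p \<longleftrightarrow> bij_betw p {..<m} {..<m} \<and> (\<forall>i<m. \<forall>j<m. i < j \<longrightarrow> efficiency I (p i) \<le> efficiency I (p j))"

lemma sorted_orderD:
  assumes "sorted_order p"
  shows "distinct (map p [0..<m])" "set (map p [0..<m]) = {..<m}" "sorted_wrt (\<lambda>x y. efficiency I x \<le> efficiency I y) (map p [0..<m])"
    "\<And>i. i < m \<Longrightarrow> p i < m"
proof -
  have p: "inj_on p {..<m}" "p ` {..<m} = {..<m}" "\<And>i j. i < j \<Longrightarrow> j < m \<Longrightarrow> efficiency I (p i) \<le> efficiency I (p j)"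
    using assms by (simp_all add: sorted_order_def bij_betw_def)
  show "distinct (map p [0..<m])" "set (map p [0..<m]) = {..<m}" using p(1,2) by (simp_all add: distinct_map atLeast0LessThan)
  show "sorted_wrt (\<lambda>x y. efficiency I x \<le> efficiency I y) (map p [0..<m])"
    unfolding sorted_wrt_iff_nth_less using p(3) by simp
  show "p i < m" if "i < m" for i using p(2) that by blast
qed

lemma rows_runs:
  assumes \<sigma>: "\<sigma> = input_state I n m a b"
  shows "runs rows_program \<sigma> ((1 + 2) * n + 2) inst"
  unfolding rows_program_def
proof (rule runs_For[where Inv = "\<lambda>i \<tau>. \<forall>x\<le>i. \<tau> ''row'' x = x * n"])
  have in\<sigma>: "\<sigma> ''n'' 0 = n" "\<sigma> ''m'' 0 = m" "\<sigma> ''source'' 0 = source I" "\<sigma> ''sink'' 0 = sink I" "\<sigma> ''budget'' 0 = budget I" "\<sigma> ''row'' 0 = 0"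
    "\<And>e. e < m \<Longrightarrow> \<sigma> ''a'' e = a e" "\<And>e. e < m \<Longrightarrow> \<sigma> ''b'' e = b e" "\<And>e. e < m \<Longrightarrow> \<sigma> ''cap'' e = cap I e" "\<And>e. e < m \<Longrightarrow> \<sigma> ''cost'' e = cost I e"
    by (simp_all add: \<sigma> input_state_def scalar_def array_def)
  fix \<tau> assume ag: "agree (insert ''i'' (writes (Assign ''row'' (Plus (var ''i'') (Const 1)) (Plus (Read ''row'' (var ''i'')) (var ''n''))))) \<sigma> \<tau>"
  note A = agreeD[OF ag, simplified]
  show "aval (var ''n'') \<tau> = n" by (simp add: A in\<sigma>)
  { fix i assume i: "\<forall>x\<le>i. \<tau> ''row'' x = x * n" "\<tau> ''i'' 0 = i"
    show "runs (Assign ''row'' (Plus (var ''i'') (Const 1)) (Plus (Read ''row'' (var ''i'')) (var ''n''))) \<tau> 1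
        (\<lambda>\<tau>. \<forall>x\<le>Suc i. (\<tau>(''i'' := (\<tau> ''i'')(0 := Suc i))) ''row'' x = x * n)"
      using i by (intro runs_wpI) (auto simp: A in\<sigma> le_Suc_eq) }
  assume "\<forall>x\<le>n. \<tau> ''row'' x = x * n"
  then show "inst \<tau>" by (simp add: inst_def rows_def A in\<sigma>)
qed (simp_all add: \<sigma> input_state_def)

lemma proper_cost_runs:
  assumes \<sigma>: "inst \<sigma>"
  shows "runs proper_cost_program \<sigma> ((3 + 2) * m + 2) (\<lambda>\<tau>. \<forall>x<m. \<tau> ''pc'' x = proper_cost I x)"
  unfolding proper_cost_program_def
proof (rule runs_For[where Inv = "\<lambda>i \<tau>. \<forall>x<i. \<tau> ''pc'' x = proper_cost I x"])
  let ?p = "If (And (Leq (Read ''cap'' (var ''x'')) (Const 0)) (Leq (Read ''cost'' (var ''x'')) (Const 0)))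
        (Assign ''pc'' (var ''x'') (Const 1)) (Assign ''pc'' (var ''x'') (Read ''cost'' (var ''x'')))"
  fix \<tau> assume ag: "agree (insert ''x'' (writes ?p)) \<sigma> \<tau>"
  note A = agreeD[OF ag, simplified]
  show "aval (var ''m'') \<tau> = m" by (simp add: A instD[OF \<sigma>])
  fix i assume i: "i < m" "\<forall>x<i. \<tau> ''pc'' x = proper_cost I x" "\<tau> ''x'' 0 = i"
  show "runs ?p \<tau> 3 (\<lambda>\<tau>. \<forall>x<Suc i. (\<tau>(''x'' := (\<tau> ''x'')(0 := Suc i))) ''pc'' x = proper_cost I x)"
    using i by (intro runs_wpI) (auto simp: A instD[OF \<sigma>] less_Suc_eq proper_cost_def)
qed simp_all

text \<open>Lexicographic comparison of efficiency and index, a strict total order. It is phrased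
  with \<open>\<le>\<close> on efficiencies because this is what a comparison of products
  decides.\<close>

definition precedes :: "nat \<Rightarrow> nat \<Rightarrow> bool" where
  "precedes y x \<longleftrightarrow> efficiency I y \<le> efficiency I x \<and> \<not> (efficiency I x \<le> efficiency I y \<and> x \<le> y)"

lemma order_runs:
  assumes \<sigma>: "inst \<sigma>" "\<forall>x<m. \<sigma> ''pc'' x = proper_cost I x" "\<forall>x. \<sigma> ''rk'' x = 0"
  shows "runs order_program \<sigma> ((((3 + 2) * m + 2 + 2) * m + 2) + ((1 + 2) * m + 2)) (\<lambda>\<tau>. sorted_order (\<tau> ''ord''))"
proof -
  note I\<sigma> = instD[OF \<sigma>(1)]
  define rk where "rk x = card {y. y < m \<and> precedes y x}" for x
  define Inv where "Inv i j \<tau> \<longleftrightarrow> (\<forall>x<m. \<tau> ''rk'' x = card {y. y < (if x < i then m else if x = i then j else 0) \<and> precedes y x})"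
    for i j and \<tau> :: state
  have p1: "runs (For ''x'' (Const 0) (var ''m'') (For ''y'' (Const 0) (var ''m'') rank_entry)) \<sigma> (((3 + 2) * m + 2 + 2) * m + 2) (Inv m 0)"
  proof (rule runs_For2)
    show "Inv 0 0 \<sigma>" using \<sigma>(3) by (simp add: Inv_def)
    show "Inv i j (\<rho>(''x'' := f))" "Inv i j (\<rho>(''y'' := f))" if "Inv i j \<rho>" for i j \<rho> f using that by (simp_all add: Inv_def)
    show "aval (var ''m'') \<rho> = m" if ag: "agree (insert ''x'' (insert ''y'' (writes rank_entry))) \<sigma> \<rho>" for \<rho>
      by (simp add: agreeD[OF ag, simplified] I\<sigma>)
    show "Inv (Suc i) 0 \<rho>" if "Inv i m \<rho>" for i \<rho>
      unfolding Inv_def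
    proof (intro allI impI)
      fix x assume x: "x < m"
      have "\<rho> ''rk'' x = card {y. y < (if x < i then m else if x = i then m else 0) \<and> precedes y x}"
        using that x unfolding Inv_def by simp
      then show "\<rho> ''rk'' x = card {y. y < (if x < Suc i then m else if x = Suc i then 0 else 0) \<and> precedes y x}"
        by (cases "x < i"; cases "x = i") simp_all
    qed
    fix i j \<rho> assume ij: "i < m" "j < m" "Inv i j \<rho>" "\<rho> ''x'' 0 = i" "\<rho> ''y'' 0 = j"
      and ag: "agree (insert ''x'' (insert ''y'' (writes rank_entry))) \<sigma> \<rho>"
    note B = agreeD[OF ag, simplified]
    have rr: "\<rho> ''cap'' i = cap I i" "\<rho> ''cap'' j = cap I j" "\<rho> ''pc'' i = proper_cost I i" "\<rho> ''pc'' j = proper_cost I j"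
      using ij(1,2) \<sigma>(2) by (simp_all add: B I\<sigma>)
    let ?new = "if precedes j i then Suc (\<rho> ''rk'' i) else \<rho> ''rk'' i"
    let ?\<rho> = "\<rho>(''rk'' := (\<rho> ''rk'')(i := ?new))"
    have split: "{y. y < Suc j \<and> precedes y i} = (if precedes j i then insert j {y. y < j \<and> precedes y i} else {y. y < j \<and> precedes y i})"
      by (auto simp: less_Suc_eq)
    have "\<rho> ''rk'' i = card {y. y < j \<and> precedes y i}" using ij(1,3) by (simp add: Inv_def)
    then have "?new = card {y. y < Suc j \<and> precedes y i}" unfolding split by simp
    then have J: "Inv i (Suc j) ?\<rho>" using ij(3) unfolding Inv_def by simp
    have b: "bval (And (efficiency_leq ''y'' ''x'') (Not (And (efficiency_leq ''x'' ''y'') (Leq (var ''x'') (var ''y''))))) \<rho> \<longleftrightarrow> precedes j i"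
      using rr ij(4,5) by (simp add: efficiency_leq_def precedes_def efficiency_le_iff)
    have step: "wp (IfThen c q) P \<rho> = (if bval c \<rho> then wp q P \<rho> else P \<rho>)" for c q P by simp
    have "wp rank_entry P \<rho> = P ?\<rho>" for P
    proof (cases "precedes j i")
      case True
      then show ?thesis unfolding rank_entry_def step b by (simp add: ij(4))
    next
      case False
      have "?\<rho> = \<rho>" using False by (simp add: fun_eq_iff)
      then show ?thesis unfolding rank_entry_def step b using False by simp
    qed
    then show "runs rank_entry \<rho> 3 (Inv i (Suc j))" using J by (intro runs_wpI) (simp_all add: rank_entry_def)
  qed simp_all
  have lex: "precedes x y \<longleftrightarrow> efficiency I x < efficiency I y \<or> (efficiency I x = efficiency I y \<and> x < y)" for x y
    unfolding precedes_def by (cases "efficiency I x" "efficiency I y" rule: linorder_cases) auto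
  have prec: "\<not> precedes x x" "precedes x y \<Longrightarrow> precedes y z \<Longrightarrow> precedes x z" "x \<noteq> y \<Longrightarrow> precedes x y \<or> precedes y x" for x y z
    unfolding lex by auto
  have bij: "bij_betw rk {..<m} {..<m}"
    by (rule rank_bij(1)[of precedes m rk]) (rule prec(1), erule (1) prec(2), erule prec(3), rule rk_def)
  have rkp: "precedes x y" if "x < m" "y < m" "rk x < rk y" for x y
    by (rule rank_bij(2)[of precedes m rk]) (rule prec(1), erule (1) prec(2), erule prec(3), rule rk_def, use that in simp_all)
  have p2: "runs (For ''x'' (Const 0) (var ''m'') (Assign ''ord'' (Read ''rk'' (var ''x'')) (var ''x''))) \<tau> ((1 + 2) * m + 2)
      (\<lambda>\<rho>. \<forall>x<m. \<rho> ''ord'' (rk x) = x)" if \<tau>: "\<forall>x<m. \<tau> ''rk'' x = rk x" "\<tau> ''m'' 0 = m" for \<tau>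
  proof (rule runs_For[where Inv = "\<lambda>i \<rho>. \<forall>x<i. \<rho> ''ord'' (rk x) = x"])
    fix \<rho> assume ag: "agree (insert ''x'' (writes (Assign ''ord'' (Read ''rk'' (var ''x'')) (var ''x'')))) \<tau> \<rho>"
    note A = agreeD[OF ag, simplified]
    show "aval (var ''m'') \<rho> = m" by (simp add: A \<tau>)
    fix i assume i: "i < m" "\<forall>x<i. \<rho> ''ord'' (rk x) = x" "\<rho> ''x'' 0 = i"
    have "rk x \<noteq> rk i" if "x < i" for x using bij that i(1) by (auto simp: bij_betw_def inj_on_def)
    then show "runs (Assign ''ord'' (Read ''rk'' (var ''x'')) (var ''x'')) \<rho> 1 (\<lambda>\<rho>. \<forall>x<Suc i. (\<rho>(''x'' := (\<rho> ''x'')(0 := Suc i))) ''ord'' (rk x) = x)"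
      using i \<tau>(1) by (intro runs_wpI) (auto simp: A less_Suc_eq)
  qed simp_all
  show ?thesis unfolding order_program_def
  proof (rule runs_Seq[OF p1], goal_cases)
    case (1 \<tau>)
    have "\<forall>x<m. \<tau> ''rk'' x = rk x" using 1(1) by (simp add: Inv_def rk_def)
    moreover have "\<tau> ''m'' 0 = m" by (simp add: agreeD[OF 1(2), simplified] I\<sigma>)
    ultimately show ?case
    proof (rule runs_weaken[OF p2])
      fix \<rho> assume o: "\<forall>x<m. \<rho> ''ord'' (rk x) = x"
      have w: "\<rho> ''ord'' i < m \<and> rk (\<rho> ''ord'' i) = i" if "i < m" for i
      proof -
        have "i \<in> rk ` {..<m}" using bij that by (simp add: bij_betw_def)
        then show ?thesis using o by auto
      qed
      have "rk x < m" if "x < m" for x using bij that by (auto simp: bij_betw_def)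
      then have "bij_betw (\<rho> ''ord'') {..<m} {..<m}"
        by (intro bij_betw_byWitness[where f' = rk]) (use w o in auto)
      moreover have "efficiency I (\<rho> ''ord'' i) \<le> efficiency I (\<rho> ''ord'' j)" if ij: "i < m" "j < m" "i < j" for i j
      proof -
        have "i \<in> rk ` {..<m}" "j \<in> rk ` {..<m}" using bij ij by (simp_all add: bij_betw_def)
        then obtain x y where "x < m" "y < m" "i = rk x" "j = rk y" by auto
        then show ?thesis using rkp[of x y] ij(3) o by (simp add: precedes_def)
      qed
      ultimately show "sorted_order (\<rho> ''ord'')" by (simp add: sorted_order_def)
    qed simp
  qed
qed

section \<open>Maintaining the weight matrices while edges become low\<close>

lemma edge_update_wp:
  assumes \<sigma>: "inst \<sigma>" "\<sigma> ''z'' 0 = z" "z < m" and X: "X \<notin> {''row'', ''a'', ''b'', ''z'', W}"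
  shows "wp (add_edge X W) P \<sigma> = P (\<sigma>(X := (\<sigma> X)(a z * n + b z := \<sigma> X (a z * n + b z) + \<sigma> W z, b z * n + a z := \<sigma> X (b z * n + a z) + \<sigma> W z)))"
    and "wp (remove_edge X W) P \<sigma> = P (\<sigma>(X := (\<sigma> X)(a z * n + b z := \<sigma> X (a z * n + b z) - \<sigma> W z, b z * n + a z := \<sigma> X (b z * n + a z) - \<sigma> W z)))"
proof -
  note I\<sigma> = instD[OF \<sigma>(1)]
  have ab: "a z < n" "b z < n" "a z \<noteq> b z" using ends_less \<sigma>(3) by auto
  have ne: "b z * n + a z \<noteq> a z * n + b z" using mat_index[OF ab(1,2), of "b z" "a z"] ab(3) by auto
  have r: "\<sigma> ''a'' z = a z" "\<sigma> ''b'' z = b z" "\<sigma> ''row'' (a z) = a z * n" "\<sigma> ''row'' (b z) = b z * n"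
    using ab \<sigma>(3) by (simp_all add: I\<sigma>)
  have X': "X \<noteq> ''row''" "X \<noteq> ''a''" "X \<noteq> ''b''" "X \<noteq> ''z''" "X \<noteq> W" using X by auto
  show "wp (add_edge X W) P \<sigma> = P (\<sigma>(X := (\<sigma> X)(a z * n + b z := \<sigma> X (a z * n + b z) + \<sigma> W z, b z * n + a z := \<sigma> X (b z * n + a z) + \<sigma> W z)))"
    using X' X'[symmetric] ne by (simp add: add_edge_def r \<sigma>(2))
  show "wp (remove_edge X W) P \<sigma> = P (\<sigma>(X := (\<sigma> X)(a z * n + b z := \<sigma> X (a z * n + b z) - \<sigma> W z, b z * n + a z := \<sigma> X (b z * n + a z) - \<sigma> W z)))"
    using X' X'[symmetric] ne by (simp add: remove_edge_def r \<sigma>(2))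
qed

lemma add_edge_runs:
  assumes \<sigma>: "inst \<sigma>" "\<sigma> ''z'' 0 = z" "z < m" and X: "X \<notin> {''row'', ''a'', ''b'', ''z'', W}"
    and W: "\<sigma> W z = w z" and F: "mat_rel n (\<sigma> X) (wmat F w)" "finite F" "z \<notin> F"
  shows "runs (add_edge X W) \<sigma> 2 (\<lambda>\<tau>. mat_rel n (\<tau> X) (wmat (insert z F) w))"
proof (intro runs_wpI)
  show "wp (add_edge X W) (\<lambda>\<tau>. mat_rel n (\<tau> X) (wmat (insert z F) w)) \<sigma>"
    unfolding edge_update_wp(1)[OF \<sigma> X] W using mat_rel_add_edge[OF F(1) \<sigma>(3) F(2,3)] by simp
qed (simp add: add_edge_def)

lemma remove_edge_runs:
  assumes \<sigma>: "inst \<sigma>" "\<sigma> ''z'' 0 = z" "z < m" and X: "X \<notin> {''row'', ''a'', ''b'', ''z'', W}"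
    and W: "\<sigma> W z = w z" and F: "mat_rel n (\<sigma> X) (wmat F w)" "finite F" "z \<in> F"
  shows "runs (remove_edge X W) \<sigma> 2 (\<lambda>\<tau>. mat_rel n (\<tau> X) (wmat (F - {z}) w))"
proof (intro runs_wpI)
  show "wp (remove_edge X W) (\<lambda>\<tau>. mat_rel n (\<tau> X) (wmat (F - {z}) w)) \<sigma>"
    unfolding edge_update_wp(2)[OF \<sigma> X] W using mat_rel_remove_edge[OF F(1) \<sigma>(3) F(2,3)] by simp
qed (simp add: remove_edge_def)

definition mats_ok :: "nat set \<Rightarrow> state \<Rightarrow> bool" where
  "mats_ok L \<tau> \<longleftrightarrow> mat_rel n (\<tau> ''lo'') (wmat L (cap I)) \<and> mat_rel n (\<tau> ''hi'') (wmat ({..<m} - L) (cap I)) \<and>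
     mat_rel n (\<tau> ''hc'') (wmat ({..<m} - L) (cost I))"

lemma mats_ok_cong:
  assumes "agree W \<sigma> \<tau>" "mats_ok L \<sigma>" "W \<inter> {''lo'', ''hi'', ''hc''} = {}"
  shows "mats_ok L \<tau>"
proof -
  have "\<tau> x = \<sigma> x" if "x \<in> {''lo'', ''hi'', ''hc''}" for x using assms(1,3) that by (auto simp: agree_def)
  then show ?thesis using assms(2) by (simp add: mats_ok_def)
qed

lemma reset_runs:
  assumes \<sigma>: "inst \<sigma>"
  shows "runs reset_program \<sigma> (((3 + 2) * (n * n) + 2) + ((4 + 2) * m + 2)) (mats_ok {})"
proof -
  note I\<sigma> = instD[OF \<sigma>]
  have p1: "runs (For ''q'' (Const 0) (Read ''row'' (var ''n'')) clear_entry) \<sigma> ((3 + 2) * (n * n) + 2)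
     (\<lambda>\<tau>. \<forall>q<n*n. \<tau> ''lo'' q = 0 \<and> \<tau> ''hi'' q = 0 \<and> \<tau> ''hc'' q = 0)"
  proof (rule runs_For[where Inv = "\<lambda>z \<tau>. \<forall>q<z. \<tau> ''lo'' q = 0 \<and> \<tau> ''hi'' q = 0 \<and> \<tau> ''hc'' q = 0"])
    fix \<tau> assume ag: "agree (insert ''q'' (writes clear_entry)) \<sigma> \<tau>"
    show "aval (Read ''row'' (var ''n'')) \<tau> = n * n" by (simp add: agreeD[OF ag, simplified] I\<sigma>)
  qed (auto intro!: runs_wpI simp: less_Suc_eq clear_entry_def)
  let ?A = "add_edge ''hi'' ''cap'' ;; add_edge ''hc'' ''cost''"
  have p2: "runs (For ''z'' (Const 0) (var ''m'') ?A) \<tau> ((4 + 2) * m + 2) (mats_ok {})"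
    if z: "\<forall>q<n*n. \<tau> ''lo'' q = 0 \<and> \<tau> ''hi'' q = 0 \<and> \<tau> ''hc'' q = 0" and i\<tau>: "inst \<tau>" for \<tau>
  proof (rule runs_For[where Inv = "\<lambda>i \<tau>. mat_rel n (\<tau> ''hi'') (wmat {..<i} (cap I)) \<and> mat_rel n (\<tau> ''hc'') (wmat {..<i} (cost I))"])
    have 0: "mat_rel n f (wmat {} w)" if "\<forall>q<n*n. f q = 0" for f w
      using that mat_index_less by (simp add: mat_rel_def wmat_def)
    fix \<rho>
    show "mat_rel n ((\<tau>(''z'' := (\<tau> ''z'')(0 := aval (Const 0) \<tau>))) ''hi'') (wmat {..<aval (Const 0) \<tau>} (cap I)) \<and>
        mat_rel n ((\<tau>(''z'' := (\<tau> ''z'')(0 := aval (Const 0) \<tau>))) ''hc'') (wmat {..<aval (Const 0) \<tau>} (cost I))"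
      using z by (simp add: 0)
    assume ag: "agree (insert ''z'' (writes ?A)) \<tau> \<rho>"
    note A = agreeD[OF ag, simplified]
    have i\<rho>: "inst \<rho>" using ag i\<tau> by (rule inst_cong) simp
    show "aval (var ''m'') \<rho> = m" by (simp add: instD[OF i\<rho>])
    { fix i assume i: "i < m" "mat_rel n (\<rho> ''hi'') (wmat {..<i} (cap I)) \<and> mat_rel n (\<rho> ''hc'') (wmat {..<i} (cost I))" "\<rho> ''z'' 0 = i"
      have s1: "runs (add_edge ''hi'' ''cap'') \<rho> 2 (\<lambda>\<rho>. mat_rel n (\<rho> ''hi'') (wmat (insert i {..<i}) (cap I)))"
        using i by (intro add_edge_runs[OF i\<rho> i(3,1)]) (simp_all add: instD[OF i\<rho>])
      have "runs ?A \<rho> (2 + 2) (\<lambda>\<upsilon>. mat_rel n (\<upsilon> ''hi'') (wmat (insert i {..<i}) (cap I)) \<and> mat_rel n (\<upsilon> ''hc'') (wmat (insert i {..<i}) (cost I)))"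
      proof (rule runs_Seq[OF s1], goal_cases)
        case (1 \<upsilon>)
        note B = agreeD[OF 1(2), simplified]
        have i\<upsilon>: "inst \<upsilon>" using 1(2) i\<rho> by (rule inst_cong) simp
        have "\<upsilon> ''z'' 0 = i" using i(3) by (simp add: B)
        then have s2: "runs (add_edge ''hc'' ''cost'') \<upsilon> 2 (\<lambda>\<rho>. mat_rel n (\<rho> ''hc'') (wmat (insert i {..<i}) (cost I)))"
          using i by (intro add_edge_runs[OF i\<upsilon> _ i(1)]) (simp_all add: instD[OF i\<upsilon>], simp_all add: B)
        then show ?case
        proof (rule runs_weaken)
          fix \<psi> assume c: "mat_rel n (\<psi> ''hc'') (wmat (insert i {..<i}) (cost I))" and ag': "agree (writes (add_edge ''hc'' ''cost'')) \<upsilon> \<psi>"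
          show "mat_rel n (\<psi> ''hi'') (wmat (insert i {..<i}) (cap I)) \<and> mat_rel n (\<psi> ''hc'') (wmat (insert i {..<i}) (cost I))"
            using c 1(1) by (simp add: agreeD[OF ag', simplified])
        qed simp
      qed
      then show "runs ?A \<rho> 4 (\<lambda>\<rho>. mat_rel n ((\<rho>(''z'' := (\<rho> ''z'')(0 := Suc i))) ''hi'') (wmat {..<Suc i} (cap I)) \<and>
          mat_rel n ((\<rho>(''z'' := (\<rho> ''z'')(0 := Suc i))) ''hc'') (wmat {..<Suc i} (cost I)))"
        by (simp add: lessThan_Suc) }
    assume J: "mat_rel n (\<rho> ''hi'') (wmat {..<m} (cap I)) \<and> mat_rel n (\<rho> ''hc'') (wmat {..<m} (cost I))"
    have "mat_rel n (\<rho> ''lo'') (wmat {} (cap I))" using z by (simp add: A 0)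
    then show "mats_ok {} \<rho>" using J by (simp add: mats_ok_def)
  qed simp_all
  show ?thesis unfolding reset_program_def
  proof (rule runs_Seq[OF p1], goal_cases)
    case (1 \<tau>)
    have "inst \<tau>" using 1(2) \<sigma> by (rule inst_cong) simp
    then show ?case using 1(1) by (intro p2)
  qed
qed

lemma low_edges_Suc:
  assumes p: "sorted_order p" and j: "j < m"
  shows "low_edges I (map p [0..<m]) (Suc j) e = (if cap I (p j) \<le> cap I e then insert (p j) (low_edges I (map p [0..<m]) j e) else low_edges I (map p [0..<m]) j e)"
    and "p j \<notin> low_edges I (map p [0..<m]) j e"
proof -
  have take: "set (take i (map p [0..<m])) = p ` {..<i}" if "i \<le> m" for i using that by (simp add: take_map atLeast0LessThan)
  show "low_edges I (map p [0..<m]) (Suc j) e = (if cap I (p j) \<le> cap I e then insert (p j) (low_edges I (map p [0..<m]) j e) else low_edges I (map p [0..<m]) j e)"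
    using j by (auto simp: low_edges_def take lessThan_Suc)
  have inj: "inj_on p {..<m}" using p by (simp add: sorted_order_def bij_betw_def)
  have "p j \<noteq> p i" if "i < j" for i using inj_onD[OF inj, of j i] that j by auto
  then have "p j \<notin> p ` {..<j}" by auto
  then show "p j \<notin> low_edges I (map p [0..<m]) j e" using j by (simp add: low_edges_def take)
qed

lemma move_runs:
  assumes p: "sorted_order p" and \<sigma>: "inst \<sigma>" "\<sigma> ''ord'' = p" "\<sigma> ''e'' 0 = e" "\<sigma> ''j'' 0 = j" and ej: "e < m" "j < m"
    and mats: "mats_ok (low_edges I (map p [0..<m]) j e) \<sigma>"
  shows "runs move_program \<sigma> 8 (mats_ok (low_edges I (map p [0..<m]) (Suc j) e))"
proof -
  let ?L = "low_edges I (map p [0..<m]) j e"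
  have L: "?L \<subseteq> {..<m}" using low_edges_subset[of "map p [0..<m]" I] sorted_orderD(2)[OF p] G(3) by simp
  have fin: "finite ?L" using L finite_subset by blast
  have z: "p j < m" using sorted_orderD(4)[OF p ej(2)] .
  let ?\<sigma> = "\<sigma>(''z'' := (\<sigma> ''z'')(0 := p j))"
  let ?b = "Leq (Read ''cap'' (var ''z'')) (Read ''cap'' (var ''e''))"
  have "runs move_program \<sigma> (1 + Suc (2 + (2 + 2))) (mats_ok (low_edges I (map p [0..<m]) (Suc j) e))"
    unfolding move_program_def
  proof (rule runs_Seq[where Q = "\<lambda>\<tau>. \<tau> = ?\<sigma>"], goal_cases)
    case 1 show ?case by (intro runs_wpI) (simp_all add: \<sigma>)
  next
    case (2 \<tau>)
    note A = agreeD[OF 2(2), simplified]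
    have i\<tau>: "inst \<tau>" using 2(2) \<sigma>(1) by (rule inst_cong) simp
    have m\<tau>: "mats_ok ?L \<tau>" using 2(2) mats by (rule mats_ok_cong) simp
    have z\<tau>: "\<tau> ''z'' 0 = p j" by (simp add: 2(1))
    have b: "bval ?b \<tau> \<longleftrightarrow> cap I (p j) \<le> cap I e" using z ej(1) by (simp add: z\<tau> A \<sigma> instD[OF \<sigma>(1)])
    show ?case
    proof (rule runs_If)
      assume "bval ?b \<tau>"
      then have eq: "low_edges I (map p [0..<m]) (Suc j) e = insert (p j) ?L" using b low_edges_Suc(1)[OF p ej(2)] by simp
      have s1: "runs (add_edge ''lo'' ''cap'') \<tau> 2 (\<lambda>\<rho>. mat_rel n (\<rho> ''lo'') (wmat (insert (p j) ?L) (cap I)))"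
        using m\<tau> fin z low_edges_Suc(2)[OF p ej(2)]
        by (intro add_edge_runs[OF i\<tau> z\<tau> z]) (simp_all add: instD[OF i\<tau>] mats_ok_def)
      show "runs (add_edge ''lo'' ''cap'' ;; remove_edge ''hi'' ''cap'' ;; remove_edge ''hc'' ''cost'') \<tau> (2 + (2 + 2))
          (mats_ok (low_edges I (map p [0..<m]) (Suc j) e))"
      proof (rule runs_Seq[OF s1], goal_cases)
        case (1 \<rho>)
        note B = agreeD[OF 1(2), simplified]
        have i\<rho>: "inst \<rho>" using 1(2) i\<tau> by (rule inst_cong) simp
        have z\<rho>: "\<rho> ''z'' 0 = p j" by (simp add: B z\<tau>)
        have s2: "runs (remove_edge ''hi'' ''cap'') \<rho> 2 (\<lambda>\<rho>. mat_rel n (\<rho> ''hi'') (wmat (({..<m} - ?L) - {p j}) (cap I)))"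
        proof (rule remove_edge_runs[OF i\<rho> z\<rho> z])
          show "mat_rel n (\<rho> ''hi'') (wmat ({..<m} - ?L) (cap I))" using m\<tau> by (simp add: B mats_ok_def)
        qed (use z low_edges_Suc(2)[OF p ej(2)] in \<open>simp_all add: instD[OF i\<rho>]\<close>)
        show ?case
        proof (rule runs_Seq[OF s2], goal_cases)
          case (1 \<upsilon>)
          note C = agreeD[OF 1(2), simplified]
          have i\<upsilon>: "inst \<upsilon>" using 1(2) i\<rho> by (rule inst_cong) simp
          have z\<upsilon>: "\<upsilon> ''z'' 0 = p j" by (simp add: C z\<rho>)
          have s3: "runs (remove_edge ''hc'' ''cost'') \<upsilon> 2 (\<lambda>\<rho>. mat_rel n (\<rho> ''hc'') (wmat (({..<m} - ?L) - {p j}) (cost I)))"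
          proof (rule remove_edge_runs[OF i\<upsilon> z\<upsilon> z])
            show "mat_rel n (\<upsilon> ''hc'') (wmat ({..<m} - ?L) (cost I))" using m\<tau> by (simp add: B C mats_ok_def)
          qed (use z low_edges_Suc(2)[OF p ej(2)] in \<open>simp_all add: instD[OF i\<upsilon>]\<close>)
          then show ?case
          proof (rule runs_weaken)
            fix \<psi> assume c: "mat_rel n (\<psi> ''hc'') (wmat (({..<m} - ?L) - {p j}) (cost I))" and ag: "agree (writes (remove_edge ''hc'' ''cost'')) \<upsilon> \<psi>"
            note D = agreeD[OF ag, simplified]
            have "{..<m} - insert (p j) ?L = ({..<m} - ?L) - {p j}" by blast
            moreover have "mat_rel n (\<psi> ''lo'') (wmat (insert (p j) ?L) (cap I))" using \<open>mat_rel n (\<rho> ''lo'') _\<close> by (simp add: C D)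
            moreover have "mat_rel n (\<psi> ''hi'') (wmat (({..<m} - ?L) - {p j}) (cap I))" using 1(1) by (simp add: D)
            ultimately show "mats_ok (low_edges I (map p [0..<m]) (Suc j) e) \<psi>" unfolding eq mats_ok_def using c by simp
          qed simp
        qed
      qed
    next
      assume "\<not> bval ?b \<tau>"
      then have eq: "low_edges I (map p [0..<m]) (Suc j) e = ?L" using b low_edges_Suc(1)[OF p ej(2)] by simp
      show "runs Skip \<tau> (2 + (2 + 2)) (mats_ok (low_edges I (map p [0..<m]) (Suc j) e))"
        unfolding eq using m\<tau> by (intro runs_wpI) simp_all
    qed
  qed
  then show ?thesis by simp
qed

section \<open>The loops over edges, positions and thresholds, and the output\<close>

lemma best_ok_mono: "best_ok es Done \<tau> \<Longrightarrow> Done' \<subseteq> Done \<Longrightarrow> best_ok es Done' \<tau>"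
  by (auto simp: best_ok_def)

text \<open>Ordered as in the program: the edge \<open>d\<close> varies in the outer loop, the
  position \<open>i\<close> in the inner one.\<close>

definition completed :: "nat list \<Rightarrow> nat \<Rightarrow> nat \<Rightarrow> (nat \<times> nat \<times> nat) set" where
  "completed es e j = {(i, d, \<theta>). \<theta> \<in> thresholds I (low_edges I es i d) \<and> 1 \<le> i \<and> i \<le> m \<and> (d < e \<or> d = e \<and> i \<le> j)}"

text \<open>Connectivities take \<open>1040 * (K * (n * n * n))\<close> steps and each of fewer than
  \<open>n\<close> thresholds takes \<open>2100 * (K * (n * n))\<close>; moving one edge takes
  constant time.\<close>

lemma position_step_runs:
  assumes K: "1 \<le> K" "m \<le> K * K" and p: "sorted_order p" and \<sigma>: "inst \<sigma>" "\<sigma> ''ord'' = p" "\<sigma> ''e'' 0 = e" "\<sigma> ''j'' 0 = j"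
    and ej: "e < m" "j < m" and mats: "mats_ok (low_edges I (map p [0..<m]) j e) \<sigma>"
    and ok: "best_ok (map p [0..<m]) (completed (map p [0..<m]) e j) \<sigma>"
  shows "runs position_step \<sigma> (3200 * (K * (n * n * n)))
     (\<lambda>\<tau>. mats_ok (low_edges I (map p [0..<m]) (Suc j) e) \<tau> \<and> best_ok (map p [0..<m]) (completed (map p [0..<m]) e (Suc j)) \<tau>)"
proof -
  define es where "es = map p [0..<m]"
  define L where "L = low_edges I es (Suc j) e"
  have es: "set es = {..<m}" unfolding es_def by (rule sorted_orderD(2)[OF p])
  have L: "L \<subseteq> {..<m}" unfolding L_def using low_edges_subset[of es I] es G(3) by simp
  note move = move_runs[OF p \<sigma> ej mats, folded es_def, folded L_def]
  let ?Q = "\<lambda>\<tau>. mats_ok L \<tau> \<and> best_ok es (completed es e (Suc j)) \<tau>"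
  have "runs position_step \<sigma> (8 + (1040 * (K * (n * n * n)) + ((2100 * (K * (n * n)) + 2) * n + 2))) ?Q"
    unfolding position_step_def
  proof (rule runs_Seq[OF move], goal_cases)
    case (1 \<tau>)
    note A = agreeD[OF 1(2), simplified]
    have i\<tau>: "inst \<tau>" using 1(2) \<sigma>(1) by (rule inst_cong) simp
    have ok\<tau>: "best_ok es (completed es e j) \<tau>" using 1(2) ok[folded es_def] by (rule best_ok_cong) simp
    have gh: "runs gh_program \<tau> (1040 * (K * (n * n * n))) (gh_done L)"
      using 1(1) by (intro gh_program_runs[OF L K i\<tau>]) (simp add: mats_ok_def)
    show ?case
    proof (rule runs_Seq[OF gh], goal_cases)
      case (1 \<rho>)
      note B = agreeD[OF 1(2), simplified]
      have i\<rho>: "inst \<rho>" using 1(2) i\<tau> by (rule inst_cong) simp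
      have ok\<rho>: "best_ok es (completed es e j) \<rho>" using 1(2) ok\<tau> by (rule best_ok_cong) simp
      have m\<rho>: "mats_ok L \<rho>" using 1(2) \<open>mats_ok L \<tau>\<close> by (rule mats_ok_cong) simp
      \<comment> \<open>Progress within one position, indexed by the flow values of
        \<open>\<rho>\<close>. They are fixed during the loop, as \<open>threshold_step\<close> does
        not write \<open>fl\<close>, and by \<open>gh_done\<close> they exhaust the
        thresholds.\<close>
      define X where "X k = completed es e j \<union> (\<lambda>l. (Suc j, e, \<rho> ''fl'' l)) ` {1..<k}" for k
      have X0: "X (aval (Const 1) \<rho>) = completed es e j" by (simp add: X_def)
      show ?case
      proof (rule runs_For[where Inv = "\<lambda>k. best_ok es (X k)"])
        show "''k'' \<notin> writes threshold_step" by simp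
        show "aval (Const 1) \<rho> \<le> n" using n_pos by simp
        show "best_ok es (X (aval (Const 1) \<rho>)) (\<rho>(''k'' := (\<rho> ''k'')(0 := aval (Const 1) \<rho>)))"
          by (rule best_ok_cong[of "{''k''}" \<rho>, OF _ ok\<rho>[unfolded X0[symmetric]]]) (simp_all add: agree_def)
        fix \<upsilon> assume ag: "agree (insert ''k'' (writes threshold_step)) \<rho> \<upsilon>"
        note C = agreeD[OF ag, simplified]
        have i\<upsilon>: "inst \<upsilon>" using ag i\<rho> by (rule inst_cong) simp
        have m\<upsilon>: "mats_ok L \<upsilon>" using ag m\<rho> by (rule mats_ok_cong) simp
        show "aval (var ''n'') \<upsilon> = n" by (simp add: instD[OF i\<upsilon>])
        { fix k assume k: "aval (Const 1) \<rho> \<le> k" "k < n" "best_ok es (X k) \<upsilon>" "\<upsilon> ''k'' 0 = k"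
          have gh: "gh_done L \<upsilon>" using 1(1) by (simp add: gh_done_def C)
          have e: "\<upsilon> ''e'' 0 = e" "\<upsilon> ''j'' 0 = j" by (simp_all add: A B C \<sigma>)
          have k1: "1 \<le> k" using k(1) by simp
          have Xk: "insert (Suc j, e, \<upsilon> ''fl'' k) (X k) = X (Suc k)"
            using k1 by (simp add: X_def C atLeastLessThanSuc)
          have "runs threshold_step \<upsilon> (2100 * (K * (n * n))) (best_ok es (insert (Suc j, e, \<upsilon> ''fl'' k) (X k)))"
            using m\<upsilon> unfolding mats_ok_def
            by (intro threshold_step_runs[OF K es i\<upsilon> e k(4) ej k1 k(2) L_def gh _ _ _ k(3)]) simp_all
          then show "runs threshold_step \<upsilon> (2100 * (K * (n * n))) (\<lambda>\<psi>. best_ok es (X (Suc k)) (\<psi>(''k'' := (\<psi> ''k'')(0 := Suc k))))"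
          proof (rule runs_weaken)
            fix \<psi> assume "best_ok es (insert (Suc j, e, \<upsilon> ''fl'' k) (X k)) \<psi>"
            then show "best_ok es (X (Suc k)) (\<psi>(''k'' := (\<psi> ''k'')(0 := Suc k)))"
              unfolding Xk by (rule best_ok_cong[where W = "{''k''}", rotated]) (simp_all add: agree_def)
          qed simp }
        assume f: "best_ok es (X n) \<upsilon>"
        have "thresholds I L = {\<rho> ''fl'' k | k. 1 \<le> k \<and> k < n}" using 1(1) by (simp add: gh_done_def)
        then have "completed es e (Suc j) \<subseteq> X n" by (auto simp: completed_def X_def L_def le_Suc_eq)
        then show "?Q \<upsilon>" using m\<upsilon> best_ok_mono[OF f] by simp
      qed
    qed
  qed
  then show ?thesis unfolding es_def[symmetric] L_def[symmetric]
  proof (rule runs_weaken)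
    have n1: "1 \<le> n" using n_pos by simp
    have c: "n * 1 \<le> n * (n * n)" by (intro mult_le_mono2) (use n1 in simp)
    have "1 * (n * n * n) \<le> K * (n * n * n)" by (rule mult_le_mono1) (rule K(1))
    moreover have "8 + (1040 * (K * (n * n * n)) + ((2100 * (K * (n * n)) + 2) * n + 2)) = 3140 * (K * (n * n * n)) + 2 * n + 10"
      by (simp add: algebra_simps)
    moreover have "n \<le> n * n * n" using c by (simp add: mult.assoc)
    ultimately show "8 + (1040 * (K * (n * n * n)) + ((2100 * (K * (n * n)) + 2) * n + 2)) \<le> 3200 * (K * (n * n * n))"
      using n1 by linarith
  qed
qed

lemma edge_step_runs:
  assumes K: "1 \<le> K" "m \<le> K * K" and p: "sorted_order p" and \<sigma>: "inst \<sigma>" "\<sigma> ''ord'' = p" "\<sigma> ''e'' 0 = e"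
    and e: "e < m" and ok: "best_ok (map p [0..<m]) (completed (map p [0..<m]) e 0) \<sigma>"
  shows "runs edge_step \<sigma> ((((3 + 2) * (n * n) + 2) + ((4 + 2) * m + 2)) + ((3200 * (K * (n * n * n)) + 2) * m + 2))
     (best_ok (map p [0..<m]) (completed (map p [0..<m]) (Suc e) 0))"
  unfolding edge_step_def
proof (rule runs_Seq[OF reset_runs[OF \<sigma>(1)]], goal_cases)
  case (1 \<tau>)
  let ?es = "map p [0..<m]"
  note A = agreeD[OF 1(2), simplified]
  have i\<tau>: "inst \<tau>" using 1(2) \<sigma>(1) by (rule inst_cong) simp
  have ok\<tau>: "best_ok ?es (completed ?es e 0) \<tau>" using 1(2) ok by (rule best_ok_cong) simp
  have m\<tau>: "mats_ok (low_edges I ?es 0 e) \<tau>" using 1(1) by (simp add: low_edges_def)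
  show ?case
  proof (rule runs_For[where Inv = "\<lambda>j \<tau>. mats_ok (low_edges I ?es j e) \<tau> \<and> best_ok ?es (completed ?es e j) \<tau>"])
    let ?\<tau> = "\<tau>(''j'' := (\<tau> ''j'')(0 := aval (Const 0) \<tau>))"
    have "agree {''j''} \<tau> ?\<tau>" by (simp add: agree_def)
    then show "mats_ok (low_edges I ?es (aval (Const 0) \<tau>) e) ?\<tau> \<and> best_ok ?es (completed ?es e (aval (Const 0) \<tau>)) ?\<tau>"
      using mats_ok_cong[of "{''j''}" \<tau> ?\<tau>, OF _ m\<tau>] best_ok_cong[of "{''j''}" \<tau> ?\<tau>, OF _ ok\<tau>] by simp
    fix \<rho> assume ag: "agree (insert ''j'' (writes position_step)) \<tau> \<rho>"
    note B = agreeD[OF ag, simplified]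
    have i\<rho>: "inst \<rho>" using ag i\<tau> by (rule inst_cong) simp
    show "aval (var ''m'') \<rho> = m" by (simp add: instD[OF i\<rho>])
    { fix j assume j: "j < m" "mats_ok (low_edges I ?es j e) \<rho> \<and> best_ok ?es (completed ?es e j) \<rho>" "\<rho> ''j'' 0 = j"
      have o: "\<rho> ''ord'' = p" "\<rho> ''e'' 0 = e" by (simp_all add: A B \<sigma>)
      have "runs position_step \<rho> (3200 * (K * (n * n * n)))
         (\<lambda>\<tau>. mats_ok (low_edges I ?es (Suc j) e) \<tau> \<and> best_ok ?es (completed ?es e (Suc j)) \<tau>)"
        using j(2) by (intro position_step_runs[OF K p i\<rho> o j(3) e j(1)]) simp_all
      then show "runs position_step \<rho> (3200 * (K * (n * n * n))) (\<lambda>\<psi>. mats_ok (low_edges I ?es (Suc j) e) (\<psi>(''j'' := (\<psi> ''j'')(0 := Suc j))) \<and>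
          best_ok ?es (completed ?es e (Suc j)) (\<psi>(''j'' := (\<psi> ''j'')(0 := Suc j))))"
      proof (rule runs_weaken)
        fix \<psi> assume q: "mats_ok (low_edges I ?es (Suc j) e) \<psi> \<and> best_ok ?es (completed ?es e (Suc j)) \<psi>"
        let ?\<psi> = "\<psi>(''j'' := (\<psi> ''j'')(0 := Suc j))"
        have "agree {''j''} \<psi> ?\<psi>" by (simp add: agree_def)
        then show "mats_ok (low_edges I ?es (Suc j) e) ?\<psi> \<and> best_ok ?es (completed ?es e (Suc j)) ?\<psi>"
          using q mats_ok_cong[of "{''j''}" \<psi> ?\<psi>] best_ok_cong[of "{''j''}" \<psi> ?\<psi>] by simp
      qed simp }
    assume f: "mats_ok (low_edges I ?es m e) \<rho> \<and> best_ok ?es (completed ?es e m) \<rho>"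
    have "completed ?es (Suc e) 0 \<subseteq> completed ?es e m" by (auto simp: completed_def less_Suc_eq)
    then show "best_ok ?es (completed ?es (Suc e) 0) \<rho>" using f best_ok_mono by blast
  qed simp_all
qed

lemma output_runs:
  assumes p: "sorted_order p" and \<sigma>: "inst \<sigma>" "\<sigma> ''ord'' = p"
    and j: "\<sigma> ''bj'' 0 \<le> m" and e: "\<sigma> ''be'' 0 < m" and bs: "\<forall>x<n. \<sigma> ''bs'' x \<le> 1"
  shows "runs (For ''x'' (Const 0) (var ''m'') output_entry) \<sigma> ((4 + 2) * m + 2) (\<lambda>\<tau>. output_set m \<tau> =
     high_cut I (low_edges I (map p [0..<m]) (\<sigma> ''bj'' 0) (\<sigma> ''be'' 0)) {x. x < n \<and> \<sigma> ''bs'' x \<noteq> 0})"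
proof -
  note I\<sigma> = instD[OF \<sigma>(1)]
  define j where "j = \<sigma> ''bj'' 0"
  define e where "e = \<sigma> ''be'' 0"
  define D where "D = {x. x < n \<and> \<sigma> ''bs'' x \<noteq> 0}"
  define R where "R = high_cut I (low_edges I (map p [0..<m]) j e) D"
  have inj: "inj_on p {..<m}" and im: "p ` {..<m} = {..<m}" using p by (simp_all add: sorted_order_def bij_betw_def)
  have take: "set (take j (map p [0..<m])) = p ` {..<j}" using j by (simp add: take_map atLeast0LessThan j_def)
  have R: "p i \<in> R \<longleftrightarrow> \<not> (i < j \<and> cap I (p i) \<le> cap I e) \<and> \<sigma> ''bs'' (a (p i)) \<noteq> \<sigma> ''bs'' (b (p i))" if i: "i < m" for i
  proof -
    have pm: "p i < m" using sorted_orderD(4)[OF p i] .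
    have ab: "a (p i) < n" "b (p i) < n" using ends_less[OF pm] by simp_all
    have "p i \<in> p ` {..<j} \<longleftrightarrow> i < j" using inj_onD[OF inj, of i] i j j_def by auto
    then have low: "p i \<in> low_edges I (map p [0..<m]) j e \<longleftrightarrow> i < j \<and> cap I (p i) \<le> cap I e" by (simp add: low_edges_def take)
    have "p i \<in> cut_edges G D \<longleftrightarrow> (a (p i) \<in> D) \<noteq> (b (p i) \<in> D)"
      using in_cut_edges[OF G(1) _ G(4)[OF pm]] G(3) pm by simp
    also have "\<dots> \<longleftrightarrow> \<sigma> ''bs'' (a (p i)) \<noteq> \<sigma> ''bs'' (b (p i))"
    proof -
      have "\<sigma> ''bs'' (a (p i)) = 0 \<or> \<sigma> ''bs'' (a (p i)) = 1" "\<sigma> ''bs'' (b (p i)) = 0 \<or> \<sigma> ''bs'' (b (p i)) = 1"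
        using bs ab by (auto simp: le_Suc_eq)
      then show ?thesis using ab by (auto simp: D_def)
    qed
    finally show ?thesis using low pm by (auto simp: R_def high_cut_def G(3))
  qed
  have "runs (For ''x'' (Const 0) (var ''m'') output_entry) \<sigma> ((4 + 2) * m + 2) (\<lambda>\<tau>. output_set m \<tau> = R)"
  proof (rule runs_For[where Inv = "\<lambda>i \<tau>. \<forall>y<i. \<tau> ''out'' (p y) = (if p y \<in> R then 1 else 0)"])
    fix \<tau> assume ag: "agree (insert ''x'' (writes output_entry)) \<sigma> \<tau>"
    note A = agreeD[OF ag, simplified]
    have i\<tau>: "inst \<tau>" using ag \<sigma>(1) by (rule inst_cong) simp
    show "aval (var ''m'') \<tau> = m" by (simp add: instD[OF i\<tau>])
    { fix i assume i: "i < m" "\<forall>y<i. \<tau> ''out'' (p y) = (if p y \<in> R then 1 else 0)" "\<tau> ''x'' 0 = i"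
      have pm: "p i < m" using sorted_orderD(4)[OF p i(1)] .
      have r: "\<tau> ''ord'' i = p i" "\<tau> ''cap'' (p i) = cap I (p i)" "\<tau> ''be'' 0 = e" "\<tau> ''bj'' 0 = j" "\<tau> ''cap'' e = cap I e"
        "\<tau> ''a'' (p i) = a (p i)" "\<tau> ''b'' (p i) = b (p i)" "\<tau> ''bs'' = \<sigma> ''bs''"
        using assms(5) by (simp_all add: A \<sigma> e_def j_def I\<sigma> pm)
      have ne: "p y \<noteq> p i" if "y < i" for y using inj_onD[OF inj, of y i] that i(1) by auto
      let ?c = "And (Not (And (Less (var ''x'') (var ''bj'')) (Leq (Read ''cap'' (var ''z'')) (Read ''cap'' (var ''be'')))))
           (Not (Equal (Read ''bs'' (Read ''a'' (var ''z''))) (Read ''bs'' (Read ''b'' (var ''z'')))))"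
      let ?\<tau> = "\<tau>(''z'' := (\<tau> ''z'')(0 := p i))"
      have c: "bval ?c ?\<tau> \<longleftrightarrow> p i \<in> R" unfolding R[OF i(1)] using i(3) by (auto simp: r)
      have step: "wp (''z'' ::= A ;; If d q q') P \<tau> = (if bval d ?\<tau> then wp q P ?\<tau> else wp q' P ?\<tau>)" if "aval A \<tau> = p i" for A d q q' P
        using that by simp
      have "wp output_entry P \<tau> = P (?\<tau>(''out'' := (\<tau> ''out'')(p i := if p i \<in> R then 1 else 0)))" for P
        unfolding output_entry_def using i(3) r(1) by (subst step) (simp, simp only: c, simp)
      then show "runs output_entry \<tau> 4 (\<lambda>\<rho>. \<forall>y<Suc i. (\<rho>(''x'' := (\<rho> ''x'')(0 := Suc i))) ''out'' (p y) = (if p y \<in> R then 1 else 0))"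
        using i(2) ne by (intro runs_wpI) (simp_all add: less_Suc_eq output_entry_def) }
    assume f: "\<forall>y<m. \<tau> ''out'' (p y) = (if p y \<in> R then 1 else 0)"
    have f': "\<tau> ''out'' z = (if z \<in> R then 1 else 0)" if "z < m" for z
    proof -
      have "z \<in> p ` {..<m}" using im that by simp
      then show ?thesis using f by auto
    qed
    have "R \<subseteq> {..<m}" by (auto simp: R_def high_cut_def G(3))
    then show "output_set m \<tau> = R" using f' by (auto simp: output_set_def split: if_splits)
  qed simp_all
  then show ?thesis by (simp add: R_def D_def j_def e_def)
qed

text \<open>Something has been found, since the triple of \<open>empty_candidate\<close> has been
  covered. The record and the coverage of all triples are then the premises of
  \<open>algorithm_output_intro\<close>.\<close>

lemma best_found:
  assumes p: "sorted_order p" and ok: "best_ok (map p [0..<m]) (completed (map p [0..<m]) m 0) \<tau>"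
  shows "recorded (map p [0..<m]) \<tau>"
    and "algorithm_output I (high_cut I (low_edges I (map p [0..<m]) (\<tau> ''bj'' 0) (\<tau> ''be'' 0)) {x. x < n \<and> \<tau> ''bs'' x \<noteq> 0})"
proof -
  define es where "es = map p [0..<m]"
  note es = sorted_orderD(1-3)[OF p, folded es_def]
  have len: "length es = m" by (simp add: es_def)
  have cov: "covered es \<tau> j e \<theta>" if "1 \<le> j" "j \<le> m" "e < m" "\<theta> \<in> thresholds I (low_edges I es j e)" for j e \<theta>
    using ok that by (auto simp: best_ok_def completed_def es_def)
  have L: "low_edges I es j e \<subseteq> {..<m}" for j e using low_edges_subset[of es I] es(2) G(3) by simp
  have found: "\<tau> ''found'' 0 \<noteq> 0"
  proof -
    have E: "edges G \<noteq> {}" using m by (auto simp: G(3))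
    have es': "set es = edges G" using es(2) G(3) by simp
    obtain e \<theta> D where e: "e \<in> edges G" "\<theta> \<in> thresholds I (low_edges I es (length es) e)"
      and D: "threshold_cut I (low_edges I es (length es) e) \<theta> D" "high_cut I (low_edges I es (length es) e) D = {}"
      using empty_candidate[OF I E es'] by blast
    let ?L = "low_edges I es m e"
    have D': "threshold_cut I ?L \<theta> D" "high_cut I ?L D = {}" using D len by simp_all
    have c: "covered es \<tau> m e \<theta>" using e m G(3) len by (intro cov) auto
    have cl: "closed_cut I ?L \<theta> D" using D'(1) by (simp add: threshold_cut_def)
    then have "\<not> low_conn I ?L \<theta> (source I) (sink I)" using G(2,5,6) by (auto simp: closed_cut_def is_cut_def)
    then obtain D2 where D2: "threshold_cut I ?L \<theta> D2" "sum (cost I) (high_cut I ?L D2) \<le> budget I \<longrightarrow> \<tau> ''found'' 0 \<noteq> 0"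
      using c unfolding covered_def Let_def by blast
    \<comment> \<open>The cut \<open>D2\<close> covering this triple may differ from
      \<open>D\<close>, but it has minimum cost too, hence cost 0, and is affordable under any
      budget.\<close>
    have "sum (cost I) (high_cut I ?L D2) \<le> sum (cost I) (high_cut I ?L D)" using D2(1) cl by (simp add: threshold_cut_def)
    then show ?thesis using D2(2) D'(2) by simp
  qed
  then have rec: "recorded es \<tau>" using ok by (simp add: best_ok_def es_def)
  then show "recorded (map p [0..<m]) \<tau>" by (simp add: es_def)
  let ?j = "\<tau> ''bj'' 0" and ?e = "\<tau> ''be'' 0" and ?D = "{x. x < n \<and> \<tau> ''bs'' x \<noteq> 0}"
  obtain \<theta> where r: "1 \<le> ?j" "?j \<le> m" "?e < m" "\<theta> \<in> thresholds I (low_edges I es ?j ?e)" "threshold_cut I (low_edges I es ?j ?e) \<theta> ?D"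
      "sum (cost I) (high_cut I (low_edges I es ?j ?e) ?D) \<le> budget I"
      "objective I (high_cut I (low_edges I es ?j ?e) ?D) = real (\<tau> ''best'' 0)"
    using rec unfolding recorded_def Let_def by blast
  have "algorithm_output I (high_cut I (low_edges I es ?j ?e) ?D)"
  proof (rule algorithm_output_intro[OF I es(1) _ es(3) _ _ r(4,5,6)])
    fix j e \<theta> assume j: "j \<in> {1..length es}" and e: "e \<in> edges G" and th: "\<theta> \<in> thresholds I (low_edges I es j e)"
      and nc: "\<not> low_conn I (low_edges I es j e) \<theta> (source I) (sink I)"
    have "covered es \<tau> j e \<theta>" using j e th len G(3) by (intro cov) auto
    then show "\<exists>D. threshold_cut I (low_edges I es j e) \<theta> D \<and>
        (sum (cost I) (high_cut I (low_edges I es j e) D) \<le> budget I \<longrightarrow>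
         objective I (high_cut I (low_edges I es ?j ?e) ?D) \<le> objective I (high_cut I (low_edges I es j e) D))"
      using nc unfolding covered_def Let_def r(7) by blast
  qed (use es(2) r(1-3) len G(3) in auto)
  then show "algorithm_output I (high_cut I (low_edges I (map p [0..<m]) ?j ?e) ?D)" by (simp add: es_def)
qed

text \<open>The m^2 positions dominate with \<open>3200 * (K * (n * n * n))\<close> steps each.
  Sorting, the m rebuildings of the matrices and the output are absorbed in the remaining
  100.\<close>

lemma nfi_program_runs:
  assumes K: "1 \<le> K" "m \<le> K * K"
  shows "runs nfi_program (input_state I n m a b) (3300 * (K * (m * m) * (n * n * n))) (\<lambda>\<tau>. algorithm_output I (output_set m \<tau>))"
proof -
  define \<sigma> where "\<sigma> = input_state I n m a b"
  have zero: "\<sigma> ''rk'' = (\<lambda>_. 0)" "\<sigma> ''found'' = (\<lambda>_. 0)" by (simp_all add: \<sigma>_def input_state_def)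
  let ?c = "(((3 + 2) * (n * n) + 2) + ((4 + 2) * m + 2)) + ((3200 * (K * (n * n * n)) + 2) * m + 2)"
  let ?t = "((1 + 2) * n + 2) + (((3 + 2) * m + 2) + (((((3 + 2) * m + 2 + 2) * m + 2) + ((1 + 2) * m + 2)) +
     (((?c + 2) * m + 2) + ((4 + 2) * m + 2))))"
  have "runs nfi_program \<sigma> ?t (\<lambda>\<tau>. algorithm_output I (output_set m \<tau>))"
    unfolding nfi_program_def
  proof (rule runs_Seq[OF rows_runs[OF \<sigma>_def]], goal_cases)
    case (1 \<tau>)
    note A = agreeD[OF 1(2), simplified]
    show ?case
    proof (rule runs_Seq[OF proper_cost_runs[OF 1(1)]], goal_cases)
      case (1 \<rho>)
      note B = agreeD[OF 1(2), simplified]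
      have i\<rho>: "inst \<rho>" using 1(2) \<open>inst \<tau>\<close> by (rule inst_cong) simp
      have z\<rho>: "\<forall>x. \<rho> ''rk'' x = 0" by (simp add: A B zero)
      show ?case
      proof (rule runs_Seq[OF order_runs[OF i\<rho> 1(1) z\<rho>]], goal_cases)
        case (1 \<upsilon>)
        note C = agreeD[OF 1(2), simplified]
        have i\<upsilon>: "inst \<upsilon>" using 1(2) i\<rho> by (rule inst_cong) simp
        define p where "p = \<upsilon> ''ord''"
        have p: "sorted_order p" using 1(1) by (simp add: p_def)
        let ?es = "map p [0..<m]"
        have loop: "runs (For ''e'' (Const 0) (var ''m'') edge_step) \<upsilon> ((?c + 2) * m + 2) (best_ok ?es (completed ?es m 0))"
        proof (rule runs_For[where Inv = "\<lambda>e. best_ok ?es (completed ?es e 0)"])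
          have "\<upsilon> ''found'' 0 = 0" by (simp add: A B C zero)
          then show "best_ok ?es (completed ?es (aval (Const 0) \<upsilon>) 0) (\<upsilon>(''e'' := (\<upsilon> ''e'')(0 := aval (Const 0) \<upsilon>)))"
            by (auto simp: best_ok_def completed_def)
          fix \<psi> assume ag: "agree (insert ''e'' (writes edge_step)) \<upsilon> \<psi>"
          note D = agreeD[OF ag, simplified]
          have i\<psi>: "inst \<psi>" using ag i\<upsilon> by (rule inst_cong) simp
          show "aval (var ''m'') \<psi> = m" by (simp add: instD[OF i\<psi>])
          fix e assume e: "e < m" "best_ok ?es (completed ?es e 0) \<psi>" "\<psi> ''e'' 0 = e"
          have o: "\<psi> ''ord'' = p" by (simp add: D p_def)
          show "runs edge_step \<psi> ?c (\<lambda>\<tau>. best_ok ?es (completed ?es (Suc e) 0) (\<tau>(''e'' := (\<tau> ''e'')(0 := Suc e))))"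
          proof (rule runs_weaken[OF edge_step_runs[OF K p i\<psi> o e(3,1,2)]])
            fix \<theta> assume "best_ok ?es (completed ?es (Suc e) 0) \<theta>"
            then show "best_ok ?es (completed ?es (Suc e) 0) (\<theta>(''e'' := (\<theta> ''e'')(0 := Suc e)))"
              by (rule best_ok_cong[where W = "{''e''}", rotated]) (simp_all add: agree_def)
          qed simp
        qed simp_all
        show ?case
        proof (rule runs_Seq[OF loop], goal_cases)
          case (1 \<psi>)
          note D = agreeD[OF 1(2), simplified]
          have i\<psi>: "inst \<psi>" using 1(2) i\<upsilon> by (rule inst_cong) simp
          have o: "\<psi> ''ord'' = p" by (simp add: D p_def)
          note best = best_found[OF p 1(1)]
          have r: "\<psi> ''bj'' 0 \<le> m" "\<psi> ''be'' 0 < m" "\<forall>x<n. \<psi> ''bs'' x \<le> 1" using best(1) by (simp_all add: recorded_def Let_def)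
          show ?case
            by (rule runs_weaken[OF output_runs[OF p i\<psi> o r]]) (use best(2) in simp_all)
        qed
      qed
    qed
  qed
  then show ?thesis unfolding \<sigma>_def
  proof (rule runs_weaken)
    define M where "M = m * m"
    define N where "N = n * n * n"
    have n2: "2 \<le> n" by (rule n_pos)
    have m1: "1 \<le> m" using m by simp
    have M: "m \<le> M" "1 \<le> M" using m1 by (simp_all add: M_def)
    have nn: "n \<le> n * n" "1 \<le> n * n" using n2 by simp_all
    have N: "n * n \<le> N" "n \<le> N" "1 \<le> N"
    proof -
      show "n * n \<le> N" using n2 by (simp add: N_def)
      then show "n \<le> N" "1 \<le> N" using nn by linarith+
    qed
    define T where "T = K * M * N"
    have KM: "M \<le> K * M" using K(1) by simp
    have T: "M \<le> T" "N \<le> T" "m \<le> T" "n \<le> T" "1 \<le> T"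
    proof -
      have "M * 1 \<le> K * M * N" by (rule mult_le_mono[OF KM N(3)])
      then show "M \<le> T" by (simp add: T_def)
      have "1 * N \<le> K * M * N" using KM M(2) by (intro mult_le_mono1) linarith
      then show "N \<le> T" by (simp add: T_def)
      show "m \<le> T" "1 \<le> T" using \<open>M \<le> T\<close> M by linarith+
      show "n \<le> T" using \<open>N \<le> T\<close> N by linarith
    qed
    have nm: "n * n * m \<le> T"
    proof -
      have "n * n * m \<le> N * (K * M)" by (rule mult_le_mono[OF N(1)]) (use M(1) KM in linarith)
      then show ?thesis by (simp add: T_def mult_ac)
    qed
    have "?t = 3200 * T + 5 * (n * n * m) + 13 * M + 26 * m + 3 * n + 12" by (simp add: T_def M_def N_def algebra_simps)
    moreover have "K * (m * m) * (n * n * n) = T" by (simp add: T_def M_def N_def)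
    ultimately show "?t \<le> 3300 * (K * (m * m) * (n * n * n))" using T nm by linarith
  qed
qed

end

lemma nat_sqrt_bound:
  assumes "0 < m"
  obtains K :: nat where "1 \<le> K" "m \<le> K * K" "real K \<le> 2 * sqrt (real m)"
proof
  \<comment> \<open>Rounding up at most doubles the root, because it is at least 1.\<close>
  define K where "K = nat \<lceil>sqrt (real m)\<rceil>"
  have s: "1 \<le> sqrt (real m)" using assms by simp
  have le: "sqrt (real m) \<le> real K" by (simp add: K_def)
  have "real m = sqrt (real m) * sqrt (real m)" by simp
  also have "\<dots> \<le> real K * real K" using le s by (intro mult_mono) auto
  finally have "real m \<le> real (K * K)" by simp
  then show "m \<le> K * K" by (simp only: of_nat_le_iff)
  have "1 \<le> real K" using s le by linarith
  then show "1 \<le> K" by simp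
  have "real K \<le> sqrt (real m) + 1" using s by (simp add: K_def)
  then show "real K \<le> 2 * sqrt (real m)" using s by linarith
qed

lemma (in numbered_nfi) nfi_program_exec:
  "\<exists>k \<tau>. exec nfi_program (input_state I n m a b) k \<tau> \<and> algorithm_output I (output_set m \<tau>) \<and>
     real k \<le> 6600 * real m powr (5 / 2) * real n ^ 3"
proof -
  obtain K where K: "1 \<le> K" "m \<le> K * K" "real K \<le> 2 * sqrt (real m)" using nat_sqrt_bound[OF m] by blast
  obtain k \<tau> where k: "exec nfi_program (input_state I n m a b) k \<tau>" "k \<le> 3300 * (K * (m * m) * (n * n * n))"
      "algorithm_output I (output_set m \<tau>)"
    using nfi_program_runs[OF K(1,2)] by (auto simp: runs_def)
  have "real m powr (5 / 2) = real m powr (1 / 2 + 2)" by simp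
  also have "\<dots> = sqrt (real m) * real m powr 2" unfolding powr_add by (simp add: powr_half_sqrt)
  also have "\<dots> = sqrt (real m) * (real m * real m)" using m by (simp add: powr_numeral power2_eq_square)
  finally have pw: "real m powr (5 / 2) = sqrt (real m) * (real m * real m)" .
  have "real k \<le> real (3300 * (K * (m * m) * (n * n * n)))" using k(2) by (simp only: of_nat_le_iff)
  also have "\<dots> = 3300 * (real K * (real m * real m * (real n * real n * real n)))" by simp
  also have "\<dots> \<le> 3300 * (2 * sqrt (real m) * (real m * real m * (real n * real n * real n)))"
    using K(3) by (intro mult_left_mono mult_right_mono) auto
  also have "\<dots> = 6600 * real m powr (5 / 2) * real n ^ 3" unfolding pw by (simp add: power3_eq_cube)
  finally show ?thesis using k by blast
qed

theorem theorem2: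
  shows
    "(\<forall>I :: ('v, 'e) nfi. nfi_instance I \<and> edges (graph I) \<noteq> {} \<longrightarrow>
        (\<exists>R. algorithm_output I R) \<and>
        (\<forall>R. algorithm_output I R \<longrightarrow>
           feasible I R \<and>
           (0 < OPT I \<longrightarrow>
              objective I R \<le> 2 * (real (card (verts (graph I))) - 1) * OPT I)))
     \<and>
     (\<exists>(P :: com) (K :: real). \<forall>(I :: (nat, nat) nfi) n m a b.
        nfi_instance I \<and> numbered I n m a b \<and> 0 < m \<longrightarrow>
        (\<exists>k \<tau>. exec P (input_state I n m a b) k \<tau> \<and>
           algorithm_output I (output_set m \<tau>) \<and>
           real k \<le> K * real m powr (5 / 2) * real n ^ 3))"
proof
  show "\<forall>I :: ('v, 'e) nfi. nfi_instance I \<and> edges (graph I) \<noteq> {} \<longrightarrow>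
      (\<exists>R. algorithm_output I R) \<and>
      (\<forall>R. algorithm_output I R \<longrightarrow>
         feasible I R \<and>
         (0 < OPT I \<longrightarrow>
            objective I R \<le> 2 * (real (card (verts (graph I))) - 1) * OPT I))"
    using algorithm_output_exists algorithm_output_approx by blast
  show "\<exists>(P :: com) (K :: real). \<forall>(I :: (nat, nat) nfi) n m a b.
      nfi_instance I \<and> numbered I n m a b \<and> 0 < m \<longrightarrow>
      (\<exists>k \<tau>. exec P (input_state I n m a b) k \<tau> \<and>
         algorithm_output I (output_set m \<tau>) \<and>
         real k \<le> K * real m powr (5 / 2) * real n ^ 3)"
  \<comment> \<open>The constant 6600 is 3300, from the count in terms of \<open>K\<close>, times
    the 2 lost by rounding the square root of m up to \<open>K\<close>.\<close>
  proof (rule exI[of _ nfi_program], rule exI[of _ 6600], intro allI impI, elim conjE)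
    fix I :: "(nat, nat) nfi" and n m a b
    assume "nfi_instance I" "numbered I n m a b" "0 < m"
    then interpret numbered_nfi I n m a b by unfold_locales
    show "\<exists>k \<tau>. exec nfi_program (input_state I n m a b) k \<tau> \<and>
        algorithm_output I (output_set m \<tau>) \<and>
        real k \<le> 6600 * real m powr (5 / 2) * real n ^ 3"
      by (rule nfi_program_exec)
  qed
qed

end
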